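(* Let $\mathbb{K}$ be a field that contains all roots of $1$. Assume that $\operatorname{char}\mathbb{K}\ne 2$ or $\mathbb{K}$ is perfect. Let $n\ge 3$ be an integer, and let $Q\subset\mathbb{P}^{n-1}$ be a smooth quadric hypersurface over $\mathbb{K}$. The following assertions hold. (i) The group $\operatorname{Aut}(Q)$ has bounded finite subgroups if and only if $Q(\mathbb{K})=\varnothing$. (ii) If $n$ is odd and $Q(\mathbb{K})=\varnothing$, then every non-trivial element of finite order in the group $\operatorname{Aut}(Q)$ has order $2$, and every finite subgroup of $\operatorname{Aut}(Q)$ has order at most $2^{n-1}$. (iii) If $n$ is even and $Q(\mathbb{K})=\varnothing$, then every non-trivial element of finite order in the group $\operatorname{Aut}(Q)$ has order $2$ or $4$, and every finite subgroup of $\operatorname{Aut}(Q)$ has order at most $8^{n-1}$. (iv) If $n=4$ and $Q(\mathbb{K})=\varnothing$, then every finite subgroup of $\operatorname{Aut}(Q)$ has order at most $32$.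
   Context: A field $\mathbb{K}$ contains all roots of $1$ if for every positive integer $n$ the polynomial $x^n-1$ splits completely in $\mathbb{K}[x]$. $\operatorname{Aut}(Q)$ is the group of automorphisms of $Q$ over $\mathbb{K}$. A group $\Gamma$ has bounded finite subgroups if there is a constant $B=B(\Gamma)$ such that $|G|\le B$ for every finite subgroup $G\subset\Gamma$. *)

theory Defs
  imports
    "HOL-Algebra.Algebraic_Closure_Type"
    "HOL-Algebra.Multiplicative_Group"
    "HOL-Algebra.Bij"
    "HOL-Analysis.Cartesian_Space"
    "HOL-Library.Poly_Mapping"
begin

section \<open>Fields\<close>

definition contains_all_roots_of_unity :: "'a::field itself \<Rightarrow> bool" where
  "contains_all_roots_of_unity _ \<longleftrightarrow>
     (\<forall>m>0. \<exists>A :: 'a multiset. Polynomial.monom 1 m - 1 = (\<Prod>a\<in>#A. [:- a, 1:]))"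

definition perfect_field :: "'a::field itself \<Rightarrow> bool" where
  "perfect_field _ \<longleftrightarrow> CHAR('a) = 0 \<or> surj (\<lambda>x::'a. x ^ CHAR('a))"


section \<open>Multivariate polynomials\<close>

type_synonym ('n, 'a) mvpoly = "('n \<Rightarrow>\<^sub>0 nat) \<Rightarrow>\<^sub>0 'a"

definition homogeneous :: "nat \<Rightarrow> ('n::finite, 'a::zero) mvpoly \<Rightarrow> bool" where
  "homogeneous d p \<longleftrightarrow> (\<forall>m\<in>Poly_Mapping.keys p. (\<Sum>i\<in>UNIV. Poly_Mapping.lookup m i) = d)"

text \<open>Evaluation at a point with coordinates in an extension, the coefficients being sent
  there by \<open>h\<close>.\<close>

definition mv_eval ::
    "('a::zero \<Rightarrow> 'b::comm_semiring_1) \<Rightarrow> ('n::finite, 'a) mvpoly \<Rightarrow> 'b ^ 'n \<Rightarrow> 'b" where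
  "mv_eval h p x =
     (\<Sum>m\<in>Poly_Mapping.keys p.
        h (Poly_Mapping.lookup p m) * (\<Prod>i\<in>UNIV. (x $ i) ^ Poly_Mapping.lookup m i))"

definition mv_pderiv :: "'n \<Rightarrow> ('n::finite, 'a::comm_semiring_1) mvpoly \<Rightarrow> ('n, 'a) mvpoly" where
  "mv_pderiv i p =
     (\<Sum>m\<in>Poly_Mapping.keys p.
        Poly_Mapping.single (m - Poly_Mapping.single i 1)
          (of_nat (Poly_Mapping.lookup m i) * Poly_Mapping.lookup p m))"


section \<open>Projective hypersurfaces\<close>

text \<open>A point of projective space is the set of all its vectors of homogeneous coordinates.\<close>

definition proj_point :: "'b::field ^ 'n \<Rightarrow> ('b ^ 'n) set" where
  "proj_point x = {c *s x | c. c \<noteq> 0}"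

definition hypersurface_points ::
    "('a::zero \<Rightarrow> 'b::field) \<Rightarrow> ('n::finite, 'a) mvpoly \<Rightarrow> ('b ^ 'n) set set" where
  "hypersurface_points h q = {proj_point x | x. x \<noteq> 0 \<and> mv_eval h q x = 0}"

abbreviation rational_points :: "('n::finite, 'a::field) mvpoly \<Rightarrow> ('a ^ 'n) set set" where
  "rational_points \<equiv> hypersurface_points (\<lambda>c. c)"

abbreviation geometric_points ::
    "('n::finite, 'a::field) mvpoly \<Rightarrow> ('a alg_closure ^ 'n) set set" where
  "geometric_points \<equiv> hypersurface_points to_ac"

text \<open>Smoothness over the ground field, i.e. the Jacobian criterion at all geometric points.\<close>

definition smooth_hypersurface :: "('n::finite, 'a::field) mvpoly \<Rightarrow> bool" where
  "smooth_hypersurface q \<longleftrightarrow>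
     (\<forall>x. x \<noteq> 0 \<and> mv_eval to_ac q x = 0 \<longrightarrow> (\<exists>i. mv_eval to_ac (mv_pderiv i q) x \<noteq> 0))"

definition smooth_quadric :: "('n::finite, 'a::field) mvpoly \<Rightarrow> bool" where
  "smooth_quadric q \<longleftrightarrow> q \<noteq> 0 \<and> homogeneous 2 q \<and> smooth_hypersurface q"


section \<open>Automorphisms over the ground field\<close>

text \<open>
  Morphisms over the ground field \<open>'a\<close> are given in the classical language, as maps on geometric
  points. A map from the hypersurface \<open>q = 0\<close> to the ambient projective space is a morphism over
  \<open>'a\<close> if every geometric point has a neighbourhood of the form \<open>g \<noteq> 0\<close> on which the map is
  given by homogeneous polynomials of one common degree without common zeros there. All the
  polynomials, including \<open>g\<close>, have coefficients in \<open>'a\<close>, not in its algebraic closure.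
  For a geometrically reduced hypersurface (in particular a smooth one) these maps are
  exactly the morphisms of \<open>'a\<close>-schemes: such a morphism is determined by its effect on
  geometric points, and the sets \<open>g \<noteq> 0\<close> are a basis of the Zariski topology of the scheme.
  No assumption that \<open>'a\<close> is perfect is needed.
\<close>

definition regular_map ::
    "('n::finite, 'a::field) mvpoly \<Rightarrow>
     (('a alg_closure ^ 'n) set \<Rightarrow> ('a alg_closure ^ 'n) set) \<Rightarrow> bool" where
  "regular_map q \<phi> \<longleftrightarrow>
     (\<forall>x. x \<noteq> 0 \<and> mv_eval to_ac q x = 0 \<longrightarrow>
        (\<exists>(d::nat) (e::nat) (f :: 'n \<Rightarrow> ('n, 'a) mvpoly) (g :: ('n, 'a) mvpoly).
           (\<forall>j. homogeneous d (f j)) \<and> homogeneous e g \<and> mv_eval to_ac g x \<noteq> 0 \<and>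
           (\<forall>y. y \<noteq> 0 \<and> mv_eval to_ac q y = 0 \<and> mv_eval to_ac g y \<noteq> 0 \<longrightarrow>
              (\<chi> j. mv_eval to_ac (f j) y) \<noteq> 0 \<and>
              \<phi> (proj_point y) = proj_point (\<chi> j. mv_eval to_ac (f j) y))))"

definition Aut_hypersurface ::
    "('n::finite, 'a::field) mvpoly \<Rightarrow>
     (('a alg_closure ^ 'n) set \<Rightarrow> ('a alg_closure ^ 'n) set) monoid" where
  "Aut_hypersurface q =
     BijGroup (geometric_points q)
       \<lparr>carrier := {\<phi> \<in> Bij (geometric_points q).
                      regular_map q \<phi> \<and>
                      regular_map q (inv_into (geometric_points q) \<phi>)}\<rparr>"


section \<open>Finite subgroups\<close>

definition bounded_finite_subgroups :: "('g, 'm) monoid_scheme \<Rightarrow> bool" where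
  "bounded_finite_subgroups \<Gamma> \<longleftrightarrow>
     (\<exists>B::nat. \<forall>G. subgroup G \<Gamma> \<and> finite G \<longrightarrow> card G \<le> B)"

end

theory Submission
  imports Defs "HOL-Analysis.Determinants"
begin

no_notation fps_nth (infixl \<open>$\<close> 75)

text \<open>
  A rational point \<open>x\<close> is completed by smoothness to a hyperbolic pair, and the torus scaling the
  pair by \<open>t\<close> and \<open>1 / t\<close> contains cyclic groups of arbitrarily large order, because the ground
  field has all roots of unity. Over a perfect field of characteristic two a rational point always
  exists: for orthogonal vectors \<open>v\<close>, \<open>w\<close> with \<open>q v = \<alpha>\<^sup>2\<close> and \<open>q w = \<beta>\<^sup>2\<close>, the vector
  \<open>\<beta> v + \<alpha> w\<close> is isotropic.

  Let now \<open>q\<close> be anisotropic, so that the characteristic is not two. Every automorphism is linear: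
  along a conic of the quadric it is given by a polynomial curve \<open>F\<close>, and the inner products of the
  images of tangent fields form a nowhere degenerate Gram matrix of polynomials, whose determinant
  is therefore constant. Comparing the conic with its reversed parametrisation gives
  \<open>deg F = 2\<close>; hence the automorphism is linear in affine charts. A line over the ground field
  meets the quadric in a pair of conjugate points, whence the matrix can be taken over the ground
  field, and it is a similitude \<open>A\<close> with some multiplier \<open>c\<close>.

  An orthogonal transformation of finite order has eigenvalues in the ground field, and anisotropy
  makes them \<open>1\<close> or \<open>- 1\<close>. Applied to \<open>A\<^sup>2 / c\<close> this bounds the order by \<open>4\<close>; for odd \<open>n\<close> the
  multiplier is a square and \<open>A\<close> itself can be made orthogonal. In a finite group \<open>H\<close> of
  similitudes modulo scalars, the elements with square multiplier lift to an elementary abelian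
  \<open>2\<close>-group of orthogonal transformations, which splits the space into \<open>s\<close> weight spaces, permuted
  by \<open>H\<close>. If \<open>d\<close> is the least dimension of a weight space, elements of its stabiliser with
  multipliers in distinct square classes act on it by linearly independent operators, so that
  there are at most \<open>d\<^sup>2\<close> classes. This yields
  \<open>card H \<le> 2 ^ (s - 1) * s * d\<^sup>2\<close> with \<open>s * d \<le> n\<close>.
\<close>

section \<open>Polynomial functions of one variable\<close>

text \<open>Linearity is the main obstacle, because an automorphism is given only by local formulas
  of unknown degree. The determinant argument is a comparison of line bundles done in coordinates:
  the tangent spaces of a quadric carry a nondegenerate form with values in O(2), and transport by
  the automorphism gives one with values in the pullback of O(2). On a conic O(1) has degree 2, so
  the determinants give \<open>4 * N = 2 * e * N\<close>, where \<open>N = n - 2\<close> and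
  \<open>e\<close> is the degree of the image curve. The argument also covers quadric surfaces,
  whose geometric Picard group has rank two. Descent must include imperfect fields, so a linear
  functional from the closure to the ground field replaces averaging over a Galois group. In the
  count of square classes an operator of the stabiliser squares to plus or minus its multiplier on
  the block. The sign is harmless because \<open>- 1\<close> is a square, fourth roots of unity
  being present. The factor \<open>2 ^ (s - 1)\<close> arises because an isometric lift is
  determined by its \<open>s\<close> signs on the weight spaces and each group element with square
  multiplier has two lifts.\<close>

definition polyf :: "('k::field \<Rightarrow> 'k) \<Rightarrow> bool" where
  "polyf f \<longleftrightarrow> (\<exists>p. \<forall>t. f t = poly p t)"

definition pcurve :: "('k::field \<Rightarrow> 'k ^ 'n) \<Rightarrow> bool" where
  "pcurve c \<longleftrightarrow> (\<forall>i. polyf (\<lambda>t. c t $ i))"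

lemma polyfE:
  assumes "polyf f" obtains p where "\<And>t. f t = poly p t"
  using assms unfolding polyf_def by blast

lemma polyf_poly [intro!]: "polyf (\<lambda>t. poly p t)"
  unfolding polyf_def by blast

lemma polyf_const [simp, intro!]: "polyf (\<lambda>t. a)"
  unfolding polyf_def by (rule exI[of _ "[:a:]"]) simp

lemma polyf_ident [simp, intro!]: "polyf (\<lambda>t. t)"
  unfolding polyf_def by (rule exI[of _ "[:0, 1:]"]) simp

lemma polyf_add [intro!]: "polyf f \<Longrightarrow> polyf g \<Longrightarrow> polyf (\<lambda>t. f t + g t)"
  unfolding polyf_def by (metis poly_add)

lemma polyf_mult [intro!]: "polyf f \<Longrightarrow> polyf g \<Longrightarrow> polyf (\<lambda>t. f t * g t)"
  unfolding polyf_def by (metis poly_mult)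

lemma polyf_diff [intro!]: "polyf f \<Longrightarrow> polyf g \<Longrightarrow> polyf (\<lambda>t. f t - g t)"
  unfolding polyf_def by (metis poly_diff)

lemma polyf_power [intro!]: "polyf f \<Longrightarrow> polyf (\<lambda>t. f t ^ m)"
  unfolding polyf_def by (metis poly_power)

lemma polyf_sum [intro!]: "(\<And>i. i \<in> A \<Longrightarrow> polyf (f i)) \<Longrightarrow> polyf (\<lambda>t. \<Sum>i\<in>A. f i t)"
  by (induction A rule: infinite_finite_induct) auto

lemma polyf_prod [intro!]: "(\<And>i. i \<in> A \<Longrightarrow> polyf (f i)) \<Longrightarrow> polyf (\<lambda>t. \<Prod>i\<in>A. f i t)"
  by (induction A rule: infinite_finite_induct) auto

lemma pcurve_const [simp, intro!]: "pcurve (\<lambda>t. v)"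
  by (simp add: pcurve_def)

lemma pcurve_add [intro!]: "pcurve c \<Longrightarrow> pcurve d \<Longrightarrow> pcurve (\<lambda>t. c t + d t)"
  by (auto simp: pcurve_def)

lemma pcurve_scale [intro!]: "polyf f \<Longrightarrow> pcurve c \<Longrightarrow> pcurve (\<lambda>t. f t *s c t)"
  by (auto simp: pcurve_def)

lemma pcurve_sum [intro!]: "(\<And>i. i \<in> A \<Longrightarrow> pcurve (c i)) \<Longrightarrow> pcurve (\<lambda>t. \<Sum>i\<in>A. c i t)"
  by (induction A rule: infinite_finite_induct) auto

lemma pcurve_mv [intro!]: "pcurve c \<Longrightarrow> pcurve (\<lambda>t. A *v c t)"
  unfolding pcurve_def matrix_vector_mult_def by (auto intro!: polyf_sum polyf_mult)

text \<open>Euclid's argument: over a finite field \<open>?p\<close> would take the value 1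
  everywhere and have no root.\<close>

lemma infinite_alg_closed: "infinite (UNIV :: 'k::alg_closed_field set)"
proof
  assume fin: "finite (UNIV :: 'k set)"
  let ?p = "(\<Prod>a\<in>(UNIV :: 'k set). [:- a, 1:]) + 1"
  have deg: "degree (\<Prod>a\<in>(UNIV :: 'k set). [:- a, 1:]) = card (UNIV :: 'k set)"
    by (subst degree_prod_eq_sum_degree) auto
  have pos: "card (UNIV :: 'k set) > 0"
    using fin by (simp add: card_gt_0_iff)
  have "degree ?p = card (UNIV :: 'k set)"
    using deg pos by (subst degree_add_eq_left) auto
  then obtain x where "poly ?p x = 0"
    using alg_closed_imp_poly_has_root[of ?p] pos by auto
  moreover have "poly (\<Prod>a\<in>(UNIV :: 'k set). [:- a, 1:]) x = 0"
    using fin by (auto simp: poly_prod intro: prod_zero)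
  ultimately show False by simp
qed

lemma poly_eq_0_if_all:
  fixes p :: "'k::alg_closed_field poly"
  assumes "\<And>t. poly p t = 0" shows "p = 0"
proof (rule ccontr)
  assume "p \<noteq> 0"
  then have "finite {t. poly p t = 0}" by (rule poly_roots_finite)
  with assms infinite_alg_closed[where 'k='k] show False by simp
qed

lemma poly_eq_if_all:
  fixes p q :: "'k::alg_closed_field poly"
  assumes "\<And>t. poly p t = poly q t" shows "p = q"
  using poly_eq_0_if_all[of "p - q"] assms by simp

text \<open>Polynomials in one variable form a domain. This identity principle extends every
  identity known only where a denominator is nonzero to the whole line.\<close>

lemma polyf_vanish:
  fixes f g :: "'k::alg_closed_field \<Rightarrow> 'k"
  assumes f: "polyf f" and g: "polyf g" and z: "\<And>t. f t \<noteq> 0 \<Longrightarrow> g t = 0" and nz: "f t1 \<noteq> 0"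
  shows "g t = 0"
proof -
  obtain p where p: "\<And>t. f t = poly p t" using f by (elim polyfE) metis
  obtain r where r: "\<And>t. g t = poly r t" using g by (elim polyfE) metis
  have "poly (p * r) t = 0" for t using z[of t] p r by auto
  then have "p * r = 0" by (rule poly_eq_0_if_all)
  moreover have "p \<noteq> 0" using nz p by auto
  ultimately show ?thesis by (simp add: r)
qed

lemma polyf_vanish_nonzero:
  fixes g :: "'k::alg_closed_field \<Rightarrow> 'k"
  assumes g: "polyf g" and z: "\<And>t. t \<noteq> 0 \<Longrightarrow> g t = 0"
  shows "g t = 0"
  by (rule polyf_vanish[of "\<lambda>t. t" g 1]) (use assms in auto)

lemma polyf_nonvanishing_const:
  fixes f :: "'k::alg_closed_field \<Rightarrow> 'k"
  assumes f: "polyf f" and nz: "\<And>t. f t \<noteq> 0"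
  shows "f t = f 0"
proof -
  obtain p where p: "\<And>t. f t = poly p t" using f by (elim polyfE) metis
  have "degree p = 0"
    using alg_closed_imp_poly_has_root[of p] nz p by (metis gr0I)
  then show ?thesis by (metis p degree_eq_zeroE poly_const_conv)
qed

text \<open>Divisibility can be tested near each point of the line, \<open>m\<close> being the
  denominator allowed near \<open>t1\<close>. One root of \<open>p\<close> is removed at a time:
  where \<open>p\<close> vanishes and \<open>m\<close> does not, \<open>a\<close> vanishes too, and
  the hypothesis survives cancelling the common linear factor.\<close>

lemma polyf_divides:
  fixes a p :: "'k::alg_closed_field \<Rightarrow> 'k"
  assumes a: "polyf a" and p: "polyf p" and nz: "p t0 \<noteq> 0"
    and loc: "\<And>t1. \<exists>m r. polyf m \<and> polyf r \<and> m t1 \<noteq> 0 \<and> (\<forall>t. m t * a t = p t * r t)"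
  shows "\<exists>r. polyf r \<and> (\<forall>t. a t = p t * r t)"
proof -
  have "P dvd B" if "P \<noteq> 0" and "\<And>t1. \<exists>m. poly m t1 \<noteq> 0 \<and> P dvd m * B" for P B :: "'k poly"
    using that
  proof (induction "degree P" arbitrary: P B)
    case 0
    then show ?case by (metis is_unit_iff_degree unit_imp_dvd)
  next
    case (Suc n)
    obtain x where x: "poly P x = 0"
      using alg_closed_imp_poly_has_root[of P] Suc.hyps(2) by auto
    then obtain P1 where P1: "P = [:- x, 1:] * P1" by (metis dvdE poly_eq_0_iff_dvd)
    obtain m where m: "poly m x \<noteq> 0" "P dvd m * B" using Suc.prems(2) by blast
    have "poly (m * B) x = 0" using m(2) x by (metis dvdE mult_zero_left poly_mult)
    then have "poly B x = 0" using m(1) by simp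
    then obtain B1 where B1: "B = [:- x, 1:] * B1" by (metis dvdE poly_eq_0_iff_dvd)
    have P10: "P1 \<noteq> 0" using P1 Suc.prems(1) by auto
    have "degree P = Suc (degree P1)"
      unfolding P1 using P10 by (subst degree_mult_eq) auto
    then have "n = degree P1" using Suc.hyps(2) by simp
    moreover have "\<exists>m. poly m t1 \<noteq> 0 \<and> P1 dvd m * B1" for t1
    proof -
      obtain m where m: "poly m t1 \<noteq> 0" "P dvd m * B" using Suc.prems(2) by blast
      then have "[:- x, 1:] * P1 dvd [:- x, 1:] * (m * B1)"
        unfolding P1 B1 by (metis mult.left_commute)
      then have "P1 dvd m * B1" by (subst (asm) dvd_times_left_cancel_iff) auto
      with m(1) show ?thesis by blast
    qed
    ultimately have "P1 dvd B1" using Suc.hyps(1) P10 by blast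
    then show ?case unfolding P1 B1 by (rule mult_dvd_mono[OF dvd_refl])
  qed
  note * = this
  obtain P where P: "\<And>t. p t = poly P t" using p by (elim polyfE) metis
  obtain B where B: "\<And>t. a t = poly B t" using a by (elim polyfE) metis
  have "P dvd B"
  proof (rule *)
    show "P \<noteq> 0" using nz P by auto
    fix t1
    obtain m r where mr: "polyf m" "polyf r" "m t1 \<noteq> 0" "\<forall>t. m t * a t = p t * r t" using loc[of t1] by metis
    obtain M where M: "\<And>t. m t = poly M t" using mr(1) by (elim polyfE) metis
    obtain R where R: "\<And>t. r t = poly R t" using mr(2) by (elim polyfE) metis
    have "M * B = P * R" by (rule poly_eq_if_all) (use mr(4) M R B P in auto)
    then show "\<exists>m. poly m t1 \<noteq> 0 \<and> P dvd m * B" using mr(3) M by (metis dvd_triv_left)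
  qed
  then obtain R where "B = P * R" by (auto elim: dvdE)
  then show ?thesis using B P by (intro exI[of _ "poly R"] conjI allI polyf_poly) simp
qed

text \<open>Dividing out the common zeros extends the projective curve across them. The recursion is
  on the degree of one coordinate that is not identically zero.\<close>

lemma pcurve_reduce:
  fixes f :: "'k::alg_closed_field \<Rightarrow> 'k ^ 'n"
  assumes f: "pcurve f" and nz: "f t0 \<noteq> 0"
  shows "\<exists>h F. polyf h \<and> pcurve F \<and> (\<forall>t. F t \<noteq> 0) \<and> (\<forall>t. f t = h t *s F t)"
proof -
  obtain j where j: "f t0 $ j \<noteq> 0" using nz by (auto simp: vec_eq_iff)
  obtain p where p: "\<And>t. f t $ j = poly p t" using f by (auto simp: polyf_def pcurve_def)
  have "p \<noteq> 0" using j p by auto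
  from f p this show ?thesis
  proof (induction "degree p" arbitrary: p f rule: less_induct)
    case less
    show ?case
    proof (cases "\<forall>t. f t \<noteq> 0")
      case True
      then show ?thesis using less.prems(1) by (intro exI[of _ "\<lambda>t. 1"] exI[of _ f]) auto
    next
      case False
      then obtain x where x: "f x = 0" by auto
      have "\<exists>r. \<forall>t. f t $ i = (t - x) * poly r t" for i
      proof -
        obtain s where s: "\<And>t. f t $ i = poly s t"
          using less.prems(1) by (auto simp: polyf_def pcurve_def)
        have "poly s x = 0" using s[of x] x by simp
        then obtain r where "s = [:- x, 1:] * r" by (metis dvdE poly_eq_0_iff_dvd)
        then have "\<forall>t. f t $ i = (t - x) * poly r t" using s by (simp only: poly_mult) simp
        then show ?thesis ..
      qed
      then obtain r where r: "\<And>i t. f t $ i = (t - x) * poly (r i) t" by metis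
      define f1 where "f1 = (\<lambda>t. \<chi> i. poly (r i) t)"
      have f1: "pcurve f1" by (auto simp: f1_def pcurve_def polyf_def)
      have eq: "p = [:- x, 1:] * r j"
        by (rule poly_eq_if_all) (simp add: less.prems(2)[symmetric] r[of _ j] algebra_simps)
      have rj: "r j \<noteq> 0" using eq less.prems(3) by auto
      have "degree p = Suc (degree (r j))"
        unfolding eq using rj by (subst degree_mult_eq) auto
      then have "\<exists>h F. polyf h \<and> pcurve F \<and> (\<forall>t. F t \<noteq> 0) \<and> (\<forall>t. f1 t = h t *s F t)"
        using less.hyps[of "r j" f1] f1 rj by (simp add: f1_def)
      then obtain h F where hF: "polyf h" "pcurve F" "\<forall>t. F t \<noteq> 0" "\<forall>t. f1 t = h t *s F t" by blast
      have "f t = ((t - x) * h t) *s F t" for t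
      proof -
        have "f t = (t - x) *s f1 t" by (simp add: vec_eq_iff r f1_def)
        then show ?thesis using hF(4) by (simp add: vector_smult_assoc)
      qed
      then show ?thesis using hF by (intro exI[of _ "\<lambda>t. (t - x) * h t"] exI[of _ F]) auto
    qed
  qed
qed

text \<open>The factor is a quotient of two \<open>j\<close>-th coordinates. It can be computed with
  any other coordinate \<open>F t $ i\<close> as denominator, and these denominators have no common
  zero, so local divisibility applies.\<close>

lemma pcurve_proportional:
  fixes F :: "'k::alg_closed_field \<Rightarrow> 'k ^ 'n"
  assumes F: "pcurve F" "\<And>t. F t \<noteq> 0" and F': "pcurve F'"
    and par: "\<And>t i j. F t $ i * F' t $ j = F t $ j * F' t $ i"
  shows "\<exists>h. polyf h \<and> (\<forall>t. F' t = h t *s F t)"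
proof -
  obtain j where j: "F 0 $ j \<noteq> 0" using F(2)[of 0] by (auto simp: vec_eq_iff)
  have pj: "polyf (\<lambda>t. F t $ j)" "polyf (\<lambda>t. F' t $ j)" using F F' by (auto simp: pcurve_def)
  have "\<exists>r. polyf r \<and> (\<forall>t. F' t $ j = F t $ j * r t)"
  proof (rule polyf_divides[where ?t0.0=0])
    fix t1
    obtain i where i: "F t1 $ i \<noteq> 0" using F(2)[of t1] by (auto simp: vec_eq_iff)
    show "\<exists>m r. polyf m \<and> polyf r \<and> m t1 \<noteq> 0 \<and> (\<forall>t. m t * F' t $ j = F t $ j * r t)"
      using F(1) F' i par
      by (intro exI[of _ "\<lambda>t. F t $ i"] exI[of _ "\<lambda>t. F' t $ i"]) (auto simp: pcurve_def)
  qed (use pj j in auto)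
  then obtain r where r: "polyf r" "\<And>t. F' t $ j = F t $ j * r t" by blast
  have "F' t $ i - r t * F t $ i = 0" for t i
  proof (rule polyf_vanish[of "\<lambda>t. F t $ j" "\<lambda>t. F' t $ i - r t * F t $ i" 0])
    show "polyf (\<lambda>t. F' t $ i - r t * F t $ i)" using F F' r by (auto simp: pcurve_def)
  next
    fix t assume "F t $ j \<noteq> 0"
    moreover have "F t $ j * (F' t $ i - r t * F t $ i) = 0"
      using par[of t i j] r(2)[of t] by (auto simp: algebra_simps)
    ultimately show "F' t $ i - r t * F t $ i = 0" by simp
  qed (use pj j in auto)
  then show ?thesis using r(1) by (intro exI[of _ r]) (auto simp: vec_eq_iff)
qed

text \<open>A nonzero top coefficient \<open>A e\<close> is what later makes the reversed curve
  nonzero at infinity.\<close>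

lemma pcurve_expand:
  fixes F :: "'k::alg_closed_field \<Rightarrow> 'k ^ 'n"
  assumes F: "pcurve F" "F t0 \<noteq> 0"
  shows "\<exists>e A. A e \<noteq> 0 \<and> (\<forall>t. F t = (\<Sum>j\<le>e. t ^ j *s A j))"
proof -
  obtain p where p: "\<And>i t. F t $ i = poly (p i) t"
    using F(1) unfolding pcurve_def polyf_def by metis
  define e where "e = Max ((\<lambda>i. degree (p i)) ` UNIV)"
  have le: "degree (p i) \<le> e" for i unfolding e_def by (rule Max_ge) auto
  have "e \<in> (\<lambda>i. degree (p i)) ` UNIV" unfolding e_def by (rule Max_in) auto
  then obtain i0 where i0: "degree (p i0) = e" by auto
  define A where "A = (\<lambda>j. \<chi> i. coeff (p i) j)"
  have "A e \<noteq> 0"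
  proof (cases "e = 0")
    case False
    then have "coeff (p i0) e \<noteq> 0" using i0 by (metis degree_0 leading_coeff_0_iff)
    then show ?thesis by (auto simp: A_def vec_eq_iff)
  next
    \<comment> \<open>For \<open>e = 0\<close> the degree does not exclude the zero polynomial, so
      the value at \<open>t0\<close> is used.\<close>
    case True
    then have "F t0 $ i = coeff (p i) 0" for i
      using le[of i] p by (metis degree_eq_zeroE coeff_pCons_0 le_zero_eq poly_const_conv)
    then show ?thesis using F(2) True by (auto simp: vec_eq_iff A_def)
  qed
  moreover have "F t = (\<Sum>j\<le>e. t ^ j *s A j)" for t
  proof (unfold vec_eq_iff, intro allI)
    fix i
    have "F t $ i = (\<Sum>j\<le>e. coeff (p i) j * t ^ j)"
      unfolding p by (simp add: poly_altdef, rule sum.mono_neutral_left)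
        (use le[of i] in \<open>auto simp: coeff_eq_0\<close>)
    then show "F t $ i = (\<Sum>j\<le>e. t ^ j *s A j) $ i" by (simp add: A_def mult.commute)
  qed
  ultimately show ?thesis by blast
qed

lemma poly3_zero:
  fixes p0 p1 :: "'k::alg_closed_field"
  assumes r: "polyf r" and z: "\<And>s. p0 + s * p1 + s^2 * r s = 0"
  shows "p0 = 0" "p1 = 0"
proof -
  obtain p where p: "\<And>t. r t = poly p t" using r by (elim polyfE) metis
  have "pCons p0 (pCons p1 p) = 0"
    by (rule poly_eq_0_if_all) (use z p in \<open>simp add: algebra_simps power2_eq_square\<close>)
  then show "p0 = 0" "p1 = 0" by auto
qed

section \<open>Homogeneous polynomial functions and their differentials\<close>

text \<open>The last argument is the differential, as a function of the point and the tangent vector.\<close>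

inductive hpoly :: "nat \<Rightarrow> ('k::field ^ 'n \<Rightarrow> 'k) \<Rightarrow> ('k ^ 'n \<Rightarrow> 'k ^ 'n \<Rightarrow> 'k) \<Rightarrow> bool" where
  zero: "hpoly d (\<lambda>x. 0) (\<lambda>x w. 0)"
| const: "hpoly 0 (\<lambda>x. a) (\<lambda>x w. 0)"
| coord: "hpoly 1 (\<lambda>x. x $ i) (\<lambda>x w. w $ i)"
| add: "hpoly d f f' \<Longrightarrow> hpoly d g g' \<Longrightarrow> hpoly d (\<lambda>x. f x + g x) (\<lambda>x w. f' x w + g' x w)"
| mult: "hpoly d f f' \<Longrightarrow> hpoly e g g' \<Longrightarrow>
    hpoly (d + e) (\<lambda>x. f x * g x) (\<lambda>x w. f' x w * g x + f x * g' x w)"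

lemma hpoly_sum:
  "(\<And>i. i \<in> A \<Longrightarrow> hpoly d (f i) (f' i)) \<Longrightarrow> hpoly d (\<lambda>x. \<Sum>i\<in>A. f i x) (\<lambda>x w. \<Sum>i\<in>A. f' i x w)"
  by (induction A rule: infinite_finite_induct) (auto intro: hpoly.intros)

lemma hpoly_scale: "hpoly d f f' \<Longrightarrow> hpoly d (\<lambda>x. a * f x) (\<lambda>x w. a * f' x w)"
  using hpoly.mult[OF hpoly.const[of a], of d f f'] by simp

lemma hpoly_diff: "hpoly d f f' \<Longrightarrow> hpoly d g g' \<Longrightarrow>
    hpoly d (\<lambda>x. f x - g x) (\<lambda>x w. f' x w - g' x w)"
  using hpoly.add[OF _ hpoly_scale[of d g g' "-1"], of f f'] by simp

lemma hpoly_homogeneous: "hpoly d f f' \<Longrightarrow> f (a *s x) = a ^ d * f x"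
  by (induction rule: hpoly.induct) (auto simp: algebra_simps power_add)

text \<open>The factor \<open>a\<close> on the left keeps the truncated exponent
  \<open>d - 1\<close> out of the statement.\<close>

lemma hpoly_deriv_homogeneous: "hpoly d f f' \<Longrightarrow> a * f' (a *s x) w = a ^ d * f' x w"
proof (induction rule: hpoly.induct)
  case (mult d f f' e g g')
  have "a * (f' (a *s x) w * g (a *s x) + f (a *s x) * g' (a *s x) w)
      = (a * f' (a *s x) w) * g (a *s x) + f (a *s x) * (a * g' (a *s x) w)"
    by (simp add: algebra_simps)
  also have "\<dots> = a ^ (d + e) * (f' x w * g x + f x * g' x w)"
    using mult by (simp add: hpoly_homogeneous power_add algebra_simps)
  finally show ?case .
qed (auto simp: algebra_simps)

lemma hpoly_deriv_add: "hpoly d f f' \<Longrightarrow> f' x (v + w) = f' x v + f' x w"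
  by (induction rule: hpoly.induct) (auto simp: algebra_simps)

lemma hpoly_deriv_scale: "hpoly d f f' \<Longrightarrow> f' x (a *s w) = a * f' x w"
  by (induction rule: hpoly.induct) (auto simp: algebra_simps)

lemma hpoly_euler: "hpoly d f f' \<Longrightarrow> f' x x = of_nat d * f x"
  by (induction rule: hpoly.induct) (auto simp: algebra_simps)

lemma hpoly_pcurve: "hpoly d f f' \<Longrightarrow> pcurve c \<Longrightarrow> polyf (\<lambda>t. f (c t))"
  by (induction rule: hpoly.induct) (auto simp: pcurve_def)

lemma hpoly_deriv_pcurve: "hpoly d f f' \<Longrightarrow> pcurve c \<Longrightarrow> pcurve w \<Longrightarrow> polyf (\<lambda>t. f' (c t) (w t))"
proof (induction rule: hpoly.induct)
  case (mult d f f' e g g')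
  then show ?case by (auto intro!: hpoly_pcurve[OF _ \<open>pcurve c\<close>])
qed (auto simp: pcurve_def)

text \<open>Charts of a quadric are quadratic, so these curves are the ones that occur. The
  acceleration \<open>y\<close> enters only the remainder.\<close>

lemma hpoly_taylor:
  "hpoly d f f' \<Longrightarrow> \<exists>r. polyf r \<and> (\<forall>s. f (x + s *s w + s^2 *s y) = f x + s * f' x w + s^2 * r s)"
proof (induction rule: hpoly.induct)
  case (zero d)
  then show ?case by (intro exI[of _ "\<lambda>_. 0"]) auto
next
  case (const a)
  then show ?case by (intro exI[of _ "\<lambda>_. 0"]) auto
next
  case (coord i)
  then show ?case by (intro exI[of _ "\<lambda>_. y $ i"]) auto
next
  case (add d f f' g g')
  then obtain r1 r2 where
    "polyf r1 \<and> (\<forall>s. f (x + s *s w + s^2 *s y) = f x + s * f' x w + s^2 * r1 s)"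
    "polyf r2 \<and> (\<forall>s. g (x + s *s w + s^2 *s y) = g x + s * g' x w + s^2 * r2 s)" by blast
  then show ?case by (intro exI[of _ "\<lambda>s. r1 s + r2 s"]) (auto simp: algebra_simps)
next
  case (mult d f f' e g g')
  then obtain r1 r2 where
    "polyf r1 \<and> (\<forall>s. f (x + s *s w + s^2 *s y) = f x + s * f' x w + s^2 * r1 s)"
    "polyf r2 \<and> (\<forall>s. g (x + s *s w + s^2 *s y) = g x + s * g' x w + s^2 * r2 s)" by blast
  then show ?case
    by (intro exI[of _ "\<lambda>s. r1 s * (g x + s * g' x w + s^2 * r2 s) + f x * r2 s
          + f' x w * g' x w + s * f' x w * r2 s"])
       (auto simp: algebra_simps power2_eq_square intro!: polyf_add polyf_mult)
qed

lemma hpoly_comp: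
  fixes f :: "'k::field ^ 'n \<Rightarrow> 'k ^ 'm"
  assumes "hpoly e g g'" and "\<And>j. hpoly d (\<lambda>x. f x $ j) (\<lambda>x w. f' x w $ j)"
  shows "hpoly (d * e) (\<lambda>x. g (f x)) (\<lambda>x w. g' (f x) (f' x w))"
  using assms(1)
proof (induction rule: hpoly.induct)
  case (const a)
  then show ?case using hpoly.const by simp
next
  case (coord i)
  then show ?case using assms(2)[of i] by simp
next
  case (mult d1 f1 f1' e1 g1 g1')
  then show ?case
    using hpoly.mult[OF mult.IH] by (simp add: distrib_left)
qed (auto intro: hpoly.intros)

text \<open>An identity that holds only on the quadric may be differentiated along a curve inside
  it: it holds on a nonempty open part of the curve, hence along all of it, and the linear Taylor
  coefficient is zero.\<close>

lemma hpoly_deriv_vanish: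
  fixes x :: "'k::alg_closed_field ^ 'n"
  assumes P: "hpoly d P P'" and g: "hpoly e g g'" and gx: "g x \<noteq> 0"
    and z: "\<And>s. g (x + s *s w + s^2 *s y) \<noteq> 0 \<Longrightarrow> P (x + s *s w + s^2 *s y) = 0"
  shows "P' x w = 0"
proof -
  let ?c = "\<lambda>s. x + s *s w + s^2 *s y"
  have c: "pcurve ?c" by auto
  have "P (?c s) = 0" for s
    by (rule polyf_vanish[of "\<lambda>s. g (?c s)" "\<lambda>s. P (?c s)" 0])
       (use hpoly_pcurve[OF P c] hpoly_pcurve[OF g c] z gx in auto)
  moreover obtain r where r: "polyf r" "\<And>s. P (?c s) = P x + s * P' x w + s^2 * r s"
    using hpoly_taylor[OF P, of x w y] by blast
  ultimately show ?thesis using poly3_zero(2)[OF r(1), of "P x" "P' x w"] by simp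
qed

section \<open>Non-degenerate quadratic forms\<close>

locale quad_form =
  fixes M :: "'k::field ^ 'n ^ 'n"
  assumes M_sym: "M $ i $ j = M $ j $ i"
    and M_nondeg: "M *v x = 0 \<Longrightarrow> x = 0"
    and two: "(2::'k) \<noteq> 0"
begin

definition bf :: "'k ^ 'n \<Rightarrow> 'k ^ 'n \<Rightarrow> 'k" where
  "bf v w = (\<Sum>i\<in>UNIV. v $ i * (M *v w) $ i)"

definition qf :: "'k ^ 'n \<Rightarrow> 'k" where "qf v = bf v v"

lemma bf_alt: "bf v w = (\<Sum>i\<in>UNIV. \<Sum>j\<in>UNIV. M $ i $ j * (v $ i * w $ j))"
  unfolding bf_def matrix_vector_mult_def by (simp add: sum_distrib_left mult_ac)

lemma bf_add_left: "bf (v + v') w = bf v w + bf v' w"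
  by (simp add: bf_def distrib_right sum.distrib)

lemma bf_add_right: "bf w (v + v') = bf w v + bf w v'"
  by (simp add: bf_def matrix_vector_right_distrib distrib_left sum.distrib)

lemma bf_scale_left: "bf (a *s v) w = a * bf v w"
  by (simp add: bf_def sum_distrib_left mult_ac)

lemma bf_scale_right: "bf v (a *s w) = a * bf v w"
  by (simp add: bf_def vec.scale sum_distrib_left mult_ac)

lemma bf_sym: "bf v w = bf w v"
proof -
  have "bf v w = (\<Sum>j\<in>UNIV. \<Sum>i\<in>UNIV. M $ i $ j * (v $ i * w $ j))"
    unfolding bf_alt by (rule sum.swap)
  also have "\<dots> = bf w v"
    unfolding bf_alt by (intro sum.cong refl) (simp add: M_sym mult_ac)
  finally show ?thesis .
qed

lemma bf_zero [simp]: "bf 0 v = 0" "bf v 0 = 0"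
  using bf_scale_left[of 0 0 v] bf_scale_right[of v 0 0] by simp_all

lemma bf_minus_left: "bf (- v) w = - bf v w"
  using bf_scale_left[of "-1" v w] by (simp add: vector_sneg_minus1[symmetric])

lemma bf_minus_right: "bf v (- w) = - bf v w"
  using bf_minus_left[of w v] by (simp add: bf_sym)

lemma bf_diff_left: "bf (v - v') w = bf v w - bf v' w"
  using bf_add_left[of v "- v'" w] by (simp add: bf_minus_left)

lemma bf_diff_right: "bf w (v - v') = bf w v - bf w v'"
  using bf_diff_left[of v v' w] by (simp add: bf_sym)

lemma bf_sum_left: "bf (\<Sum>i\<in>A. f i) w = (\<Sum>i\<in>A. bf (f i) w)"
  by (induction A rule: infinite_finite_induct) (auto simp: bf_add_left)

lemma bf_sum_right: "bf w (\<Sum>i\<in>A. f i) = (\<Sum>i\<in>A. bf w (f i))"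
  by (induction A rule: infinite_finite_induct) (auto simp: bf_add_right)

lemmas bf_lin = bf_add_left bf_add_right bf_scale_left bf_scale_right bf_diff_left bf_diff_right
  bf_minus_left bf_minus_right

lemma qf_zero [simp]: "qf 0 = 0"
  by (simp add: qf_def)

lemma qf_add: "qf (v + w) = qf v + 2 * bf v w + qf w"
  by (simp add: qf_def bf_lin bf_sym[of w v])

lemma qf_scale: "qf (a *s v) = a^2 * qf v"
  by (simp add: qf_def bf_lin power2_eq_square)

lemma bf_nondeg:
  assumes "\<And>w. bf w v = 0" shows "v = 0"
proof (rule M_nondeg)
  have "(M *v v) $ i = 0" for i
  proof -
    have "bf (axis i 1) v = (\<Sum>j\<in>UNIV. if j = i then (M *v v) $ i else 0)"
      unfolding bf_def by (rule sum.cong) (auto simp: axis_def)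
    then show ?thesis using assms by simp
  qed
  then show "M *v v = 0" by (simp add: vec_eq_iff)
qed

lemma bf_nondeg': "v \<noteq> 0 \<Longrightarrow> \<exists>w. bf w v \<noteq> 0"
  using bf_nondeg by blast

lemma bf_polyf [intro!]: "pcurve c \<Longrightarrow> pcurve d \<Longrightarrow> polyf (\<lambda>t. bf (c t) (d t))"
  unfolding bf_alt by (auto simp: pcurve_def)

lemma qf_polyf [intro!]: "pcurve c \<Longrightarrow> polyf (\<lambda>t. qf (c t))"
  unfolding qf_def by auto

text \<open>With the value \<open>- 1\<close> the vector \<open>x + u + qf u *s y\<close> is
  isotropic for every \<open>u\<close> orthogonal to both, since the cross term
  \<open>2 * qf u * bf x y\<close> cancels \<open>qf u\<close>.\<close>

definition hyp :: "'k ^ 'n \<Rightarrow> 'k ^ 'n \<Rightarrow> bool" where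
  "hyp x y \<longleftrightarrow> qf x = 0 \<and> qf y = 0 \<and> 2 * bf x y = -1"

definition perp :: "'k ^ 'n \<Rightarrow> 'k ^ 'n \<Rightarrow> ('k ^ 'n) set" where
  "perp x y = {u. bf x u = 0 \<and> bf y u = 0}"

lemma hyp_sym: "hyp x y \<Longrightarrow> hyp y x"
  by (simp add: hyp_def bf_sym)

lemma perp_sym: "perp x y = perp y x"
  by (auto simp: perp_def)

lemma hyp_nz: "hyp x y \<Longrightarrow> x \<noteq> 0" "hyp x y \<Longrightarrow> y \<noteq> 0"
  by (auto simp: hyp_def)

lemma hyp_bf: "hyp x y \<Longrightarrow> bf x x = 0" "hyp x y \<Longrightarrow> bf y y = 0"
   "hyp x y \<Longrightarrow> bf x y = - (1/2)" "hyp x y \<Longrightarrow> bf y x = - (1/2)"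
  using two by (auto simp: hyp_def qf_def field_simps bf_sym[of y x])

lemma hyp_scale:
  assumes "qf x = 0" "qf z = 0" "bf x z \<noteq> 0"
  shows "hyp x ((- 1 / (2 * bf x z)) *s z)"
  using assms two by (simp add: hyp_def qf_def bf_lin)

lemma hyp_exists:
  assumes x: "x \<noteq> 0" "qf x = 0" shows "\<exists>y. hyp x y"
proof -
  obtain z where z: "bf z x \<noteq> 0" using bf_nondeg'[OF x(1)] by blast
  \<comment> \<open>Along the isotropic direction \<open>x\<close> the form changes linearly, so one
    step makes the partner isotropic.\<close>
  define y where "y = z - (qf z / (2 * bf x z)) *s x"
  have "qf y = 0"
    using z two x(2) by (simp add: y_def qf_def bf_lin bf_sym[of z x])
  moreover have "bf x y \<noteq> 0" using z x(2) by (simp add: y_def qf_def bf_lin bf_sym[of x z])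
  ultimately show ?thesis using hyp_scale[OF x(2)] by blast
qed

lemma perp_subspace: "vec.subspace (perp x y)"
  by (auto simp: perp_def vec.subspace_def bf_lin)

lemma perp_add: "u \<in> perp x y \<Longrightarrow> v \<in> perp x y \<Longrightarrow> u + v \<in> perp x y"
  by (auto simp: perp_def bf_lin)

lemma perp_scale: "u \<in> perp x y \<Longrightarrow> a *s u \<in> perp x y"
  by (auto simp: perp_def bf_lin)

lemma perpD: "u \<in> perp x y \<Longrightarrow> bf x u = 0" "u \<in> perp x y \<Longrightarrow> bf y u = 0"
  "u \<in> perp x y \<Longrightarrow> bf u x = 0" "u \<in> perp x y \<Longrightarrow> bf u y = 0"
  by (auto simp: perp_def bf_sym[of u])

lemma hyp_decomp:
  assumes "hyp x y"
  obtains u where "u \<in> perp x y" "v = (-2 * bf y v) *s x + (-2 * bf x v) *s y + u"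
proof -
  define u where "u = v - ((-2 * bf y v) *s x + (-2 * bf x v) *s y)"
  have "u \<in> perp x y"
    by (simp add: u_def perp_def bf_lin hyp_bf(1,2)[OF assms])
       (simp add: hyp_bf(3,4)[OF assms] two)
  then show ?thesis by (intro that[of u]) (simp_all add: u_def)
qed

lemma perp_nondeg:
  assumes h: "hyp x y" and v: "v \<in> perp x y" "v \<noteq> 0"
  shows "\<exists>w\<in>perp x y. bf w v \<noteq> 0"
proof -
  obtain w where w: "bf w v \<noteq> 0" using bf_nondeg'[OF v(2)] by blast
  obtain u where u: "u \<in> perp x y" "w = (-2 * bf y w) *s x + (-2 * bf x w) *s y + u"
    using hyp_decomp[OF h] by blast
  have "bf w v = bf ((-2 * bf y w) *s x + (-2 * bf x w) *s y + u) v" using u(2) by simp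
  also have "\<dots> = bf u v" using perpD[OF v(1)] by (simp add: bf_lin)
  finally show ?thesis using u(1) w by auto
qed

text \<open>If the partner \<open>w\<close> of \<open>v\<close> provided by nondegeneracy is
  isotropic, then \<open>w + v\<close> or \<open>v\<close> itself serves.\<close>

lemma perp_nonisotropic_bf:
  assumes h: "hyp x y" and v: "v \<in> perp x y" "v \<noteq> 0"
  shows "\<exists>w\<in>perp x y. qf w \<noteq> 0 \<and> bf w v \<noteq> 0"
proof -
  obtain w where w: "w \<in> perp x y" "bf w v \<noteq> 0" using perp_nondeg[OF assms] by blast
  show ?thesis
  proof (cases "qf w = 0")
    case False
    then show ?thesis using w by blast
  next
    case w0: True
    show ?thesis
    proof (cases "qf v = 0")
      case True
      have "qf (w + v) \<noteq> 0" "bf (w + v) v \<noteq> 0"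
        using True w0 w two by (simp_all add: qf_add bf_sym[of v w]) (simp add: bf_lin qf_def)
      then show ?thesis using perp_add[OF w(1) v(1)] by blast
    next
      case False
      then show ?thesis using v by (auto simp: qf_def)
    qed
  qed
qed

lemma perp_nonisotropic:
  assumes h: "hyp x y" and n: "CARD('n) \<ge> 3"
  shows "\<exists>u\<in>perp x y. qf u \<noteq> 0"
proof -
  have "vec.dim (vec.span {x, y}) \<le> card {x, y}"
    by (simp add: vec.dim_le_card')
  also have "\<dots> \<le> 2" by (simp add: card_insert_if)
  finally have "vec.span {x, y} \<noteq> UNIV" using n by (metis One_nat_def Suc_1 Suc_leI not_less_eq_eq
    numeral_3_eq_3 vec_dim_card order_trans)
  then obtain v where v: "v \<notin> vec.span {x, y}" by blast
  obtain u where u: "u \<in> perp x y" "v = (-2 * bf y v) *s x + (-2 * bf x v) *s y + u"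
    using hyp_decomp[OF h] by blast
  have "u \<noteq> 0"
  proof
    assume "u = 0"
    then have "v = (-2 * bf y v) *s x + (-2 * bf x v) *s y" using u(2) by simp
    also have "\<dots> \<in> vec.span {x, y}"
      by (intro vec.span_add vec.span_scale vec.span_base) auto
    finally show False using v by simp
  qed
  then show ?thesis using perp_nonisotropic_bf[OF h u(1)] by blast
qed

text \<open>The affine chart of the quadric centred at \<open>x\<close> whose complement is the
  tangent hyperplane section at \<open>y\<close>.\<close>

definition chart :: "'k ^ 'n \<Rightarrow> 'k ^ 'n \<Rightarrow> 'k ^ 'n \<Rightarrow> 'k ^ 'n" where
  "chart x y u = x + u + qf u *s y"

lemma qf_chart: "hyp x y \<Longrightarrow> u \<in> perp x y \<Longrightarrow> qf (chart x y u) = 0"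
  using two by (simp add: chart_def qf_def bf_lin hyp_bf perpD)

lemma chart_bf: "hyp x y \<Longrightarrow> u \<in> perp x y \<Longrightarrow> bf y (chart x y u) = - (1/2)"
  "hyp x y \<Longrightarrow> u \<in> perp x y \<Longrightarrow> bf x (chart x y u) = - qf u / 2"
  by (simp_all add: chart_def bf_lin hyp_bf perpD)

lemma chart_nz: assumes "hyp x y" "u \<in> perp x y" shows "chart x y u \<noteq> 0"
  using chart_bf(1)[OF assms] two by auto

text \<open>The chart is contained in no hyperplane. If \<open>z\<close> were orthogonal to all its
  points, the coefficients of the polynomial in \<open>t\<close> obtained from \<open>t *s u\<close>
  would make \<open>z\<close> orthogonal to \<open>x\<close>, \<open>y\<close> and every
  non-isotropic \<open>u\<close>.\<close>

lemma bf_chart_exists: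
  assumes h: "hyp x y" and n: "CARD('n) \<ge> 3" and inf: "infinite (UNIV :: 'k set)" and z: "z \<noteq> 0"
  shows "\<exists>u\<in>perp x y. qf u \<noteq> 0 \<and> bf z (chart x y u) \<noteq> 0"
proof (rule ccontr)
  assume "\<not> ?thesis"
  then have *: "bf z (chart x y u) = 0" if "u \<in> perp x y" "qf u \<noteq> 0" for u using that by blast
  have eq: "bf z x = 0 \<and> bf z u = 0 \<and> bf z y = 0" if u: "u \<in> perp x y" "qf u \<noteq> 0" for u
  proof -
    let ?p = "[:bf z x, bf z u, qf u * bf z y:]"
    have "poly ?p t = 0" if "t \<noteq> 0" for t
      using *[OF perp_scale[OF u(1), of t]] u(2) that
      by (simp add: chart_def qf_scale bf_lin algebra_simps power2_eq_square)
    then have "UNIV - {0} \<subseteq> {t. poly ?p t = 0}" by auto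
    then have "infinite {t. poly ?p t = 0}"
      using inf by (metis finite_Diff_insert finite.emptyI Diff_empty infinite_super)
    then have "?p = 0" using poly_roots_finite by blast
    then show ?thesis using u(2) by auto
  qed
  obtain u0 where u0: "u0 \<in> perp x y" "qf u0 \<noteq> 0" using perp_nonisotropic[OF h n] by blast
  have zxy: "z \<in> perp x y" using eq[OF u0] by (simp add: perp_def bf_sym)
  obtain u where "u \<in> perp x y" "qf u \<noteq> 0" "bf u z \<noteq> 0"
    using perp_nonisotropic_bf[OF h zxy z] by blast
  then show False using eq[of u] by (simp add: bf_sym)
qed

text \<open>The vector \<open>u\<close> is split off orthogonally because reversing the conic in
  direction \<open>u\<close> changes the sign of the tangent field of \<open>u\<close> and of no
  other, so that the change of chart is diagonal in this basis.\<close>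

lemma adapted_basis:
  assumes h: "hyp x y" and u: "u \<in> perp x y" "qf u \<noteq> 0"
  obtains B :: "'n \<Rightarrow> 'k ^ 'n" and i0 i1 i2 where
    "i0 \<noteq> i1" "B i0 = x" "B i1 = y" "B i2 = u" "i2 \<noteq> i0" "i2 \<noteq> i1"
    "\<And>i. i \<noteq> i0 \<Longrightarrow> i \<noteq> i1 \<Longrightarrow> B i \<in> perp x y"
    "\<And>i. i \<noteq> i0 \<Longrightarrow> i \<noteq> i1 \<Longrightarrow> i \<noteq> i2 \<Longrightarrow> bf u (B i) = 0"
    "\<And>c. (\<Sum>i\<in>UNIV. c i *s B i) = 0 \<Longrightarrow> c = (\<lambda>i. 0)"
proof -
  define W where "W = {v. bf x v = 0 \<and> bf y v = 0 \<and> bf u v = 0}"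
  have W: "vec.subspace W" by (auto simp: W_def vec.subspace_def bf_lin)
  obtain BW where BW: "BW \<subseteq> W" "vec.independent BW" "W \<subseteq> vec.span BW"
    using vec.basis_exists[of W] by metis
  have spW: "vec.span BW \<subseteq> W" using BW(1) W by (rule vec.span_minimal)
  have uW: "u \<notin> vec.span BW" using spW u(2) by (auto simp: W_def qf_def)
  have "vec.span (insert u BW) \<subseteq> {v. bf x v = 0}"
    by (rule vec.span_minimal)
       (use BW(1) perpD[OF u(1)] in \<open>auto simp: W_def vec.subspace_def bf_lin\<close>)
  then have yW: "y \<notin> vec.span (insert u BW)" using hyp_bf[OF h] two by auto
  have "vec.span (insert y (insert u BW)) \<subseteq> {v. bf y v = 0}"
    by (rule vec.span_minimal)
       (use BW(1) perpD[OF u(1)] hyp_bf[OF h] in \<open>auto simp: W_def vec.subspace_def bf_lin\<close>)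
  then have xW: "x \<notin> vec.span (insert y (insert u BW))" using hyp_bf[OF h] two by auto
  define S where "S = insert x (insert y (insert u BW))"
  have indS: "vec.independent S" unfolding S_def
    using xW yW uW BW(2) by (simp add: vec.independent_insertI)
  have "v \<in> vec.span S" for v
  proof -
    obtain w where w: "w \<in> perp x y" "v = (-2 * bf y v) *s x + (-2 * bf x v) *s y + w"
      using hyp_decomp[OF h] by blast
    define w' where "w' = w - (bf u w / qf u) *s u"
    have "w' \<in> W" using perpD[OF w(1)] perpD[OF u(1)] u(2)
      by (simp add: w'_def W_def bf_lin qf_def)
    then have "w' \<in> vec.span S" using BW(3) vec.span_mono[of BW S] by (auto simp: S_def)
    moreover have "v = (-2 * bf y v) *s x + (-2 * bf x v) *s y + ((bf u w / qf u) *s u + w')"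
      using w(2) by (simp add: w'_def)
    moreover have "x \<in> vec.span S" "y \<in> vec.span S" "u \<in> vec.span S"
      by (auto simp: S_def intro: vec.span_base)
    ultimately show ?thesis
      by (metis vec.span_add vec.span_scale)
  qed
  then have "vec.span S = UNIV" by blast
  then have "card S = CARD('n)"
    using vec.dim_eq_card[of S UNIV] indS by (simp add: card_cart_basis)
  moreover have finS: "finite S" using vec.finiteI_independent[OF indS] .
  ultimately obtain B where B: "bij_betw B (UNIV :: 'n set) S"
    using finite_same_card_bij[of "UNIV :: 'n set" S] by auto
  have injB: "inj B" and imB: "range B = S" using B by (auto simp: bij_betw_def)
  obtain i0 i1 i2 where i: "B i0 = x" "B i1 = y" "B i2 = u"
    using imB unfolding S_def by (metis insertI1 insertI2 rangeE)
  have d1: "x \<noteq> y" using xW by (metis vec.span_base insertI1)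
  have d2: "y \<noteq> u" using yW by (metis vec.span_base insertI1)
  have d3: "x \<noteq> u" using xW by (metis vec.span_base insertI1 insertI2)
  have BWi: "B j \<in> BW" if "j \<noteq> i0" "j \<noteq> i1" "j \<noteq> i2" for j
  proof -
    have "B j \<in> S" using imB by blast
    moreover have "B j \<noteq> x" "B j \<noteq> y" "B j \<noteq> u" using that injB i by (metis injD)+
    ultimately show ?thesis by (auto simp: S_def)
  qed
  show ?thesis
  proof
    show "B j \<in> perp x y" if "j \<noteq> i0" "j \<noteq> i1" for j
      using BWi[OF that] BW(1) u(1) i by (cases "j = i2") (auto simp: W_def perp_def)
    show "bf u (B j) = 0" if "j \<noteq> i0" "j \<noteq> i1" "j \<noteq> i2" for j
      using BWi[OF that] BW(1) by (auto simp: W_def)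
    show "c = (\<lambda>i. 0)" if "(\<Sum>i\<in>UNIV. c i *s B i) = 0" for c
    proof
      fix j
      have "(\<Sum>v\<in>S. c (inv_into UNIV B v) *s v) = 0"
        using that unfolding imB[symmetric] by (simp add: sum.reindex[OF injB] injB)
      then show "c j = 0"
        using vec.independentD[OF indS finS order_refl, of "\<lambda>v. c (inv_into UNIV B v)" "B j"] imB injB by auto
    qed
  qed (use i d1 d2 d3 in auto)
qed

end

lemma (in quad_form) isotropic_exists:
  assumes n: "CARD('n) \<ge> 2" and cl: "\<And>p :: 'k poly. degree p > 0 \<Longrightarrow> \<exists>t. poly p t = 0"
  shows "\<exists>x. x \<noteq> 0 \<and> qf x = 0"
proof -
  obtain i j :: 'n where ij: "i \<noteq> j"
    using n by (metis One_nat_def Suc_1 card_le_Suc0_iff_eq finite not_less_eq_eq UNIV_I)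
  define v w :: "'k ^ 'n" where "v = axis i 1" and "w = axis j 1"
  show ?thesis
  proof (cases "qf w = 0")
    case True
    moreover have "w \<noteq> 0" by (simp add: w_def)
    ultimately show ?thesis by blast
  next
    case False
    let ?p = "[:qf v, 2 * bf v w, qf w:]"
    have "degree ?p > 0" using False by simp
    then obtain t where "poly ?p t = 0" using cl by blast
    then have "qf (v + t *s w) = 0"
      by (simp add: qf_add qf_scale bf_lin algebra_simps power2_eq_square)
    moreover have "(v + t *s w) $ i = 1" using ij by (simp add: v_def w_def axis_def)
    then have "v + t *s w \<noteq> 0" by (metis zero_index zero_neq_one)
    ultimately show ?thesis by blast
  qed
qed

lemma proj_point_eq_iff: "proj_point a = proj_point b \<longleftrightarrow> (\<exists>c. c \<noteq> 0 \<and> a = c *s b)"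
  for a b :: "'b::field ^ 'n"
proof
  assume *: "proj_point a = proj_point b"
  have "a = 1 *s a" by simp
  then have "a \<in> proj_point a" unfolding proj_point_def by fastforce
  then show "\<exists>c. c \<noteq> 0 \<and> a = c *s b" unfolding * by (auto simp: proj_point_def)
next
  assume "\<exists>c. c \<noteq> 0 \<and> a = c *s b"
  then obtain c where c: "c \<noteq> 0" "a = c *s b" by blast
  have "d *s b = (d / c) *s a" for d using c by (simp add: vector_smult_assoc)
  then have "\<exists>e. d *s b = e *s a \<and> e \<noteq> 0" if "d \<noteq> 0" for d
    using that c(1) by (intro exI[of _ "d / c"]) auto
  moreover have "\<exists>e. d *s a = e *s b \<and> e \<noteq> 0" if "d \<noteq> 0" for d
    using that c by (intro exI[of _ "d * c"]) (auto simp: vector_smult_assoc)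
  ultimately show "proj_point a = proj_point b"
    unfolding proj_point_def by blast
qed

lemma proj_point_scale: "c \<noteq> 0 \<Longrightarrow> proj_point (c *s a) = proj_point a"
  for a :: "'b::field ^ 'n"
  by (auto simp: proj_point_eq_iff)

lemma independent_family_spans:
  fixes B :: "'n::finite \<Rightarrow> 'k::field ^ 'n"
  assumes "\<And>c. (\<Sum>i\<in>UNIV. c i *s B i) = 0 \<Longrightarrow> c = (\<lambda>i. 0)"
  shows "\<exists>c. v = (\<Sum>i\<in>UNIV. c i *s B i)"
proof -
  define A where "A = (\<chi> r i. B i $ r)"
  have A: "A *v w = (\<Sum>i\<in>UNIV. (w $ i) *s B i)" for w
    by (simp add: A_def vec_eq_iff matrix_vector_mult_def mult.commute)
  have "\<forall>w. A *v w = 0 \<longrightarrow> w = 0"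
  proof (intro allI impI)
    fix w assume "A *v w = 0"
    then have "(\<lambda>i. w $ i) = (\<lambda>i. 0)" using assms[of "\<lambda>i. w $ i"] by (simp add: A)
    then show "w = 0" by (simp add: vec_eq_iff fun_eq_iff)
  qed
  then obtain A' where "A' ** A = mat 1" unfolding matrix_left_invertible_ker[symmetric] by blast
  then have "A ** A' = mat 1" by (simp add: matrix_left_right_inverse)
  then have "v = A *v (A' *v v)" by (simp add: matrix_vector_mul_assoc)
  then show ?thesis unfolding A by blast
qed

section \<open>Regular maps along conics\<close>

locale quad_closed = quad_form M for M :: "'k::alg_closed_field ^ 'n ^ 'n" +
  assumes n3: "CARD('n) \<ge> 3"
begin

text \<open>The formal differentials belong to the data, so that derivatives of different
  representations can be compared. Nothing is claimed about \<open>f\<close> away from the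
  quadric.\<close>

definition lrep where
  "lrep \<phi> d f f' e g g' \<longleftrightarrow>
     (\<forall>j. hpoly d (\<lambda>x :: 'k ^ 'n. (f x :: 'k ^ 'n) $ j) (\<lambda>x w. (f' x w :: 'k ^ 'n) $ j)) \<and>
     hpoly e g g' \<and>
     (\<forall>y. y \<noteq> 0 \<longrightarrow> qf y = 0 \<longrightarrow> g y \<noteq> 0 \<longrightarrow> f y \<noteq> 0 \<and> \<phi> (proj_point y) = proj_point (f y))"

definition regular :: "(('k ^ 'n) set \<Rightarrow> ('k ^ 'n) set) \<Rightarrow> bool" where
  "regular \<phi> \<longleftrightarrow>
     (\<forall>x. x \<noteq> 0 \<longrightarrow> qf x = 0 \<longrightarrow> (\<exists>d f f' e g g'. lrep \<phi> d f f' e g g' \<and> g x \<noteq> 0))"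

lemma regularE:
  assumes "regular \<phi>" "x \<noteq> 0" "qf x = 0"
  obtains d f f' e g g' where "lrep \<phi> d f f' e g g'" "g x \<noteq> 0"
proof -
  have "\<exists>d f f' e g g'. lrep \<phi> d f f' e g g' \<and> g x \<noteq> 0"
    using assms unfolding regular_def by simp
  then show ?thesis by (elim exE conjE) (rule that)
qed

text \<open>The velocity at \<open>s = 0\<close> of \<open>chart x y (u + s *s v)\<close>; the
  \<open>y\<close>-component is the differential of \<open>qf\<close>.\<close>

definition tang :: "'k ^ 'n \<Rightarrow> 'k ^ 'n \<Rightarrow> 'k ^ 'n \<Rightarrow> 'k ^ 'n" where
  "tang y u v = v + (2 * bf u v) *s y"

lemma chart_line:
  "chart x y (u + s *s v) = chart x y u + s *s tang y u v + s^2 *s (qf v *s y)"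
  unfolding chart_def tang_def qf_add qf_scale
  by (simp add: vec_eq_iff bf_lin algebra_simps power2_eq_square)

lemma tang_lin: "tang y u (v + w) = tang y u v + tang y u w" "tang y u (a *s v) = a *s tang y u v"
  by (simp_all add: tang_def bf_lin vec_eq_iff algebra_simps)

lemma tang_pcurve [intro!]: "pcurve (\<lambda>t. tang y (t *s u) v)"
  unfolding tang_def by (auto simp: bf_lin)

lemma chart_pcurve [intro!]: "pcurve (\<lambda>t. chart x y (t *s u))"
  unfolding chart_def by (auto simp: qf_scale)

context
  fixes \<phi> d f f' e g g' assumes rep: "lrep \<phi> d f f' e g g'"
begin

lemma lrepD: "hpoly d (\<lambda>x. f x $ j) (\<lambda>x w. f' x w $ j)" "hpoly e g g'"
  "\<And>y. y \<noteq> 0 \<Longrightarrow> qf y = 0 \<Longrightarrow> g y \<noteq> 0 \<Longrightarrow> f y \<noteq> 0"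
  "\<And>y. y \<noteq> 0 \<Longrightarrow> qf y = 0 \<Longrightarrow> g y \<noteq> 0 \<Longrightarrow> \<phi> (proj_point y) = proj_point (f y)"
  using rep by (auto simp: lrep_def)

lemma lrep_pcurve: "pcurve c \<Longrightarrow> pcurve (\<lambda>t. f (c t))"
  unfolding pcurve_def[of "\<lambda>t. f (c t)"] by (auto intro: hpoly_pcurve[OF lrepD(1)])

lemma lrep_deriv_pcurve: "pcurve c \<Longrightarrow> pcurve w \<Longrightarrow> pcurve (\<lambda>t. f' (c t) (w t))"
  unfolding pcurve_def[of "\<lambda>t. f' (c t) (w t)"] by (auto intro: hpoly_deriv_pcurve[OF lrepD(1)])

lemma lrep_g_polyf: "pcurve c \<Longrightarrow> polyf (\<lambda>t. g (c t))"
  by (rule hpoly_pcurve[OF lrepD(2)])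

lemma lrep_scale: "f (a *s x) = a ^ d *s f x"
  using hpoly_homogeneous[OF lrepD(1)] by (simp add: vec_eq_iff)

lemma lrep_deriv_lin: "f' x (v + w) = f' x v + f' x w" "f' x (a *s v) = a *s f' x v"
  using hpoly_deriv_add[OF lrepD(1)] hpoly_deriv_scale[OF lrepD(1)] by (simp_all add: vec_eq_iff)

lemma lrep_deriv_scale: "a *s f' (a *s x) w = a ^ d *s f' x w"
  using hpoly_deriv_homogeneous[OF lrepD(1)] by (simp add: vec_eq_iff)

lemma lrep_euler: "f' x x = of_nat d *s f x"
  using hpoly_euler[OF lrepD(1)] by (simp add: vec_eq_iff)

end

end

locale quad_aut = quad_closed M for M :: "'k::alg_closed_field ^ 'n ^ 'n" +
  fixes \<phi> \<psi> :: "('k ^ 'n) set \<Rightarrow> ('k ^ 'n) set"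
  assumes reg: "regular \<phi>" and reg': "regular \<psi>"
    and maps: "x \<noteq> 0 \<Longrightarrow> qf x = 0 \<Longrightarrow> \<exists>z. z \<noteq> 0 \<and> qf z = 0 \<and> \<phi> (proj_point x) = proj_point z"
    and inverse: "x \<noteq> 0 \<Longrightarrow> qf x = 0 \<Longrightarrow> \<psi> (\<phi> (proj_point x)) = proj_point x"
begin

lemma image_isotropic:
  assumes "x \<noteq> 0" "qf x = 0" "\<phi> (proj_point x) = proj_point z"
  shows "qf z = 0"
proof -
  obtain z' where "qf z' = 0" "\<phi> (proj_point x) = proj_point z'" using maps assms by blast
  then show ?thesis using assms(3) by (auto simp: proj_point_eq_iff qf_scale)
qed

definition on_quadric :: "('k \<Rightarrow> 'k ^ 'n) \<Rightarrow> bool" where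
  "on_quadric c \<longleftrightarrow> pcurve c \<and> (\<forall>t. c t \<noteq> 0 \<and> qf (c t) = 0)"

lemma on_quadricD: "on_quadric c \<Longrightarrow> pcurve c" "on_quadric c \<Longrightarrow> c t \<noteq> 0" "on_quadric c \<Longrightarrow> qf (c t) = 0"
  by (auto simp: on_quadric_def)

lemma on_quadric_chart: "hyp x y \<Longrightarrow> u \<in> perp x y \<Longrightarrow> on_quadric (\<lambda>t. chart x y (t *s u))"
  by (auto simp: on_quadric_def qf_chart chart_nz perp_scale)

text \<open>Having no zeros, \<open>F\<close> is a primitive lift of the image curve. It is unique
  up to a constant factor, so its degree is an invariant.\<close>

definition image_curve :: "('k \<Rightarrow> 'k ^ 'n) \<Rightarrow> ('k \<Rightarrow> 'k ^ 'n) \<Rightarrow> bool" where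
  "image_curve c F \<longleftrightarrow> pcurve F \<and> (\<forall>t. F t \<noteq> 0 \<and> \<phi> (proj_point (c t)) = proj_point (F t))"

lemma image_curveD: "image_curve c F \<Longrightarrow> pcurve F" "image_curve c F \<Longrightarrow> F t \<noteq> 0"
  "image_curve c F \<Longrightarrow> \<phi> (proj_point (c t)) = proj_point (F t)"
  by (auto simp: image_curve_def)

lemma image_curve_qf: "on_quadric c \<Longrightarrow> image_curve c F \<Longrightarrow> qf (F t) = 0"
  by (rule image_isotropic[OF on_quadricD(2,3) image_curveD(3)])

text \<open>Where \<open>g0\<close> and \<open>g\<close> are both nonzero, \<open>F\<close> and
  \<open>f (c t)\<close> lift the same point; being parallel there, they are parallel everywhere.
  The assumption on \<open>F\<close> is restricted to \<open>g0 t \<noteq> 0\<close>, so that the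
  lemma applies before \<open>F\<close> is known to lift every point.\<close>

lemma curve_rep_aux:
  assumes c: "on_quadric c" and F: "pcurve F" "\<And>t. F t \<noteq> 0"
    and F_im: "\<And>t. g0 t \<noteq> 0 \<Longrightarrow> \<phi> (proj_point (c t)) = proj_point (F t)"
    and g0: "polyf g0" "g0 t0 \<noteq> 0"
    and rep: "lrep \<phi> d f f' e g g'" and gt: "g (c t1) \<noteq> 0"
  shows "\<exists>h. polyf h \<and> (\<forall>t. f (c t) = h t *s F t) \<and> (\<forall>t. g (c t) \<noteq> 0 \<longrightarrow> h t \<noteq> 0)"
proof -
  note pc = on_quadricD(1)[OF c]
  have pf: "pcurve (\<lambda>t. f (c t))" by (rule lrep_pcurve[OF rep pc])
  have pg: "polyf (\<lambda>t. g (c t))" by (rule lrep_g_polyf[OF rep pc])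
  have *: "F t $ i * f (c t) $ j - F t $ j * f (c t) $ i = 0" if "g0 t \<noteq> 0" for t i j
  proof (rule polyf_vanish[of "\<lambda>t. g0 t * g (c t)" "\<lambda>t. F t $ i * f (c t) $ j - F t $ j * f (c t) $ i"])
    have "\<exists>t2. g0 t2 * g (c t2) \<noteq> 0"
    proof (rule ccontr)
      assume "\<nexists>t2. g0 t2 * g (c t2) \<noteq> 0"
      then have "g (c t1) = 0"
        using polyf_vanish[OF g0(1) pg _ g0(2), of t1] by auto
      then show False using gt by simp
    qed
    \<comment> \<open>Any parameter at which both factors are nonzero is a suitable witness.\<close>
    then show "g0 (SOME t. g0 t * g (c t) \<noteq> 0) * g (c (SOME t. g0 t * g (c t) \<noteq> 0)) \<noteq> 0"
      by (rule someI_ex)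
    show "polyf (\<lambda>t. g0 t * g (c t))" using g0 pg by auto
    show "polyf (\<lambda>t. F t $ i * f (c t) $ j - F t $ j * f (c t) $ i)"
      using F(1) pf by (auto simp: pcurve_def)
    fix t assume "g0 t * g (c t) \<noteq> 0"
    then have "proj_point (F t) = proj_point (f (c t))"
      using F_im[of t] lrepD(4)[OF rep] on_quadricD[OF c] by simp
    then obtain a where "F t = a *s f (c t)" by (auto simp: proj_point_eq_iff)
    then show "F t $ i * f (c t) $ j - F t $ j * f (c t) $ i = 0" by simp
  qed
  have par: "F t $ i * f (c t) $ j = F t $ j * f (c t) $ i" for t i j
  proof -
    have "F t $ i * f (c t) $ j - F t $ j * f (c t) $ i = 0"
      by (rule polyf_vanish[of g0 "\<lambda>t. F t $ i * f (c t) $ j - F t $ j * f (c t) $ i" t0])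
        (use * g0 F(1) pf in \<open>auto simp: pcurve_def\<close>)
    then show ?thesis by simp
  qed
  obtain h where h: "polyf h" "\<forall>t. f (c t) = h t *s F t"
    using pcurve_proportional[OF F pf par] by blast
  moreover have "h t \<noteq> 0" if "g (c t) \<noteq> 0" for t
    using lrepD(3)[OF rep _ _ that] on_quadricD[OF c] h(2) by auto
  ultimately show ?thesis by blast
qed

lemma curve_rep:
  assumes "on_quadric c" "image_curve c F" "lrep \<phi> d f f' e g g'" "g (c t1) \<noteq> 0"
  shows "\<exists>h. polyf h \<and> (\<forall>t. f (c t) = h t *s F t) \<and> (\<forall>t. g (c t) \<noteq> 0 \<longrightarrow> h t \<noteq> 0)"
  by (rule curve_rep_aux[where ?g0.0 = "\<lambda>t. 1"]) (use assms in \<open>auto simp: image_curve_def\<close>)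

text \<open>Near each \<open>t1\<close> a local formula for the automorphism is
  \<open>h t *s F t\<close> with \<open>h t1\<close> nonzero, so \<open>F\<close> gives the right
  point there as well.\<close>

lemma image_curve_extend:
  assumes c: "on_quadric c" and F: "pcurve F" "\<And>t. F t \<noteq> 0"
    and g0: "polyf g0" "g0 t0 \<noteq> 0"
    and F_im: "\<And>t. g0 t \<noteq> 0 \<Longrightarrow> \<phi> (proj_point (c t)) = proj_point (F t)"
  shows "image_curve c F"
proof -
  have "\<phi> (proj_point (c t1)) = proj_point (F t1)" for t1
  proof -
    obtain d f f' e g g' where rep: "lrep \<phi> d f f' e g g'" "g (c t1) \<noteq> 0"
      using regularE[OF reg on_quadricD(2,3)[OF c, of t1]] .
    obtain h where h: "\<forall>t. f (c t) = h t *s F t" "\<forall>t. g (c t) \<noteq> 0 \<longrightarrow> h t \<noteq> 0"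
      using curve_rep_aux[OF c F F_im g0 rep] by blast
    have "\<phi> (proj_point (c t1)) = proj_point (f (c t1))"
      using lrepD(4)[OF rep(1)] rep(2) on_quadricD[OF c] by blast
    then show ?thesis using h rep(2) by (simp add: proj_point_scale)
  qed
  then show ?thesis using F by (simp add: image_curve_def)
qed

lemma image_curve_exists:
  assumes c: "on_quadric c" shows "\<exists>F. image_curve c F"
proof -
  obtain d f f' e g g' where rep: "lrep \<phi> d f f' e g g'" "g (c 0) \<noteq> 0"
    using regularE[OF reg on_quadricD(2,3)[OF c, of 0]] .
  have "f (c 0) \<noteq> 0" using lrepD(3)[OF rep(1)] rep(2) on_quadricD[OF c] by blast
  then obtain h F where F: "polyf h" "pcurve F" "\<forall>t. F t \<noteq> 0" "\<forall>t. f (c t) = h t *s F t"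
    using pcurve_reduce[OF lrep_pcurve[OF rep(1) on_quadricD(1)[OF c]], of 0] by metis
  have "image_curve c F"
  proof (rule image_curve_extend[OF c F(2), where ?g0.0 = "\<lambda>t. g (c t)" and ?t0.0 = 0])
    show "polyf (\<lambda>t. g (c t))" by (rule lrep_g_polyf[OF rep(1) on_quadricD(1)[OF c]])
    fix t assume g: "g (c t) \<noteq> 0"
    then have "f (c t) \<noteq> 0" using lrepD(3)[OF rep(1)] on_quadricD[OF c] by blast
    then have "h t \<noteq> 0" using F(4) by auto
    have "\<phi> (proj_point (c t)) = proj_point (f (c t))"
      using lrepD(4)[OF rep(1)] g on_quadricD[OF c] by blast
    then show "\<phi> (proj_point (c t)) = proj_point (F t)"
      using F(4) \<open>h t \<noteq> 0\<close> by (simp add: proj_point_scale)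
  qed (use F rep(2) in auto)
  then show ?thesis by blast
qed

section \<open>The differential of an automorphism\<close>

context
  fixes x y assumes h: "hyp x y"
begin

lemma chart_line_in_quadric:
  assumes "u \<in> perp x y" "v \<in> perp x y"
  shows "chart x y u + s *s tang y u v + s^2 *s (qf v *s y) \<noteq> 0"
    "qf (chart x y u + s *s tang y u v + s^2 *s (qf v *s y)) = 0"
  using chart_nz[OF h] qf_chart[OF h] perp_add perp_scale assms
  unfolding chart_line[symmetric] by blast+

text \<open>Differentiating \<open>qf (f z) = 0\<close> along the quadric puts the image tangents
  into the tangent hyperplane at the image point.\<close>

lemma deriv_isotropic:
  assumes u: "u \<in> perp x y" and v: "v \<in> perp x y"
    and rep: "lrep \<phi> d f f' e g g'" and g: "g (chart x y u) \<noteq> 0"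
  shows "bf (f (chart x y u)) (f' (chart x y u) (tang y u v)) = 0"
proof -
  let ?z = "chart x y u" and ?w = "tang y u v"
  have hP: "hpoly (d + d) (\<lambda>z. \<Sum>i\<in>UNIV. \<Sum>j\<in>UNIV. M $ i $ j * (f z $ i * f z $ j))
      (\<lambda>z w. \<Sum>i\<in>UNIV. \<Sum>j\<in>UNIV. M $ i $ j * (f' z w $ i * f z $ j + f z $ i * f' z w $ j))"
    by (rule hpoly_sum, rule hpoly_sum, rule hpoly_scale, rule hpoly.mult[OF lrepD(1)[OF rep] lrepD(1)[OF rep]])
  have van: "(\<Sum>i\<in>UNIV. \<Sum>j\<in>UNIV. M $ i $ j * (f (?z + s *s ?w + s^2 *s (qf v *s y)) $ i *
        f (?z + s *s ?w + s^2 *s (qf v *s y)) $ j)) = 0"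
      if "g (?z + s *s ?w + s^2 *s (qf v *s y)) \<noteq> 0" for s
  proof -
    note p = chart_line_in_quadric[OF u v, of s]
    have "qf (f (?z + s *s ?w + s^2 *s (qf v *s y))) = 0"
      by (rule image_isotropic[OF p lrepD(4)[OF rep p that]])
    then show ?thesis unfolding qf_def[of "f _"] bf_alt .
  qed
  have "(\<Sum>i\<in>UNIV. \<Sum>j\<in>UNIV. M $ i $ j * (f' ?z ?w $ i * f ?z $ j + f ?z $ i * f' ?z ?w $ j)) = 0"
    by (rule hpoly_deriv_vanish[OF hP lrepD(2)[OF rep] g van])
  then have "bf (f' ?z ?w) (f ?z) + bf (f ?z) (f' ?z ?w) = 0"
    unfolding bf_alt by (simp add: distrib_left sum.distrib)
  then show ?thesis using two by (simp add: bf_sym[of "f' ?z ?w"] mult_2[symmetric] del: mult_2)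
qed

text \<open>The two-by-two minors of \<open>f\<close> and \<open>f1\<close> vanish on the quadric.
  Their derivatives say that the rescaled differentials agree modulo the image point.\<close>

lemma deriv_rep_change:
  assumes u: "u \<in> perp x y" and v: "v \<in> perp x y"
    and rep: "lrep \<phi> d f f' e g g'" and g: "g (chart x y u) \<noteq> 0"
    and rep1: "lrep \<phi> d1 f1 f1' e1 g1 g1'" and g1: "g1 (chart x y u) \<noteq> 0"
    and eq: "f (chart x y u) = a *s F" "f1 (chart x y u) = a1 *s F" and F: "F \<noteq> 0"
  shows "\<exists>m. a *s f1' (chart x y u) (tang y u v) = a1 *s f' (chart x y u) (tang y u v) + m *s F"
proof -
  let ?z = "chart x y u" and ?w = "tang y u v"
  let ?p = "\<lambda>s. ?z + s *s ?w + s^2 *s (qf v *s y)"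
  have *: "(f' ?z ?w $ i * f1 ?z $ j + f ?z $ i * f1' ?z ?w $ j)
      - (f' ?z ?w $ j * f1 ?z $ i + f ?z $ j * f1' ?z ?w $ i) = 0" for i j
  proof -
    have hP: "hpoly (d + d1) (\<lambda>z. f z $ i * f1 z $ j - f z $ j * f1 z $ i)
       (\<lambda>z w. (f' z w $ i * f1 z $ j + f z $ i * f1' z w $ j)
          - (f' z w $ j * f1 z $ i + f z $ j * f1' z w $ i))"
      by (rule hpoly_diff[OF hpoly.mult[OF lrepD(1)[OF rep] lrepD(1)[OF rep1]]
            hpoly.mult[OF lrepD(1)[OF rep] lrepD(1)[OF rep1]]])
    have hg: "hpoly (e + e1) (\<lambda>z. g z * g1 z) (\<lambda>z w. g' z w * g1 z + g z * g1' z w)"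
      by (rule hpoly.mult[OF lrepD(2)[OF rep] lrepD(2)[OF rep1]])
    have van: "f (?p s) $ i * f1 (?p s) $ j - f (?p s) $ j * f1 (?p s) $ i = 0"
      if "g (?p s) * g1 (?p s) \<noteq> 0" for s
    proof -
    from that
    have "proj_point (f (?p s)) = proj_point (f1 (?p s))"
      using lrepD(4)[OF rep] lrepD(4)[OF rep1] chart_line_in_quadric[OF u v] by (metis mult_eq_0_iff)
    then obtain b where "f (?p s) = b *s f1 (?p s)" by (auto simp: proj_point_eq_iff)
    then show ?thesis by simp
    qed
    show ?thesis by (rule hpoly_deriv_vanish[OF hP hg _ van]) (use g g1 in auto)
  qed
  define D where "D = a *s f1' ?z ?w - a1 *s f' ?z ?w"
  have D: "D $ i * F $ j = D $ j * F $ i" for i j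
    using *[of i j] by (simp add: D_def eq algebra_simps)
  obtain j where j: "F $ j \<noteq> 0" using F by (auto simp: vec_eq_iff)
  have "D = (D $ j / F $ j) *s F" using D[of _ j] j by (simp add: vec_eq_iff field_simps)
  then show ?thesis unfolding D_def by (metis add.commute diff_add_cancel)
qed

text \<open>For a representation \<open>p\<close> of \<open>\<psi>\<close> the vector
  \<open>p (f z)\<close> is parallel to \<open>z\<close>. If the image tangent is parallel to
  \<open>f z\<close>, then Euler's relation for \<open>p\<close> and the derivatives of the minors
  make the tangent vector parallel to the point; pairing with \<open>y\<close> shows that it is
  zero.\<close>

lemma deriv_inj:
  assumes u: "u \<in> perp x y" and v: "v \<in> perp x y"
    and rep: "lrep \<phi> d f f' e g g'" and g: "g (chart x y u) \<noteq> 0"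
    and E: "f' (chart x y u) (tang y u v) = a *s f (chart x y u)"
  shows "v = 0"
proof -
  let ?z = "chart x y u" and ?w = "tang y u v"
  have z: "?z \<noteq> 0" "qf ?z = 0" using chart_nz[OF h u] qf_chart[OF h u] by auto
  have fz: "f ?z \<noteq> 0" "\<phi> (proj_point ?z) = proj_point (f ?z)" using lrepD(3,4)[OF rep z g] by auto
  have "qf (f ?z) = 0" by (rule image_isotropic[OF z fz(2)])
  then obtain d1 p p' e1 r r' where rep1: "lrep \<psi> d1 p p' e1 r r'" and r: "r (f ?z) \<noteq> 0"
    using regularE[OF reg' fz(1)] by metis
  have img: "\<exists>b. b \<noteq> 0 \<and> p (f zz) = b *s zz" if zz: "zz \<noteq> 0" "qf zz = 0" "g zz \<noteq> 0" "r (f zz) \<noteq> 0" for zz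
  proof -
    have 1: "f zz \<noteq> 0" "\<phi> (proj_point zz) = proj_point (f zz)"
      using lrepD(3,4)[OF rep zz(1,2,3)] by auto
    have "qf (f zz) = 0" by (rule image_isotropic[OF zz(1,2) 1(2)])
    then have "\<psi> (proj_point (f zz)) = proj_point (p (f zz))"
      using lrepD(4)[OF rep1 1(1)] zz(4) by blast
    then have "proj_point (p (f zz)) = proj_point zz" using inverse[OF zz(1,2)] 1(2) by simp
    then show ?thesis by (simp add: proj_point_eq_iff)
  qed
  obtain b where b: "b \<noteq> 0" "p (f ?z) = b *s ?z" using img[OF z g r] by blast
  let ?p = "\<lambda>s. ?z + s *s ?w + s^2 *s (qf v *s y)"
  have *: "(p' (f ?z) (f' ?z ?w) $ i * ?z $ j + p (f ?z) $ i * ?w $ j)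
      - (p' (f ?z) (f' ?z ?w) $ j * ?z $ i + p (f ?z) $ j * ?w $ i) = 0" for i j
  proof -
    have hP: "hpoly (d * d1 + 1) (\<lambda>z. p (f z) $ i * z $ j - p (f z) $ j * z $ i)
       (\<lambda>z w. (p' (f z) (f' z w) $ i * z $ j + p (f z) $ i * w $ j)
          - (p' (f z) (f' z w) $ j * z $ i + p (f z) $ j * w $ i))"
      by (rule hpoly_diff[OF
            hpoly.mult[OF hpoly_comp[OF lrepD(1)[OF rep1] lrepD(1)[OF rep]] hpoly.coord]
            hpoly.mult[OF hpoly_comp[OF lrepD(1)[OF rep1] lrepD(1)[OF rep]] hpoly.coord]])
    have hg: "hpoly (e + d * e1) (\<lambda>z. g z * r (f z))
        (\<lambda>z w. g' z w * r (f z) + g z * r' (f z) (f' z w))"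
      by (rule hpoly.mult[OF lrepD(2)[OF rep] hpoly_comp[OF lrepD(2)[OF rep1] lrepD(1)[OF rep]]])
    have van: "p (f (?p s)) $ i * ?p s $ j - p (f (?p s)) $ j * ?p s $ i = 0"
      if nz: "g (?p s) * r (f (?p s)) \<noteq> 0" for s
    proof -
      obtain b where b: "p (f (?p s)) = b *s ?p s"
        using img[OF chart_line_in_quadric[OF u v, of s]] nz by (metis mult_eq_0_iff)
      show ?thesis unfolding b by (simp only: vector_smult_component) (simp only: mult_ac diff_self)
    qed
    show ?thesis by (rule hpoly_deriv_vanish[OF hP hg _ van]) (use g r in auto)
  qed
  have "p' (f ?z) (f' ?z ?w) = (a * of_nat d1 * b) *s ?z"
    by (simp add: E lrep_deriv_lin(2)[OF rep1] lrep_euler[OF rep1] b(2) mult.assoc)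
  then have par: "?z $ i * ?w $ j = ?z $ j * ?w $ i" for i j
    using *[of i j] b by (simp add: algebra_simps)
  obtain j where j: "?z $ j \<noteq> 0" using z(1) by (auto simp: vec_eq_iff)
  define k where "k = ?w $ j / ?z $ j"
  have w: "?w = k *s ?z" using par[of _ j] j by (simp add: k_def vec_eq_iff field_simps)
  have "bf y ?w = 0" using perpD[OF v] h by (simp add: tang_def bf_lin hyp_bf)
  then have "k = 0" using chart_bf(1)[OF h u] two by (simp add: w bf_lin)
  then have "?w = 0" using w by simp
  moreover have "bf x ?w = - bf u v" using perpD[OF v] two
    by (simp add: tang_def bf_lin hyp_bf[OF h])
  ultimately show "v = 0" by (simp add: tang_def)
qed

end

end

context quad_aut
begin

text \<open>\<open>gram x y u F v w G\<close> says that \<open>G\<close> is the inner product of the images of two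
  tangent fields along the conic \<open>t \<mapsto> chart x y (t *s u)\<close>. It does not depend on the local
  representation of \<open>\<phi>\<close>, because the image tangents are well defined modulo the isotropic \<open>F t\<close>.\<close>

definition gram where
  "gram x y u F v w G \<longleftrightarrow> polyf G \<and>
     (\<forall>d f f' e g g' a t. lrep \<phi> d f f' e g g' \<longrightarrow> g (chart x y (t *s u)) \<noteq> 0 \<longrightarrow>
        f (chart x y (t *s u)) = a *s F t \<longrightarrow>
        G t * a^2 = bf (f' (chart x y (t *s u)) (tang y (t *s u) v))
                       (f' (chart x y (t *s u)) (tang y (t *s u) w)))"

lemma gramD:
  assumes "gram x y u F v w G" "lrep \<phi> d f f' e g g'" "g (chart x y (t *s u)) \<noteq> 0"
    "f (chart x y (t *s u)) = a *s F t"
  shows "G t * a^2 = bf (f' (chart x y (t *s u)) (tang y (t *s u) v))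
                       (f' (chart x y (t *s u)) (tang y (t *s u) w))"
  by (rule assms(1)[unfolded gram_def, THEN conjunct2, rule_format, OF assms(2-4)])

text \<open>A change of representation alters the image tangents by multiples of \<open>F t\<close>,
  which is isotropic and orthogonal to them, so the quotient by \<open>a^2\<close> is well defined.
  Local divisibility glues the quotients into one polynomial function.\<close>

lemma gram_exists:
  assumes h: "hyp x y" and u: "u \<in> perp x y" and v: "v \<in> perp x y" and w: "w \<in> perp x y"
    and F: "image_curve (\<lambda>t. chart x y (t *s u)) F"
  shows "\<exists>G. gram x y u F v w G"
proof -
  let ?c = "\<lambda>t. chart x y (t *s u)"
  have tu: "t *s u \<in> perp x y" for t by (rule perp_scale[OF u])
  have c: "on_quadric ?c" by (rule on_quadric_chart[OF h u])
  note pc = on_quadricD(1)[OF c] and Fnz = image_curveD(2)[OF F]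
  have change: "a^2 * bf (f1' (?c t) (tang y (t *s u) v)) (f1' (?c t) (tang y (t *s u) w))
      = a1^2 * bf (f' (?c t) (tang y (t *s u) v)) (f' (?c t) (tang y (t *s u) w))"
    if rep: "lrep \<phi> d f f' e g g'" "g (?c t) \<noteq> 0" "f (?c t) = a *s F t"
      and rep1: "lrep \<phi> d1 f1 f1' e1 g1 g1'" "g1 (?c t) \<noteq> 0" "f1 (?c t) = a1 *s F t"
    for d f f' e g g' a d1 f1 f1' e1 g1 g1' a1 t
  proof -
    have nz: "a \<noteq> 0" using lrepD(3)[OF rep(1) on_quadricD(2,3)[OF c] rep(2)] rep(3) by auto
    have orth: "bf (F t) (f' (?c t) (tang y (t *s u) v)) = 0" if "v \<in> perp x y" for v
      using deriv_isotropic[OF h tu that rep(1,2)] nz rep(3) by (simp add: bf_lin)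
    obtain m where m: "a *s f1' (?c t) (tang y (t *s u) v) = a1 *s f' (?c t) (tang y (t *s u) v) + m *s F t"
      using deriv_rep_change[OF h tu v rep(1,2) rep1(1,2) rep(3) rep1(3) Fnz] by blast
    obtain m' where m': "a *s f1' (?c t) (tang y (t *s u) w) = a1 *s f' (?c t) (tang y (t *s u) w) + m' *s F t"
      using deriv_rep_change[OF h tu w rep(1,2) rep1(1,2) rep(3) rep1(3) Fnz] by blast
    have FF: "bf (F t) (F t) = 0" using image_curve_qf[OF c F] by (simp add: qf_def)
    have "a^2 * bf (f1' (?c t) (tang y (t *s u) v)) (f1' (?c t) (tang y (t *s u) w))
       = bf (a *s f1' (?c t) (tang y (t *s u) v)) (a *s f1' (?c t) (tang y (t *s u) w))"
      by (simp add: bf_lin power2_eq_square)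
    also have "\<dots> = a1^2 * bf (f' (?c t) (tang y (t *s u) v)) (f' (?c t) (tang y (t *s u) w))"
      unfolding m m' using orth[OF v] orth[OF w] FF bf_sym[of "f' (?c t) (tang y (t *s u) v)" "F t"]
      by (simp add: bf_lin power2_eq_square)
    finally show ?thesis .
  qed
  let ?num = "\<lambda>f' t. bf (f' (?c t) (tang y (t *s u) v)) (f' (?c t) (tang y (t *s u) w))"
  have num: "polyf (?num f')" if "lrep \<phi> d f f' e g g'" for d f f' e g g'
    by (intro bf_polyf lrep_deriv_pcurve[OF that pc] tang_pcurve)
  obtain d f f' e g g' where rep: "lrep \<phi> d f f' e g g'" "g (?c 0) \<noteq> 0"
    using regularE[OF reg on_quadricD(2,3)[OF c, of 0]] .
  obtain h0 where h0: "polyf h0" "\<And>t. f (?c t) = h0 t *s F t" "\<And>t. g (?c t) \<noteq> 0 \<Longrightarrow> h0 t \<noteq> 0"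
    using curve_rep[OF c F rep] by metis
  \<comment> \<open>\<open>change\<close> needs both denominators to be nonzero; the resulting
    identity of polynomial functions holds for all parameters.\<close>
  have global: "h0 t ^ 2 * ?num f1' t = h1 t ^ 2 * ?num f' t"
    if rep1: "lrep \<phi> d1 f1 f1' e1 g1 g1'" "g1 (?c t1) \<noteq> 0"
      and h1: "polyf h1" "\<And>t. f1 (?c t) = h1 t *s F t"
    for d1 f1 f1' e1 g1 g1' h1 t1 t
  proof -
    have pg: "polyf (\<lambda>t. g (?c t))" "polyf (\<lambda>t. g1 (?c t))"
      by (rule lrep_g_polyf[OF rep(1) pc], rule lrep_g_polyf[OF rep1(1) pc])
    let ?D = "\<lambda>t. h0 t ^ 2 * ?num f1' t - h1 t ^ 2 * ?num f' t"
    have pD: "polyf ?D"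
      by (intro polyf_diff polyf_mult polyf_power num[OF rep(1)] num[OF rep1(1)] h0(1) h1(1))
    have D: "?D t = 0" if "g (?c t) \<noteq> 0" for t
    proof (rule polyf_vanish[OF pg(2) pD _ rep1(2)])
      fix t assume g1: "g1 (?c t) \<noteq> 0"
      show "?D t = 0"
      proof (rule polyf_vanish[OF pg(1) pD _ rep(2)])
        fix t' assume g: "g (?c t') \<noteq> 0"
        show "?D t' = 0"
        proof (rule polyf_vanish[OF polyf_mult[OF pg] pD])
          show "g (?c t'') * g1 (?c t'') \<noteq> 0 \<Longrightarrow> ?D t'' = 0" for t''
            using change[OF rep(1) _ h0(2) rep1(1) _ h1(2)] by simp
          show "g (?c (SOME t. g (?c t) * g1 (?c t) \<noteq> 0)) * g1 (?c (SOME t. g (?c t) * g1 (?c t) \<noteq> 0)) \<noteq> 0"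
          proof (rule someI_ex[of "\<lambda>t. g (?c t) * g1 (?c t) \<noteq> 0"])
            show "\<exists>t. g (?c t) * g1 (?c t) \<noteq> 0"
              using polyf_vanish[OF pg(1,2) _ rep(2), of t1] rep1(2) by auto
          qed
        qed
      qed
    qed
    have "?D t = 0" by (rule polyf_vanish[OF pg(1) pD D rep(2)])
    then show ?thesis by simp
  qed
  have "\<exists>G. polyf G \<and> (\<forall>t. ?num f' t = h0 t ^ 2 * G t)"
  proof (rule polyf_divides[where ?t0.0 = 0])
    show "polyf (?num f')" by (rule num[OF rep(1)])
    show "polyf (\<lambda>t. h0 t ^ 2)" using h0(1) by blast
    show "h0 0 ^ 2 \<noteq> 0" using h0(3)[OF rep(2)] by simp
    fix t1
    obtain d1 f1 f1' e1 g1 g1' where rep1: "lrep \<phi> d1 f1 f1' e1 g1 g1'" "g1 (?c t1) \<noteq> 0"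
      using regularE[OF reg on_quadricD(2,3)[OF c, of t1]] .
    obtain h1 where h1: "polyf h1" "\<And>t. f1 (?c t) = h1 t *s F t" "\<And>t. g1 (?c t) \<noteq> 0 \<Longrightarrow> h1 t \<noteq> 0"
      using curve_rep[OF c F rep1] by metis
    have "polyf (\<lambda>t. h1 t ^ 2)" using h1(1) by blast
    moreover have "h1 t1 ^ 2 \<noteq> 0" using h1(3)[OF rep1(2)] by simp
    moreover have "\<forall>t. h1 t ^ 2 * ?num f' t = h0 t ^ 2 * ?num f1' t"
      using global[OF rep1 h1(1,2)] by simp
    ultimately show "\<exists>m r. polyf m \<and> polyf r \<and> m t1 \<noteq> 0 \<and> (\<forall>t. m t * ?num f' t = h0 t ^ 2 * r t)"
      using num[OF rep1(1)] by (intro exI[of _ "\<lambda>t. h1 t ^ 2"] exI[of _ "?num f1'"]) simp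
  qed
  then obtain G where G: "polyf G" "\<And>t. ?num f' t = h0 t ^ 2 * G t" by metis
  have "G t * a^2 = ?num f1' t"
    if rep1: "lrep \<phi> d1 f1 f1' e1 g1 g1'" "g1 (?c t) \<noteq> 0" "f1 (?c t) = a *s F t"
    for d1 f1 f1' e1 g1 g1' a t
  proof -
    obtain h1 where h1: "polyf h1" "\<And>t. f1 (?c t) = h1 t *s F t"
      using curve_rep[OF c F rep1(1,2)] by metis
    have "(h1 t - a) *s F t = 0" using rep1(3) h1(2)[of t] by (simp add: vec.scale_left_diff_distrib)
    then have a: "a = h1 t" using Fnz[of t] by simp
    let ?D = "\<lambda>t. ?num f1' t - h1 t ^ 2 * G t"
    have "?D t = 0"
    proof (rule polyf_vanish[OF h0(1), of ?D])
      show "polyf ?D" by (intro polyf_diff polyf_mult polyf_power num[OF rep1(1)] G(1) h1(1))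
      show "h0 0 \<noteq> 0" by (rule h0(3)[OF rep(2)])
      fix t assume "h0 t \<noteq> 0"
      then show "?D t = 0" using global[OF rep1(1,2) h1, of t] G(2)[of t] by (simp add: power2_eq_square)
    qed
    then show ?thesis by (simp add: a mult.commute)
  qed
  then show ?thesis using G(1) unfolding gram_def by (intro exI[of _ G]) simp
qed

text \<open>By injectivity of the differential the image tangents, the image point and a vector
  \<open>z0\<close> not orthogonal to that point form a basis. An image tangent in the radical,
  corrected by a multiple of the image point to be orthogonal to \<open>z0\<close>, is orthogonal to
  everything.\<close>

lemma gram_nondeg:
  fixes B :: "'n \<Rightarrow> 'k ^ 'n"
  assumes h: "hyp x y" and u: "u \<in> perp x y"
    and B: "i0 \<noteq> i1" "\<And>i. i \<noteq> i0 \<Longrightarrow> i \<noteq> i1 \<Longrightarrow> B i \<in> perp x y"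
      "\<And>c. (\<Sum>i\<in>UNIV. c i *s B i) = 0 \<Longrightarrow> c = (\<lambda>i. 0)"
    and rep: "lrep \<phi> d f f' e g g'" and g: "g (chart x y u) \<noteq> 0"
    and v: "v \<in> perp x y"
    and orth: "\<And>i. i \<noteq> i0 \<Longrightarrow> i \<noteq> i1 \<Longrightarrow>
       bf (f' (chart x y u) (tang y u (B i))) (f' (chart x y u) (tang y u v)) = 0"
  shows "v = 0"
proof -
  let ?z = "chart x y u"
  define E where "E = (\<lambda>v. f' ?z (tang y u v))"
  have E_lin: "E (v + w) = E v + E w" "E (a *s v) = a *s E v" for v w a
    by (simp_all add: E_def tang_lin lrep_deriv_lin[OF rep])
  have E_sum: "E (\<Sum>i\<in>A. F i) = (\<Sum>i\<in>A. E (F i))" for A and F :: "'n \<Rightarrow> 'k ^ 'n"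
  proof (induction A rule: infinite_finite_induct)
    case empty
    show ?case using E_lin(2)[of 0 0] by simp
  qed (use E_lin(2)[of 0 0] in \<open>auto simp: E_lin\<close>)
  have z: "?z \<noteq> 0" "qf ?z = 0" using chart_nz[OF h u] qf_chart[OF h u] by auto
  have fz: "f ?z \<noteq> 0" "\<phi> (proj_point ?z) = proj_point (f ?z)" using lrepD(3,4)[OF rep z g] by auto
  have q: "qf (f ?z) = 0" by (rule image_isotropic[OF z fz(2)])
  have fE: "bf (f ?z) (E w) = 0" if "w \<in> perp x y" for w
    unfolding E_def by (rule deriv_isotropic[OF h u that rep g])
  obtain z0 where z0: "bf z0 (f ?z) \<noteq> 0" using bf_nondeg'[OF fz(1)] by blast
  define C where "C = (\<lambda>i. if i = i0 then f ?z else if i = i1 then z0 else E (B i))"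
  let ?R = "UNIV - {i0, i1}"
  have split: "(\<Sum>i\<in>UNIV. Y i) = Y i0 + Y i1 + sum Y ?R" for Y :: "'n \<Rightarrow> 'k ^ 'n"
    using B(1) by (simp add: sum.remove[of UNIV i0] sum.remove[of "UNIV - {i0}" i1]
        Diff_insert2[symmetric] insert_commute add.assoc)
  have RB: "i \<in> ?R \<Longrightarrow> B i \<in> perp x y" for i using B(2) by auto
  have sumC: "(\<Sum>i\<in>UNIV. c i *s C i) = c i0 *s f ?z + c i1 *s z0 + E (\<Sum>i\<in>?R. c i *s B i)" for c
  proof -
    have "(\<Sum>i\<in>?R. c i *s C i) = (\<Sum>i\<in>?R. E (c i *s B i))"
      by (rule sum.cong) (auto simp: C_def E_lin)
    then show ?thesis using B(1) by (simp add: split E_sum) (simp add: C_def)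
  qed
  have in_perp: "(\<Sum>i\<in>?R. c i *s B i) \<in> perp x y" for c
    by (intro vec.subspace_sum[OF perp_subspace] perp_scale RB)
  have ind: "c = (\<lambda>i. 0)" if c0: "(\<Sum>i\<in>UNIV. c i *s C i) = 0" for c
  proof -
    let ?w = "\<Sum>i\<in>?R. c i *s B i"
    have 0: "c i0 *s f ?z + c i1 *s z0 + E ?w = 0" using c0 sumC by simp
    have "bf (f ?z) (c i0 *s f ?z + c i1 *s z0 + E ?w) = c i1 * bf (f ?z) z0"
      using q fE[OF in_perp] by (simp add: bf_lin qf_def)
    then have c1: "c i1 = 0" using z0 0 by (simp add: bf_sym)
    then have "E ?w = (- (c i0)) *s f ?z" using 0 by (simp add: eq_neg_iff_add_eq_0 add.commute)
    then have w0: "?w = 0" using deriv_inj[OF h u in_perp rep g] unfolding E_def by blast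
    have "E 0 = 0" using E_lin(2)[of 0 0] by simp
    then have c00: "c i0 = 0" using 0 c1 w0 fz(1) by simp
    have "(\<Sum>i\<in>UNIV. c i *s B i) = 0" using c1 c00 w0 by (simp add: split)
    then show ?thesis by (rule B(3))
  qed
  have EE: "bf (E w) (E v) = 0" if "w = (\<Sum>i\<in>?R. c i *s B i)" for w c
    unfolding that E_sum E_lin using orth by (simp add: bf_sum_left bf_lin E_def)
  define k where "k = bf z0 (E v) / bf z0 (f ?z)"
  have "bf w (E v - k *s f ?z) = 0" for w
  proof -
    obtain c where c: "w = (\<Sum>i\<in>UNIV. c i *s C i)" using independent_family_spans[OF ind] by blast
    have "bf (E (\<Sum>i\<in>?R. c i *s B i)) (f ?z) = 0" using fE[OF in_perp] by (simp add: bf_sym)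
    then show ?thesis unfolding c sumC
      using fE[OF v] q z0 EE[OF refl, of c] by (simp add: bf_lin k_def qf_def)
  qed
  then have "E v = k *s f ?z" using bf_nondeg by (metis eq_iff_diff_eq_0)
  then show ?thesis using deriv_inj[OF h u v rep g] unfolding E_def by blast
qed

end

section \<open>Determinants of Gram matrices and the degree of the image of a conic\<close>

lemma polyf_det:
  fixes A :: "'k::field \<Rightarrow> 'k ^ 'n ^ 'n"
  assumes "\<And>i j. polyf (\<lambda>t. A t $ i $ j)"
  shows "polyf (\<lambda>t. det (A t))"
  unfolding det_def using assms by (intro polyf_sum polyf_mult polyf_const polyf_prod)

definition diagm :: "('n \<Rightarrow> 'k::field) \<Rightarrow> 'k ^ 'n ^ 'n" where
  "diagm d = (\<chi> i j. if i = j then d i else 0)"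

lemma diagm_mult: "(diagm d ** A ** diagm d') $ i $ j = d i * A $ i $ j * d' j"
  unfolding diagm_def matrix_matrix_mult_def
  by (simp add: if_distrib[of "\<lambda>z. z * _"] if_distrib[of "\<lambda>z. _ * z"] cong: if_cong)

lemma det_diagm: "det (diagm d) = prod d UNIV"
  using det_diagonal[of "diagm d"] by (simp add: diagm_def)

lemma monomial_identity_degree:
  fixes C C' :: "'k::alg_closed_field"
  assumes "\<And>s. s \<noteq> 0 \<Longrightarrow> s ^ a * C = s ^ b * C'" "C \<noteq> 0" "C' \<noteq> 0"
  shows "a = b"
proof -
  have eq: "s ^ a * C - s ^ b * C' = 0" for s
    by (rule polyf_vanish_nonzero[of "\<lambda>s. s ^ a * C - s ^ b * C'"]) (use assms in auto)
  have "Polynomial.monom C a = Polynomial.monom C' b"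
    by (rule poly_eq_if_all) (use eq in \<open>simp add: poly_monom mult.commute\<close>)
  then show ?thesis using assms(2,3) by (metis degree_monom_eq)
qed

context quad_aut
begin

text \<open>Identity rows at the two indices of \<open>P\<close>, which belong to \<open>x\<close>
  and \<open>y\<close>, preserve the determinant of the Gram matrix of the remaining directions and
  keep the index type \<open>'n\<close>.\<close>

definition padded :: "'n set \<Rightarrow> ('n \<Rightarrow> 'n \<Rightarrow> 'k \<Rightarrow> 'k) \<Rightarrow> 'k \<Rightarrow> 'k ^ 'n ^ 'n" where
  "padded P G t = (\<chi> i j. if i \<in> P \<or> j \<in> P then if i = j then 1 else 0 else G i j t)"

lemma padded_polyf:
  assumes "\<And>i j. i \<notin> P \<Longrightarrow> j \<notin> P \<Longrightarrow> polyf (G i j)"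
  shows "polyf (\<lambda>t. padded P G t $ i $ j)"
  using assms[of i j] by (cases "i \<in> P \<or> j \<in> P") (auto simp: padded_def)

lemma gram_matrix_nonsingular:
  fixes B :: "'n \<Rightarrow> 'k ^ 'n"
  assumes h: "hyp x y" and u: "u \<in> perp x y"
    and F: "image_curve (\<lambda>t. chart x y (t *s u)) F"
    and B: "i0 \<noteq> i1" "\<And>i. i \<noteq> i0 \<Longrightarrow> i \<noteq> i1 \<Longrightarrow> B i \<in> perp x y"
      "\<And>c. (\<Sum>i\<in>UNIV. c i *s B i) = 0 \<Longrightarrow> c = (\<lambda>i. 0)"
    and G: "\<And>i j. i \<notin> {i0, i1} \<Longrightarrow> j \<notin> {i0, i1} \<Longrightarrow> gram x y u F (B i) (B j) (G i j)"
  shows "det (padded {i0, i1} G t) \<noteq> 0"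
proof
  let ?c = "chart x y (t *s u)" and ?R = "UNIV - {i0, i1}"
  assume "det (padded {i0, i1} G t) = 0"
  then have "\<nexists>A. A ** padded {i0, i1} G t = mat 1"
    using invertible_det_nz invertible_left_inverse by blast
  then obtain v where v: "padded {i0, i1} G t *v v = 0" "v \<noteq> 0"
    unfolding matrix_left_invertible_ker by blast
  have row: "(\<Sum>j\<in>UNIV. padded {i0, i1} G t $ i $ j * v $ j) = 0" for i
    using v(1) by (simp add: vec_eq_iff matrix_vector_mult_def)
  have vP: "v $ i = 0" if "i \<in> {i0, i1}" for i
  proof -
    have "(\<Sum>j\<in>UNIV. padded {i0, i1} G t $ i $ j * v $ j) = (\<Sum>j\<in>UNIV. if j = i then v $ i else 0)"
      using that by (intro sum.cong) (auto simp: padded_def)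
    then show ?thesis using row[of i] by simp
  qed
  have vG: "(\<Sum>j\<in>?R. G i j t * v $ j) = 0" if i: "i \<in> ?R" for i
  proof -
    have "(\<Sum>j\<in>UNIV. padded {i0, i1} G t $ i $ j * v $ j) = (\<Sum>j\<in>?R. padded {i0, i1} G t $ i $ j * v $ j)"
      by (rule sum.mono_neutral_right) (use vP in auto)
    also have "\<dots> = (\<Sum>j\<in>?R. G i j t * v $ j)"
      using i by (intro sum.cong) (auto simp: padded_def)
    finally show ?thesis using row by simp
  qed
  have c: "on_quadric (\<lambda>t. chart x y (t *s u))" by (rule on_quadric_chart[OF h u])
  obtain d f f' e g g' where rep: "lrep \<phi> d f f' e g g'" "g ?c \<noteq> 0"
    using regularE[OF reg on_quadricD(2,3)[OF c, of t]] .
  obtain h1 where h1: "polyf h1" "\<And>t. f (chart x y (t *s u)) = h1 t *s F t"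
    using curve_rep[OF c F rep] by metis
  define E where "E = (\<lambda>v. f' ?c (tang y (t *s u) v))"
  have E_lin: "E (v + w) = E v + E w" "E (a *s v) = a *s E v" for v w a
    by (simp_all add: E_def tang_lin lrep_deriv_lin[OF rep(1)])
  have E_sum: "E (\<Sum>i\<in>A. F i) = (\<Sum>i\<in>A. E (F i))" for A and F :: "'n \<Rightarrow> 'k ^ 'n"
    by (induction A rule: infinite_finite_induct) (use E_lin(2)[of 0 0] in \<open>auto simp: E_lin\<close>)
  define w where "w = (\<Sum>j\<in>?R. v $ j *s B j)"
  have w: "w \<in> perp x y" unfolding w_def
    by (intro vec.subspace_sum[OF perp_subspace] perp_scale B(2)) auto
  have "bf (E (B i)) (E w) = 0" if i: "i \<noteq> i0" "i \<noteq> i1" for i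
  proof -
    have "bf (E (B i)) (E w) = (\<Sum>j\<in>?R. v $ j * bf (E (B i)) (E (B j)))"
      by (simp add: w_def E_sum E_lin bf_sum_right bf_lin)
    also have "\<dots> = (\<Sum>j\<in>?R. v $ j * (G i j t * h1 t ^ 2))"
      using gramD[OF G rep h1(2), of i] i by (intro sum.cong) (auto simp: E_def)
    also have "\<dots> = h1 t ^ 2 * (\<Sum>j\<in>?R. G i j t * v $ j)"
      by (simp add: sum_distrib_left mult_ac)
    also have "\<dots> = 0" using vG i by simp
    finally show ?thesis .
  qed
  then have "w = 0"
    using gram_nondeg[OF h perp_scale[OF u] B rep w] by (simp add: E_def)
  moreover have "(\<Sum>j\<in>UNIV. v $ j *s B j) = w"
    unfolding w_def by (rule sum.mono_neutral_right) (use vP in auto)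
  ultimately have "(\<lambda>j. v $ j) = (\<lambda>j. 0)" using B(3)[of "\<lambda>j. v $ j"] by simp
  then show False using v(2) by (simp add: vec_eq_iff fun_eq_iff)
qed

text \<open>Transition law between the two ends of the conic. Homogeneity of the differential at
  \<open>s^2\<close> times the point gives one factor \<open>s^2\<close> per argument, and the
  rescaling of the lift enters squared. The multiples \<open>m\<close>, \<open>m'\<close> of the
  point become multiples of \<open>F\<close>, which pair to zero.\<close>

lemma gram_reverse:
  assumes h: "hyp x y" and h': "hyp x' y'"
    and u: "u \<in> perp x y" and v: "v \<in> perp x y" and w: "w \<in> perp x y"
    and F: "image_curve (\<lambda>t. chart x y (t *s u)) F"
    and s: "s \<noteq> 0"
    and ch: "chart x' y' (s *s u) = s^2 *s chart x y ((1 / s) *s u)"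
    and R: "R s = s ^ e0 *s F (1 / s)"
    and tv: "tang y' (s *s u) v = a *s tang y ((1 / s) *s u) v + m *s chart x y ((1 / s) *s u)"
    and tw: "tang y' (s *s u) w = b *s tang y ((1 / s) *s u) w + m' *s chart x y ((1 / s) *s u)"
    and G: "gram x y u F v w G" and G': "gram x' y' u R v w G'"
  shows "s ^ 4 * G' s = s ^ (2 * e0) * (a * b * G (1 / s))"
proof -
  let ?c = "chart x y ((1 / s) *s u)" and ?T = "tang y ((1 / s) *s u)" and ?T' = "tang y' (s *s u)"
  have c: "on_quadric (\<lambda>t. chart x y (t *s u))" by (rule on_quadric_chart[OF h u])
  obtain d f f' e g g' where rep: "lrep \<phi> d f f' e g g'" "g ?c \<noteq> 0"
    using regularE[OF reg on_quadricD(2,3)[OF c, of "1 / s"]] .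
  obtain h1 where h1: "\<And>t. f (chart x y (t *s u)) = h1 t *s F t"
      "\<And>t. g (chart x y (t *s u)) \<noteq> 0 \<Longrightarrow> h1 t \<noteq> 0"
    using curve_rep[OF c F rep] by metis
  define k where "k = h1 (1 / s)"
  have k: "k \<noteq> 0" "f ?c = k *s F (1 / s)" using h1 rep(2) by (auto simp: k_def)
  have gs: "g (chart x' y' (s *s u)) \<noteq> 0"
    using rep(2) s unfolding ch hpoly_homogeneous[OF lrepD(2)[OF rep(1)]] by simp
  have "f (chart x' y' (s *s u)) = (s^2) ^ d *s (k *s F (1 / s))"
    unfolding ch lrep_scale[OF rep(1)] k(2) ..
  also have "\<dots> = ((s^2) ^ d * k / s ^ e0) *s R s"
    using s by (simp add: R vector_smult_assoc)
  finally have fs: "f (chart x' y' (s *s u)) = ((s^2) ^ d * k / s ^ e0) *s R s" .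
  let ?E = "\<lambda>v. f' ?c (?T v)"
  have der: "s^2 *s f' (chart x' y' (s *s u)) z = (s^2) ^ d *s f' ?c z" for z
    unfolding ch by (rule lrep_deriv_scale[OF rep(1)])
  have FE: "bf (F (1 / s)) (?E z) = 0" if "z \<in> perp x y" for z
    using deriv_isotropic[OF h perp_scale[OF u] that rep] k by (simp add: bf_lin)
  have EF: "bf (?E z) (F (1 / s)) = 0" if "z \<in> perp x y" for z
    using FE[OF that] by (simp add: bf_sym)
  have FF: "bf (F (1 / s)) (F (1 / s)) = 0" using image_curve_qf[OF c F] by (simp add: qf_def)
  have v': "f' ?c (?T' v) = a *s ?E v + (m * of_nat d * k) *s F (1 / s)"
    unfolding tv by (simp add: lrep_deriv_lin[OF rep(1)] lrep_euler[OF rep(1)] k(2) vector_smult_assoc)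
  have w': "f' ?c (?T' w) = b *s ?E w + (m' * of_nat d * k) *s F (1 / s)"
    unfolding tw by (simp add: lrep_deriv_lin[OF rep(1)] lrep_euler[OF rep(1)] k(2) vector_smult_assoc)
  have "s ^ 4 * (G' s * ((s^2) ^ d * k / s ^ e0)^2)
      = bf (s^2 *s f' (chart x' y' (s *s u)) (?T' v)) (s^2 *s f' (chart x' y' (s *s u)) (?T' w))"
    unfolding gramD[OF G' rep(1) gs fs] by (simp add: bf_lin power4_eq_xxxx power2_eq_square)
  also have "\<dots> = ((s^2) ^ d)^2 * (a * b * bf (?E v) (?E w))"
    unfolding der v' w' using FE[OF v] FE[OF w] EF[OF v] EF[OF w] FF
    by (simp add: bf_lin power2_eq_square)
  also have "\<dots> = ((s^2) ^ d)^2 * (a * b * (G (1 / s) * k^2))"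
    using gramD[OF G rep k(2)] by simp
  finally show ?thesis using s k(1) by (simp add: field_simps power_mult power2_eq_square)
qed

text \<open>Both Gram determinants are polynomial functions without zeros, hence constants
  \<open>C\<close> and \<open>C'\<close>. The transition law turns into an equality of two monomials
  in \<open>s\<close>, whose exponents fix the degree \<open>e\<close>.\<close>

lemma image_conic:
  assumes h: "hyp x y" and u: "u \<in> perp x y" "qf u \<noteq> 0"
  shows "\<exists>a0 a1 a2. a0 \<noteq> 0 \<and> a2 \<noteq> 0 \<and> \<phi> (proj_point x) = proj_point a0 \<and>
    \<phi> (proj_point y) = proj_point a2 \<and>
    image_curve (\<lambda>t. chart x y (t *s u)) (\<lambda>t. a0 + t *s a1 + t^2 *s a2)"
proof -
  let ?c = "\<lambda>t. chart x y (t *s u)"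
  have c: "on_quadric ?c" by (rule on_quadric_chart[OF h u(1)])
  obtain F where F: "image_curve ?c F" using image_curve_exists[OF c] by blast
  obtain e A where A: "A e \<noteq> 0" "\<And>t. F t = (\<Sum>j\<le>e. t ^ j *s A j)"
    using pcurve_expand[OF image_curveD(1,2)[OF F]] by metis
  \<comment> \<open>The lift in the parameter \<open>s = 1 / t\<close>; its value at
    \<open>s = 0\<close> is \<open>A e\<close>.\<close>
  define R where "R = (\<lambda>s. \<Sum>j\<le>e. s ^ (e - j) *s A j)"
  have R: "R s = s ^ e *s F (1 / s)" if "s \<noteq> 0" for s
  proof -
    have "s ^ (e - j) *s A j = s ^ e *s ((1 / s) ^ j *s A j)" if "j \<le> e" for j
      using that \<open>s \<noteq> 0\<close> by (simp add: vector_smult_assoc power_diff power_one_over)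
    then show ?thesis unfolding R_def A(2) vec.scale_sum_right by (intro sum.cong) auto
  qed
  have "R 0 = (\<Sum>j\<le>e. if j = e then A e else 0)"
    unfolding R_def by (rule sum.cong) (auto simp: power_0_left)
  also have "\<dots> = A e" by (subst sum.delta) auto
  finally have R0: "R 0 = A e" .
  have Rnz: "R s \<noteq> 0" for s
    using R0 A(1) R[of s] image_curveD(2)[OF F, of "1 / s"] by (cases "s = 0") auto
  have Rp: "pcurve R" unfolding R_def by auto
  \<comment> \<open>The factor \<open>qf u\<close> is distributed so that the pair stays normalised
    and the new chart at \<open>s *s u\<close> is exactly \<open>s^2\<close> times the old one at
    \<open>(1 / s) *s u\<close>.\<close>
  define x' where "x' = qf u *s y"
  define y' where "y' = (1 / qf u) *s x"
  have h': "hyp x' y'"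
    using h u(2) by (simp add: hyp_def x'_def y'_def qf_scale bf_lin bf_sym[of y x])
  have perp': "perp x' y' = perp x y" using u(2) by (auto simp: perp_def x'_def y'_def bf_lin)
  note u' = u(1)[folded perp']
  let ?c' = "\<lambda>s. chart x' y' (s *s u)"
  have c': "on_quadric ?c'" by (rule on_quadric_chart[OF h' u'])
  have ch: "?c' s = s^2 *s ?c (1 / s)" if "s \<noteq> 0" for s
    using that u(2) by (simp add: chart_def x'_def y'_def qf_scale vec_eq_iff)
      (simp add: field_simps power2_eq_square)
  have R_img: "image_curve ?c' R"
  proof (rule image_curve_extend[OF c' Rp Rnz, where ?g0.0 = "\<lambda>t. t" and ?t0.0 = 1])
    fix s :: 'k assume s: "s \<noteq> 0"
    then show "\<phi> (proj_point (?c' s)) = proj_point (R s)"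
      using image_curveD(3)[OF F, of "1 / s"] by (simp add: ch R proj_point_scale)
  qed auto
  obtain B :: "'n \<Rightarrow> 'k ^ 'n" and i0 i1 i2 where B: "i0 \<noteq> i1" "B i0 = x" "B i1 = y" "B i2 = u"
      "i2 \<noteq> i0" "i2 \<noteq> i1"
    "\<And>i. i \<noteq> i0 \<Longrightarrow> i \<noteq> i1 \<Longrightarrow> B i \<in> perp x y"
    "\<And>i. i \<noteq> i0 \<Longrightarrow> i \<noteq> i1 \<Longrightarrow> i \<noteq> i2 \<Longrightarrow> bf u (B i) = 0"
    "\<And>c. (\<Sum>i\<in>UNIV. c i *s B i) = 0 \<Longrightarrow> c = (\<lambda>i. 0)"
    by (rule adapted_basis[OF h u]) (rule that)
  let ?P = "{i0, i1}"
  have BP: "B i \<in> perp x y" if "i \<notin> ?P" for i using B(7) that by simp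
  define G where "G = (\<lambda>i j. SOME G. gram x y u F (B i) (B j) G)"
  have G: "gram x y u F (B i) (B j) (G i j)" if "i \<notin> ?P" "j \<notin> ?P" for i j
    unfolding G_def by (rule someI_ex[OF gram_exists[OF h u(1) BP[OF that(1)] BP[OF that(2)] F]])
  define G' where "G' = (\<lambda>i j. SOME G. gram x' y' u R (B i) (B j) G)"
  have G': "gram x' y' u R (B i) (B j) (G' i j)" if "i \<notin> ?P" "j \<notin> ?P" for i j
    unfolding G'_def using BP[OF that(1)] BP[OF that(2)]
    by (intro someI_ex[OF gram_exists[OF h' u' _ _ R_img]]) (simp_all add: perp')
  have det: "det (padded ?P G t) \<noteq> 0" for t
    by (rule gram_matrix_nonsingular[where B = B and G = G, OF h u(1) F B(1,7,9) G])
  have det': "det (padded ?P G' t) \<noteq> 0" for t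
    by (rule gram_matrix_nonsingular[where B = B and G = G', OF h' u' R_img B(1) B(7)[folded perp'] B(9) G'])
  have pol: "polyf (\<lambda>t. det (padded ?P G t))" "polyf (\<lambda>t. det (padded ?P G' t))"
    using padded_polyf[of ?P G] padded_polyf[of ?P G'] G G' by (auto intro!: polyf_det simp: gram_def)
  define C where "C = det (padded ?P G 0)"
  define C' where "C' = det (padded ?P G' 0)"
  have C: "det (padded ?P G t) = C" "det (padded ?P G' t) = C'" for t
    unfolding C_def C'_def using polyf_nonvanishing_const[OF pol(1)] polyf_nonvanishing_const[OF pol(2)] det det'
    by blast+
  \<comment> \<open>Inverting the parameter reverses the velocity along the conic, up to a multiple
    of the point, and fixes the fields orthogonal to \<open>u\<close>.\<close>
  define \<epsilon> :: "'n \<Rightarrow> 'k" where "\<epsilon> = (\<lambda>i. if i = i2 then -1 else 1)"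
  define N where "N = card (UNIV - ?P)"
  have rel: "s ^ 4 * G' i j s = s ^ (2 * e) * (\<epsilon> i * \<epsilon> j * G i j (1 / s))"
    if s: "s \<noteq> 0" and ij: "i \<notin> ?P" "j \<notin> ?P" for s i j
  proof (rule gram_reverse[OF h h' u(1) BP[OF ij(1)] BP[OF ij(2)] F s ch[OF s] R[OF s] _ _ G[OF ij] G'[OF ij]])
    have *: "tang y' (s *s u) (B i) = \<epsilon> i *s tang y ((1 / s) *s u) (B i) +
        (if i = i2 then 2 * s else 0) *s chart x y ((1 / s) *s u)" if "i \<notin> ?P" for i
    proof (cases "i = i2")
      case True
      then show ?thesis using s u(2)
        by (simp add: \<epsilon>_def B(4) tang_def bf_lin qf_def[symmetric] chart_def qf_scale y'_def vec_eq_iff)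
           (simp add: field_simps power2_eq_square)
    next
      case False
      then show ?thesis using B(8) that by (simp add: \<epsilon>_def tang_def bf_lin)
    qed
    show "tang y' (s *s u) (B i) = \<epsilon> i *s tang y ((1 / s) *s u) (B i) +
        (if i = i2 then 2 * s else 0) *s chart x y ((1 / s) *s u)" by (rule *[OF ij(1)])
    show "tang y' (s *s u) (B j) = \<epsilon> j *s tang y ((1 / s) *s u) (B j) +
        (if j = i2 then 2 * s else 0) *s chart x y ((1 / s) *s u)" by (rule *[OF ij(2)])
  qed
  have "s ^ (4 * N) * C' = s ^ (2 * e * N) * C" if s: "s \<noteq> 0" for s
  proof -
    \<comment> \<open>The entrywise factors are realised by scaling rows and columns; on the padding
      both scalings are 1.\<close>
    define d1 where "d1 = (\<lambda>i. if i \<in> ?P then 1 else s^2)"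
    define d2 where "d2 = (\<lambda>i. if i \<in> ?P then 1 else \<epsilon> i * s ^ e)"
    have "diagm d1 ** padded ?P G' s ** diagm d1 = diagm d2 ** padded ?P G (1 / s) ** diagm d2"
    proof -
      have "d1 i * padded ?P G' s $ i $ j * d1 j = d2 i * padded ?P G (1 / s) $ i $ j * d2 j" for i j
      proof (cases "i \<in> ?P \<or> j \<in> ?P")
        case True
        then show ?thesis by (auto simp: d1_def d2_def padded_def)
      next
        case False
        then have "d1 i * padded ?P G' s $ i $ j * d1 j = s ^ 4 * G' i j s"
          by (simp add: d1_def padded_def power2_eq_square power4_eq_xxxx mult_ac)
        also have "\<dots> = s ^ (2 * e) * (\<epsilon> i * \<epsilon> j * G i j (1 / s))" using rel[OF s] False by simp
        also have "\<dots> = d2 i * padded ?P G (1 / s) $ i $ j * d2 j"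
          using False by (simp add: d2_def padded_def power_mult power2_eq_square power_mult_distrib mult_ac)
        finally show ?thesis .
      qed
      then show ?thesis by (simp add: vec_eq_iff diagm_mult)
    qed
    then have "det (diagm d1 ** padded ?P G' s ** diagm d1)
        = det (diagm d2 ** padded ?P G (1 / s) ** diagm d2)" by simp
    then have eq: "(prod d1 UNIV)^2 * C' = (prod d2 UNIV)^2 * C"
      by (simp add: det_mul det_diagm C power2_eq_square mult_ac)
    have "prod d1 UNIV = prod d1 (UNIV - ?P)"
      by (rule prod.mono_neutral_right) (auto simp: d1_def)
    also have "\<dots> = (\<Prod>i\<in>UNIV - ?P. s^2)" by (rule prod.cong) (auto simp: d1_def)
    finally have p1: "(prod d1 UNIV)^2 = s ^ (4 * N)" by (simp add: N_def flip: power_mult)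
    have "prod d2 UNIV = prod d2 (UNIV - ?P)"
      by (rule prod.mono_neutral_right) (auto simp: d2_def)
    also have "\<dots> = (\<Prod>i\<in>UNIV - ?P. \<epsilon> i * s ^ e)" by (rule prod.cong) (auto simp: d2_def)
    also have "\<dots> = prod \<epsilon> (UNIV - ?P) * s ^ (e * N)"
      by (simp add: prod.distrib N_def power_mult)
    finally have "(prod d2 UNIV)^2 = (\<Prod>i\<in>UNIV - ?P. (\<epsilon> i)^2) * s ^ (2 * e * N)"
      by (simp add: power_mult_distrib prod_power_distrib mult.assoc mult.commute[of _ 2] flip: power_mult)
    also have "(\<Prod>i\<in>UNIV - ?P. (\<epsilon> i)^2) = 1" by (rule prod.neutral) (auto simp: \<epsilon>_def)
    finally have p2: "(prod d2 UNIV)^2 = s ^ (2 * e * N)" by simp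
    show ?thesis using eq unfolding p1 p2 .
  qed
  then have "4 * N = 2 * e * N"
    using monomial_identity_degree[where a = "4 * N" and b = "2 * e * N" and C = C' and C' = C] det det' by (auto simp: C_def C'_def)
  moreover have "i2 \<in> UNIV - ?P" using B(5,6) by simp
  then have "N > 0" unfolding N_def by (auto simp: card_gt_0_iff)
  ultimately have e: "e = 2" by simp
  have Fe: "F t = A 0 + t *s A 1 + t^2 *s A 2" for t
    unfolding A(2) e by (simp add: numeral_2_eq_2)
  have F0: "F 0 = A 0" by (simp add: Fe)
  have "image_curve ?c (\<lambda>t. A 0 + t *s A 1 + t^2 *s A 2)" using F by (simp add: Fe[abs_def])
  moreover have "\<phi> (proj_point x) = proj_point (A 0)"
    using image_curveD(3)[OF F, of 0] F0 by (simp add: chart_def)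
  moreover have "\<phi> (proj_point y) = proj_point (A 2)"
    using image_curveD(3)[OF R_img, of 0] R0 u(2) by (simp add: chart_def e x'_def proj_point_scale)
  moreover have "A 0 \<noteq> 0" using image_curveD(2)[OF F, of 0] F0 by simp
  ultimately show ?thesis using A(1) unfolding e by blast
qed

end

section \<open>From conics to a linear map\<close>

lemma polyf_first_order:
  fixes h :: "'k::field \<Rightarrow> 'k"
  assumes "polyf h" shows "\<exists>h1 r. polyf r \<and> (\<forall>t. h t = h 0 + t * h1 + t^2 * r t)"
proof -
  obtain p where p: "\<And>t. h t = poly p t" using assms by (elim polyfE) metis
  obtain a p1 where p1: "p = pCons a p1" by (cases p)
  obtain b p2 where p2: "p1 = pCons b p2" by (cases p1)
  show ?thesis
    by (intro exI[of _ b] exI[of _ "poly p2"])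
       (auto simp: p p1 p2 algebra_simps power2_eq_square)
qed

context quad_aut
begin

text \<open>The outer coefficients are fixed up to scalars by the images of \<open>x\<close> and
  \<open>y\<close>, so only \<open>l\<close> and \<open>\<gamma>\<close> depend on \<open>u\<close>.
  The relations are the coefficients of \<open>qf\<close> along the curve, which vanishes
  identically.\<close>

lemma image_conic_normalized:
  assumes h: "hyp x y" and u: "u \<in> perp x y" "qf u \<noteq> 0"
    and a: "\<phi> (proj_point x) = proj_point a" and a': "\<phi> (proj_point y) = proj_point a'"
  shows "\<exists>l \<gamma>. \<gamma> \<noteq> 0 \<and> image_curve (\<lambda>t. chart x y (t *s u)) (\<lambda>t. a + t *s l + t^2 *s (\<gamma> *s a')) \<and>
    bf a l = 0 \<and> bf a' l = 0 \<and> qf l + 2 * \<gamma> * bf a a' = 0"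
proof -
  obtain a0 a1 a2 where *: "\<phi> (proj_point x) = proj_point a0" "\<phi> (proj_point y) = proj_point a2"
    "image_curve (\<lambda>t. chart x y (t *s u)) (\<lambda>t. a0 + t *s a1 + t^2 *s a2)"
    using image_conic[OF h u] by blast
  obtain k where k: "k \<noteq> 0" "a0 = k *s a" using *(1) a proj_point_eq_iff[of a0 a] by metis
  obtain k' where k': "k' \<noteq> 0" "a2 = k' *s a'" using *(2) a' proj_point_eq_iff[of a2 a'] by metis
  define l where "l = (1 / k) *s a1"
  define \<gamma> where "\<gamma> = k' / k"
  have eq: "a0 + t *s a1 + t^2 *s a2 = k *s (a + t *s l + t^2 *s (\<gamma> *s a'))" for t
    using k k' by (simp add: l_def \<gamma>_def vec_eq_iff algebra_simps)
  have img: "image_curve (\<lambda>t. chart x y (t *s u)) (\<lambda>t. a + t *s l + t^2 *s (\<gamma> *s a'))"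
    using *(3) k(1) unfolding image_curve_def eq by (auto simp: proj_point_scale)
  have qa: "qf a = 0" "qf a' = 0"
    using image_isotropic[OF hyp_nz(1)[OF h] _ a] image_isotropic[OF hyp_nz(2)[OF h] _ a'] h
    by (simp_all add: hyp_def)
  have "qf (a + t *s l + t^2 *s (\<gamma> *s a')) = 0" for t
    by (rule image_curve_qf[OF on_quadric_chart[OF h u(1)] img])
  note on_q = this
  have "poly [:0, 2 * bf a l, qf l + 2 * \<gamma> * bf a a', 2 * \<gamma> * bf a' l:] t = 0" for t
    using qa on_q[of t] by (simp add: qf_add qf_scale bf_lin bf_sym[of l a'] algebra_simps power2_eq_square)
  then have "[:0, 2 * bf a l, qf l + 2 * \<gamma> * bf a a', 2 * \<gamma> * bf a' l:] = 0"
    by (rule poly_eq_0_if_all)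
  moreover have "\<gamma> \<noteq> 0" using k k' by (simp add: \<gamma>_def)
  ultimately show ?thesis using img two by auto
qed

definition linmap :: "('k ^ 'n \<Rightarrow> 'k ^ 'n) \<Rightarrow> bool" where
  "linmap L \<longleftrightarrow> (\<forall>v w. L (v + w) = L v + L w) \<and> (\<forall>a v. L (a *s v) = a *s L v)"

lemma linmapD: "linmap L \<Longrightarrow> L (v + w) = L v + L w" "linmap L \<Longrightarrow> L (a *s v) = a *s L v"
  "linmap L \<Longrightarrow> L 0 = 0" "linmap L \<Longrightarrow> L (v - w) = L v - L w"
proof -
  assume L: "linmap L"
  show "L (v + w) = L v + L w" "L (a *s v) = a *s L v" using L by (auto simp: linmap_def)
  have "L (0 *s 0) = 0 *s L 0" using L unfolding linmap_def by blast
  then show "L 0 = 0" by simp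
  have "L (v - w) = L (v + (-1) *s w)" by (simp add: vec_eq_iff)
  also have "\<dots> = L v + (-1) *s L w" using L unfolding linmap_def by metis
  finally show "L (v - w) = L v - L w" by (simp add: vec_eq_iff)
qed

lemma linmap_matrix: "linmap L \<Longrightarrow> \<exists>A. \<forall>v. L v = A *v v"
proof -
  assume L: "linmap L"
  have "Vector_Spaces.linear (*s) (*s) L"
    by unfold_locales (use L in \<open>auto simp: linmap_def\<close>)
  then show ?thesis using matrix_works by metis
qed

text \<open>Non-isotropic vectors are dense: through an isotropic \<open>v\<close> there is a line
  leaving the cone, and \<open>P\<close> is polynomial on lines.\<close>

lemma vanish_on_nonisotropic:
  assumes h: "hyp x y" and P: "\<And>v w. pcurve (\<lambda>s. v + s *s w) \<Longrightarrow> polyf (\<lambda>s. P (v + s *s w))"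
    and z: "\<And>u. u \<in> perp x y \<Longrightarrow> qf u \<noteq> 0 \<Longrightarrow> P u = 0" and v: "v \<in> perp x y"
  shows "P v = 0"
proof (cases "qf v = 0")
  case True
  obtain u where u: "u \<in> perp x y" "qf u \<noteq> 0" using perp_nonisotropic[OF h n3] by blast
  let ?c = "\<lambda>s. v + s *s u"
  have c: "pcurve ?c" by auto
  have "\<exists>s. qf (?c s) \<noteq> 0"
  proof (rule ccontr)
    assume "\<nexists>s. qf (?c s) \<noteq> 0"
    then have "poly [:0, 2 * bf v u, qf u:] s = 0" for s
      using True by (auto simp: qf_add qf_scale bf_lin algebra_simps power2_eq_square)
    then have "[:0, 2 * bf v u, qf u:] = 0" by (rule poly_eq_0_if_all)
    then show False using u by simp
  qed
  then obtain s0 where s0: "qf (?c s0) \<noteq> 0" by blast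
  have "P (?c 0) = 0"
    by (rule polyf_vanish[OF qf_polyf[OF c] P[OF c] z s0]) (auto intro: perp_add perp_scale u v)
  then show ?thesis by simp
qed (use z v in blast)

text \<open>The linear coefficient of each image conic is the differential \<open>D u\<close> at
  \<open>x\<close> up to a multiple of \<open>a\<close>. Removing the multiple that prevents
  orthogonality to \<open>a'\<close> yields \<open>L\<close>, which is linear because
  \<open>D\<close> is.\<close>

lemma chart_image:
  assumes h: "hyp x y" and a': "\<phi> (proj_point y) = proj_point a'"
  obtains a L where "a \<noteq> 0" "\<phi> (proj_point x) = proj_point a" "bf a a' \<noteq> 0" "linmap L"
    "\<And>v. v \<in> perp x y \<Longrightarrow> L v = 0 \<Longrightarrow> v = 0"
    "\<And>u. u \<in> perp x y \<Longrightarrow> qf u \<noteq> 0 \<Longrightarrow> qf (L u) \<noteq> 0"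
    "\<And>u. u \<in> perp x y \<Longrightarrow> qf u \<noteq> 0 \<Longrightarrow> bf a (L u) = 0"
    "\<And>u. u \<in> perp x y \<Longrightarrow> qf u \<noteq> 0 \<Longrightarrow> bf a' (L u) = 0"
    "\<And>u. u \<in> perp x y \<Longrightarrow> qf u \<noteq> 0 \<Longrightarrow> image_curve (\<lambda>t. chart x y (t *s u))
         (\<lambda>t. a + t *s L u + t^2 *s ((- qf (L u) / (2 * bf a a')) *s a'))"
proof -
  have x: "x \<noteq> 0" "qf x = 0" and y: "y \<noteq> 0" "qf y = 0" using h hyp_nz[OF h] by (auto simp: hyp_def)
  obtain d f f' e g g' where rep: "lrep \<phi> d f f' e g g'" "g x \<noteq> 0"
    using regularE[OF reg x] .
  define a where "a = f x"
  define D where "D = f' x"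
  have a: "a \<noteq> 0" "\<phi> (proj_point x) = proj_point a" using lrepD(3,4)[OF rep(1) x rep(2)] by (auto simp: a_def)
  have D_lin: "D (v + w) = D v + D w" "D (k *s v) = k *s D v" for v w k
    by (simp_all add: D_def lrep_deriv_lin[OF rep(1)])
  have ch0: "chart x y 0 = x" "tang y 0 v = v" for v by (auto simp: chart_def tang_def)
  have zp: "0 \<in> perp x y" by (simp add: perp_def)
  have g0: "g (chart x y 0) \<noteq> 0" using rep(2) by (simp add: ch0)
  have D_inj: "v = 0" if "v \<in> perp x y" "D v = k *s a" for v k
    using deriv_inj[OF h zp that(1) rep(1) g0, of k] that(2) by (simp add: ch0 D_def a_def)
  have aD: "bf a (D v) = 0" if "v \<in> perp x y" for v
    using deriv_isotropic[OF h zp that rep(1) g0] by (simp add: ch0 D_def a_def)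
  have qa: "qf a = 0" by (rule image_isotropic[OF x a(2)])
  have conic: "\<exists>\<eta> \<gamma>. \<gamma> \<noteq> 0 \<and>
      image_curve (\<lambda>t. chart x y (t *s u)) (\<lambda>t. a + t *s (D u - \<eta> *s a) + t^2 *s (\<gamma> *s a')) \<and>
      bf a' (D u - \<eta> *s a) = 0 \<and> qf (D u - \<eta> *s a) + 2 * \<gamma> * bf a a' = 0"
    if u: "u \<in> perp x y" "qf u \<noteq> 0" for u
  proof -
    obtain l \<gamma> where l: "\<gamma> \<noteq> 0"
      "image_curve (\<lambda>t. chart x y (t *s u)) (\<lambda>t. a + t *s l + t^2 *s (\<gamma> *s a'))"
      "bf a' l = 0" "qf l + 2 * \<gamma> * bf a a' = 0"
      using image_conic_normalized[OF h u a(2) a'] by blast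
    have g0': "g (chart x y (0 *s u)) \<noteq> 0" using g0 by simp
    obtain h1 where h1: "polyf h1" "\<And>t. f (chart x y (t *s u)) = h1 t *s (a + t *s l + t^2 *s (\<gamma> *s a'))"
      using curve_rep[OF on_quadric_chart[OF h u(1)] l(2) rep(1), of 0] g0' by metis
    have "(h1 0 - 1) *s a = 0" using h1(2)[of 0] by (simp add: ch0 a_def vec.scale_left_diff_distrib)
    then have h10: "h1 0 = 1" using a(1) by simp
    \<comment> \<open>\<open>h1\<close> compares the formula \<open>f\<close> with the normalised
      lift; its first-order coefficient is the ambiguity in \<open>D u\<close>.\<close>
    obtain \<eta> r where \<eta>: "polyf r" "\<And>t. h1 t = 1 + t * \<eta> + t^2 * r t"
      using polyf_first_order[OF h1(1)] unfolding h10 by blast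
    have "l $ j = D u $ j - \<eta> * a $ j" for j
    proof -
      obtain r1 where r1: "polyf r1"
        "\<And>s. f (x + s *s u + s^2 *s (qf u *s y)) $ j = f x $ j + s * f' x u $ j + s^2 * r1 s"
        using hpoly_taylor[OF lrepD(1)[OF rep(1)]] by blast
      let ?r = "\<lambda>s. r1 s - r s * (a $ j + s * l $ j + s^2 * (\<gamma> * a' $ j)) - \<eta> * l $ j
          - \<gamma> * a' $ j - s * \<eta> * \<gamma> * a' $ j"
      have "polyf ?r" using r1(1) \<eta>(1) by (intro polyf_diff polyf_mult polyf_add polyf_power) auto
      moreover have "0 + s * (D u $ j - \<eta> * a $ j - l $ j) + s^2 * ?r s = 0" for s
      proof -
        have "x + s *s u + s^2 *s (qf u *s y) = chart x y (s *s u)"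
          by (simp add: chart_def qf_scale vector_smult_assoc)
        then have "f x $ j + s * f' x u $ j + s^2 * r1 s
            = (1 + s * \<eta> + s^2 * r s) * (a $ j + s * l $ j + s^2 * (\<gamma> * a' $ j))"
          using r1(2)[of s] arg_cong[OF h1(2)[of s], of "\<lambda>v. v $ j"]
          by (simp only: \<eta>(2)[of s] vector_add_component vector_smult_component)
        then show ?thesis by (simp add: D_def a_def algebra_simps power2_eq_square)
      qed
      ultimately show ?thesis using poly3_zero(2)[of ?r 0 "D u $ j - \<eta> * a $ j - l $ j"] by simp
    qed
    then have "l = D u - \<eta> *s a" by (simp add: vec_eq_iff)
    then show ?thesis using l by blast
  qed
  \<comment> \<open>If the images of \<open>x\<close> and \<open>y\<close> were orthogonal, all
    \<open>D u\<close> would be isotropic, hence mutually orthogonal, and the Gram matrix at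
    \<open>x\<close> would be zero.\<close>
  have aa': "bf a a' \<noteq> 0"
  proof
    assume 0: "bf a a' = 0"
    have qD: "qf (D u) = 0" if u: "u \<in> perp x y" for u
    proof (rule vanish_on_nonisotropic[OF h _ _ u, of "\<lambda>u. qf (D u)"])
      fix v w show "polyf (\<lambda>s. qf (D (v + s *s w)))" by (auto simp: D_lin)
    next
      fix u assume u: "u \<in> perp x y" "qf u \<noteq> 0"
      obtain \<eta> \<gamma> where "qf (D u - \<eta> *s a) + 2 * \<gamma> * bf a a' = 0" using conic[OF u] by blast
      then show "qf (D u) = 0"
        using 0 aD[OF u(1)] qa by (simp add: qf_def bf_lin bf_sym[of "D u" a])
    qed
    have bD: "bf (D u) (D v) = 0" if "u \<in> perp x y" "v \<in> perp x y" for u v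
    proof -
      have "qf (D (u + v)) = 0" by (rule qD[OF perp_add[OF that]])
      then show ?thesis using qD that two by (simp add: D_lin qf_add)
    qed
    obtain u0 where u0: "u0 \<in> perp x y" "qf u0 \<noteq> 0" using perp_nonisotropic[OF h n3] by blast
    obtain B :: "'n \<Rightarrow> 'k ^ 'n" and i0 i1 i2 where B: "i0 \<noteq> i1" "B i0 = x" "B i1 = y" "B i2 = u0"
        "i2 \<noteq> i0" "i2 \<noteq> i1"
      "\<And>i. i \<noteq> i0 \<Longrightarrow> i \<noteq> i1 \<Longrightarrow> B i \<in> perp x y"
      "\<And>i. i \<noteq> i0 \<Longrightarrow> i \<noteq> i1 \<Longrightarrow> i \<noteq> i2 \<Longrightarrow> bf u0 (B i) = 0"
      "\<And>c. (\<Sum>i\<in>UNIV. c i *s B i) = 0 \<Longrightarrow> c = (\<lambda>i. 0)"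
      by (rule adapted_basis[OF h u0]) (rule that)
    have "u0 = 0"
      by (rule gram_nondeg[OF h zp B(1,7,9) rep(1) g0 u0(1)])
         (auto simp: ch0 D_def[symmetric] intro: bD B(7) u0(1))
    then show False using u0(2) by simp
  qed
  define L where "L = (\<lambda>v. D v - (bf a' (D v) / bf a a') *s a)"
  have L: "linmap L"
    unfolding linmap_def L_def D_lin bf_lin
    by (auto simp: vec_eq_iff algebra_simps add_divide_distrib)
  have L_inj: "v = 0" if "v \<in> perp x y" "L v = 0" for v
    using D_inj[OF that(1), of "bf a' (D v) / bf a a'"] that(2) by (simp add: L_def)
  have **: "qf (L u) \<noteq> 0 \<and> bf a (L u) = 0 \<and> bf a' (L u) = 0 \<and>
       image_curve (\<lambda>t. chart x y (t *s u))
         (\<lambda>t. a + t *s L u + t^2 *s ((- qf (L u) / (2 * bf a a')) *s a'))"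
    if u: "u \<in> perp x y" "qf u \<noteq> 0" for u
  proof -
    obtain \<eta> \<gamma> where \<eta>: "\<gamma> \<noteq> 0"
      "image_curve (\<lambda>t. chart x y (t *s u)) (\<lambda>t. a + t *s (D u - \<eta> *s a) + t^2 *s (\<gamma> *s a'))"
      "bf a' (D u - \<eta> *s a) = 0" "qf (D u - \<eta> *s a) + 2 * \<gamma> * bf a a' = 0"
      using conic[OF u] by blast
    have "\<eta> = bf a' (D u) / bf a a'" using \<eta>(3) aa' by (simp add: bf_lin bf_sym[of a' a] field_simps)
    then have Lu: "D u - \<eta> *s a = L u" by (simp add: L_def)
    have \<gamma>: "\<gamma> = - qf (L u) / (2 * bf a a')" using \<eta>(4) aa' two unfolding Lu by (simp add: field_simps eq_neg_iff_add_eq_0)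
    have "bf a (L u) = 0" using aD[OF u(1)] qa by (simp add: L_def bf_lin qf_def)
    then show ?thesis using \<eta> unfolding Lu \<gamma> by auto
  qed
  show ?thesis
    by (rule that[OF a aa' L L_inj **[THEN conjunct1] **[THEN conjunct2, THEN conjunct1]
          **[THEN conjunct2, THEN conjunct2, THEN conjunct1]
          **[THEN conjunct2, THEN conjunct2, THEN conjunct2]])
qed

text \<open>What \<open>chart_image\<close> leaves open is that the quadratic coefficient
  \<open>\<gamma> u\<close> is a constant multiple of \<open>qf u\<close>. This follows by viewing
  the same points in the chart centred at \<open>y\<close>: it gives a second linear map
  \<open>L2\<close>, pointwise proportional to \<open>L\<close> with a factor that involves
  \<open>qf u / \<gamma> u\<close>.\<close>

theorem automorphism_linear:
  "\<exists>A c. c \<noteq> 0 \<and> (\<forall>v. qf (A *v v) = c * qf v) \<and>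
     (\<forall>z. z \<noteq> 0 \<longrightarrow> qf z = 0 \<longrightarrow> \<phi> (proj_point z) = proj_point (A *v z))"
proof -
  obtain x where x: "x \<noteq> 0" "qf x = 0"
    using isotropic_exists n3 alg_closed_imp_poly_has_root by (metis One_nat_def Suc_1 Suc_leD numeral_3_eq_3)
  obtain y where h: "hyp x y" using hyp_exists[OF x] by blast
  have y: "y \<noteq> 0" "qf y = 0" using h hyp_nz[OF h] by (auto simp: hyp_def)
  obtain a' where a': "\<phi> (proj_point y) = proj_point a'" "a' \<noteq> 0" using maps[OF y] by blast
  obtain a L where a: "a \<noteq> 0" "\<phi> (proj_point x) = proj_point a" "bf a a' \<noteq> 0" and L: "linmap L"
    and L_inj: "\<And>v. v \<in> perp x y \<Longrightarrow> L v = 0 \<Longrightarrow> v = 0"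
    and qL: "\<And>u. u \<in> perp x y \<Longrightarrow> qf u \<noteq> 0 \<Longrightarrow> qf (L u) \<noteq> 0"
    and aL: "\<And>u. u \<in> perp x y \<Longrightarrow> qf u \<noteq> 0 \<Longrightarrow> bf a (L u) = 0"
    and a'L: "\<And>u. u \<in> perp x y \<Longrightarrow> qf u \<noteq> 0 \<Longrightarrow> bf a' (L u) = 0"
    and img: "\<And>u. u \<in> perp x y \<Longrightarrow> qf u \<noteq> 0 \<Longrightarrow> image_curve (\<lambda>t. chart x y (t *s u))
         (\<lambda>t. a + t *s L u + t^2 *s ((- qf (L u) / (2 * bf a a')) *s a'))"
    by (rule chart_image[OF h a'(1)]) (rule that)
  obtain a'' L2 where a'': "a'' \<noteq> 0" "\<phi> (proj_point y) = proj_point a''" "bf a'' a \<noteq> 0"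
    and L2: "linmap L2"
    and "\<And>v. v \<in> perp y x \<Longrightarrow> L2 v = 0 \<Longrightarrow> v = 0"
    and "\<And>u. u \<in> perp y x \<Longrightarrow> qf u \<noteq> 0 \<Longrightarrow> qf (L2 u) \<noteq> 0"
    and a''L2: "\<And>u. u \<in> perp y x \<Longrightarrow> qf u \<noteq> 0 \<Longrightarrow> bf a'' (L2 u) = 0"
    and aL2: "\<And>u. u \<in> perp y x \<Longrightarrow> qf u \<noteq> 0 \<Longrightarrow> bf a (L2 u) = 0"
    and img2: "\<And>u. u \<in> perp y x \<Longrightarrow> qf u \<noteq> 0 \<Longrightarrow> image_curve (\<lambda>t. chart y x (t *s u))
         (\<lambda>t. a'' + t *s L2 u + t^2 *s ((- qf (L2 u) / (2 * bf a'' a)) *s a))"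
    by (rule chart_image[OF hyp_sym[OF h] a(2)]) (rule that)
  obtain k where k: "k \<noteq> 0" "a'' = k *s a'" using a''(2) a'(1) proj_point_eq_iff[of a'' a'] by metis
  have qa: "qf a = 0" "qf a' = 0"
    using image_isotropic[OF x a(2)] image_isotropic[OF y a'(1)] by auto
  define \<gamma> where "\<gamma> = (\<lambda>u. - qf (L u) / (2 * bf a a'))"
  define m where "m = (\<lambda>u. k * qf u / \<gamma> u)"
  have \<gamma>nz: "\<gamma> u \<noteq> 0" if "u \<in> perp x y" "qf u \<noteq> 0" for u
    using qL[OF that] a(3) two by (simp add: \<gamma>_def)
  have L2m: "L2 u = m u *s L u" if u: "u \<in> perp x y" "qf u \<noteq> 0" for u
  proof -
    \<comment> \<open>The coordinate of the same projective point in the chart centred at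
      \<open>y\<close>.\<close>
    define u' where "u' = (1 / qf u) *s u"
    have u': "u' \<in> perp y x" "qf u' \<noteq> 0"
      using u by (auto simp: u'_def perp_sym[of y x] qf_scale intro: perp_scale)
    have ch: "chart x y u = qf u *s chart y x u'"
      using u(2) by (simp add: chart_def u'_def qf_scale vec_eq_iff)
        (simp add: field_simps power2_eq_square)
    define \<gamma>2 where "\<gamma>2 = - qf (L2 u') / (2 * bf a'' a)"
    have "proj_point (a + L u + \<gamma> u *s a') = \<phi> (proj_point (chart x y u))"
      using image_curveD(3)[OF img[OF u], of 1] by (simp add: \<gamma>_def)
    also have "\<dots> = proj_point (a'' + L2 u' + \<gamma>2 *s a)"
      using image_curveD(3)[OF img2[OF u'], of 1] u(2) by (simp add: ch proj_point_scale \<gamma>2_def)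
    finally obtain \<mu> where \<mu>: "a + L u + \<gamma> u *s a' = \<mu> *s (a'' + L2 u' + \<gamma>2 *s a)"
      by (auto simp: proj_point_eq_iff)
    have "bf a (a + L u + \<gamma> u *s a') = bf a (\<mu> *s (a'' + L2 u' + \<gamma>2 *s a))" using \<mu> by simp
    then have m1: "\<gamma> u = \<mu> * k"
      using aL[OF u] aL2[OF u'] qa a(3) by (simp add: bf_lin k(2) qf_def)
    have "bf a' (L2 u') = 0" using a''L2[OF u'] k by (simp add: bf_lin)
    moreover have "bf a' (a + L u + \<gamma> u *s a') = bf a' (\<mu> *s (a'' + L2 u' + \<gamma>2 *s a))" using \<mu> by simp
    ultimately have m2: "\<mu> * \<gamma>2 = 1"
      using a'L[OF u] qa a(3) by (simp add: bf_lin k(2) qf_def bf_sym[of a' a])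
    have "\<mu> *s (a'' + L2 u' + \<gamma>2 *s a) = a + \<mu> *s L2 u' + \<gamma> u *s a'"
      by (simp add: k(2) vec.scale_right_distrib vector_smult_assoc m1 m2)
    then have "L u = \<mu> *s L2 u'" using \<mu> by simp
    then have Lu: "L u = (\<mu> / qf u) *s L2 u" by (simp add: u'_def linmapD[OF L2] vector_smult_assoc)
    have "\<mu> \<noteq> 0" using m2 by auto
    then show ?thesis using u(2) k(1) by (simp add: Lu m_def m1 vector_smult_assoc)
  qed
  \<comment> \<open>Pointwise proportional linear maps, one of them injective, have a constant
    factor; \<open>s\<close> keeps the sum away from the isotropic cone.\<close>
  have m_const: "m u = m v" if u: "u \<in> perp x y" "qf u \<noteq> 0" and v: "v \<in> perp x y" "qf v \<noteq> 0" for u v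
  proof -
    have Lnz: "L u \<noteq> 0" "L v \<noteq> 0" using qL[OF u] qL[OF v] by auto
    have "\<exists>s. s \<noteq> 0 \<and> qf (u + s *s v) \<noteq> 0"
    proof (rule ccontr)
      assume "\<not> ?thesis"
      then have "qf (u + s *s v) = 0" if "s \<noteq> 0" for s using that by blast
      then have "qf (u + 0 *s v) = 0"
        by (rule polyf_vanish_nonzero[of "\<lambda>s. qf (u + s *s v)" 0, rotated]) auto
      then show False using u by simp
    qed
    then obtain s where s: "s \<noteq> 0" "qf (u + s *s v) \<noteq> 0" by blast
    have w: "u + s *s v \<in> perp x y" using u v by (auto intro: perp_add perp_scale)
    define \<mu> where "\<mu> = m (u + s *s v)"
    have "L2 (u + s *s v) = \<mu> *s L (u + s *s v)" unfolding \<mu>_def by (rule L2m[OF w s(2)])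
    then have "m u *s L u + (s * m v) *s L v = \<mu> *s L u + (\<mu> * s) *s L v"
      by (simp add: linmapD(1,2)[OF L2] linmapD(1,2)[OF L] L2m[OF u] L2m[OF v] vector_smult_assoc vec.scale_right_distrib)
    then have "L ((m u - \<mu>) *s u + (s * (m v - \<mu>)) *s v) = 0"
      unfolding linmapD(1,2)[OF L] by (simp add: vec_eq_iff algebra_simps)
    then have dep: "(m u - \<mu>) *s u + (s * (m v - \<mu>)) *s v = 0"
      by (rule L_inj[rotated]) (use u v in \<open>auto intro: perp_add perp_scale\<close>)
    show ?thesis
    proof (cases "m v = \<mu>")
      case True
      then have "(m u - \<mu>) *s u = 0" using dep by simp
      moreover have "u \<noteq> 0" using u by auto
      ultimately show ?thesis using True by simp
    next
      case False
      define c where "c = - (m u - \<mu>) / (s * (m v - \<mu>))"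
      have "(s * (m v - \<mu>)) *s v = (s * (m v - \<mu>)) *s (c *s u)"
      proof -
        have "(s * (m v - \<mu>)) *s v = - ((m u - \<mu>) *s u)"
          using dep by (simp add: eq_neg_iff_add_eq_0 add.commute)
        moreover have "(s * (m v - \<mu>)) * c = - (m u - \<mu>)" using False s(1) by (simp add: c_def)
        ultimately show ?thesis by (simp only: vector_smult_assoc) (simp add: vec_eq_iff left_diff_distrib)
      qed
      then have "v = c *s u" using False s(1) by (simp only: vec.scale_cancel_left) simp
      then have "m v *s L v = m u *s L v"
        using L2m[OF u] L2m[OF v] by (auto simp add: linmapD[OF L2] linmapD[OF L] vector_smult_assoc mult.commute)
      then show ?thesis using Lnz by simp
    qed
  qed
  obtain u0 where u0: "u0 \<in> perp x y" "qf u0 \<noteq> 0" using perp_nonisotropic[OF h n3] by blast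
  define \<rho> where "\<rho> = k / m u0"
  have m0: "m u0 \<noteq> 0" using u0 \<gamma>nz[OF u0] k by (simp add: m_def)
  then have \<rho>0: "\<rho> \<noteq> 0" using k by (simp add: \<rho>_def)
  have \<gamma>q: "\<gamma> u = \<rho> * qf u" if u: "u \<in> perp x y" "qf u \<noteq> 0" for u
  proof -
    have "m u0 = k * qf u / \<gamma> u" using m_const[OF u0 u] by (simp add: m_def)
    then show ?thesis using \<gamma>nz[OF u] m0 by (simp add: \<rho>_def field_simps)
  qed
  define c where "c = - 2 * bf a a' * \<rho>"
  have c0: "c \<noteq> 0" using a(3) two \<rho>0 by (simp add: c_def)
  have qLc: "qf (L w) - c * qf w = 0" if w: "w \<in> perp x y" for w
  proof (rule vanish_on_nonisotropic[OF h _ _ w, of "\<lambda>w. qf (L w) - c * qf w"])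
    fix v w show "polyf (\<lambda>s. qf (L (v + s *s w)) - c * qf (v + s *s w))"
      by (auto simp: linmapD[OF L])
  next
    fix u assume u: "u \<in> perp x y" "qf u \<noteq> 0"
    then have "- qf (L u) / (2 * bf a a') = \<rho> * qf u" using \<gamma>q by (simp add: \<gamma>_def)
    then have "- qf (L u) = \<rho> * qf u * (2 * bf a a')" using a(3) two by (simp add: field_simps)
    then have "qf (L u) = - (\<rho> * qf u * (2 * bf a a'))" by (metis minus_minus)
    then show "qf (L u) - c * qf u = 0" by (simp add: c_def)
  qed
  have aL': "bf a (L w) = 0" if w: "w \<in> perp x y" for w
    by (rule vanish_on_nonisotropic[where P = "\<lambda>w. bf a (L w)", OF h _ aL w]) (auto simp: linmapD[OF L])
  have a'L': "bf a' (L w) = 0" if w: "w \<in> perp x y" for w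
    by (rule vanish_on_nonisotropic[where P = "\<lambda>w. bf a' (L w)", OF h _ a'L w]) (auto simp: linmapD[OF L])
  \<comment> \<open>The image of \<open>y\<close> is scaled by \<open>\<rho>\<close> so that
    \<open>chart x y u\<close> goes to \<open>a + L u + \<gamma> u *s a'\<close>.\<close>
  define T where "T = (\<lambda>v. (-2 * bf y v) *s a + (-2 * bf x v * \<rho>) *s a'
      + L (v - ((-2 * bf y v) *s x + (-2 * bf x v) *s y)))"
  have "linmap T"
    unfolding linmap_def T_def
    by (auto simp: linmapD[OF L] bf_lin vec_eq_iff algebra_simps)
  then obtain A where A: "\<And>v. T v = A *v v" using linmap_matrix by blast
  have T: "T (\<alpha> *s x + \<beta> *s y + u) = \<alpha> *s a + (\<beta> * \<rho>) *s a' + L u" if "u \<in> perp x y" for \<alpha> \<beta> u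
  proof -
    have "-2 * bf y (\<alpha> *s x + \<beta> *s y + u) = \<alpha>" "-2 * bf x (\<alpha> *s x + \<beta> *s y + u) = \<beta>"
      using perpD[OF that] two by (simp_all add: bf_lin hyp_bf[OF h])
    then show ?thesis unfolding T_def by simp
  qed
  have sim: "qf (A *v v) = c * qf v" for v
  proof -
    obtain u \<alpha> \<beta> where u: "u \<in> perp x y" "v = \<alpha> *s x + \<beta> *s y + u" using hyp_decomp[OF h] by metis
    have "qf (A *v v) = 2 * \<alpha> * \<beta> * \<rho> * bf a a' + qf (L u)"
      unfolding A[symmetric] u(2) T[OF u(1)]
      using aL'[OF u(1)] a'L'[OF u(1)] qa by (simp add: qf_add qf_scale bf_lin)
    also have "\<dots> = c * (2 * \<alpha> * \<beta> * bf x y + qf u)"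
      using qLc[OF u(1)] two by (simp add: c_def hyp_bf[OF h] algebra_simps)
    also have "2 * \<alpha> * \<beta> * bf x y + qf u = qf v"
      unfolding u(2) using perpD[OF u(1)] h by (simp add: qf_add qf_scale bf_lin hyp_def)
    finally show ?thesis .
  qed
  have Anz: "A *v v \<noteq> 0" if nz: "v \<noteq> 0" for v
  proof
    assume 0: "A *v v = 0"
    obtain w where w: "bf w v \<noteq> 0" using bf_nondeg'[OF nz] by blast
    have "qf (A *v (w + v)) = c * qf (w + v)" by (rule sim)
    moreover have "qf v = 0" using sim[of v] 0 c0 by simp
    ultimately have "c * (2 * bf w v) = 0"
      using 0 sim[of w] by (simp add: matrix_vector_right_distrib qf_add distrib_left)
    then show False using w two c0 by simp
  qed
  have gen: "\<phi> (proj_point z) = proj_point (A *v z)" if z: "qf z = 0" "bf z x * bf z y \<noteq> 0" for z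
  proof -
    obtain u \<alpha> \<beta> where u: "u \<in> perp x y" "z = \<alpha> *s x + \<beta> *s y + u" "\<alpha> = -2 * bf y z" "\<beta> = -2 * bf x z"
      using hyp_decomp[OF h] by metis
    have \<alpha>: "\<alpha> \<noteq> 0" "\<beta> \<noteq> 0"
      using z(2) two u(3,4) bf_sym[of z x] bf_sym[of z y] by auto
    have "qf z = - \<alpha> * \<beta> + qf u"
      unfolding u(2) using perpD[OF u(1)] h two by (simp add: qf_add qf_scale bf_lin hyp_bf[OF h]) (simp add: hyp_def)
    then have qu: "qf u = \<alpha> * \<beta>" using z by simp
    define u' where "u' = (1 / \<alpha>) *s u"
    have u': "u' \<in> perp x y" "qf u' \<noteq> 0" using u(1) \<alpha> qu by (auto simp: u'_def qf_scale intro: perp_scale)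
    have zc: "z = \<alpha> *s chart x y u'"
      unfolding u(2) using \<alpha> by (simp add: chart_def u'_def qf_scale qu vec_eq_iff)
        (simp add: field_simps power2_eq_square)
    have "\<phi> (proj_point (chart x y u')) = proj_point (a + L u' + \<gamma> u' *s a')"
      using image_curveD(3)[OF img[OF u'], of 1] by (simp add: \<gamma>_def)
    also have "a + L u' + \<gamma> u' *s a' = T (chart x y u')"
      using T[OF u'(1), of 1 "qf u'"] \<gamma>q[OF u'] by (simp add: chart_def algebra_simps)
    finally show ?thesis using \<alpha> by (simp add: zc proj_point_scale A vec.scale)
  qed
  \<comment> \<open>A point not covered by \<open>gen\<close> lies on a conic that meets the covered
    open set. Along it \<open>A\<close> gives a nowhere vanishing polynomial lift, which is then
    correct at \<open>t = 0\<close> too.\<close>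
  have "\<phi> (proj_point z) = proj_point (A *v z)" if z: "z \<noteq> 0" "qf z = 0" for z
  proof -
    obtain u where u: "u \<in> perp x y" "qf u \<noteq> 0" "bf z (chart x y u) \<noteq> 0"
      using bf_chart_exists[OF h n3 infinite_alg_closed z(1)] by blast
    define y1 where "y1 = (- 1 / (2 * bf z (chart x y u))) *s chart x y u"
    have h1: "hyp z y1" unfolding y1_def by (rule hyp_scale[OF z(2) qf_chart[OF h u(1)] u(3)])
    have four: "(4 :: 'k) \<noteq> 0" using two by (metis mult_2 mult_eq_0_iff numeral_Bit0)
    have y1: "bf y1 x \<noteq> 0" "bf y1 y \<noteq> 0"
      using u two four chart_bf[OF h u(1)] by (auto simp: y1_def bf_lin bf_sym[of "chart x y u" x] bf_sym[of "chart x y u" y])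
    obtain w where w: "w \<in> perp z y1" "qf w \<noteq> 0" using perp_nonisotropic[OF h1 n3] by blast
    let ?c = "\<lambda>t. chart z y1 (t *s w)"
    let ?g = "\<lambda>t. bf (?c t) x * bf (?c t) y"
    have c: "on_quadric ?c" by (rule on_quadric_chart[OF h1 w(1)])
    have "\<exists>t0. ?g t0 \<noteq> 0"
    proof (rule ccontr)
      assume "\<not> ?thesis"
      then have "poly ([:bf z x, bf w x, qf w * bf y1 x:] * [:bf z y, bf w y, qf w * bf y1 y:]) t = 0" for t
        by (simp add: chart_def bf_lin qf_scale algebra_simps power2_eq_square)
      then have "[:bf z x, bf w x, qf w * bf y1 x:] * [:bf z y, bf w y, qf w * bf y1 y:] = 0"
        by (rule poly_eq_0_if_all)
      then show False using w(2) y1 by (simp only: mult_eq_0_iff) auto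
    qed
    then obtain t0 where t0: "?g t0 \<noteq> 0" by blast
    have "image_curve ?c (\<lambda>t. A *v ?c t)"
    proof (rule image_curve_extend[OF c, where ?g0.0 = ?g and ?t0.0 = t0])
      show "polyf ?g" using on_quadricD(1)[OF c] by auto
      show "\<phi> (proj_point (?c t)) = proj_point (A *v ?c t)" if "?g t \<noteq> 0" for t
        by (rule gen[OF on_quadricD(3)[OF c] that])
    qed (use Anz on_quadricD[OF c] t0 in auto)
    from image_curveD(3)[OF this, of 0] show ?thesis by (simp add: chart_def)
  qed
  then show ?thesis using c0 sim by blast
qed

end

section \<open>Evaluation of multivariate polynomials\<close>

lemma mv_eval_superset:
  assumes "finite S" "Poly_Mapping.keys p \<subseteq> S" "h 0 = 0"
  shows "mv_eval h p x = (\<Sum>m\<in>S. h (Poly_Mapping.lookup p m) * (\<Prod>i\<in>UNIV. (x $ i) ^ Poly_Mapping.lookup m i))"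
  unfolding mv_eval_def
  by (rule sum.mono_neutral_left) (use assms in \<open>auto simp: in_keys_iff\<close>)

lemma mv_eval_zero [simp]: "mv_eval h 0 x = 0"
  by (simp add: mv_eval_def)

lemma mv_eval_add:
  fixes h :: "'a::field \<Rightarrow> 'b::field"
  assumes h: "h 0 = 0" "\<And>a b. h (a + b) = h a + h b"
  shows "mv_eval h (p + r) x = mv_eval h p x + mv_eval h r x"
proof -
  let ?S = "Poly_Mapping.keys p \<union> Poly_Mapping.keys r"
  have "Poly_Mapping.keys (p + r) \<subseteq> ?S" by (rule Poly_Mapping.keys_add)
  then show ?thesis
    by (simp add: mv_eval_superset[of ?S _ h] h lookup_add distrib_right sum.distrib)
qed

lemma mv_eval_sum:
  fixes h :: "'a::field \<Rightarrow> 'b::field"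
  assumes h: "h 0 = 0" "\<And>a b. h (a + b) = h a + h b"
  shows "mv_eval h (\<Sum>m\<in>S. p m) x = (\<Sum>m\<in>S. mv_eval h (p m) x)"
  by (induction S rule: infinite_finite_induct) (auto simp: mv_eval_add[OF h])

lemma mv_eval_single:
  assumes "h 0 = 0"
  shows "mv_eval h (Poly_Mapping.single m c) x = h c * (\<Prod>i\<in>UNIV. (x $ i) ^ Poly_Mapping.lookup m i)"
  using mv_eval_superset[of "{m}" "Poly_Mapping.single m c" h x] assms by simp

lemma prod_delta_power:
  fixes x :: "'b::comm_semiring_1 ^ 'n"
  shows "(\<Prod>i\<in>UNIV. (x $ i) ^ (if i = a then 1 else 0)) = x $ a"
proof -
  have "(\<Prod>i\<in>UNIV. (x $ i) ^ (if i = a then 1 else 0)) = (\<Prod>i\<in>UNIV. if i = a then x $ i else 1)"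
    by (rule prod.cong) auto
  then show ?thesis by simp
qed

lemma sum_eq_1_nat:
  fixes f :: "'n::finite \<Rightarrow> nat"
  assumes "sum f UNIV = 1" shows "\<exists>b. \<forall>i. f i = (if i = b then 1 else 0)"
proof -
  obtain b where b: "f b \<noteq> 0" using assms by (metis sum.neutral zero_neq_one)
  have "sum f UNIV = f b + sum f (UNIV - {b})" by (simp add: sum.remove)
  then have 1: "f b = 1" "sum f (UNIV - {b}) = 0" using b assms by linarith+
  then have "f i = 0" if "i \<noteq> b" for i using iffD1[OF sum_eq_0_iff[OF finite] 1(2)] that by blast
  then show ?thesis using 1 by (intro exI[of _ b]) auto
qed

lemma sum_eq_2_nat:
  fixes f :: "'n::finite \<Rightarrow> nat"
  assumes "sum f UNIV = 2"
  shows "\<exists>a b. \<forall>i. f i = (if i = a then 1 else 0) + (if i = b then 1 else 0)"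
proof -
  obtain a where a: "f a \<noteq> 0" using assms by (metis sum.neutral zero_neq_numeral)
  let ?f = "\<lambda>i. f i - (if i = a then 1 else 0)"
  have f: "f i = ?f i + (if i = a then 1 else 0)" for i using a by auto
  have "sum f UNIV = sum ?f UNIV + (\<Sum>i\<in>UNIV. if i = a then 1 else 0)"
    by (subst sum.distrib[symmetric]) (rule sum.cong, use f in auto)
  then have "sum ?f UNIV = 1" using assms by simp
  then obtain b where "\<forall>i. ?f i = (if i = b then 1 else 0)" using sum_eq_1_nat by blast
  then show ?thesis using f by (metis add.commute)
qed

text \<open>Each monomial is entered at one of its two positions. Not symmetrising \<open>C\<close>
  keeps it meaningful in characteristic two, and the gradient is given by \<open>C\<close> plus its
  transpose.\<close>

lemma quadric_matrix:
  fixes q :: "('n::finite, 'a::field) mvpoly"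
  assumes "homogeneous 2 q"
  shows "\<exists>C :: 'a ^ 'n ^ 'n.
    (\<forall>x. mv_eval (\<lambda>c. c) q x = (\<Sum>i\<in>UNIV. \<Sum>j\<in>UNIV. C $ i $ j * (x $ i * x $ j))) \<and>
    (\<forall>x. mv_eval to_ac q x = (\<Sum>i\<in>UNIV. \<Sum>j\<in>UNIV. to_ac (C $ i $ j) * (x $ i * x $ j))) \<and>
    (\<forall>i x. mv_eval to_ac (mv_pderiv i q) x = (\<Sum>j\<in>UNIV. to_ac (C $ i $ j + C $ j $ i) * x $ j))"
proof -
  let ?K = "Poly_Mapping.keys q"
  have "\<exists>a b. \<forall>i. Poly_Mapping.lookup m i = (if i = a then 1 else 0) + (if i = b then 1 else 0)"
    if "m \<in> ?K" for m
    using assms that by (intro sum_eq_2_nat) (auto simp: homogeneous_def)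
  then obtain a b where ab: "\<And>m i. m \<in> ?K \<Longrightarrow>
      Poly_Mapping.lookup m i = (if i = a m then 1 else 0) + (if i = b m then 1 else 0)"
    by metis
  let ?c = "Poly_Mapping.lookup q"
  define C where "C = (\<chi> i j. \<Sum>m\<in>?K. if a m = i \<and> b m = j then ?c m else 0)"
  have bil: "(\<Sum>i\<in>UNIV. \<Sum>j\<in>UNIV. h (C $ i $ j) * Y i j) = (\<Sum>m\<in>?K. h (?c m) * Y (a m) (b m))"
    if h: "h 0 = 0" "\<And>a b. h (a + b) = h a + h b" for h :: "'a \<Rightarrow> 'b::field" and Y
  proof -
    have hs: "h (\<Sum>m\<in>S. F m) = (\<Sum>m\<in>S. h (F m))" for S and F :: "_ \<Rightarrow> 'a"
      by (induction S rule: infinite_finite_induct) (auto simp: h)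
    have "(\<Sum>i\<in>UNIV. \<Sum>j\<in>UNIV. h (C $ i $ j) * Y i j)
        = (\<Sum>i\<in>UNIV. \<Sum>j\<in>UNIV. \<Sum>m\<in>?K. if a m = i then if b m = j then h (?c m) * Y i j else 0 else 0)"
      by (auto simp: C_def hs sum_distrib_right h(1) intro!: sum.cong)
    also have "\<dots> = (\<Sum>i\<in>UNIV. \<Sum>m\<in>?K. \<Sum>j\<in>UNIV. if a m = i then if b m = j then h (?c m) * Y i j else 0 else 0)"
      by (intro sum.cong refl) (rule sum.swap)
    also have "\<dots> = (\<Sum>m\<in>?K. \<Sum>i\<in>UNIV. \<Sum>j\<in>UNIV. if a m = i then if b m = j then h (?c m) * Y i j else 0 else 0)"
      by (rule sum.swap)
    also have "\<dots> = (\<Sum>m\<in>?K. h (?c m) * Y (a m) (b m))"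
    proof (rule sum.cong)
      fix m
      have "(\<Sum>i\<in>UNIV. \<Sum>j\<in>UNIV. if a m = i then if b m = j then h (?c m) * Y i j else 0 else 0)
          = (\<Sum>i\<in>UNIV. if a m = i then h (?c m) * Y i (b m) else 0)"
        by (intro sum.cong) auto
      then show "(\<Sum>i\<in>UNIV. \<Sum>j\<in>UNIV. if a m = i then if b m = j then h (?c m) * Y i j else 0 else 0)
          = h (?c m) * Y (a m) (b m)" by simp
    qed simp
    finally show ?thesis .
  qed
  have eval: "mv_eval h q x = (\<Sum>m\<in>?K. h (?c m) * (x $ a m * x $ b m))" for h :: "'a \<Rightarrow> 'b::field" and x
    unfolding mv_eval_def
    by (intro sum.cong refl arg_cong2[where f = "(*)"])
       (simp add: ab power_add prod.distrib prod_delta_power)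
  have pd: "mv_eval to_ac (mv_pderiv i q) x = (\<Sum>j\<in>UNIV. to_ac (C $ i $ j + C $ j $ i) * x $ j)" for i x
  proof -
    have "mv_eval to_ac (mv_pderiv i q) x = (\<Sum>m\<in>?K. to_ac (?c m) *
        ((if a m = i then x $ b m else 0) + (if b m = i then x $ a m else 0)))"
      unfolding mv_pderiv_def mv_eval_sum[OF to_ac_0 to_ac_add] mv_eval_single[where h = to_ac, OF to_ac_0]
    proof (rule sum.cong[OF refl])
      fix m assume m: "m \<in> ?K"
      have e: "Poly_Mapping.lookup (m - Poly_Mapping.single i 1) k =
          (if k = a m then 1 else 0) + (if k = b m then 1 else 0) - (if k = i then 1 else 0)" for k
        by (auto simp: lookup_minus lookup_single when_def ab[OF m])
      show "to_ac (of_nat (Poly_Mapping.lookup m i) * ?c m) *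
          (\<Prod>k\<in>UNIV. (x $ k) ^ Poly_Mapping.lookup (m - Poly_Mapping.single i 1) k)
        = to_ac (?c m) * ((if a m = i then x $ b m else 0) + (if b m = i then x $ a m else 0))"
      proof (cases "a m = i")
        case True
        have "(\<Prod>k\<in>UNIV. (x $ k) ^ Poly_Mapping.lookup (m - Poly_Mapping.single i 1) k)
            = (\<Prod>k\<in>UNIV. (x $ k) ^ (if k = b m then 1 else 0))"
          by (rule prod.cong[OF refl], simp only: e) (auto simp: True)
        also have "\<dots> = x $ b m" by (rule prod_delta_power)
        finally show ?thesis using True by (auto simp: ab[OF m])
      next
        case False
        show ?thesis
        proof (cases "b m = i")
          case True
          have "(\<Prod>k\<in>UNIV. (x $ k) ^ Poly_Mapping.lookup (m - Poly_Mapping.single i 1) k)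
              = (\<Prod>k\<in>UNIV. (x $ k) ^ (if k = a m then 1 else 0))"
            by (rule prod.cong[OF refl], simp only: e) (auto simp: True)
          also have "\<dots> = x $ a m" by (rule prod_delta_power)
          finally show ?thesis using True False by (auto simp: ab[OF m])
        next
          case f: False
          then show ?thesis using False by (simp add: ab[OF m])
        qed
      qed
    qed
    also have "\<dots> = (\<Sum>m\<in>?K. to_ac (?c m) * (if a m = i then x $ b m else 0))
        + (\<Sum>m\<in>?K. to_ac (?c m) * (if b m = i then x $ a m else 0))"
      by (simp add: distrib_left sum.distrib)
    also have "(\<Sum>m\<in>?K. to_ac (?c m) * (if a m = i then x $ b m else 0))
        = (\<Sum>i'\<in>UNIV. \<Sum>j\<in>UNIV. to_ac (C $ i' $ j) * (if i' = i then x $ j else 0))"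
      by (rule bil[symmetric]) auto
    also have "\<dots> = (\<Sum>i'\<in>UNIV. if i' = i then \<Sum>j\<in>UNIV. to_ac (C $ i $ j) * x $ j else 0)"
      by (intro sum.cong) auto
    also have "\<dots> = (\<Sum>j\<in>UNIV. to_ac (C $ i $ j) * x $ j)" by simp
    also have "(\<Sum>m\<in>?K. to_ac (?c m) * (if b m = i then x $ a m else 0))
        = (\<Sum>i'\<in>UNIV. \<Sum>j\<in>UNIV. to_ac (C $ i' $ j) * (if j = i then x $ i' else 0))"
      by (rule bil[symmetric]) auto
    also have "\<dots> = (\<Sum>i'\<in>UNIV. to_ac (C $ i' $ i) * x $ i')"
      by (intro sum.cong) (auto simp: if_distrib[of "\<lambda>z. _ * z"] cong: if_cong)
    finally show ?thesis by (simp add: sum.distrib distrib_right)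
  qed
  show ?thesis
    by (intro exI[of _ C] conjI allI pd)
       (simp_all add: eval bil[of "\<lambda>c. c"] bil[of to_ac])
qed

lemma hpoly_power: "\<exists>f'. hpoly k (\<lambda>x :: 'k::field ^ 'n. (x $ i) ^ k) f'"
proof (induction k)
  case 0
  show ?case using hpoly.const[of 1] by auto
next
  case (Suc k)
  then obtain f' where "hpoly k (\<lambda>x :: 'k ^ 'n. (x $ i) ^ k) f'" by blast
  from hpoly.mult[OF hpoly.coord[of i] this] show ?case by auto
qed

lemma hpoly_monomial:
  fixes m :: "'n::finite \<Rightarrow> nat"
  shows "finite S \<Longrightarrow> \<exists>f'. hpoly (sum m S) (\<lambda>x :: 'k::field ^ 'n. \<Prod>i\<in>S. (x $ i) ^ m i) f'"
proof (induction S rule: finite_induct)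
  case empty
  show ?case using hpoly.const[of 1] by auto
next
  case (insert i S)
  then obtain f' where "hpoly (sum m S) (\<lambda>x :: 'k ^ 'n. \<Prod>i\<in>S. (x $ i) ^ m i) f'" by blast
  moreover obtain g' where "hpoly (m i) (\<lambda>x :: 'k ^ 'n. (x $ i) ^ m i) g'" using hpoly_power by blast
  ultimately show ?case using hpoly.mult[of "m i" _ g' "sum m S" _ f'] insert(1,2) by auto
qed

lemma hpoly_mv_eval:
  fixes p :: "('n::finite, 'a::zero) mvpoly" and h :: "'a \<Rightarrow> 'k::field"
  assumes "homogeneous d p" shows "\<exists>f'. hpoly d (mv_eval h p) f'"
proof -
  have "\<exists>f'. hpoly d (\<lambda>x. h (Poly_Mapping.lookup p m) * (\<Prod>i\<in>UNIV. (x $ i) ^ Poly_Mapping.lookup m i)) f'"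
    if "m \<in> Poly_Mapping.keys p" for m
  proof -
    have "sum (Poly_Mapping.lookup m) UNIV = d" using assms that by (simp add: homogeneous_def)
    then obtain f' where "hpoly d (\<lambda>x :: 'k ^ 'n. \<Prod>i\<in>UNIV. (x $ i) ^ Poly_Mapping.lookup m i) f'"
      using hpoly_monomial[of UNIV "Poly_Mapping.lookup m"] by auto
    from hpoly_scale[OF this] show ?thesis by blast
  qed
  then have tm: "hpoly d (\<lambda>x. h (Poly_Mapping.lookup p m) * (\<Prod>i\<in>UNIV. (x $ i) ^ Poly_Mapping.lookup m i))
      (SOME f'. hpoly d (\<lambda>x. h (Poly_Mapping.lookup p m) *
          (\<Prod>i\<in>UNIV. (x $ i) ^ Poly_Mapping.lookup m i)) f')"
    if "m \<in> Poly_Mapping.keys p" for m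
    using that by (intro someI_ex[of "hpoly d _"])
  show ?thesis unfolding mv_eval_def[abs_def] by (rule exI, rule hpoly_sum, rule tm)
qed

definition linear_form :: "'a ^ 'n \<Rightarrow> ('n::finite, 'a::field) mvpoly" where
  "linear_form v = (\<Sum>i\<in>UNIV. Poly_Mapping.single (Poly_Mapping.single i 1) (v $ i))"

lemma homogeneous_linear_form:
  fixes v :: "'a::field ^ 'n"
  shows "homogeneous 1 (linear_form v)"
proof -
  have "Poly_Mapping.keys (linear_form v) \<subseteq>
      (\<Union>i. Poly_Mapping.keys (Poly_Mapping.single (Poly_Mapping.single i (1::nat)) (v $ i)))"
    unfolding linear_form_def by (rule Poly_Mapping.keys_sum)
  then have "\<exists>i. m = Poly_Mapping.single i 1" if "m \<in> Poly_Mapping.keys (linear_form v)" for m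
    using that by (auto split: if_splits)
  moreover have "(\<Sum>j\<in>UNIV. Poly_Mapping.lookup (Poly_Mapping.single i (1::nat)) j) = 1" for i :: 'n
    by (simp add: lookup_single when_def)
  ultimately show ?thesis unfolding homogeneous_def by metis
qed

lemma mv_eval_linear_form: "mv_eval to_ac (linear_form v) x = (\<Sum>i\<in>UNIV. to_ac (v $ i) * x $ i)"
proof -
  have "Poly_Mapping.lookup (Poly_Mapping.single i 1) j = (if j = i then 1 else (0::nat))" for i j :: 'b
    by (simp add: lookup_single when_def)
  then have "(\<Prod>j\<in>UNIV. (x $ j) ^ Poly_Mapping.lookup (Poly_Mapping.single i 1) j) = x $ i" for i
    by (simp only: prod_delta_power)
  then show ?thesis
    unfolding linear_form_def by (simp add: mv_eval_sum mv_eval_single)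
qed

text \<open>An element of the extension generated by \<open>\<theta>\<close> and its conjugate under
  \<open>\<theta> \<mapsto> - \<theta>\<close>. As a relation it is closed under ring operations as
  soon as \<open>\<theta>^2\<close> is in the ground field, without constructing the conjugation as
  a map.\<close>

definition conj_pair :: "'a::field alg_closure \<Rightarrow> 'a alg_closure \<Rightarrow> 'a alg_closure \<Rightarrow> bool" where
  "conj_pair \<theta> a b \<longleftrightarrow> (\<exists>r0 r1. a = to_ac r0 + \<theta> * to_ac r1 \<and> b = to_ac r0 - \<theta> * to_ac r1)"

context
  fixes \<theta> :: "'a::field alg_closure" and \<delta> assumes \<theta>: "\<theta>^2 = to_ac \<delta>"
begin

lemma conj_pair_const: "conj_pair \<theta> (to_ac r) (to_ac r)"
  unfolding conj_pair_def by (intro exI[of _ r] exI[of _ 0]) simp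

lemma conj_pair_add: "conj_pair \<theta> a b \<Longrightarrow> conj_pair \<theta> a' b' \<Longrightarrow> conj_pair \<theta> (a + a') (b + b')"
proof -
  assume "conj_pair \<theta> a b" "conj_pair \<theta> a' b'"
  then obtain r0 r1 s0 s1 where *: "a = to_ac r0 + \<theta> * to_ac r1" "b = to_ac r0 - \<theta> * to_ac r1"
    "a' = to_ac s0 + \<theta> * to_ac s1" "b' = to_ac s0 - \<theta> * to_ac s1" unfolding conj_pair_def by blast
  show ?thesis unfolding conj_pair_def *
    by (intro exI[of _ "r0 + s0"] exI[of _ "r1 + s1"]) (simp add: algebra_simps)
qed

lemma conj_pair_mult: "conj_pair \<theta> a b \<Longrightarrow> conj_pair \<theta> a' b' \<Longrightarrow> conj_pair \<theta> (a * a') (b * b')"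
proof -
  assume "conj_pair \<theta> a b" "conj_pair \<theta> a' b'"
  then obtain r0 r1 s0 s1 where *: "a = to_ac r0 + \<theta> * to_ac r1" "b = to_ac r0 - \<theta> * to_ac r1"
    "a' = to_ac s0 + \<theta> * to_ac s1" "b' = to_ac s0 - \<theta> * to_ac s1" unfolding conj_pair_def by blast
  have "a * a' = to_ac (r0 * s0) + \<theta>^2 * to_ac (r1 * s1) + \<theta> * to_ac (r0 * s1 + r1 * s0)"
    "b * b' = to_ac (r0 * s0) + \<theta>^2 * to_ac (r1 * s1) - \<theta> * to_ac (r0 * s1 + r1 * s0)"
    unfolding * by (simp_all add: algebra_simps power2_eq_square)
  then show ?thesis unfolding conj_pair_def \<theta>
    by (intro exI[of _ "r0 * s0 + \<delta> * (r1 * s1)"] exI[of _ "r0 * s1 + r1 * s0"]) simp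
qed

lemma conj_pair_power: "conj_pair \<theta> a b \<Longrightarrow> conj_pair \<theta> (a ^ m) (b ^ m)"
  by (induction m) (use conj_pair_const[of 1] in \<open>auto intro: conj_pair_mult\<close>)

lemma conj_pair_sum: "(\<And>i. i \<in> S \<Longrightarrow> conj_pair \<theta> (a i) (b i)) \<Longrightarrow> conj_pair \<theta> (sum a S) (sum b S)"
  by (induction S rule: infinite_finite_induct) (use conj_pair_const[of 0] in \<open>auto intro: conj_pair_add\<close>)

lemma conj_pair_prod: "(\<And>i. i \<in> S \<Longrightarrow> conj_pair \<theta> (a i) (b i)) \<Longrightarrow> conj_pair \<theta> (prod a S) (prod b S)"
  by (induction S rule: infinite_finite_induct) (use conj_pair_const[of 1] in \<open>auto intro: conj_pair_mult\<close>)

lemma conj_pair_mv_eval: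
  "(\<And>i. conj_pair \<theta> (x $ i) (y $ i)) \<Longrightarrow> conj_pair \<theta> (mv_eval to_ac p x) (mv_eval to_ac p y)"
  unfolding mv_eval_def
  by (intro conj_pair_sum conj_pair_mult conj_pair_const conj_pair_prod conj_pair_power)

end

section \<open>Extension of scalars\<close>

definition vec_ac :: "'a::field ^ 'n \<Rightarrow> 'a alg_closure ^ 'n" where
  "vec_ac v = (\<chi> i. to_ac (v $ i))"

definition mat_ac :: "'a::field ^ 'n ^ 'm \<Rightarrow> 'a alg_closure ^ 'n ^ 'm" where
  "mat_ac A = (\<chi> i j. to_ac (A $ i $ j))"

lemma vec_ac_simps: "vec_ac (v + w) = vec_ac v + vec_ac w" "vec_ac (a *s v) = to_ac a *s vec_ac v"
  "vec_ac (v - w) = vec_ac v - vec_ac w"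
  "mat_ac A *v vec_ac v = vec_ac (A *v v)" "vec_ac v = 0 \<longleftrightarrow> v = 0" "vec_ac v = vec_ac w \<longleftrightarrow> v = w"
  by (simp_all add: vec_ac_def mat_ac_def vec_eq_iff matrix_vector_mult_def to_ac_sum)

lemma mat_ac_mult: "mat_ac (A ** B) = mat_ac A ** mat_ac B"
  by (simp add: mat_ac_def vec_eq_iff matrix_matrix_mult_def to_ac_sum)

lemma mat_ac_one: "mat_ac (mat 1) = mat 1"
  by (auto simp: mat_ac_def vec_eq_iff mat_def)

text \<open>Extend \<open>x\<close> to a basis of the closure over the ground field. Applied
  entrywise, \<open>l\<close> turns linear relations with coefficients in the ground field into
  relations inside it.\<close>

lemma linear_functional_exists:
  fixes x :: "'a::field alg_closure"
  assumes "x \<noteq> 0"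
  obtains l :: "'a alg_closure \<Rightarrow> 'a" where "\<And>a b. l (a + b) = l a + l b" "\<And>c a. l (to_ac c * a) = c * l a" "l x \<noteq> 0"
proof -
  interpret K: vector_space "\<lambda>c (a :: 'a alg_closure). to_ac c * a"
    by unfold_locales (auto simp: algebra_simps)
  interpret P: vector_space_pair "\<lambda>c (a :: 'a alg_closure). to_ac c * a" "(*) :: 'a \<Rightarrow> 'a \<Rightarrow> 'a" ..
  have "K.independent {x}" using assms by simp
  then obtain l where l: "Vector_Spaces.linear (\<lambda>c (a :: 'a alg_closure). to_ac c * a) (*) l" "\<forall>y\<in>{x}. l y = 1"
    using P.linear_independent_extend[of "{x}" "\<lambda>_. 1"] by blast
  interpret l: Vector_Spaces.linear "\<lambda>c (a :: 'a alg_closure). to_ac c * a" "(*)" l by (rule l(1))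
  show ?thesis by (rule that[of l]) (use l(2) in \<open>auto simp: l.add l.scale\<close>)
qed

lemma matrix_mult_axis_component: "(A *v axis i 1) $ k = (A $ k $ i :: 'k::field)"
proof -
  have "(A *v axis i 1) $ k = (\<Sum>j\<in>UNIV. if j = i then A $ k $ i else 0)"
    unfolding matrix_vector_mult_def vec_lambda_beta by (rule sum.cong) (auto simp: axis_def)
  then show ?thesis by simp
qed

text \<open>A kernel vector \<open>v\<close> is isotropic, and adding it to any \<open>w\<close>
  does not change \<open>qf\<close>; the cross term then puts \<open>v\<close> into the
  radical.\<close>

lemma (in quad_form) similitude_inj:
  assumes c: "c \<noteq> 0" and sim: "\<And>v. qf (A *v v) = c * qf v" and v: "v \<noteq> 0"
  shows "A *v v \<noteq> 0"
proof
  assume 0: "A *v v = 0"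
  obtain w where w: "bf w v \<noteq> 0" using bf_nondeg'[OF v] by blast
  have "qf (A *v (w + v)) = c * qf (w + v)" by (rule sim)
  moreover have "qf v = 0" using sim[of v] 0 c by simp
  ultimately have "c * (2 * bf w v) = 0"
    using 0 sim[of w] by (simp add: matrix_vector_right_distrib qf_add distrib_left)
  then show False using w two c by simp
qed

section \<open>Descent of the linear map to the ground field\<close>

locale pointless_quadric =
  fixes q :: "('n::finite, 'a::field) mvpoly" and M :: "'a ^ 'n ^ 'n"
  assumes two: "(2 :: 'a) \<noteq> 0"
    and M_sym: "M $ i $ j = M $ j $ i"
    and eval: "mv_eval (\<lambda>c. c) q v = (\<Sum>i\<in>UNIV. \<Sum>j\<in>UNIV. M $ i $ j * (v $ i * v $ j))"
    and eval_ac: "mv_eval to_ac q x = (\<Sum>i\<in>UNIV. \<Sum>j\<in>UNIV. to_ac (M $ i $ j) * (x $ i * x $ j))"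
    and nondeg: "mat_ac M *v x = 0 \<Longrightarrow> x = 0"
    and anisotropic: "v \<noteq> 0 \<Longrightarrow> mv_eval (\<lambda>c. c) q v \<noteq> 0"
    and n3: "CARD('n) \<ge> 3"
begin

sublocale K: quad_form M
proof
  fix x assume "M *v x = 0"
  then have "mat_ac M *v vec_ac x = 0" by (simp add: vec_ac_simps)
  then show "x = 0" using nondeg vec_ac_simps(5) by blast
qed (rule M_sym, rule two)

sublocale ac: quad_closed "mat_ac M"
proof
  show "(2 :: 'a alg_closure) \<noteq> 0" using two by (metis to_ac_eq_0_iff to_ac_numeral)
qed (use M_sym nondeg n3 in \<open>auto simp: mat_ac_def\<close>)

lemma qf_eval: "K.qf v = mv_eval (\<lambda>c. c) q v"
  by (simp add: eval K.qf_def K.bf_alt)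

lemma qf_eval_ac: "ac.qf x = mv_eval to_ac q x"
  unfolding eval_ac ac.qf_def ac.bf_alt by (simp add: mat_ac_def)

lemma bf_vec_ac: "ac.bf (vec_ac v) (vec_ac w) = to_ac (K.bf v w)"
  unfolding ac.bf_alt K.bf_alt by (simp add: mat_ac_def vec_ac_def to_ac_sum)

lemma qf_vec_ac: "ac.qf (vec_ac v) = to_ac (K.qf v)"
  by (simp add: ac.qf_def K.qf_def bf_vec_ac)

lemma qf_nz: "v \<noteq> 0 \<Longrightarrow> K.qf v \<noteq> 0"
  using anisotropic by (simp add: qf_eval)

lemma regular_map_regular:
  assumes "regular_map q \<phi>" shows "ac.regular \<phi>"
  unfolding ac.regular_def
proof (intro allI impI)
  fix x assume x: "x \<noteq> 0" "ac.qf x = 0"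
  obtain d e f g where f: "\<forall>j. homogeneous d (f j)" and g: "homogeneous e g" "mv_eval to_ac g x \<noteq> 0"
    and rep: "\<forall>y. y \<noteq> 0 \<and> mv_eval to_ac q y = 0 \<and> mv_eval to_ac g y \<noteq> 0 \<longrightarrow>
              (\<chi> j. mv_eval to_ac (f j) y) \<noteq> 0 \<and>
              \<phi> (proj_point y) = proj_point (\<chi> j. mv_eval to_ac (f j) y)"
    using assms x unfolding regular_map_def qf_eval_ac by meson
  obtain g' where g': "hpoly e (mv_eval to_ac g) g'" using hpoly_mv_eval[OF g(1)] by blast
  have "\<forall>j. \<exists>f'. hpoly d (mv_eval to_ac (f j)) f'" using hpoly_mv_eval f by blast
  then obtain f' where f': "\<And>j. hpoly d (mv_eval to_ac (f j)) (f' j)" by metis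
  have "ac.lrep \<phi> d (\<lambda>y. \<chi> j. mv_eval to_ac (f j) y) (\<lambda>y w. \<chi> j. f' j y w) e (mv_eval to_ac g) g'"
    unfolding ac.lrep_def using f' g' rep by (simp add: qf_eval_ac)
  then show "\<exists>d f f' e g g'. ac.lrep \<phi> d f f' e g g' \<and> g x \<noteq> 0" using g(2) by blast
qed

lemma geometric_points_iff: "P \<in> geometric_points q \<longleftrightarrow> (\<exists>x. P = proj_point x \<and> x \<noteq> 0 \<and> ac.qf x = 0)"
  by (auto simp: hypersurface_points_def qf_eval_ac)

lemma automorphism_linear_ac:
  assumes "\<phi> \<in> carrier (Aut_hypersurface q)"
  shows "\<exists>A c. c \<noteq> 0 \<and> (\<forall>v. ac.qf (A *v v) = c * ac.qf v) \<and>
     (\<forall>z. z \<noteq> 0 \<longrightarrow> ac.qf z = 0 \<longrightarrow> \<phi> (proj_point z) = proj_point (A *v z))"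
proof -
  let ?S = "geometric_points q"
  have *: "regular_map q \<phi>" "regular_map q (inv_into ?S \<phi>)" "\<phi> \<in> Bij ?S"
    using assms by (auto simp: Aut_hypersurface_def)
  then have bij: "bij_betw \<phi> ?S ?S" by (simp add: Bij_def)
  interpret quad_aut "mat_ac M" \<phi> "inv_into ?S \<phi>"
  proof
    show "ac.regular \<phi>" "ac.regular (inv_into ?S \<phi>)" using * regular_map_regular by auto
    fix x assume x: "x \<noteq> 0" "ac.qf x = 0"
    then have P: "proj_point x \<in> ?S" using geometric_points_iff by blast
    then have "\<phi> (proj_point x) \<in> ?S" using bij by (auto simp: bij_betw_def)
    then show "\<exists>z. z \<noteq> 0 \<and> ac.qf z = 0 \<and> \<phi> (proj_point x) = proj_point z"
      using geometric_points_iff by blast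
    show "inv_into ?S \<phi> (\<phi> (proj_point x)) = proj_point x"
      using bij P by (simp add: bij_betw_def)
  qed
  show ?thesis by (rule automorphism_linear)
qed

lemma three_indices:
  obtains k :: 'n where "k \<noteq> i" "k \<noteq> j"
proof -
  have "card {i, j} < CARD('n)" using n3 by (metis card_2_iff card_insert_if card.empty
    Suc_1 Suc_le_eq finite.emptyI insert_absorb2 insert_not_empty lessI less_le_trans nat_le_linear
    not_less numeral_3_eq_3 order_less_le_trans singletonD finite.insertI empty_iff One_nat_def)
  then have "{i, j} \<noteq> UNIV" by auto
  then show ?thesis using that by blast
qed

text \<open>Galois descent by hand: a conjugate pair of points of the quadric spans a plane over the
  ground field, so the linear relations expressing that \<open>A\<close> induces \<open>\<phi>\<close> on such a
  pair have coefficients in the ground field, and they survive a functional \<open>l\<close>.\<close>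

lemma descent_conjugate_pair:
  assumes reg: "regular_map q \<phi>"
    and A: "\<And>z. z \<noteq> 0 \<Longrightarrow> ac.qf z = 0 \<Longrightarrow> \<phi> (proj_point z) = proj_point (A *v z)"
    and l: "\<And>a b. l (a + b) = l a + l b" "\<And>c a. l (to_ac c * a) = c * l a"
    and \<theta>: "\<theta>^2 = to_ac \<delta>" "\<theta> \<notin> range to_ac"
    and z: "vec_ac v + \<theta> *s vec_ac w \<noteq> 0" "ac.qf (vec_ac v + \<theta> *s vec_ac w) = 0"
      "vec_ac v - \<theta> *s vec_ac w \<noteq> 0" "ac.qf (vec_ac v - \<theta> *s vec_ac w) = 0"
  shows "\<exists>\<tau>. mat_ac (\<chi> i j. l (A $ i $ j)) *v (vec_ac v + \<theta> *s vec_ac w) = \<tau> *s (A *v (vec_ac v + \<theta> *s vec_ac w))"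
proof -
  let ?z = "vec_ac v + \<theta> *s vec_ac w" and ?z' = "vec_ac v - \<theta> *s vec_ac w"
  define A' where "A' = (\<chi> i j. l (A $ i $ j))"
  obtain d e f g where g: "mv_eval to_ac g ?z \<noteq> 0"
    and rep: "\<forall>y. y \<noteq> 0 \<and> mv_eval to_ac q y = 0 \<and> mv_eval to_ac g y \<noteq> 0 \<longrightarrow>
              (\<chi> j. mv_eval to_ac (f j) y) \<noteq> 0 \<and>
              \<phi> (proj_point y) = proj_point (\<chi> j. mv_eval to_ac (f j) y)"
    using reg z(1,2) unfolding regular_map_def qf_eval_ac by meson
  have cp: "conj_pair \<theta> (?z $ i) (?z' $ i)" for i
    unfolding conj_pair_def by (intro exI[of _ "v $ i"] exI[of _ "w $ i"]) (simp add: vec_ac_def)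
  have \<theta>0: "\<theta> \<noteq> 0" using \<theta>(2) by (metis rangeI to_ac_0)
  obtain g0 g1 where g01: "mv_eval to_ac g ?z = to_ac g0 + \<theta> * to_ac g1"
      "mv_eval to_ac g ?z' = to_ac g0 - \<theta> * to_ac g1"
    using conj_pair_mv_eval[OF \<theta>(1) cp, of g] unfolding conj_pair_def by blast
  \<comment> \<open>A zero at the conjugate point would express \<open>\<theta>\<close> in the
    ground field or force \<open>g\<close> to vanish at the original point.\<close>
  have g': "mv_eval to_ac g ?z' \<noteq> 0"
  proof
    assume 0: "mv_eval to_ac g ?z' = 0"
    show False
    proof (cases "g1 = 0")
      case True
      then show False using 0 g g01 by simp
    next
      case False
      then have "\<theta> = to_ac (g0 / g1)" using 0 g01(2) by (simp add: field_simps)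
      then show False using \<theta>(2) by blast
    qed
  qed
  have "\<forall>j. \<exists>r0 r1. mv_eval to_ac (f j) ?z = to_ac r0 + \<theta> * to_ac r1 \<and>
      mv_eval to_ac (f j) ?z' = to_ac r0 - \<theta> * to_ac r1"
    using conj_pair_mv_eval[OF \<theta>(1) cp] unfolding conj_pair_def by blast
  then obtain r0 r1 where r: "\<And>j. mv_eval to_ac (f j) ?z = to_ac (r0 j) + \<theta> * to_ac (r1 j)"
      "\<And>j. mv_eval to_ac (f j) ?z' = to_ac (r0 j) - \<theta> * to_ac (r1 j)" by metis
  have F: "(\<chi> j. mv_eval to_ac (f j) ?z) \<noteq> 0"
      "proj_point (A *v ?z) = proj_point (\<chi> j. mv_eval to_ac (f j) ?z)"
    using rep g z(1,2) A[OF z(1,2)] by (auto simp: qf_eval_ac)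
  have F': "proj_point (A *v ?z') = proj_point (\<chi> j. mv_eval to_ac (f j) ?z')"
    using rep g' z(3,4) A[OF z(3,4)] by (auto simp: qf_eval_ac)
  obtain k where k: "k \<noteq> 0" "A *v ?z = k *s (\<chi> j. mv_eval to_ac (f j) ?z)" using F(2) by (auto simp: proj_point_eq_iff)
  obtain k' where k': "A *v ?z' = k' *s (\<chi> j. mv_eval to_ac (f j) ?z')" using F' by (auto simp: proj_point_eq_iff)
  define a b where "a = A *v vec_ac v" and "b = A *v vec_ac w"
  have ab: "A *v ?z = a + \<theta> *s b" "A *v ?z' = a - \<theta> *s b"
    by (simp_all add: a_def b_def matrix_vector_right_distrib matrix_vector_mult_diff_distrib vec.scale)
  have lsum: "l (\<Sum>i\<in>S. h i) = (\<Sum>i\<in>S. l (h i))" for S and h :: "'n \<Rightarrow> _"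
  proof -
    have "l (to_ac 0 * 0) = 0 * l 0" by (rule l(2))
    then have "l 0 = 0" by simp
    then show ?thesis by (induction S rule: infinite_finite_induct) (auto simp: l)
  qed
  have la: "l (a $ i) = (A' *v v) $ i" "l (b $ i) = (A' *v w) $ i" for i
    by (simp_all add: a_def b_def A'_def matrix_vector_mult_def vec_ac_def lsum mult.commute[of _ "to_ac _"] l(2) mult.commute)
  have e1: "(a $ i + \<theta> * b $ i) * (to_ac (r0 j) + \<theta> * to_ac (r1 j))
      = (a $ j + \<theta> * b $ j) * (to_ac (r0 i) + \<theta> * to_ac (r1 i))" for i j
  proof -
    have "a $ i + \<theta> * b $ i = k * (to_ac (r0 i) + \<theta> * to_ac (r1 i))" for i
      using arg_cong[OF k(2), of "\<lambda>v. v $ i"] unfolding ab by (simp add: r)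
    then show ?thesis by simp
  qed
  have e2: "(a $ i - \<theta> * b $ i) * (to_ac (r0 j) - \<theta> * to_ac (r1 j))
      = (a $ j - \<theta> * b $ j) * (to_ac (r0 i) - \<theta> * to_ac (r1 i))" for i j
  proof -
    have "a $ i - \<theta> * b $ i = k' * (to_ac (r0 i) - \<theta> * to_ac (r1 i))" for i
      using arg_cong[OF k', of "\<lambda>v. v $ i"] unfolding ab by (simp add: r)
    then show ?thesis by simp
  qed
  \<comment> \<open>\<open>s1\<close> and \<open>s2\<close> are the even and odd parts in
    \<open>\<theta>\<close> of the proportionality relations \<open>e1\<close> and
    \<open>e2\<close>. Their coefficients lie in the ground field, which is what allows
    \<open>l\<close> to be applied.\<close>
  have s1: "to_ac (r0 j) * a $ i + to_ac (\<delta> * r1 j) * b $ i = to_ac (r0 i) * a $ j + to_ac (\<delta> * r1 i) * b $ j" for i j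
  proof -
    have "2 * (to_ac (r0 j) * a $ i + \<theta>^2 * to_ac (r1 j) * b $ i)
        = 2 * (to_ac (r0 i) * a $ j + \<theta>^2 * to_ac (r1 i) * b $ j)"
      using arg_cong2[OF e1[of i j] e2[of i j], of "(+)"] by (simp add: algebra_simps power2_eq_square)
    then have "to_ac (r0 j) * a $ i + \<theta>^2 * to_ac (r1 j) * b $ i
        = to_ac (r0 i) * a $ j + \<theta>^2 * to_ac (r1 i) * b $ j"
      by (simp only: mult_left_cancel[OF ac.two])
    then show ?thesis by (simp add: \<theta>(1))
  qed
  have s2: "to_ac (r1 j) * a $ i + to_ac (r0 j) * b $ i = to_ac (r1 i) * a $ j + to_ac (r0 i) * b $ j" for i j
  proof -
    have "(2 * \<theta>) * (to_ac (r1 j) * a $ i + to_ac (r0 j) * b $ i)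
        = (2 * \<theta>) * (to_ac (r1 i) * a $ j + to_ac (r0 i) * b $ j)"
      using arg_cong2[OF e1[of i j] e2[of i j], of "(-)"] by (simp add: algebra_simps)
    then show ?thesis using ac.two \<theta>0 by (subst (asm) mult_left_cancel) auto
  qed
  let ?a = "A' *v v" and ?b = "A' *v w"
  have t1: "r0 j * ?a $ i + (\<delta> * r1 j) * ?b $ i = r0 i * ?a $ j + (\<delta> * r1 i) * ?b $ j" for i j
    using arg_cong[OF s1[of j i], of l] by (simp only: l la)
  have t2: "r1 j * ?a $ i + r0 j * ?b $ i = r1 i * ?a $ j + r0 i * ?b $ j" for i j
    using arg_cong[OF s2[of j i], of l] by (simp only: l la)
  define F where "F = (\<chi> j. mv_eval to_ac (f j) ?z)"
  define D where "D = mat_ac A' *v ?z"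
  have D: "D $ i = to_ac (?a $ i) + \<theta> * to_ac (?b $ i)" for i
    by (simp add: D_def matrix_vector_right_distrib vec.scale vec_ac_simps) (simp add: vec_ac_def)
  have "D $ i * F $ j = D $ j * F $ i" for i j
  proof -
    have "D $ i * F $ j = to_ac (r0 j * ?a $ i) + \<theta>^2 * to_ac (r1 j * ?b $ i)
        + \<theta> * to_ac (r1 j * ?a $ i + r0 j * ?b $ i)" for i j
      by (simp add: D F_def r algebra_simps power2_eq_square)
    then have *: "D $ i * F $ j = to_ac (r0 j * ?a $ i + (\<delta> * r1 j) * ?b $ i)
        + \<theta> * to_ac (r1 j * ?a $ i + r0 j * ?b $ i)" for i j
      by (simp add: \<theta>(1) algebra_simps)
    show ?thesis unfolding * t1[of j i] t2[of j i] ..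
  qed
  moreover obtain j where j: "F $ j \<noteq> 0" using F(1) by (auto simp: F_def vec_eq_iff)
  ultimately have "D = (D $ j / F $ j) *s F" by (simp add: vec_eq_iff field_simps)
  then obtain m where "D = m *s F" by blast
  also have "F = (1 / k) *s (A *v ?z)" using k by (simp add: F_def)
  finally have "D = (m * (1 / k)) *s (A *v ?z)" by (simp only: vector_smult_assoc)
  then show ?thesis unfolding D_def A'_def by (rule exI)
qed

text \<open>Let \<open>A'\<close> arise from \<open>A\<close> by applying \<open>l\<close> to the
  entries. The quotient \<open>T\<close> of \<open>A'\<close> by \<open>A\<close> has the conjugate
  points of every rational line as eigenvectors, so it sends a rational vector into each rational
  plane containing it. With at least three coordinates this makes \<open>T\<close> scalar.\<close>

theorem automorphism_matrix:
  assumes \<phi>: "\<phi> \<in> carrier (Aut_hypersurface q)"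
  shows "\<exists>A c. c \<noteq> 0 \<and> (\<forall>v. K.qf (A *v v) = c * K.qf v) \<and>
     (\<forall>z. z \<noteq> 0 \<longrightarrow> ac.qf z = 0 \<longrightarrow> \<phi> (proj_point z) = proj_point (mat_ac A *v z))"
proof -
  obtain A c where c: "c \<noteq> 0" and sim: "\<And>v. ac.qf (A *v v) = c * ac.qf v"
    and A: "\<And>z. z \<noteq> 0 \<Longrightarrow> ac.qf z = 0 \<Longrightarrow> \<phi> (proj_point z) = proj_point (A *v z)"
    using automorphism_linear_ac[OF \<phi>] by metis
  have reg: "regular_map q \<phi>" using \<phi> by (simp add: Aut_hypersurface_def)
  have inj: "A *v v \<noteq> 0" if "v \<noteq> 0" for v by (rule ac.similitude_inj[OF c sim that])
  then obtain Ai where Ai: "Ai ** A = mat 1" using matrix_left_invertible_ker[of A] by blast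
  then have Ai': "A ** Ai = mat 1" by (simp add: matrix_left_right_inverse)
  fix i0 :: 'n
  have "A *v axis i0 1 \<noteq> 0" by (rule inj) simp
  then obtain j0 where "A $ j0 $ i0 \<noteq> 0"
    by (auto simp: vec_eq_iff matrix_mult_axis_component)
  then obtain l where l: "\<And>a b. l (a + b) = l a + l b" "\<And>c a. l (to_ac c * a) = c * l a"
      "l (A $ j0 $ i0) \<noteq> 0"
    by (rule linear_functional_exists) blast
  define A' where "A' = (\<chi> i j. l (A $ i $ j))"
  define T where "T = Ai ** mat_ac A'"
  have eig: "\<exists>\<tau>. T *v z = \<tau> *s z" if "mat_ac A' *v z = \<tau> *s (A *v z)" for z \<tau>
  proof -
    have "T *v z = Ai *v (mat_ac A' *v z)" by (simp add: T_def matrix_vector_mul_assoc)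
    also have "\<dots> = \<tau> *s z" unfolding that
      by (simp add: vec.scale matrix_vector_mul_assoc Ai)
    finally show ?thesis by blast
  qed
  have plane: "\<exists>\<alpha> \<beta>. T *v vec_ac v = \<alpha> *s vec_ac v + \<beta> *s vec_ac w"
    if w: "w \<noteq> 0" and vw: "\<And>t. v \<noteq> t *s w" for v w
  proof -
    \<comment> \<open>Making \<open>v\<close> orthogonal to \<open>w\<close> removes the linear
      term, so that the line meets the quadric at the parameters with square
      \<open>\<delta>\<close>. Anisotropy keeps them out of the ground field.\<close>
    define \<kappa> where "\<kappa> = K.bf v w / K.qf w"
    define v0 where "v0 = v - \<kappa> *s w"
    have qw: "K.qf w \<noteq> 0" by (rule qf_nz[OF w])
    have v0: "v0 + t *s w \<noteq> 0" for t
    proof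
      assume "v0 + t *s w = 0"
      then have "v = (\<kappa> - t) *s w" by (simp add: v0_def vec_eq_iff algebra_simps eq_diff_eq)
      then show False using vw by blast
    qed
    have orth: "K.bf v0 w = 0" using qw by (simp add: v0_def K.bf_lin \<kappa>_def K.qf_def)
    define \<delta> where "\<delta> = - K.qf v0 / K.qf w"
    have "degree [:- to_ac \<delta>, 0, 1:] > 0" by simp
    then obtain \<theta> where "poly [:- to_ac \<delta>, 0, 1:] \<theta> = 0" using alg_closed_imp_poly_has_root by blast
    then have \<theta>: "\<theta>^2 = to_ac \<delta>" by (simp add: power2_eq_square)
    have qz: "ac.qf (vec_ac v0 + s *s vec_ac w) = 0" if "s^2 = to_ac \<delta>" for s
    proof -
      have "ac.qf (vec_ac v0 + s *s vec_ac w) = to_ac (K.qf v0 + \<delta> * K.qf w)"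
        by (simp add: ac.qf_add ac.qf_scale ac.bf_lin bf_vec_ac qf_vec_ac orth that)
      then show ?thesis using qw by (simp add: \<delta>_def)
    qed
    have \<theta>K: "\<theta> \<notin> range to_ac"
    proof
      assume "\<theta> \<in> range to_ac"
      then obtain t where t: "\<theta> = to_ac t" by blast
      have "vec_ac v0 + \<theta> *s vec_ac w = vec_ac (v0 + t *s w)" by (simp add: vec_ac_simps t)
      then have "K.qf (v0 + t *s w) = 0" using qz[OF \<theta>] by (simp add: qf_vec_ac)
      then show False using qf_nz[OF v0] by blast
    qed
    have znz: "vec_ac v0 + s *s vec_ac w \<noteq> 0" if "s \<notin> range to_ac" for s
    proof
      assume 0: "vec_ac v0 + s *s vec_ac w = 0"
      obtain i where i: "w $ i \<noteq> 0" using w by (auto simp: vec_eq_iff)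
      have "to_ac (v0 $ i) + s * to_ac (w $ i) = 0"
        using arg_cong[OF 0, of "\<lambda>v. v $ i"] by (simp add: vec_ac_def)
      then have "s = to_ac (- v0 $ i / w $ i)" using i by (simp add: field_simps eq_neg_iff_add_eq_0)
      then show False using that by blast
    qed
    have m\<theta>: "(- \<theta>)^2 = to_ac \<delta>" "- \<theta> \<notin> range to_ac"
    proof -
      show "(- \<theta>)^2 = to_ac \<delta>" using \<theta> by simp
      show "- \<theta> \<notin> range to_ac"
      proof
        assume "- \<theta> \<in> range to_ac"
        then obtain t where "- \<theta> = to_ac t" by blast
        then have "\<theta> = to_ac (- t)" by (metis minus_minus to_ac_minus)
        then show False using \<theta>K by blast
      qed
    qed
    have neg: "vec_ac v0 - s *s vec_ac w = vec_ac v0 + (- s) *s vec_ac w" for s by (simp add: vec_eq_iff)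
    obtain \<tau> where \<tau>: "T *v (vec_ac v0 + \<theta> *s vec_ac w) = \<tau> *s (vec_ac v0 + \<theta> *s vec_ac w)"
      using descent_conjugate_pair[OF reg A l(1,2) \<theta> \<theta>K, of v0 w] qz[OF \<theta>] qz[OF m\<theta>(1)]
        znz[OF \<theta>K] znz[OF m\<theta>(2)] eig unfolding A'_def neg by blast
    obtain \<tau>' where \<tau>': "T *v (vec_ac v0 + (- \<theta>) *s vec_ac w) = \<tau>' *s (vec_ac v0 + (- \<theta>) *s vec_ac w)"
      using descent_conjugate_pair[OF reg A l(1,2) m\<theta>, of v0 w] qz[OF \<theta>] qz[OF m\<theta>(1)]
        znz[OF \<theta>K] znz[OF m\<theta>(2)] eig unfolding A'_def neg minus_minus by blast
    define p r where "p = T *v vec_ac v0" and "r = T *v vec_ac w"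
    have pr: "p + \<theta> *s r = \<tau> *s (vec_ac v0 + \<theta> *s vec_ac w)"
      "p - \<theta> *s r = \<tau>' *s (vec_ac v0 - \<theta> *s vec_ac w)"
      using \<tau> \<tau>' by (simp_all add: p_def r_def matrix_vector_right_distrib matrix_vector_mult_diff_distrib vec.scale)
    have \<theta>0: "\<theta> \<noteq> 0" using \<theta>K by (metis rangeI to_ac_0)
    have "2 *s p = (\<tau> + \<tau>') *s vec_ac v0 + (\<theta> * (\<tau> - \<tau>')) *s vec_ac w"
      using arg_cong2[OF pr, of "(+)"] by (simp add: vec_eq_iff algebra_simps)
    then have p: "p = ((\<tau> + \<tau>') / 2) *s vec_ac v0 + (\<theta> * (\<tau> - \<tau>') / 2) *s vec_ac w"
      using ac.two by (simp add: vec_eq_iff field_simps)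
    have "(2 * \<theta>) *s r = (\<tau> - \<tau>') *s vec_ac v0 + (\<theta> * (\<tau> + \<tau>')) *s vec_ac w"
      using arg_cong2[OF pr, of "(-)"] by (simp add: vec_eq_iff algebra_simps)
    then have r: "r = ((\<tau> - \<tau>') / (2 * \<theta>)) *s vec_ac v0 + ((\<tau> + \<tau>') / 2) *s vec_ac w"
      using ac.two \<theta>0 by (simp add: vec_eq_iff field_simps)
    have v: "vec_ac v0 = vec_ac v - to_ac \<kappa> *s vec_ac w" by (simp add: v0_def vec_ac_simps)
    have "vec_ac v = vec_ac v0 + to_ac \<kappa> *s vec_ac w" by (simp add: v)
    then have "T *v vec_ac v = p + to_ac \<kappa> *s r"
      by (simp add: p_def r_def matrix_vector_right_distrib vec.scale)
    also have "\<dots> = ((\<tau> + \<tau>') / 2 + to_ac \<kappa> * ((\<tau> - \<tau>') / (2 * \<theta>))) *s vec_ac v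
       + (\<theta> * (\<tau> - \<tau>') / 2 + to_ac \<kappa> * ((\<tau> + \<tau>') / 2)
          - to_ac \<kappa> * ((\<tau> + \<tau>') / 2 + to_ac \<kappa> * ((\<tau> - \<tau>') / (2 * \<theta>)))) *s vec_ac w"
      unfolding p r v by (simp add: vec_eq_iff algebra_simps)
    finally show ?thesis by blast
  qed
  have vax: "vec_ac (axis i 1) = axis i 1" for i :: 'n by (auto simp: vec_ac_def axis_def vec_eq_iff)
  have Tax: "(T *v axis i 1) $ k = T $ k $ i" for i k
    by (simp add: matrix_mult_axis_component)
  \<comment> \<open>The image of \<open>axis i 1\<close> lies in its plane with
    \<open>axis j 1\<close> for a third index \<open>j\<close>, which leaves no \<open>k\<close>-th
    coordinate.\<close>
  have off: "T $ k $ i = 0" if "k \<noteq> i" for k i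
  proof -
    obtain j where j: "j \<noteq> i" "j \<noteq> k" by (rule three_indices)
    have "axis i (1::'a) \<noteq> t *s axis j 1" for t
      using j by (auto simp: vec_eq_iff axis_def dest: spec[of _ i])
    then obtain \<alpha> \<beta> where "T *v axis i 1 = \<alpha> *s axis i 1 + \<beta> *s axis j 1"
      using plane[of "axis j 1" "axis i 1"] by (auto simp: vax)
    from arg_cong[OF this, of "\<lambda>v. v $ k"] show ?thesis
      using that j by (simp add: Tax) (simp add: axis_def)
  qed
  have diag: "T $ i $ i = T $ j $ j" for i j
  proof (cases "i = j")
    case False
    obtain k where k: "k \<noteq> i" "k \<noteq> j" by (rule three_indices)
    have "axis i (1::'a) + axis j 1 \<noteq> t *s axis k 1" for t
    proof
      assume "axis i (1::'a) + axis j 1 = t *s axis k 1"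
      from arg_cong[OF this, of "\<lambda>v. v $ i"] show False using k False by (simp add: axis_def)
    qed
    then obtain \<alpha> \<beta> where "T *v (axis i 1 + axis j 1) = \<alpha> *s (axis i 1 + axis j 1) + \<beta> *s axis k 1"
      using plane[of "axis k 1" "axis i 1 + axis j 1"] by (auto simp: vax vec_ac_simps)
    then have *: "(T *v axis i 1) $ m + (T *v axis j 1) $ m = \<alpha> * (axis i 1 $ m + axis j 1 $ m) + \<beta> * axis k 1 $ m" for m
      by (simp add: matrix_vector_right_distrib vec_eq_iff)
    have "T $ i $ i = \<alpha>" using *[of i] k False off[of i j] by (simp add: Tax) (simp add: axis_def)
    moreover have "T $ j $ j = \<alpha>" using *[of j] k False off[of j i] by (simp add: Tax) (simp add: axis_def)
    ultimately show ?thesis by simp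
  qed simp
  define t where "t = T $ i0 $ i0"
  have T: "T *v z = t *s z" for z
  proof -
    have "(T *v z) $ i = (\<Sum>j\<in>UNIV. if j = i then t * z $ i else 0)" for i
      unfolding matrix_vector_mult_def vec_lambda_beta
      by (rule sum.cong[OF refl]) (use off diag[of i i0] in \<open>auto simp: t_def\<close>)
    then show ?thesis by (simp add: vec_eq_iff)
  qed
  have A'T: "mat_ac A' *v z = t *s (A *v z)" for z
  proof -
    have "mat_ac A' *v z = A *v (T *v z)"
      by (simp add: T_def matrix_vector_mul_assoc matrix_mul_assoc Ai')
    then show ?thesis by (simp add: T vec.scale)
  qed
  have "t \<noteq> 0"
  proof
    assume "t = 0"
    then have "(mat_ac A' *v axis i0 1) $ j0 = 0" by (simp add: A'T)
    then show False using l(3) by (simp add: matrix_mult_axis_component mat_ac_def A'_def)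
  qed
  define v1 :: "'a ^ 'n" where "v1 = axis i0 1"
  have v1: "v1 \<noteq> 0" by (simp add: v1_def)
  have simA': "ac.qf (mat_ac A' *v z) = t^2 * c * ac.qf z" for z
    by (simp add: A'T ac.qf_scale sim)
  \<comment> \<open>A value at one rational vector shows that the multiplier, known over the
    closure, lies in the ground field.\<close>
  define c' where "c' = K.qf (A' *v v1) / K.qf v1"
  have "to_ac (K.qf (A' *v v)) = t^2 * c * to_ac (K.qf v)" for v
    using simA'[of "vec_ac v"] by (simp add: vec_ac_simps qf_vec_ac)
  note simK = this
  have c': "to_ac c' = t^2 * c" using qf_nz[OF v1] by (simp add: c'_def simK)
  have "to_ac (K.qf (A' *v v)) = to_ac (c' * K.qf v)" for v by (simp add: simK c')
  then have "K.qf (A' *v v) = c' * K.qf v" for v using to_ac_eq_iff by blast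
  moreover have "c' \<noteq> 0"
  proof
    assume "c' = 0"
    then show False using c' c \<open>t \<noteq> 0\<close> by simp
  qed
  moreover have "\<phi> (proj_point z) = proj_point (mat_ac A' *v z)" if "z \<noteq> 0" "ac.qf z = 0" for z
    using A[OF that] \<open>t \<noteq> 0\<close> by (simp add: A'T proj_point_scale)
  ultimately show ?thesis by blast
qed

end

section \<open>Roots of unity and square roots\<close>

lemma dvd_prod_linear_factors:
  fixes p :: "'a::field poly"
  shows "p dvd (\<Prod>a\<in>#S. [:- a, 1:]) \<Longrightarrow> degree p > 0 \<Longrightarrow> \<exists>a. poly p a = 0"
proof (induction S)
  case empty
  then show ?case by (metis dvd_refl image_mset_empty is_unit_iff_degree not_gr_zero not_one_less_zero one_neq_zero prod_mset_empty dvd_0_left_iff zero_neq_one)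
next
  case (add a S)
  show ?case
  proof (cases "poly p a = 0")
    case False
    obtain r where r: "[:- a, 1:] * (\<Prod>a\<in>#S. [:- a, 1:]) = p * r" using add.prems(1) by (auto elim: dvdE)
    have "poly (p * r) a = 0" unfolding r[symmetric] by simp
    then have "poly r a = 0" using False by simp
    then obtain r' where "r = [:- a, 1:] * r'" by (metis dvdE poly_eq_0_iff_dvd)
    then have "[:- a, 1:] * (\<Prod>a\<in>#S. [:- a, 1:]) = [:- a, 1:] * (p * r')" unfolding r by (simp only: mult_ac)
    then have "(\<Prod>a\<in>#S. [:- a, 1:]) = p * r'" by (subst (asm) mult_left_cancel) auto
    then show ?thesis using add by simp
  qed blast
qed

lemma sqrt_minus_one_exists:
  assumes "contains_all_roots_of_unity TYPE('a::field)"
  shows "\<exists>i::'a. i^2 = -1"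
proof -
  obtain S :: "'a multiset" where S: "Polynomial.monom 1 4 - 1 = (\<Prod>a\<in>#S. [:- a, 1:])"
    using assms unfolding contains_all_roots_of_unity_def by (metis zero_less_numeral)
  have "Polynomial.monom (1::'a) 4 - 1 = [:1, 0, 1:] * [:-1, 0, 1:]"
    by (simp add: monom_altdef power4_eq_xxxx one_pCons)
  then have "[:1, 0, 1::'a:] dvd (\<Prod>a\<in>#S. [:- a, 1:])" using S by (metis dvd_triv_left)
  then obtain i :: 'a where "poly [:1, 0, 1:] i = 0" using dvd_prod_linear_factors by fastforce
  then show ?thesis by (intro exI[of _ i]) (simp add: power2_eq_square eq_neg_iff_add_eq_0 add.commute)
qed

definition subfield_set :: "'k::field set \<Rightarrow> bool" where
  "subfield_set F \<longleftrightarrow> 1 \<in> F \<and> (\<forall>x\<in>F. \<forall>y\<in>F. x - y \<in> F \<and> x * y \<in> F) \<and> (\<forall>x\<in>F. inverse x \<in> F)"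

lemma subfield_setD:
  assumes "subfield_set F"
  shows "1 \<in> F" "0 \<in> F" "x \<in> F \<Longrightarrow> y \<in> F \<Longrightarrow> x - y \<in> F" "x \<in> F \<Longrightarrow> y \<in> F \<Longrightarrow> x * y \<in> F"
    "x \<in> F \<Longrightarrow> y \<in> F \<Longrightarrow> x + y \<in> F" "x \<in> F \<Longrightarrow> - x \<in> F" "x \<in> F \<Longrightarrow> y \<in> F \<Longrightarrow> x / y \<in> F"
proof -
  show 1: "1 \<in> F" and d: "x \<in> F \<Longrightarrow> y \<in> F \<Longrightarrow> x - y \<in> F" for x y
    using assms by (auto simp: subfield_set_def)
  show m: "x \<in> F \<Longrightarrow> y \<in> F \<Longrightarrow> x * y \<in> F" using assms by (auto simp: subfield_set_def)
  show 0: "0 \<in> F" using d[OF 1 1] by simp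
  show n: "- x \<in> F" if "x \<in> F" for x using d[OF 0 that] by simp
  show "x \<in> F \<Longrightarrow> y \<in> F \<Longrightarrow> x + y \<in> F" using d[of x "- y"] n[of y] by simp
  show "x \<in> F \<Longrightarrow> y \<in> F \<Longrightarrow> x / y \<in> F"
    using assms unfolding subfield_set_def divide_inverse by blast
qed

lemma subfield_set_adjoin_sqrt:
  assumes F: "subfield_set F" and w: "w^2 \<in> F" "w \<notin> F"
  shows "subfield_set {x + y * w | x y. x \<in> F \<and> y \<in> F}" (is "subfield_set ?E")
proof -
  note D = subfield_setD[OF F]
  have "inverse (x + y * w) \<in> ?E" if x: "x \<in> F" "y \<in> F" for x y
  proof (cases "x + y * w = 0")
    case True
    then show ?thesis using D(2) by (auto intro!: exI[of _ 0])
  next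
    case False
    have "x - y * w \<noteq> 0"
    proof
      assume 0: "x - y * w = 0"
      then have "y = 0" using w(2) D(7)[OF x] by (metis eq_iff_diff_eq_0 nonzero_mult_div_cancel_left)
      then show False using 0 False by simp
    qed
    define N where "N = x * x - y * y * w^2"
    have "N = (x + y * w) * (x - y * w)" by (simp add: N_def algebra_simps power2_eq_square)
    then have "inverse (x + y * w) = (x - y * w) / N"
      using False \<open>x - y * w \<noteq> 0\<close> by (simp add: divide_inverse)
    then have "inverse (x + y * w) = x / N + (- y / N) * w" by (simp add: diff_divide_distrib)
    moreover have "N \<in> F" unfolding N_def by (intro D(3,4) x w(1))
    then have "x / N \<in> F" "- y / N \<in> F" by (auto intro!: D(6,7) x)
    ultimately show ?thesis by blast
  qed
  note inv = this
  have mem: "x + y * w \<in> ?E" if "x \<in> F" "y \<in> F" for x y using that by blast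
  show ?thesis
    unfolding subfield_set_def
  proof (intro conjI ballI)
    show "1 \<in> ?E" using mem[OF D(1,2)] by simp
    fix a assume "a \<in> ?E"
    then obtain x y where a: "a = x + y * w" "x \<in> F" "y \<in> F" by blast
    show "inverse a \<in> ?E" unfolding a(1) by (rule inv[OF a(2,3)])
    fix b assume "b \<in> ?E"
    then obtain x' y' where b: "b = x' + y' * w" "x' \<in> F" "y' \<in> F" by blast
    have "a - b = (x - x') + (y - y') * w" unfolding a b by (simp add: algebra_simps)
    then show "a - b \<in> ?E" using mem[OF D(3)[OF a(2) b(2)] D(3)[OF a(3) b(3)]] by simp
    have "a * b = (x * x' + y * y' * w^2) + (x * y' + y * x') * w"
      unfolding a b by (simp add: algebra_simps power2_eq_square)
    moreover have "x * x' + y * y' * w^2 \<in> F" "x * y' + y * x' \<in> F"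
      using a b w(1) by (auto intro!: D(4,5))
    ultimately show "a * b \<in> ?E" using mem by simp
  qed
qed

text \<open>Square roots of elements in distinct square classes are linearly independent. The ratio
  \<open>w\<close> of two of them is adjoined to \<open>F\<close>. An element of the larger field
  with square in \<open>F\<close> lies in \<open>F\<close> or in \<open>w\<close> times
  \<open>F\<close>, so at most two members merge into a class and their combined coefficient is
  nonzero.\<close>

lemma sqrt_independent:
  fixes U :: "'k::field set"
  assumes "finite U" "subfield_set F" "(2::'k) \<noteq> 0"
    "\<And>u. u \<in> U \<Longrightarrow> u \<noteq> 0 \<and> u^2 \<in> F" "\<And>u v. u \<in> U \<Longrightarrow> v \<in> U \<Longrightarrow> u \<noteq> v \<Longrightarrow> u / v \<notin> F"
    "\<And>u. u \<in> U \<Longrightarrow> x u \<in> F \<and> x u \<noteq> 0" "(\<Sum>u\<in>U. x u * u) = 0"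
  shows "U = {}"
  using assms
proof (induction "card U" arbitrary: U F x rule: less_induct)
  case less
  note F = subfield_setD[OF less.prems(2)] and fin = less.prems(1)
  note U = less.prems(4) and ratio = less.prems(5) and xF = less.prems(6) and sum0 = less.prems(7)
  show ?case
  proof (rule ccontr)
    assume "U \<noteq> {}"
    then obtain u0 where u0: "u0 \<in> U" by blast
    have "U \<noteq> {u0}" using sum0 xF[OF u0] U[OF u0] by auto
    then obtain u1 where u1: "u1 \<in> U" "u1 \<noteq> u0" using u0 by blast
    define w where "w = u1 / u0"
    have w: "w \<notin> F" using ratio[OF u1(1) u0 u1(2)] by (simp add: w_def)
    have w2: "w^2 \<in> F" using U[OF u0] U[OF u1(1)] F(7) by (simp add: w_def power_divide)
    define E where "E = {x + y * w | x y. x \<in> F \<and> y \<in> F}"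
    have E: "subfield_set E" unfolding E_def by (rule subfield_set_adjoin_sqrt[OF less.prems(2) w2 w])
    note E' = subfield_setD[OF E]
    have FE: "x \<in> F \<Longrightarrow> x \<in> E" for x using F(2) by (force simp: E_def)
    have wE: "w \<in> E" using F(1,2) by (force simp: E_def)
    \<comment> \<open>The cross term \<open>2 * a * b\<close> vanishes, since otherwise
      \<open>w\<close> would lie in \<open>F\<close>.\<close>
    have sq: "z \<in> F \<or> (\<exists>y\<in>F. z = y * w)" if "z \<in> E" "z^2 \<in> F" for z
    proof -
      obtain a b where ab: "a \<in> F" "b \<in> F" "z = a + b * w" using \<open>z \<in> E\<close> by (auto simp: E_def)
      have "z^2 = (a * a + b * b * w^2) + (2 * a * b) * w" unfolding ab by (simp add: algebra_simps power2_eq_square)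
      then have *: "(2 * a * b) * w = z^2 - (a * a + b * b * w^2)" by simp
      have "2 * a * b = 0"
      proof (rule ccontr)
        assume nz: "2 * a * b \<noteq> 0"
        have "w = (z^2 - (a * a + b * b * w^2)) / (2 * a * b)" using * nz by (simp add: field_simps)
        also have "\<dots> \<in> F"
        proof -
          have "2 \<in> F" using F(5)[OF F(1) F(1)] by simp
          then show ?thesis by (intro F(3,4,5,7) that(2) ab w2)
        qed
        finally show False using w by blast
      qed
      then show ?thesis using less.prems(3) ab by auto
    qed
    text \<open>Choosing one representative of each class modulo the larger field merges at least
      \<open>u0\<close> and \<open>u1\<close>, and no coefficient vanishes.\<close>
    define r where "r = (\<lambda>u. SOME v. v \<in> U \<and> u / v \<in> E)"
    have r: "r u \<in> U \<and> u / r u \<in> E" if "u \<in> U" for u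
      unfolding r_def by (rule someI[of _ u]) (use that U E'(1) in auto)
    have req: "r u = r v" if "u \<in> U" "v \<in> U" "u / v \<in> E" for u v
    proof -
      have "u / t \<in> E \<longleftrightarrow> v / t \<in> E" if t: "t \<in> U" for t
      proof -
        have 1: "u / t = (u / v) * (v / t)" and 2: "v / t = (u / t) / (u / v)"
          using U[OF t] U[OF \<open>u \<in> U\<close>] U[OF \<open>v \<in> U\<close>] by auto
        show ?thesis
        proof
          show "v / t \<in> E" if "u / t \<in> E" unfolding 2 by (rule E'(7)[OF that \<open>u / v \<in> E\<close>])
          show "u / t \<in> E" if "v / t \<in> E" unfolding 1 by (rule E'(4)[OF \<open>u / v \<in> E\<close> that])
        qed
      qed
      then have "(\<lambda>t. t \<in> U \<and> u / t \<in> E) = (\<lambda>t. t \<in> U \<and> v / t \<in> E)" by blast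
      then show ?thesis by (simp add: r_def)
    qed
    define V where "V = r ` U"
    have VU: "V \<subseteq> U" using r by (auto simp: V_def)
    have finV: "finite V" using fin by (simp add: V_def)
    have rV: "r v = v" if v: "v \<in> V" for v
    proof -
      obtain u where u: "u \<in> U" "v = r u" using v by (auto simp: V_def)
      then show ?thesis using req[of u v] r[of u] by auto
    qed
    have "\<not> inj_on r U"
    proof
      assume "inj_on r U"
      moreover have "r u1 = r u0" by (rule req[OF u1(1) u0]) (use wE in \<open>simp add: w_def\<close>)
      ultimately show False using u0 u1 by (meson inj_onD)
    qed
    then have cV: "card V < card U" using fin unfolding V_def by (metis card_image_le eq_card_imp_inj_on le_neq_implies_less)
    define y where "y = (\<lambda>v. (\<Sum>u\<in>{u\<in>U. r u = v}. x u * u) / v)"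
    have "V = {}"
    proof (rule less.hyps[OF cV finV E less.prems(3)])
      show "u \<noteq> 0 \<and> u^2 \<in> E" if "u \<in> V" for u using U VU that FE by blast
      show "u / v \<notin> E" if "u \<in> V" "v \<in> V" "u \<noteq> v" for u v
        using req[of u v] rV that VU by (metis subsetD)
      show "y v \<in> E \<and> y v \<noteq> 0" if v: "v \<in> V" for v
      proof -
        have vU: "v \<in> U" and vnz: "v \<noteq> 0" and v2: "v^2 \<in> F" using v VU U by blast+
        have mem: "u / v \<in> E" "u^2 \<in> F" if "u \<in> U" "r u = v" for u using r[OF that(1)] U[OF that(1)] that(2) by auto
        have two_cls: "u = v \<or> (\<exists>t\<in>F. t \<noteq> 0 \<and> u = t * w * v)" if u: "u \<in> U" "r u = v" for u
        proof -
          have "(u / v)^2 \<in> F" using mem[OF u] v2 F(7) by (simp add: power_divide)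
          then consider "u / v \<in> F" | t where "t \<in> F" "u / v = t * w" using sq mem[OF u] by blast
          then show ?thesis
          proof cases
            case 1
            then show ?thesis using ratio[OF u(1) vU] by blast
          next
            case 2
            then show ?thesis using vnz U[OF u(1)] by (intro disjI2 bexI[of _ t]) (auto simp: field_simps)
          qed
        qed
        let ?C = "{u\<in>U. r u = v}"
        have vC: "v \<in> ?C" using vU rV[OF v] by simp
        show ?thesis
        proof (cases "?C = {v}")
          case True
          then show ?thesis using xF[OF vU] FE vnz by (simp add: y_def)
        next
          case False
          then obtain u where u: "u \<in> ?C" "u \<noteq> v" using vC by blast
          then obtain t where t: "t \<in> F" "t \<noteq> 0" "u = t * w * v" using two_cls by blast
          have "u' = u" if u': "u' \<in> ?C" "u' \<noteq> v" for u'
          proof (rule ccontr)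
            assume ne: "u' \<noteq> u"
            obtain t' where t': "t' \<in> F" "t' \<noteq> 0" "u' = t' * w * v" using two_cls u' by blast
            have wnz: "w \<noteq> 0" using w F(2) by auto
            have "u' / u = t' / t" using t t' vnz wnz by simp
            then show False using ratio[of u' u] ne u u' F(7)[OF t'(1) t(1)] by auto
          qed
          then have C: "?C = {v, u}" using vC u by blast
          have yv: "y v = x v + (x u * t) * w"
            unfolding y_def C using u vnz by (simp add: t(3) field_simps)
          have xu: "x u * t \<in> F" "x u * t \<noteq> 0" using xF[of u] u t F(4) by auto
          have "y v \<noteq> 0"
          proof
            assume "y v = 0"
            then have "w = - x v / (x u * t)" using yv xu(2) by (simp add: field_simps eq_neg_iff_add_eq_0 add.commute)
            then show False using w F(7)[OF F(6) xu(1)] xF[OF vU] by auto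
          qed
          moreover have "y v \<in> E" unfolding yv E_def using xF[OF vU] xu by blast
          ultimately show ?thesis by blast
        qed
      qed
      have "(\<Sum>v\<in>V. y v * v) = (\<Sum>v\<in>V. \<Sum>u\<in>{u\<in>U. r u = v}. x u * u)"
        by (rule sum.cong) (use VU U in \<open>auto simp: y_def\<close>)
      also have "\<dots> = (\<Sum>u\<in>U. x u * u)"
        unfolding V_def by (rule sum.image_gen[symmetric, OF fin])
      finally show "(\<Sum>v\<in>V. y v * v) = 0" using sum0 by simp
    qed
    then show False using u0 by (simp add: V_def)
  qed
qed

section \<open>Torsion in the orthogonal group of an anisotropic form\<close>

locale anisotropic_form = quad_form M for M :: "'a::field ^ 'n ^ 'n" +
  assumes aniso: "v \<noteq> 0 \<Longrightarrow> qf v \<noteq> 0"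
    and roots: "contains_all_roots_of_unity TYPE('a)"
begin

lemma similitude_bf:
  assumes add: "\<And>v w. T (v + w) = T v + T w" and sim: "\<And>v. qf (T v) = c * qf v"
  shows "bf (T v) (T w) = c * bf v w"
proof -
  have "qf (T (v + w)) = c * qf (v + w)" by (rule sim)
  then have "2 * bf (T v) (T w) = 2 * (c * bf v w)"
    unfolding add qf_add sim by (simp add: algebra_simps)
  then show ?thesis by (simp only: mult_left_cancel[OF two])
qed

text \<open>The polynomial \<open>X^m - 1\<close> splits, with repeated roots if the characteristic
  divides \<open>m\<close>, and its linear factors are removed one at a time. By induction
  \<open>T (T v) - v\<close> is an eigenvector, so its eigenvalue is \<open>1\<close> or
  \<open>- 1\<close> by anisotropy. If it were nonzero, it would be an isotropic vector at the
  bottom of a Jordan chain.\<close>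

lemma orthogonal_torsion:
  fixes T :: "'a ^ 'n \<Rightarrow> 'a ^ 'n"
  assumes add: "\<And>v w. T (v + w) = T v + T w" and scale: "\<And>a v. T (a *s v) = a *s T v"
    and orth: "\<And>v. qf (T v) = qf v" and m: "m > 0" "\<And>v. (T ^^ m) v = v"
  shows "T (T v) = v"
proof -
  define op where "op = (\<lambda>(p :: 'a poly) v. \<Sum>i\<le>degree p. coeff p i *s (T ^^ i) v)"
  have opN: "op p v = (\<Sum>i\<le>N. coeff p i *s (T ^^ i) v)" if "degree p \<le> N" for p N v
    unfolding op_def by (rule sum.mono_neutral_left) (use that in \<open>auto simp: coeff_eq_0\<close>)
  have T_diff: "T (v - w) = T v - T w" for v w
    using add[of v "(-1) *s w"] scale[of "-1" w] by simp
  have pow_lin: "(T ^^ i) (v - a *s w) = (T ^^ i) v - a *s (T ^^ i) w" for i v w a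
    by (induction i) (auto simp: T_diff scale)
  have op_factor: "op ([:- a, 1:] * p) v = op p (T v - a *s v)" for a p v
  proof -
    let ?N = "Suc (degree p)"
    have "degree ([:- a, 1:] * p) \<le> ?N" using degree_mult_le[of "[:- a, 1:]" p] by simp
    then have "op ([:- a, 1:] * p) v = (\<Sum>i\<le>?N. coeff ([:- a, 1:] * p) i *s (T ^^ i) v)" by (rule opN)
    also have "\<dots> = (\<Sum>i\<le>?N. coeff (pCons 0 p) i *s (T ^^ i) v) - (\<Sum>i\<le>?N. (a * coeff p i) *s (T ^^ i) v)"
      unfolding sum_subtractf[symmetric] by (intro sum.cong) (auto simp: vec_eq_iff algebra_simps)
    also have "(\<Sum>i\<le>?N. coeff (pCons 0 p) i *s (T ^^ i) v) = op p (T v)"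
      unfolding sum.atMost_Suc_shift op_def by (simp add: funpow_swap1)
    also have "(\<Sum>i\<le>?N. (a * coeff p i) *s (T ^^ i) v) = a *s op p v"
      by (subst opN[of p ?N]) (simp_all only: vec.scale_sum_right vector_smult_assoc le_SucI order_refl)
    also have "op p (T v) - a *s op p v = op p (T v - a *s v)"
      unfolding op_def
      by (simp add: pow_lin vec.scale_sum_right sum_subtractf[symmetric])
         (simp add: vec_eq_iff algebra_simps)
    finally show ?thesis .
  qed
  have bT: "bf (T v) (T w) = bf v w" for v w
    using similitude_bf[of T 1] add orth by simp
  have key: "T (T v) = v" if "op (\<Prod>a\<in>#S. [:- a, 1:]) v = 0" for S v
    using that
  proof (induction S arbitrary: v)
    case empty
    then have "v = 0" by (simp add: op_def)
    then show ?case using scale[of 0 0] by simp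
  next
    case (add a S)
    define y where "y = T (T v) - v"
    have "T (T (T v - a *s v)) = T v - a *s v"
      by (rule add.IH) (use add.prems in \<open>simp add: op_factor del: mult_pCons_left\<close>)
    then have Ty: "T y = a *s y" by (simp add: y_def T_diff scale vec_eq_iff algebra_simps)
    have "y = 0"
    proof (rule ccontr)
      assume "y \<noteq> 0"
      then have qy: "qf y \<noteq> 0" by (rule aniso)
      have "a^2 * qf y = qf y" using orth[of y] by (simp add: Ty qf_scale)
      then have "a^2 = 1" using qy by simp
      then consider "a = 1" | "a = -1" by (metis power2_eq_1_iff)
      then show False
      proof cases
        \<comment> \<open>\<open>y\<close> is fixed by the isometry \<open>T\<close> and lies in the
          image of \<open>T - 1\<close>, and these two spaces are orthogonal. The other sign is the
          same with \<open>T + 1\<close>.\<close>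
        case 1
        define s where "s = T v + v"
        have "T s = s + y" by (simp add: s_def y_def \<open>\<And>v w. T (v + w) = T v + T w\<close>)
        then have "bf s y = bf (s + y) y" using bT[of s y] by (simp add: Ty 1)
        then show False using qy by (simp add: bf_lin qf_def)
      next
        case 2
        define s where "s = T v - v"
        have "T s = y - s" by (simp add: s_def y_def T_diff)
        then have "bf s y = bf (y - s) ((-1) *s y)" using bT[of s y] by (simp add: Ty 2)
        then show False using qy by (simp add: bf_lin qf_def)
      qed
    qed
    then show ?case by (simp add: y_def)
  qed
  obtain S :: "'a multiset" where S: "Polynomial.monom 1 m - 1 = (\<Prod>a\<in>#S. [:- a, 1:])"
    using roots m(1) unfolding contains_all_roots_of_unity_def by blast
  have "degree (Polynomial.monom (1::'a) m - 1) \<le> m"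
    by (rule degree_diff_le) (auto simp: degree_monom_le)
  then have "op (Polynomial.monom 1 m - 1) v = (\<Sum>i\<le>m. coeff (Polynomial.monom 1 m - 1) i *s (T ^^ i) v)"
    by (rule opN)
  also have "\<dots> = (\<Sum>i\<le>m. (if i = m then (T ^^ m) v else 0) - (if i = 0 then v else 0))"
    using m(1) by (intro sum.cong) (auto simp: vec_eq_iff)
  also have "\<dots> = 0" using m(2) by (simp add: sum_subtractf)
  finally show ?thesis using key[of S v] S by simp
qed

end

section \<open>Projective groups of similitudes\<close>

text \<open>Members of one fibre differ from its chosen representative by an element of
  \<open>E\<close>.\<close>

lemma (in group) card_le_fibres:
  assumes H: "subgroup H G" "finite H" and f: "\<And>x y. x \<in> D \<Longrightarrow> y \<in> D \<Longrightarrow> f x = f y \<Longrightarrow> inv x \<otimes> y \<in> E"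
    and D: "D \<subseteq> H" and E: "finite E"
  shows "card D \<le> card (f ` D) * card E"
proof -
  have finD: "finite D" using D H(2) by (rule finite_subset)
  define r where "r = (\<lambda>y. SOME x. x \<in> D \<and> f x = y)"
  have r: "r (f x) \<in> D \<and> f (r (f x)) = f x" if "x \<in> D" for x
    unfolding r_def by (rule someI[of _ x]) (use that in simp)
  have carr: "x \<in> carrier G" if "x \<in> D" for x using that D subgroup.subset[OF H(1)] by blast
  let ?g = "\<lambda>x. (f x, inv (r (f x)) \<otimes> x)"
  have "inj_on ?g D"
  proof (rule inj_onI)
    fix x y assume xy: "x \<in> D" "y \<in> D" "?g x = ?g y"
    then have e: "f x = f y" "inv (r (f x)) \<otimes> x = inv (r (f y)) \<otimes> y" by auto
    then have "inv (r (f x)) \<otimes> x = inv (r (f x)) \<otimes> y" by (simp only: e(1)[symmetric])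
    then show "x = y" using r[OF xy(1)] carr xy(1,2) by (simp add: l_cancel)
  qed
  moreover have "?g ` D \<subseteq> f ` D \<times> E" using r f by auto
  ultimately have "card D \<le> card (f ` D \<times> E)"
    using finD E by (intro card_inj_on_le[of ?g]) auto
  then show ?thesis by (simp add: card_cartesian_product)
qed

text \<open>A faithful projective representation by similitudes: the matrices are chosen lifts,
  multiplicative up to scalars only, and the identity alone acts as a scalar. Hence multipliers are
  multiplicative up to squares.\<close>

locale similitude_group = anisotropic_form M + group G
  for M :: "'a::field ^ 'n ^ 'n" and G :: "('g, 'm) monoid_scheme" (structure) +
  fixes A :: "'g \<Rightarrow> 'a ^ 'n ^ 'n" and c :: "'g \<Rightarrow> 'a"
  assumes c_nz: "x \<in> carrier G \<Longrightarrow> c x \<noteq> 0"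
    and sim: "x \<in> carrier G \<Longrightarrow> qf (A x *v v) = c x * qf v"
    and mult: "x \<in> carrier G \<Longrightarrow> y \<in> carrier G \<Longrightarrow>
      \<exists>k. k \<noteq> 0 \<and> (\<forall>v. A (x \<otimes> y) *v v = k *s (A x *v (A y *v v)))"
    and kernel: "x \<in> carrier G \<Longrightarrow> (\<And>v. A x *v v = k *s v) \<Longrightarrow> x = \<one>"
begin

lemmas act_lin = matrix_vector_right_distrib vec.scale matrix_vector_mult_diff_distrib

lemma act_inj: "x \<in> carrier G \<Longrightarrow> v \<noteq> 0 \<Longrightarrow> A x *v v \<noteq> 0"
  using sim[of x v] aniso[of v] c_nz[of x] by auto

lemma act_cancel: "x \<in> carrier G \<Longrightarrow> A x *v v = A x *v w \<Longrightarrow> v = w"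
  using act_inj[of x "v - w"] by (auto simp: act_lin)

lemma one_scalar: "\<exists>k. k \<noteq> 0 \<and> (\<forall>v. A \<one> *v v = k *s v)"
proof -
  obtain k where k: "k \<noteq> 0" "\<And>v. A (\<one> \<otimes> \<one>) *v v = k *s (A \<one> *v (A \<one> *v v))"
    using mult[of \<one> \<one>] by auto
  have "A \<one> *v v = (1 / k) *s v" for v
  proof (rule act_cancel[of \<one>])
    have "A \<one> *v ((1 / k) *s v) = (1 / k) *s (k *s (A \<one> *v (A \<one> *v v)))"
      using k(2)[of v] by (simp add: act_lin)
    then show "A \<one> *v (A \<one> *v v) = A \<one> *v ((1 / k) *s v)"
      using k(1) by (simp add: vector_smult_assoc)
  qed simp
  then show ?thesis using k(1) by (intro exI[of _ "1 / k"]) simp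
qed

lemma inv_act:
  assumes "x \<in> carrier G" shows "\<exists>k. k \<noteq> 0 \<and> (\<forall>v. A (inv x) *v (A x *v v) = k *s v)"
proof -
  obtain k where k: "k \<noteq> 0" "\<And>v. A (inv x \<otimes> x) *v v = k *s (A (inv x) *v (A x *v v))"
    using mult[of "inv x" x] assms by auto
  obtain k1 where k1: "k1 \<noteq> 0" "\<And>v. A \<one> *v v = k1 *s v" using one_scalar by blast
  have "A (inv x) *v (A x *v v) = (k1 / k) *s v" for v
    using k(2)[of v] k1(2)[of v] k(1) assms by (simp add: vec_eq_iff field_simps)
  then show ?thesis using k(1) k1(1) by (intro exI[of _ "k1 / k"]) simp
qed

lemma proj_inj:
  assumes x: "x \<in> carrier G" "y \<in> carrier G" and k: "\<And>v. A y *v v = k *s (A x *v v)"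
  shows "x = y"
proof -
  obtain k1 where k1: "\<And>v. A (inv x \<otimes> y) *v v = k1 *s (A (inv x) *v (A y *v v))"
    using mult[of "inv x" y] x by auto
  obtain k2 where k2: "\<And>v. A (inv x) *v (A x *v v) = k2 *s v" using inv_act[OF x(1)] by blast
  have "inv x \<otimes> y = \<one>"
    by (rule kernel[where k = "k1 * (k * k2)"]) (use x in \<open>auto simp: k1 k act_lin k2 vector_smult_assoc\<close>)
  then show ?thesis using x by (metis inv_equality inv_inv inv_closed)
qed

lemma exists_nonzero: "\<exists>v :: 'a ^ 'n. v \<noteq> 0"
  by (rule exI[of _ "axis undefined 1"]) simp

lemma c_mult:
  assumes "x \<in> carrier G" "y \<in> carrier G" and k: "\<And>v. A (x \<otimes> y) *v v = k *s (A x *v (A y *v v))"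
  shows "c (x \<otimes> y) = k^2 * c x * c y"
proof -
  obtain v :: "'a ^ 'n" where v: "v \<noteq> 0" using exists_nonzero by blast
  have "c (x \<otimes> y) * qf v = k^2 * c x * c y * qf v"
    using sim[of "x \<otimes> y" v] assms(1,2) by (auto simp add: k qf_scale sim mult.assoc)
  then show ?thesis using aniso[OF v] by auto
qed

lemma pow_act: "x \<in> carrier G \<Longrightarrow> \<exists>k. k \<noteq> 0 \<and> (\<forall>v. A (x [^] (m::nat)) *v v = k *s (((*v) (A x) ^^ m) v))"
proof (induction m)
  case 0
  then show ?case using one_scalar by simp
next
  case (Suc m)
  then obtain k where k: "k \<noteq> 0" "\<And>v. A (x [^] m) *v v = k *s (((*v) (A x) ^^ m) v)" by blast
  obtain k1 where k1: "k1 \<noteq> 0" "\<And>v. A (x [^] m \<otimes> x) *v v = k1 *s (A (x [^] m) *v (A x *v v))"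
    using mult[of "x [^] m" x] Suc.prems by auto
  show ?case
    by (rule exI[of _ "k1 * k"])
       (use k k1 in \<open>auto simp: vector_smult_assoc funpow_swap1\<close>)
qed

text \<open>Division by \<open>\<kappa>\<close> gives an isometry \<open>T\<close>. Its
  \<open>m\<close>-th power is a scalar with square 1, so the \<open>2 * m\<close>-th power is the
  identity and \<open>orthogonal_torsion\<close> applies.\<close>

lemma act_square_scalar:
  assumes x: "x \<in> carrier G" and m: "m > 0" "x [^] (m::nat) = \<one>" and \<kappa>: "\<kappa>^2 = c x"
  shows "A x *v (A x *v v) = c x *s v"
proof -
  have \<kappa>0: "\<kappa> \<noteq> 0" using \<kappa> c_nz[OF x] by auto
  define T where "T = (\<lambda>v. (1 / \<kappa>) *s (A x *v v))"
  have T_add: "T (v + w) = T v + T w" and T_scale: "T (a *s v) = a *s T v" for v w a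
    by (simp_all add: T_def act_lin vec_eq_iff algebra_simps)
  have orth: "qf (T v) = qf v" for v
    using \<kappa>0 by (simp add: T_def qf_scale sim[OF x] \<kappa>[symmetric] power_divide)
  have Tpow: "(T ^^ i) v = (1 / \<kappa>) ^ i *s (((*v) (A x) ^^ i) v)" for i v
    by (induction i) (auto simp: T_def act_lin vector_smult_assoc mult.commute)
  obtain k where k: "k \<noteq> 0" "\<And>v. A (x [^] m) *v v = k *s (((*v) (A x) ^^ m) v)"
    using pow_act[OF x] by blast
  obtain k1 where k1: "\<And>v. A \<one> *v v = k1 *s v" using one_scalar by blast
  define \<mu> where "\<mu> = (1 / \<kappa>) ^ m * (k1 / k)"
  have "((*v) (A x) ^^ m) v = (k1 / k) *s v" for v
    using k(2)[of v] k(1) unfolding m(2) k1 by (simp add: vec_eq_iff field_simps)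
  then have T\<mu>: "(T ^^ m) v = \<mu> *s v" for v by (simp add: Tpow \<mu>_def vector_smult_assoc)
  have orth_pow: "qf ((T ^^ i) v) = qf v" for i v by (induction i) (auto simp: orth)
  obtain v0 :: "'a ^ 'n" where v0: "v0 \<noteq> 0" using exists_nonzero by blast
  have "\<mu>^2 = 1" using orth_pow[of m v0] aniso[OF v0] by (simp add: T\<mu> qf_scale)
  then have "(T ^^ (m + m)) v = v" for v
    by (simp add: funpow_add T\<mu> vector_smult_assoc power2_eq_square)
  then have "T (T v) = v" using orthogonal_torsion[of T "m + m"] T_add T_scale orth m(1) by auto
  then have "(1 / \<kappa>) *s ((1 / \<kappa>) *s (A x *v (A x *v v))) = v" by (simp add: T_def act_lin)
  then have "c x *s v = c x *s ((1 / \<kappa> * (1 / \<kappa>)) *s (A x *v (A x *v v)))" by (simp add: vector_smult_assoc)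
  also have "\<dots> = A x *v (A x *v v)" using \<kappa>0 by (simp add: vector_smult_assoc \<kappa>[symmetric] power2_eq_square)
  finally show ?thesis by simp
qed

lemma involution_if_square:
  assumes x: "x \<in> carrier G" and m: "m > 0" "x [^] (m::nat) = \<one>" and \<kappa>: "\<kappa>^2 = c x"
  shows "x \<otimes> x = \<one>"
proof -
  obtain k where k: "\<And>v. A (x \<otimes> x) *v v = k *s (A x *v (A x *v v))" using mult[OF x x] by auto
  show ?thesis
    by (rule kernel[where k = "k * c x"])
       (use x act_square_scalar[OF assms] in \<open>auto simp: k vector_smult_assoc\<close>)
qed

text \<open>Whatever the multiplier of \<open>x\<close>, that of \<open>x \<otimes> x\<close> is the
  square of \<open>k * c x\<close>.\<close>

lemma torsion_exponent_4:
  assumes x: "x \<in> carrier G" and m: "m > 0" "x [^] (m::nat) = \<one>"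
  shows "x [^] (4::nat) = \<one>"
proof -
  obtain k where k: "\<And>v. A (x \<otimes> x) *v v = k *s (A x *v (A x *v v))" using mult[OF x x] by auto
  have "(k * c x)^2 = c (x \<otimes> x)" using c_mult[OF x x k] by (simp add: power2_eq_square)
  moreover have "(x \<otimes> x) [^] m = \<one>" using x m by (metis pow_mult_distrib r_one nat_pow_closed one_closed)
  ultimately have "(x \<otimes> x) \<otimes> (x \<otimes> x) = \<one>" using involution_if_square[of "x \<otimes> x" m] x m(1) by simp
  moreover have "x [^] (4::nat) = (x \<otimes> x) \<otimes> (x \<otimes> x)" using x by (simp add: numeral_eq_Suc m_assoc)
  ultimately show ?thesis by simp
qed

lemma ord_2_or_4:
  assumes x: "x \<in> carrier G" "x \<noteq> \<one>" "ord x > 0"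
  shows "ord x \<in> {2, 4}"
proof -
  have "x [^] (4::nat) = \<one>" using torsion_exponent_4[OF x(1,3)] x(1) by simp
  then have "ord x dvd 4" using pow_eq_id[OF x(1)] by simp
  then have "ord x \<le> 4" "ord x dvd 4" by (auto intro: dvd_imp_le)
  moreover have "ord x \<noteq> 1" using ord_eq_1[OF x(1)] x(2) by simp
  ultimately have "ord x = 2 \<or> ord x = 3 \<or> ord x = 4" using x(3) by linarith
  then show ?thesis using \<open>ord x dvd 4\<close> by auto
qed

text \<open>Taking determinants in the matrix identity for a similitude shows that
  \<open>c x ^ n\<close> is a square; for odd \<open>n\<close> so is \<open>c x\<close>.\<close>

lemma multiplier_square_odd:
  assumes n: "odd CARD('n)" and x: "x \<in> carrier G"
  shows "\<exists>\<kappa>. \<kappa>^2 = c x"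
proof -
  have bil: "bf (A x *v v) (A x *v w) = c x * bf v w" for v w
    by (rule similitude_bf) (auto simp: act_lin sim[OF x])
  have bf_axis: "bf (axis i 1) w = (M *v w) $ i" for i w
  proof -
    have "bf (axis i 1) w = (\<Sum>j\<in>UNIV. if j = i then (M *v w) $ i else 0)"
      unfolding bf_def by (rule sum.cong) (auto simp: axis_def)
    then show ?thesis by simp
  qed
  have bf_tr: "bf (B *v v) w = bf_d" if "bf_d = (\<Sum>i\<in>UNIV. v $ i * (transpose B *v (M *v w)) $ i)" for B v w bf_d
  proof -
    have "bf (B *v v) w = (\<Sum>j\<in>UNIV. \<Sum>i\<in>UNIV. (B $ j $ i * v $ i) * (M *v w) $ j)"
      unfolding bf_def matrix_vector_mult_def[of B] by (simp add: sum_distrib_right)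
    also have "\<dots> = (\<Sum>i\<in>UNIV. \<Sum>j\<in>UNIV. (B $ j $ i * v $ i) * (M *v w) $ j)" by (rule sum.swap)
    also have "\<dots> = bf_d" unfolding that matrix_vector_mult_def[of "transpose B"]
      by (intro sum.cong refl) (simp add: transpose_def sum_distrib_left mult_ac)
    finally show ?thesis .
  qed
  have "(transpose (A x) ** M ** A x) $ i $ j = (diagm (\<lambda>_. c x) ** M ** diagm (\<lambda>_. 1)) $ i $ j" for i j
  proof -
    have "(transpose (A x) ** M ** A x) $ i $ j = (transpose (A x) *v (M *v (A x *v axis j 1))) $ i"
      by (simp add: matrix_mult_axis_component[symmetric] matrix_vector_mul_assoc matrix_mul_assoc del: matrix_mult_axis_component)
    also have "\<dots> = (\<Sum>l\<in>UNIV. axis i 1 $ l * (transpose (A x) *v (M *v (A x *v axis j 1))) $ l)"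
    proof -
      have "(\<Sum>l\<in>UNIV. axis i 1 $ l * (transpose (A x) *v (M *v (A x *v axis j 1))) $ l)
        = (\<Sum>l\<in>UNIV. if l = i then (transpose (A x) *v (M *v (A x *v axis j 1))) $ i else 0)"
        by (rule sum.cong) (auto simp: axis_def)
      then show ?thesis by simp
    qed
    also have "\<dots> = bf (A x *v axis i 1) (A x *v axis j 1)" by (rule bf_tr[symmetric]) simp
    also have "\<dots> = c x * M $ i $ j" by (simp add: bil bf_axis matrix_mult_axis_component)
    also have "\<dots> = (diagm (\<lambda>_. c x) ** M ** diagm (\<lambda>_. 1)) $ i $ j"
      by (simp add: diagm_mult)
    finally show ?thesis .
  qed
  then have "transpose (A x) ** M ** A x = diagm (\<lambda>_. c x) ** M ** diagm (\<lambda>_. 1)" by (simp add: vec_eq_iff)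
  then have "det (transpose (A x) ** M ** A x) = det (diagm (\<lambda>_. c x) ** M ** diagm (\<lambda>_. 1))" by simp
  then have "det (A x) * det M * det (A x) = c x ^ CARD('n) * det M"
    by (simp add: det_mul det_diagm det_transpose)
  moreover have "det M \<noteq> 0"
    using M_nondeg matrix_left_invertible_ker[of M] invertible_det_nz[of M] invertible_left_inverse[of M] by blast
  ultimately have eq: "det (A x) ^ 2 = c x ^ CARD('n)" by (simp add: power2_eq_square)
  obtain k where k: "CARD('n) = 2 * k + 1" using n by (auto elim: oddE)
  have "(det (A x) / c x ^ k)^2 = c x"
    using c_nz[OF x] by (simp add: power_divide eq k flip: power_mult) (simp add: mult.commute)
  then show ?thesis by blast
qed

lemma ord_2_odd:
  assumes n: "odd CARD('n)" and x: "x \<in> carrier G" "x \<noteq> \<one>" "ord x > 0"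
  shows "ord x = 2"
proof -
  obtain \<kappa> where "\<kappa>^2 = c x" using multiplier_square_odd[OF n x(1)] by blast
  then have "x \<otimes> x = \<one>" using involution_if_square[of x "ord x" \<kappa>] x by simp
  then have "x [^] (2::nat) = \<one>" using x(1) by (simp add: numeral_2_eq_2)
  then have "ord x dvd 2" using pow_eq_id[OF x(1)] by simp
  then have "ord x \<le> 2" by (auto intro: dvd_imp_le)
  moreover have "ord x \<noteq> 1" using ord_eq_1[OF x(1)] x(2) by simp
  ultimately show ?thesis using x(3) by linarith
qed

end

section \<open>Orthogonal lifts of a finite subgroup and their weight spaces\<close>

locale finite_similitude_subgroup = similitude_group M G A c
  for M :: "'a::field ^ 'n ^ 'n" and G :: "('g, 'm) monoid_scheme" (structure)
    and A :: "'g \<Rightarrow> 'a ^ 'n ^ 'n" and c :: "'g \<Rightarrow> 'a" +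
  fixes H :: "'g set"
  assumes H: "subgroup H G" and finH: "finite H"
begin

lemma H_carrier: "x \<in> H \<Longrightarrow> x \<in> carrier G"
  using subgroup.subset[OF H] by blast

lemmas H_closed = subgroup.m_closed[OF H] subgroup.m_inv_closed[OF H] subgroup.one_closed[OF H]

lemma H_torsion: assumes x: "x \<in> H" shows "\<exists>m>0. x [^] (m::nat) = \<one>"
proof -
  interpret H: group "G\<lparr>carrier := H\<rparr>" by (rule subgroup.subgroup_is_group[OF H is_group])
  have "x [^] card H = \<one>"
    using H.pow_order_eq_1[of x] x by (simp add: Coset.order_def nat_pow_consistent[symmetric])
  moreover have "card H > 0" using x finH by (auto simp: card_gt_0_iff)
  ultimately show ?thesis by blast
qed

text \<open>The kernel of the map from \<open>H\<close> to the square classes of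
  multipliers.\<close>

definition H0 :: "'g set" where "H0 = {x \<in> H. \<exists>\<kappa>. \<kappa>^2 = c x}"

definition root :: "'g \<Rightarrow> 'a" where "root x = (SOME \<kappa>. \<kappa>^2 = c x)"

definition lift :: "'g \<Rightarrow> 'a \<Rightarrow> 'a ^ 'n \<Rightarrow> 'a ^ 'n" where
  "lift x \<kappa> = (\<lambda>v. (1 / \<kappa>) *s (A x *v v))"

definition S :: "('a ^ 'n \<Rightarrow> 'a ^ 'n) set" where
  "S = {lift x \<kappa> | x \<kappa>. x \<in> H \<and> \<kappa>^2 = c x}"

lemma lift_nz: "x \<in> H \<Longrightarrow> \<kappa>^2 = c x \<Longrightarrow> \<kappa> \<noteq> 0"
  using c_nz[OF H_carrier] by auto

lemma S_cases:
  assumes "T \<in> S"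
  obtains x \<kappa> where "x \<in> H" "\<kappa>^2 = c x" "\<kappa> \<noteq> 0" "T = lift x \<kappa>"
  using assms lift_nz unfolding S_def by blast

lemma S_lin: "T \<in> S \<Longrightarrow> T (v + w) = T v + T w" "T \<in> S \<Longrightarrow> T (a *s v) = a *s T v"
  by (auto simp: S_def lift_def act_lin vec_eq_iff algebra_simps)

lemma S_diff: "T \<in> S \<Longrightarrow> T (v - w) = T v - T w"
  using S_lin(1)[of T v "(-1) *s w"] S_lin(2)[of T "-1" w] by simp

lemma S_zero: "T \<in> S \<Longrightarrow> T 0 = 0"
  using S_lin(2)[of T 0 0] by simp

lemma S_orth: "T \<in> S \<Longrightarrow> qf (T v) = qf v"
proof (elim S_cases)
  fix x \<kappa> assume *: "x \<in> H" "\<kappa>^2 = c x" "\<kappa> \<noteq> 0" "T = lift x \<kappa>"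
  then show ?thesis by (simp add: lift_def qf_scale sim[OF H_carrier] power_divide *(2)[symmetric])
qed

lemma S_bf: "T \<in> S \<Longrightarrow> bf (T v) (T w) = bf v w"
  using similitude_bf[of T 1] S_lin S_orth by simp

lemma S_involution: "T \<in> S \<Longrightarrow> T (T v) = v"
proof (elim S_cases)
  fix x \<kappa> assume *: "x \<in> H" "\<kappa>^2 = c x" "\<kappa> \<noteq> 0" "T = lift x \<kappa>"
  obtain m where m: "m > 0" "x [^] (m::nat) = \<one>" using H_torsion[OF *(1)] by blast
  have "A x *v (A x *v v) = c x *s v" by (rule act_square_scalar[OF H_carrier[OF *(1)] m *(2)])
  then show ?thesis using * by (simp add: lift_def act_lin vector_smult_assoc *(2)[symmetric] power2_eq_square)
qed

lemma S_mult:
  assumes "T \<in> S" "U \<in> S" shows "(\<lambda>v. T (U v)) \<in> S"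
proof -
  obtain x \<kappa> where x: "x \<in> H" "\<kappa>^2 = c x" "\<kappa> \<noteq> 0" "T = lift x \<kappa>" using assms(1) by (rule S_cases)
  obtain y \<mu> where y: "y \<in> H" "\<mu>^2 = c y" "\<mu> \<noteq> 0" "U = lift y \<mu>" using assms(2) by (rule S_cases)
  obtain k where k: "k \<noteq> 0" "\<And>v. A (x \<otimes> y) *v v = k *s (A x *v (A y *v v))"
    using mult[OF H_carrier[OF x(1)] H_carrier[OF y(1)]] by blast
  have "(k * \<kappa> * \<mu>)^2 = c (x \<otimes> y)"
    using c_mult[OF H_carrier[OF x(1)] H_carrier[OF y(1)] k(2)] x y by (simp add: power_mult_distrib)
  moreover have "(\<lambda>v. T (U v)) = lift (x \<otimes> y) (k * \<kappa> * \<mu>)"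
    using k x y by (auto simp: lift_def act_lin vector_smult_assoc)
  ultimately show ?thesis unfolding S_def using H_closed(1)[OF x(1) y(1)] by blast
qed

text \<open>A group of exponent two is commutative.\<close>

lemma S_commute:
  assumes "T \<in> S" "U \<in> S" shows "T (U v) = U (T v)"
proof -
  have "T (U (T (U v))) = v" by (rule S_involution[OF S_mult[OF assms]])
  then have "U (T (T (U (T (U v))))) = U (T v)" by simp
  then show ?thesis by (simp add: S_involution[OF assms(1)] S_involution[OF assms(2)])
qed

lemma card_S: "finite S" "card S = 2 * card H0"
proof -
  let ?g = "\<lambda>(x, e). lift x (e * root x)"
  let ?D = "H0 \<times> {1, -1 :: 'a}"
  have root: "root x ^ 2 = c x" if "x \<in> H0" for x
    unfolding root_def by (rule someI_ex) (use that in \<open>auto simp: H0_def\<close>)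
  have H0H: "x \<in> H" if "x \<in> H0" for x using that by (auto simp: H0_def)
  have rnz: "root x \<noteq> 0" if "x \<in> H0" for x by (rule lift_nz[OF H0H[OF that] root[OF that]])
  have ne: "(1::'a) \<noteq> -1" using two by (metis add.left_inverse one_add_one)
  have "S = ?g ` ?D"
  proof (intro subset_antisym subsetI)
    fix T assume "T \<in> S"
    then obtain x \<kappa> where x: "x \<in> H" "\<kappa>^2 = c x" "\<kappa> \<noteq> 0" "T = lift x \<kappa>" by (rule S_cases)
    have x0: "x \<in> H0" using x by (auto simp: H0_def)
    then have "\<kappa>^2 = root x ^ 2" using root x by simp
    then have "\<kappa> = root x \<or> \<kappa> = - root x" by (simp add: power2_eq_iff)
    then have "T = ?g (x, 1) \<or> T = ?g (x, -1)" using x(4) by auto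
    then show "T \<in> ?g ` ?D" using x0 by blast
  next
    fix T assume "T \<in> ?g ` ?D"
    then obtain x e where *: "x \<in> H0" "e = 1 \<or> e = -1" "T = lift x (e * root x)" by auto
    then have "(e * root x)^2 = c x" using root by auto
    then show "T \<in> S" unfolding S_def using * H0H by blast
  qed
  moreover have "inj_on ?g ?D"
  proof (rule inj_onI)
    fix p r assume pr: "p \<in> ?D" "r \<in> ?D" "?g p = ?g r"
    obtain x e where p: "p = (x, e)" by (cases p)
    obtain y e' where r: "r = (y, e')" by (cases r)
    have xy: "x \<in> H0" "y \<in> H0" "e \<noteq> 0" "e' \<noteq> 0" using pr p r by auto
    have eq: "(1 / (e * root x)) *s (A x *v v) = (1 / (e' * root y)) *s (A y *v v)" for v
      using pr(3) p r by (simp add: lift_def fun_eq_iff)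
    have "A y *v v = ((e' * root y) / (e * root x)) *s (A x *v v)" for v
    proof -
      have "A y *v v = (e' * root y) *s ((1 / (e' * root y)) *s (A y *v v))"
        using xy rnz by (simp add: vector_smult_assoc)
      then show ?thesis unfolding eq[symmetric] by (simp add: vector_smult_assoc)
    qed
    then have "x = y" by (rule proj_inj[OF H_carrier[OF H0H[OF xy(1)]] H_carrier[OF H0H[OF xy(2)]]])
    moreover have "e = e'"
    proof -
      obtain v :: "'a ^ 'n" where v: "v \<noteq> 0" using exists_nonzero by blast
      have "A x *v v \<noteq> 0" by (rule act_inj[OF H_carrier[OF H0H[OF xy(1)]] v])
      then have "1 / (e * root x) = 1 / (e' * root x)"
        using eq[of v] \<open>x = y\<close> by (simp only: vec.scale_right_imp_eq vec.scale_cancel_right) auto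
      then show ?thesis using xy rnz by simp
    qed
    ultimately show "p = r" by (simp add: p r)
  qed
  moreover have "finite H0" using finH by (simp add: H0_def)
  ultimately show "finite S" "card S = 2 * card H0"
    using ne by (auto simp: card_image card_cartesian_product)
qed

definition Eig :: "(('a ^ 'n \<Rightarrow> 'a ^ 'n) \<Rightarrow> 'a) \<Rightarrow> ('a ^ 'n) set" where
  "Eig \<eta> = {v. \<forall>T\<in>S. T v = \<eta> T *s v}"

text \<open>The value 0 off \<open>S\<close> makes a weight determined by its signs on
  \<open>S\<close>; distinct weights are then separated by an element of \<open>S\<close>, and there
  are finitely many.\<close>

definition Wts :: "(('a ^ 'n \<Rightarrow> 'a ^ 'n) \<Rightarrow> 'a) set" where
  "Wts = {\<eta>. (\<exists>v\<in>Eig \<eta>. v \<noteq> 0) \<and> (\<forall>T. T \<notin> S \<longrightarrow> \<eta> T = 0)}"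

definition wt :: "'a ^ 'n \<Rightarrow> ('a ^ 'n \<Rightarrow> 'a ^ 'n) \<Rightarrow> 'a" where
  "wt w T = (if T \<in> S then if T w = w then 1 else -1 else 0)"

lemma Eig_subspace: "vec.subspace (Eig \<eta>)"
  unfolding vec.subspace_def Eig_def
  by (auto simp: S_zero S_lin vec.scale_right_distrib vector_smult_assoc mult.commute)

lemma EigD: "v \<in> Eig \<eta> \<Longrightarrow> T \<in> S \<Longrightarrow> T v = \<eta> T *s v"
  by (simp add: Eig_def)

lemma Wts_sign: assumes "\<eta> \<in> Wts" "T \<in> S" shows "\<eta> T = 1 \<or> \<eta> T = -1"
proof -
  obtain v where v: "v \<in> Eig \<eta>" "v \<noteq> 0" using assms by (auto simp: Wts_def)
  have Tv: "T v = \<eta> T *s v" using v assms(2) by (simp add: Eig_def)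
  have "v = T (T v)" using S_involution[OF assms(2)] by simp
  also have "\<dots> = (\<eta> T * \<eta> T) *s v" by (simp add: Tv S_lin(2)[OF assms(2)] vector_smult_assoc)
  finally have "(\<eta> T * \<eta> T - 1) *s v = 0" by (simp add: vec.scale_left_diff_distrib)
  then have "(\<eta> T)^2 = 1" using v(2) by (simp add: power2_eq_square)
  then show ?thesis by (simp add: power2_eq_1_iff)
qed

lemma wt_Wts:
  assumes "w \<noteq> 0" "\<And>T. T \<in> S \<Longrightarrow> T w = w \<or> T w = - w"
  shows "wt w \<in> Wts" "w \<in> Eig (wt w)"
proof -
  show "w \<in> Eig (wt w)" using assms(2) by (auto simp: Eig_def wt_def)
  then show "wt w \<in> Wts" using assms(1) by (auto simp: Wts_def wt_def)
qed

lemma finite_Wts: "finite Wts"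
proof (rule finite_subset)
  show "Wts \<subseteq> {f. \<forall>T. (T \<in> S \<longrightarrow> f T \<in> {1, -1}) \<and> (T \<notin> S \<longrightarrow> f T = 0)}"
    using Wts_sign by (auto simp: Wts_def)
  show "finite {f. \<forall>T. (T \<in> S \<longrightarrow> f T \<in> {1, -1 :: 'a}) \<and> (T \<notin> S \<longrightarrow> f T = 0)}"
    by (rule finite_set_of_finite_funs) (use card_S in auto)
qed

text \<open>The involutions are diagonalised one at a time. For a new \<open>U\<close> the vectors
  \<open>w + U w\<close> and \<open>w - U w\<close> keep the signs of the earlier involutions, by
  commutation, and their sum is twice \<open>w\<close>.\<close>

lemma span_Eig: "vec.span (\<Union>\<eta>\<in>Wts. Eig \<eta>) = UNIV"
proof -
  have "v \<in> vec.span {w. w \<noteq> 0 \<and> (\<forall>T\<in>S'. T w = w \<or> T w = - w)}" if "finite S'" "S' \<subseteq> S" for S' v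
    using that
  proof (induction S' arbitrary: v rule: finite_induct)
    case empty
    show ?case by (cases "v = 0") (auto intro: vec.span_base vec.span_zero)
  next
    case (insert U S')
    let ?W = "{w. w \<noteq> 0 \<and> (\<forall>T\<in>S'. T w = w \<or> T w = - w)}"
    let ?W' = "{w. w \<noteq> 0 \<and> (\<forall>T\<in>insert U S'. T w = w \<or> T w = - w)}"
    have US: "U \<in> S" using insert by blast
    have sub: "?W \<subseteq> vec.span ?W'"
    proof
      fix w assume w: "w \<in> ?W"
      define p where "p = w + U w"
      define m where "m = w - U w"
      have T: "T p = p \<or> T p = - p" "T m = m \<or> T m = - m" if T: "T \<in> S'" for T
      proof -
        have TS: "T \<in> S" using T insert.prems by blast
        have TU: "T (U w) = U (T w)" by (rule S_commute[OF TS US])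
        have "U (- w) = - U w" using S_lin(2)[OF US, of "-1" w] by simp
        then show "T p = p \<or> T p = - p" "T m = m \<or> T m = - m"
          using w T by (auto simp: p_def m_def S_lin(1)[OF TS] S_diff[OF TS] TU)
      qed
      have Up: "U p = p" and Um: "U m = - m"
        by (simp_all add: p_def m_def S_lin(1)[OF US] S_diff[OF US] S_involution[OF US])
      have pW: "p \<in> vec.span ?W'"
      proof (cases "p = 0")
        case False
        then show ?thesis using T(1) Up by (intro vec.span_base) auto
      qed (simp add: vec.span_zero)
      have mW: "m \<in> vec.span ?W'"
      proof (cases "m = 0")
        case False
        then show ?thesis using T(2) Um by (intro vec.span_base) auto
      qed (simp add: vec.span_zero)
      have "w = (1 / 2) *s p + (1 / 2) *s m"
        using two by (simp add: p_def m_def vec_eq_iff field_simps)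
      also have "\<dots> \<in> vec.span ?W'" by (intro vec.span_add vec.span_scale pW mW)
      finally show "w \<in> vec.span ?W'" .
    qed
    have "v \<in> vec.span ?W" using insert by blast
    also have "vec.span ?W \<subseteq> vec.span ?W'" using sub by (intro vec.span_minimal) auto
    finally show ?case .
  qed
  then have "v \<in> vec.span {w. w \<noteq> 0 \<and> (\<forall>T\<in>S. T w = w \<or> T w = - w)}" for v
    using card_S(1) by blast
  moreover have "{w. w \<noteq> 0 \<and> (\<forall>T\<in>S. T w = w \<or> T w = - w)} \<subseteq> (\<Union>\<eta>\<in>Wts. Eig \<eta>)"
    using wt_Wts by blast
  ultimately show ?thesis using vec.span_mono by blast
qed

text \<open>As the weight spaces span, an element of \<open>S\<close> is determined by its signs on
  them.\<close>

lemma card_S_le: "card S \<le> 2 ^ card Wts"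
proof -
  let ?r = "\<lambda>T. \<lambda>\<eta>\<in>Wts. \<eta> T"
  have "inj_on ?r S"
  proof (rule inj_onI)
    fix T U assume TU: "T \<in> S" "U \<in> S" "?r T = ?r U"
    have eq: "\<eta> T = \<eta> U" if "\<eta> \<in> Wts" for \<eta> using fun_cong[OF TU(3), of \<eta>] that by simp
    have "vec.subspace {v. T v = U v}"
      unfolding vec.subspace_def using S_lin[OF TU(1)] S_lin[OF TU(2)]
      by (auto, metis vector_smult_lzero)
    moreover have "(\<Union>\<eta>\<in>Wts. Eig \<eta>) \<subseteq> {v. T v = U v}" 
    proof
      fix v assume "v \<in> (\<Union>\<eta>\<in>Wts. Eig \<eta>)"
      then obtain \<eta> where "\<eta> \<in> Wts" "v \<in> Eig \<eta>" by blast
      then show "v \<in> {v. T v = U v}" using eq[of \<eta>] EigD[OF _ TU(1)] EigD[OF _ TU(2)] by simp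
    qed
    ultimately have "vec.span (\<Union>\<eta>\<in>Wts. Eig \<eta>) \<subseteq> {v. T v = U v}" by (intro vec.span_minimal)
    then show "T = U" unfolding span_Eig by auto
  qed
  moreover have "?r ` S \<subseteq> PiE Wts (\<lambda>_. {1, -1})" by (auto dest: Wts_sign)
  moreover have "finite (PiE Wts (\<lambda>_. {1, -1 :: 'a}))" using finite_Wts by (intro finite_PiE) auto
  ultimately have "card S \<le> card (PiE Wts (\<lambda>_. {1, -1 :: 'a}))" by (intro card_inj_on_le)
  also have "\<dots> = (\<Prod>i\<in>Wts. card {1, -1 :: 'a})" using finite_Wts by (rule card_PiE)
  also have "\<dots> \<le> (\<Prod>i\<in>Wts. 2)" by (intro prod_mono) (auto simp: card_insert_if)
  finally show ?thesis by simp
qed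

lemma Wts_nonempty: "Wts \<noteq> {}"
proof
  assume "Wts = {}"
  then have "vec.span {} = (UNIV :: ('a ^ 'n) set)" using span_Eig by simp
  then show False using exists_nonzero by auto
qed

lemma Eig_orth:
  assumes "\<eta> \<in> Wts" "\<eta>' \<in> Wts" "\<eta> \<noteq> \<eta>'" "v \<in> Eig \<eta>" "w \<in> Eig \<eta>'" shows "bf v w = 0"
proof -
  obtain T where T: "\<eta> T \<noteq> \<eta>' T" using assms(3) by (auto simp: fun_eq_iff)
  then have TS: "T \<in> S" using assms(1,2) by (auto simp: Wts_def) (metis)
  have "bf v w = bf (T v) (T w)" by (rule S_bf[OF TS, symmetric])
  also have "\<dots> = (\<eta> T * \<eta>' T) * bf v w" by (simp add: EigD[OF assms(4) TS] EigD[OF assms(5) TS] bf_lin)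
  also have "\<eta> T * \<eta>' T = -1" using Wts_sign[OF assms(1) TS] Wts_sign[OF assms(2) TS] T by auto
  finally have "2 * bf v w = 0" by (simp add: eq_neg_iff_add_eq_0)
  then show ?thesis using two by simp
qed

text \<open>Weight spaces are pairwise orthogonal and, the form being anisotropic, independent.
  Their dimensions add up to at most \<open>n\<close>, and a smallest one satisfies the product
  bound.\<close>

lemma minimal_block:
  obtains \<eta> B where "\<eta> \<in> Wts" "B \<subseteq> Eig \<eta>" "vec.independent B" "Eig \<eta> \<subseteq> vec.span B" "finite B"
    "card B \<ge> 1" "card Wts * card B \<le> CARD('n)" "card Wts \<ge> 1"
proof -
  define Bs where "Bs = (\<lambda>\<eta>. SOME B. B \<subseteq> Eig \<eta> \<and> vec.independent B \<and> Eig \<eta> \<subseteq> vec.span B)"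
  have "\<exists>B. B \<subseteq> Eig \<eta> \<and> vec.independent B \<and> Eig \<eta> \<subseteq> vec.span B" for \<eta>
    using vec.basis_exists[of "Eig \<eta>"] by metis
  then have Bs: "Bs \<eta> \<subseteq> Eig \<eta>" "vec.independent (Bs \<eta>)" "Eig \<eta> \<subseteq> vec.span (Bs \<eta>)" for \<eta>
    unfolding Bs_def using someI_ex[of "\<lambda>B. B \<subseteq> Eig \<eta> \<and> vec.independent B \<and> Eig \<eta> \<subseteq> vec.span B"] by blast+
  have fin: "finite (Bs \<eta>)" for \<eta> by (rule vec.finiteI_independent[OF Bs(2)])
  have pos: "card (Bs \<eta>) \<ge> 1" if "\<eta> \<in> Wts" for \<eta>
  proof -
    have "Bs \<eta> \<noteq> {}" using Bs(3)[of \<eta>] that by (auto simp: Wts_def)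
    then show ?thesis using fin[of \<eta>] by (simp add: Suc_leI card_gt_0_iff)
  qed
  have disj: "Bs \<eta> \<inter> Bs \<eta>' = {}" if "\<eta> \<in> Wts" "\<eta>' \<in> Wts" "\<eta> \<noteq> \<eta>'" for \<eta> \<eta>'
  proof (rule ccontr)
    assume "Bs \<eta> \<inter> Bs \<eta>' \<noteq> {}"
    then obtain v where v: "v \<in> Bs \<eta>" "v \<in> Bs \<eta>'" by blast
    then have "bf v v = 0" using Eig_orth[OF that] Bs(1) by blast
    moreover have "v \<noteq> 0" using v(1) Bs(2) vec.dependent_zero by blast
    ultimately show False using aniso by (simp add: qf_def)
  qed
  let ?B = "\<Union>\<eta>\<in>Wts. Bs \<eta>"
  have finB: "finite ?B" using finite_Wts fin by blast
  have "vec.independent ?B"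
  proof (rule vec.independent_if_scalars_zero[OF finB])
    fix f v assume sum0: "(\<Sum>v\<in>?B. f v *s v) = 0" and v: "v \<in> ?B"
    then obtain \<eta> where \<eta>: "\<eta> \<in> Wts" "v \<in> Bs \<eta>" by blast
    define w where "w = (\<lambda>\<eta>. \<Sum>v\<in>Bs \<eta>. f v *s v)"
    have wV: "w \<eta> \<in> Eig \<eta>" for \<eta> unfolding w_def
      by (intro vec.subspace_sum[OF Eig_subspace] vec.subspace_scale[OF Eig_subspace]) (use Bs(1) in blast)
    have "(\<Sum>\<eta>\<in>Wts. w \<eta>) = 0" using sum0 disj fin
      unfolding w_def by (subst (asm) sum.UNION_disjoint) (auto simp: finite_Wts)
    then have "0 = bf (w \<eta>) (\<Sum>\<eta>'\<in>Wts. w \<eta>')" by simp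
    also have "\<dots> = (\<Sum>\<eta>'\<in>Wts. if \<eta>' = \<eta> then qf (w \<eta>) else 0)"
      unfolding bf_sum_right using Eig_orth[OF \<eta>(1) _ _ wV wV] by (intro sum.cong) (auto simp: qf_def)
    finally have "qf (w \<eta>) = 0" using \<eta>(1) finite_Wts by simp
    then have "w \<eta> = 0" using aniso by blast
    then show "f v = 0"
      unfolding w_def using vec.independentD[OF Bs(2) fin order_refl, of f \<eta> v] \<eta>(2) by blast
  qed
  then have "card ?B \<le> CARD('n)"
    using vec.independent_card_le_dim[of ?B UNIV] by (simp add: card_cart_basis)
  moreover have "card ?B = (\<Sum>\<eta>\<in>Wts. card (Bs \<eta>))"
    by (rule card_UN_disjoint) (use finite_Wts fin disj in auto)
  ultimately have le: "(\<Sum>\<eta>\<in>Wts. card (Bs \<eta>)) \<le> CARD('n)" by simp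
  obtain \<eta> where \<eta>: "\<eta> \<in> Wts" "\<And>\<eta>'. \<eta>' \<in> Wts \<Longrightarrow> card (Bs \<eta>) \<le> card (Bs \<eta>')"
    using ex_min_if_finite[of "(\<lambda>\<eta>. card (Bs \<eta>)) ` Wts"] finite_Wts Wts_nonempty
    by (metis (no_types, lifting) arg_min_if_finite(1) arg_min_least)
  have "card Wts * card (Bs \<eta>) \<le> (\<Sum>\<eta>\<in>Wts. card (Bs \<eta>))"
    using sum_bounded_below[of Wts "card (Bs \<eta>)" "\<lambda>\<eta>. card (Bs \<eta>)"] \<eta>(2) by simp
  then have "card Wts * card (Bs \<eta>) \<le> CARD('n)" using le by simp
  moreover have "card Wts \<ge> 1" using Wts_nonempty finite_Wts by (simp add: Suc_leI card_gt_0_iff)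
  ultimately show ?thesis using that[OF \<eta>(1) Bs fin pos[OF \<eta>(1)]] by blast
qed

end

section \<open>Action of the group on a single weight space\<close>

context finite_similitude_subgroup
begin

lemma conj_act:
  assumes "x \<in> H" "y \<in> H" "z \<in> H" "x \<otimes> z = y \<otimes> x"
  shows "\<exists>r. r \<noteq> 0 \<and> c z = r^2 * c y \<and> (\<forall>v. A x *v (A z *v v) = r *s (A y *v (A x *v v)))"
proof -
  note carr = H_carrier[OF assms(1)] H_carrier[OF assms(2)] H_carrier[OF assms(3)]
  obtain k where k: "k \<noteq> 0" "\<And>v. A (x \<otimes> z) *v v = k *s (A x *v (A z *v v))"
    using mult[OF carr(1,3)] by blast
  obtain k' where k': "k' \<noteq> 0" "\<And>v. A (y \<otimes> x) *v v = k' *s (A y *v (A x *v v))"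
    using mult[OF carr(2,1)] by blast
  have "k^2 * c x * c z = k'^2 * c y * c x"
    using c_mult[OF carr(1,3) k(2)] c_mult[OF carr(2,1) k'(2)] assms(4) by metis
  then have "(k^2 * c z) * c x = (k'^2 * c y) * c x" by (simp add: mult_ac)
  then have "k^2 * c z = k'^2 * c y" by (rule iffD1[OF mult_right_cancel[OF c_nz[OF carr(1)]]])
  then have "c z = (k' / k)^2 * c y" using k(1) by (simp add: power_divide field_simps)
  moreover have "A x *v (A z *v v) = (k' / k) *s (A y *v (A x *v v))" for v
  proof -
    have "k *s (A x *v (A z *v v)) = k' *s (A y *v (A x *v v))" using k(2)[of v] k'(2)[of v] assms(4) by simp
    then have "(1 / k) *s (k *s (A x *v (A z *v v))) = (1 / k) *s (k' *s (A y *v (A x *v v)))" by simp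
    then show ?thesis using k(1) by (simp add: vector_smult_assoc)
  qed
  ultimately show ?thesis using k(1) k'(1) by (intro exI[of _ "k' / k"]) simp
qed

text \<open>Conjugation changes the multiplier by a square \<open>r^2\<close>, so a square root is
  carried along and \<open>S\<close> is normalised.\<close>

lemma conj_lift_right:
  assumes x: "x \<in> H" and T: "T \<in> S"
  shows "\<exists>T'\<in>S. \<forall>v. A x *v T' v = T (A x *v v)"
proof -
  obtain y \<kappa> where y: "y \<in> H" "\<kappa>^2 = c y" "\<kappa> \<noteq> 0" "T = lift y \<kappa>" using T by (rule S_cases)
  define z where "z = inv x \<otimes> y \<otimes> x"
  have z: "z \<in> H" unfolding z_def by (intro H_closed x y(1))
  have "x \<otimes> z = y \<otimes> x" unfolding z_def using H_carrier[OF x] H_carrier[OF y(1)] by (simp flip: m_assoc)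
  then obtain r where r: "r \<noteq> 0" "c z = r^2 * c y" "\<And>v. A x *v (A z *v v) = r *s (A y *v (A x *v v))"
    using conj_act[OF x y(1) z] by blast
  have "lift z (r * \<kappa>) \<in> S" unfolding S_def using z r(2) y(2) by (auto simp: power_mult_distrib intro!: exI)
  moreover have "A x *v lift z (r * \<kappa>) v = T (A x *v v)" for v
    using r(1) by (simp add: lift_def act_lin r(3) y(4) vector_smult_assoc)
  ultimately show ?thesis by blast
qed

lemma conj_lift_left:
  assumes x: "x \<in> H" and T: "T \<in> S"
  shows "\<exists>T'\<in>S. \<forall>v. T' (A x *v v) = A x *v T v"
proof -
  obtain z \<kappa> where z: "z \<in> H" "\<kappa>^2 = c z" "\<kappa> \<noteq> 0" "T = lift z \<kappa>" using T by (rule S_cases)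
  define y where "y = x \<otimes> z \<otimes> inv x"
  have y: "y \<in> H" unfolding y_def by (intro H_closed x z(1))
  have "x \<otimes> z = y \<otimes> x" unfolding y_def using H_carrier[OF x] H_carrier[OF z(1)] by (simp add: m_assoc)
  then obtain r where r: "r \<noteq> 0" "c z = r^2 * c y" "\<And>v. A x *v (A z *v v) = r *s (A y *v (A x *v v))"
    using conj_act[OF x y z(1)] by blast
  have "lift y (\<kappa> / r) \<in> S" unfolding S_def using y r(1,2) z(2) by (auto simp: power_divide intro!: exI)
  moreover have "lift y (\<kappa> / r) (A x *v v) = A x *v T v" for v
    using r(1) by (simp add: lift_def act_lin r(3) z(4) vector_smult_assoc)
  ultimately show ?thesis by blast
qed

lemma neg_neq: "v \<noteq> 0 \<Longrightarrow> - v \<noteq> (v :: 'a ^ 'n)"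
proof
  assume v: "v \<noteq> 0" "- v = v"
  then have "v + v = 0" by (metis add.right_inverse)
  then have "2 *s v = 0" by (simp add: vec_eq_iff)
  then show False using two v(1) by simp
qed

end

locale similitude_block = finite_similitude_subgroup M G A c H
  for M :: "'a::field ^ 'n ^ 'n" and G :: "('g, 'm) monoid_scheme" (structure)
    and A :: "'g \<Rightarrow> 'a ^ 'n ^ 'n" and c :: "'g \<Rightarrow> 'a" and H :: "'g set" +
  fixes \<eta> :: "('a ^ 'n \<Rightarrow> 'a ^ 'n) \<Rightarrow> 'a" and B :: "('a ^ 'n) set"
  assumes \<eta>: "\<eta> \<in> Wts" and B: "B \<subseteq> Eig \<eta>" "vec.independent B" "Eig \<eta> \<subseteq> vec.span B" "finite B"
    and card_B: "card B \<le> CARD('n)"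
begin

definition w0 where "w0 = (SOME v. v \<in> Eig \<eta> \<and> v \<noteq> 0)"

lemma w0: "w0 \<in> Eig \<eta>" "w0 \<noteq> 0"
  using someI_ex[of "\<lambda>v. v \<in> Eig \<eta> \<and> v \<noteq> 0"] \<eta> unfolding w0_def Wts_def by auto

definition Stab where "Stab = {x \<in> H. \<forall>w\<in>Eig \<eta>. A x *v w \<in> Eig \<eta>}"

lemma Stab: "x \<in> Stab \<Longrightarrow> x \<in> H" "x \<in> Stab \<Longrightarrow> w \<in> Eig \<eta> \<Longrightarrow> A x *v w \<in> Eig \<eta>"
  by (auto simp: Stab_def)

text \<open>The sign \<open>e\<close> does not depend on \<open>w\<close>, which is why the weight
  space is mapped into a single weight space.\<close>

lemma image_sign:
  assumes x: "x \<in> H" and T: "T \<in> S"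
  obtains e where "e = 1 \<or> e = -1" "\<And>w. w \<in> Eig \<eta> \<Longrightarrow> T (A x *v w) = e *s (A x *v w)"
proof -
  obtain T' where T': "T' \<in> S" "\<And>v. A x *v T' v = T (A x *v v)" using conj_lift_right[OF x T] by blast
  have "T (A x *v w) = \<eta> T' *s (A x *v w)" if "w \<in> Eig \<eta>" for w
    by (simp add: T'(2)[symmetric] EigD[OF that T'(1)] act_lin)
  then show ?thesis using that[of "\<eta> T'"] Wts_sign[OF \<eta> T'(1)] by blast
qed

lemma wt_image:
  assumes x: "x \<in> H" and w: "w \<in> Eig \<eta>" "w \<noteq> 0"
  shows "wt (A x *v w) \<in> Wts" "A x *v w \<in> Eig (wt (A x *v w))" "wt (A x *v w) = wt (A x *v w0)"
proof -
  have nz: "A x *v w \<noteq> 0" "A x *v w0 \<noteq> 0" using act_inj[OF H_carrier[OF x]] w(2) w0(2) by auto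
  have pm: "T (A x *v w) = A x *v w \<or> T (A x *v w) = - (A x *v w)" if "T \<in> S" for T
    by (rule image_sign[OF x that]) (use w(1) in force)
  show "wt (A x *v w) \<in> Wts" by (rule wt_Wts(1)[OF nz(1)], erule pm)
  show "A x *v w \<in> Eig (wt (A x *v w))" by (rule wt_Wts(2)[OF nz(1)], erule pm)
  show "wt (A x *v w) = wt (A x *v w0)"
  proof
    fix T
    show "wt (A x *v w) T = wt (A x *v w0) T"
    proof (cases "T \<in> S")
      case True
      obtain e where e: "e = 1 \<or> e = -1" "\<And>w. w \<in> Eig \<eta> \<Longrightarrow> T (A x *v w) = e *s (A x *v w)"
        using image_sign[OF x True] by metis
      show ?thesis using e(1) e(2)[OF w(1)] e(2)[OF w0(1)] neg_neq[OF nz(1)] neg_neq[OF nz(2)]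
        by (auto simp: wt_def)
    qed (simp add: wt_def)
  qed
qed

text \<open>The weight of the image of the one vector \<open>w0\<close> already identifies the image
  of the whole block. Equal images mean equality modulo the stabiliser, so the orbit is no larger
  than the set of weights.\<close>

lemma same_block:
  assumes x: "x \<in> H" and y: "y \<in> H" and eq: "wt (A x *v w0) = wt (A y *v w0)"
  shows "inv x \<otimes> y \<in> Stab"
proof -
  note carr = H_carrier[OF x] H_carrier[OF y]
  obtain k where k: "\<And>v. A (inv x \<otimes> y) *v v = k *s (A (inv x) *v (A y *v v))"
    using mult[of "inv x" y] carr by auto
  obtain k' where k': "\<And>v. A x *v (A (inv x) *v v) = k' *s v"
    using inv_act[of "inv x"] carr by auto
  have "A (inv x) *v (A y *v w) \<in> Eig \<eta>" if w: "w \<in> Eig \<eta>" for w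
    unfolding Eig_def
  proof (intro CollectI ballI)
    fix T assume T: "T \<in> S"
    obtain T' where T': "T' \<in> S" "\<And>v. T' (A x *v v) = A x *v T v" using conj_lift_left[OF x T] by blast
    let ?u = "A (inv x) *v (A y *v w)"
    have Ax0: "A x *v w0 \<noteq> 0" by (rule act_inj[OF carr(1) w0(2)])
    have "wt (A x *v w0) T' *s (A x *v w0) = \<eta> T *s (A x *v w0)"
      using EigD[OF wt_image(2)[OF x w0] T'(1)] T'(2)[of w0] EigD[OF w0(1) T] by (metis vec.scale)
    then have e: "wt (A x *v w0) T' = \<eta> T" using Ax0 by (metis vec.scale_cancel_right)
    have "T' (A y *v w) = \<eta> T *s (A y *v w)"
    proof (cases "w = 0")
      case True
      then show ?thesis by (simp add: S_zero[OF T'(1)])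
    next
      case False
      show ?thesis using EigD[OF wt_image(2)[OF y w False] T'(1)] wt_image(3)[OF y w False] eq e by simp
    qed
    then have "T' (k' *s (A y *v w)) = \<eta> T *s (k' *s (A y *v w))"
      by (simp add: S_lin(2)[OF T'(1)] vector_smult_assoc mult.commute)
    then have "A x *v T ?u = A x *v (\<eta> T *s ?u)" by (simp add: T'(2)[symmetric] k' act_lin)
    then show "T ?u = \<eta> T *s ?u" by (rule act_cancel[OF carr(1)])
  qed
  then show ?thesis unfolding Stab_def
    using H_closed(1)[OF H_closed(2)[OF x] y] vec.subspace_scale[OF Eig_subspace] by (auto simp: k)
qed

lemma card_H_le_Stab: "card H \<le> card Wts * card Stab"
proof -
  have "card H \<le> card ((\<lambda>x. wt (A x *v w0)) ` H) * card Stab"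
    by (rule card_le_fibres[OF H finH]) (use same_block finH in \<open>auto simp: Stab_def\<close>)
  also have "card ((\<lambda>x. wt (A x *v w0)) ` H) \<le> card Wts"
    by (rule card_mono[OF finite_Wts]) (use wt_image(1)[OF _ w0] in auto)
  finally show ?thesis by simp
qed

lemma H0_scalar:
  assumes z: "z \<in> H" "\<kappa>^2 = c z"
  obtains a where "a = \<kappa> \<or> a = - \<kappa>" "\<And>w. w \<in> Eig \<eta> \<Longrightarrow> A z *v w = a *s w"
proof -
  have T: "lift z \<kappa> \<in> S" using z unfolding S_def by blast
  have "A z *v w = (\<kappa> * \<eta> (lift z \<kappa>)) *s w" if "w \<in> Eig \<eta>" for w
  proof -
    have "\<kappa> *s lift z \<kappa> w = \<kappa> *s (\<eta> (lift z \<kappa>) *s w)" using EigD[OF that T] by simp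
    then show ?thesis using lift_nz[OF z] by (simp add: lift_def vector_smult_assoc)
  qed
  then show ?thesis using that[of "\<kappa> * \<eta> (lift z \<kappa>)"] Wts_sign[OF \<eta> T] by auto
qed

text \<open>Multipliers are multiplicative up to squares, so the commutator \<open>z\<close> has a
  square multiplier. Its lift lies in \<open>S\<close> and acts on the block by a scalar.\<close>

lemma Stab_commute:
  assumes x: "x \<in> Stab" and y: "y \<in> Stab"
  shows "\<exists>e. \<forall>w\<in>Eig \<eta>. A x *v (A y *v w) = e *s (A y *v (A x *v w))"
proof -
  note xH = Stab(1)[OF x] and yH = Stab(1)[OF y]
  note carr = H_carrier[OF xH] H_carrier[OF yH]
  define z where "z = inv (y \<otimes> x) \<otimes> (x \<otimes> y)"
  have z: "z \<in> H" unfolding z_def by (intro H_closed xH yH)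
  note zc = H_carrier[OF z]
  have xy: "x \<otimes> y = (y \<otimes> x) \<otimes> z" unfolding z_def using carr by (simp flip: m_assoc)
  obtain k1 where k1: "k1 \<noteq> 0" "\<And>v. A (x \<otimes> y) *v v = k1 *s (A x *v (A y *v v))" using mult[OF carr] by blast
  obtain k2 where k2: "k2 \<noteq> 0" "\<And>v. A (y \<otimes> x) *v v = k2 *s (A y *v (A x *v v))" using mult[OF carr(2,1)] by blast
  obtain k3 where k3: "k3 \<noteq> 0" "\<And>v. A (y \<otimes> x \<otimes> z) *v v = k3 *s (A (y \<otimes> x) *v (A z *v v))"
    using mult[of "y \<otimes> x" z] carr zc by auto
  have "c (y \<otimes> x \<otimes> z) = k3^2 * c (y \<otimes> x) * c z" by (rule c_mult[OF _ zc k3(2)]) (use carr in simp)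
  then have "k1^2 * c x * c y = k3^2 * (k2^2 * c y * c x) * c z"
    using c_mult[OF carr k1(2)] c_mult[OF carr(2,1) k2(2)] xy by metis
  then have e: "k1^2 * (c x * c y) = ((k2 * k3)^2 * c z) * (c x * c y)" by (simp add: power_mult_distrib mult_ac)
  have "c x * c y \<noteq> 0" using c_nz[OF carr(1)] c_nz[OF carr(2)] by simp
  then have "k1^2 = (k2 * k3)^2 * c z" by (rule iffD1[OF mult_right_cancel e])
  then have "(k1 / (k2 * k3))^2 = c z"
    using k2(1) k3(1) by (simp add: power_divide)
  then obtain a where a: "\<And>w. w \<in> Eig \<eta> \<Longrightarrow> A z *v w = a *s w" using H0_scalar[OF z] by metis
  have "A x *v (A y *v w) = (k3 * k2 * a / k1) *s (A y *v (A x *v w))" if w: "w \<in> Eig \<eta>" for w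
  proof -
    have "k1 *s (A x *v (A y *v w)) = (k3 * k2 * a) *s (A y *v (A x *v w))"
      using k1(2)[of w] k3(2)[of w] by (simp add: xy k2(2) a[OF w] act_lin vector_smult_assoc mult_ac)
    then have "(1 / k1) *s (k1 *s (A x *v (A y *v w))) = (1 / k1) *s ((k3 * k2 * a) *s (A y *v (A x *v w)))" by simp
    then show ?thesis using k1(1) by (simp add: vector_smult_assoc)
  qed
  then show ?thesis by blast
qed

text \<open>The multiplier of \<open>x \<otimes> x\<close> has the root \<open>k * c x\<close>; the
  sign is the weight of the corresponding lift.\<close>

lemma Stab_square:
  assumes x: "x \<in> Stab"
  shows "\<exists>a. (a = c x \<or> a = - c x) \<and> (\<forall>w\<in>Eig \<eta>. A x *v (A x *v w) = a *s w)"
proof -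
  note xH = Stab(1)[OF x]
  note carr = H_carrier[OF xH]
  obtain k where k: "k \<noteq> 0" "\<And>v. A (x \<otimes> x) *v v = k *s (A x *v (A x *v v))" using mult[OF carr carr] by blast
  have sq: "(k * c x)^2 = c (x \<otimes> x)" using c_mult[OF carr carr k(2)] by (simp add: power2_eq_square)
  obtain a where a: "a = k * c x \<or> a = - (k * c x)" "\<And>w. w \<in> Eig \<eta> \<Longrightarrow> A (x \<otimes> x) *v w = a *s w"
    using H0_scalar[OF H_closed(1)[OF xH xH] sq] by metis
  have "A x *v (A x *v w) = (a / k) *s w" if w: "w \<in> Eig \<eta>" for w
  proof -
    have "(1 / k) *s (k *s (A x *v (A x *v w))) = (1 / k) *s (a *s w)" using a(2)[OF w] k(2)[of w] by simp
    then show ?thesis using k(1) by (simp add: vector_smult_assoc)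
  qed
  then show ?thesis using a(1) k(1) by (intro exI[of _ "a / k"]) auto
qed

text \<open>On the scalar extension of the block the operators of a commuting family have a common
  eigenvector; its eigenvalues are square roots of elements in distinct square classes.\<close>

lemma commuting_independent:
  assumes R: "R \<subseteq> Stab" and dist: "\<And>x y r. x \<in> R \<Longrightarrow> y \<in> R \<Longrightarrow> c y = r^2 * c x \<Longrightarrow> x = y"
    and comm: "\<And>x y w. x \<in> R \<Longrightarrow> y \<in> R \<Longrightarrow> w \<in> Eig \<eta> \<Longrightarrow> A x *v (A y *v w) = A y *v (A x *v w)"
    and l: "\<And>x. x \<in> R \<Longrightarrow> l x \<noteq> 0" and rel: "\<And>w. w \<in> Eig \<eta> \<Longrightarrow> (\<Sum>x\<in>R. l x *s (A x *v w)) = 0"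
  shows "R = {}"
proof -
  have finR: "finite R" using R finH by (auto simp: Stab_def intro: finite_subset)
  define W where "W = vec.span (vec_ac ` Eig \<eta>)"
  have ext: "u \<in> {u. P u}" if "u \<in> W" "vec.subspace {u. P u}" "\<And>w. w \<in> Eig \<eta> \<Longrightarrow> P (vec_ac w)" for u P
    using vec.span_minimal[of "vec_ac ` Eig \<eta>" "{u. P u}"] that unfolding W_def by auto
  note sub = vec.subspace_def matrix_vector_right_distrib vec.scale
  have W_closed: "mat_ac (A x) *v u \<in> W" if "x \<in> R" "u \<in> W" for x u
  proof -
    have "vec.subspace {u. mat_ac (A x) *v u \<in> W}"
      by (auto simp: sub W_def vec.span_zero intro: vec.span_add vec.span_scale)
    moreover have "mat_ac (A x) *v vec_ac w \<in> W" if w: "w \<in> Eig \<eta>" for w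
      unfolding vec_ac_simps W_def
      by (rule vec.span_base, rule imageI, rule Stab(2)[OF _ w]) (use R \<open>x \<in> R\<close> in blast)
    ultimately show ?thesis using ext[OF that(2)] by blast
  qed
  have comm_ac: "mat_ac (A x) *v (mat_ac (A y) *v u) = mat_ac (A y) *v (mat_ac (A x) *v u)"
    if "x \<in> R" "y \<in> R" "u \<in> W" for x y u
    using ext[OF that(3), of "\<lambda>u. mat_ac (A x) *v (mat_ac (A y) *v u) = mat_ac (A y) *v (mat_ac (A x) *v u)"]
      comm[OF that(1,2)] by (auto simp: sub vec_ac_simps)
  have "\<forall>x. \<exists>a. x \<in> R \<longrightarrow> (a = c x \<or> a = - c x) \<and> (\<forall>w\<in>Eig \<eta>. A x *v (A x *v w) = a *s w)"
    using Stab_square R by blast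
  then obtain a where a: "\<And>x. x \<in> R \<Longrightarrow> a x = c x \<or> a x = - c x"
    "\<And>x w. x \<in> R \<Longrightarrow> w \<in> Eig \<eta> \<Longrightarrow> A x *v (A x *v w) = a x *s w" by metis
  have sq_ac: "mat_ac (A x) *v (mat_ac (A x) *v u) = to_ac (a x) *s u" if "x \<in> R" "u \<in> W" for x u
    using ext[OF that(2), of "\<lambda>u. mat_ac (A x) *v (mat_ac (A x) *v u) = to_ac (a x) *s u"] a(2)[OF that(1)]
    by (auto simp: sub vec_ac_simps vec.scale_right_distrib mult.commute vector_smult_assoc)
  have rel_ac: "(\<Sum>x\<in>R. to_ac (l x) *s (mat_ac (A x) *v u)) = 0" if "u \<in> W" for u
  proof -
    have *: "(\<Sum>x\<in>R. to_ac (l x) *s (mat_ac (A x) *v vec_ac w)) = 0" if "w \<in> Eig \<eta>" for w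
    proof -
      have "vec_ac (\<Sum>x\<in>Q. l x *s (A x *v w)) = (\<Sum>x\<in>Q. to_ac (l x) *s (mat_ac (A x) *v vec_ac w))" for Q
        by (induction Q rule: infinite_finite_induct) (auto simp: vec_ac_simps)
      then show ?thesis using rel[OF that] vec_ac_simps(5)[of 0] by metis
    qed
    have "vec.subspace {u. (\<Sum>x\<in>R. to_ac (l x) *s (mat_ac (A x) *v u)) = 0}"
    proof -
      have "(\<Sum>x\<in>R. to_ac (l x) *s (mat_ac (A x) *v (k *s u))) = k *s (\<Sum>x\<in>R. to_ac (l x) *s (mat_ac (A x) *v u))" for k u
        by (simp add: vec.scale vec.scale_sum_right vector_smult_assoc mult.commute)
      then show ?thesis
        by (auto simp: vec.subspace_def matrix_vector_right_distrib vec.scale_right_distrib sum.distrib)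
    qed
    then show ?thesis using ext[OF that] * by auto
  qed
  \<comment> \<open>A common eigenvector is built by adding one operator at a time. If
    \<open>\<theta> * \<theta>\<close> is its square on \<open>W\<close>, either \<open>u\<close>
    has eigenvalue \<open>- \<theta>\<close> or \<open>u'\<close> is a nonzero eigenvector for
    \<open>\<theta>\<close>; commutation preserves the earlier eigenvalues.\<close>
  have "\<exists>u\<in>W. u \<noteq> 0 \<and> (\<forall>x\<in>Q. \<exists>\<theta>. mat_ac (A x) *v u = \<theta> *s u)" if "finite Q" "Q \<subseteq> R" for Q
    using that
  proof (induction Q rule: finite_induct)
    case empty
    have "vec_ac w0 \<in> W" "vec_ac w0 \<noteq> 0"
      using w0 by (auto simp: W_def vec_ac_simps intro: vec.span_base)
    then show ?case by blast
  next
    case (insert x Q)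
    have xR: "x \<in> R" and QR: "Q \<subseteq> R" using insert.prems by auto
    have "\<exists>u\<in>W. u \<noteq> 0 \<and> (\<forall>x\<in>Q. \<exists>\<theta>. mat_ac (A x) *v u = \<theta> *s u)" by (rule insert.IH[OF QR])
    then obtain u where u: "u \<in> W" "u \<noteq> 0" and uQ: "\<forall>y\<in>Q. \<exists>\<theta>. mat_ac (A y) *v u = \<theta> *s u"
      by (elim bexE conjE)
    have "degree [:- to_ac (a x), 0, 1:] > 0" by simp
    then obtain \<theta> where "poly [:- to_ac (a x), 0, 1:] \<theta> = 0" using alg_closed_imp_poly_has_root by blast
    then have \<theta>: "\<theta> * \<theta> = to_ac (a x)" by simp
    define u' where "u' = mat_ac (A x) *v u + \<theta> *s u"
    show ?case
    proof (cases "u' = 0")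
      case True
      then have "mat_ac (A x) *v u = (- \<theta>) *s u" by (simp add: u'_def eq_neg_iff_add_eq_0)
      then have "\<exists>\<theta>. mat_ac (A x) *v u = \<theta> *s u" by (rule exI)
      then show ?thesis using u uQ by (intro bexI[of _ u] conjI ballI) (auto simp del: vec.scale_minus_left)
    next
      case False
      have "u' \<in> W" unfolding u'_def using W_closed[OF xR u(1)] u(1)
        by (auto simp: W_def intro!: vec.span_add vec.span_scale)
      moreover have xu: "mat_ac (A x) *v u' = \<theta> *s u'"
        using sq_ac[OF xR u(1)]
        by (simp add: u'_def matrix_vector_right_distrib vec.scale vec.scale_right_distrib vector_smult_assoc \<theta> add.commute)
      moreover have yu: "\<exists>\<theta>'. mat_ac (A y) *v u' = \<theta>' *s u'" if y: "y \<in> Q" for y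
      proof -
        obtain \<theta>' where \<theta>': "mat_ac (A y) *v u = \<theta>' *s u" using uQ y by blast
        have "mat_ac (A y) *v (mat_ac (A x) *v u) = \<theta>' *s (mat_ac (A x) *v u)"
          using comm_ac[of x y u] xR y QR u(1) by (auto simp: \<theta>' vec.scale)
        then have "mat_ac (A y) *v u' = \<theta>' *s u'"
          by (simp add: u'_def matrix_vector_right_distrib vec.scale \<theta>' vec.scale_right_distrib vector_smult_assoc mult.commute)
        then show ?thesis by blast
      qed
      ultimately show ?thesis using False xu by (intro bexI[of _ u']) auto
    qed
  qed
  from this[OF finR order_refl] obtain u where u: "u \<in> W" "u \<noteq> 0"
    and uR: "\<forall>x\<in>R. \<exists>\<theta>. mat_ac (A x) *v u = \<theta> *s u"
    by (elim bexE conjE)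
  then obtain \<theta> where \<theta>: "\<And>x. x \<in> R \<Longrightarrow> mat_ac (A x) *v u = \<theta> x *s u" by metis
  have \<theta>2: "\<theta> x ^ 2 = to_ac (a x)" if "x \<in> R" for x
  proof -
    have "(\<theta> x * \<theta> x) *s u = to_ac (a x) *s u"
      using sq_ac[OF that u(1)] by (simp add: \<theta>[OF that] vec.scale vector_smult_assoc)
    then show ?thesis using u(2) by (simp add: power2_eq_square)
  qed
  have anz: "a x \<noteq> 0" if "x \<in> R" for x
  proof -
    have "c x \<noteq> 0" by (rule c_nz[OF H_carrier[OF Stab(1)]]) (use R that in blast)
    then show ?thesis using a(1)[OF that] by auto
  qed
  have \<theta>nz: "\<theta> x \<noteq> 0" if "x \<in> R" for x using \<theta>2[OF that] anz[OF that] by auto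
  \<comment> \<open>\<open>a x\<close> is \<open>c x\<close> only up to sign; as \<open>- 1\<close>
    is a square, this does not affect square classes.\<close>
  obtain i :: 'a where i: "i^2 = -1" using sqrt_minus_one_exists[OF roots] by blast
  have ratio: "x = y" if x: "x \<in> R" and y: "y \<in> R" and t: "\<theta> x / \<theta> y = to_ac t" for x y t
  proof -
    have "\<theta> x = to_ac t * \<theta> y" using t \<theta>nz[OF y] by (simp add: divide_eq_eq)
    then have "\<theta> x ^ 2 = to_ac t ^ 2 * \<theta> y ^ 2" by (simp only: power_mult_distrib)
    then have "to_ac (a x) = to_ac (t^2 * a y)" unfolding \<theta>2[OF x] \<theta>2[OF y] by simp
    then have "a x = t^2 * a y" by (simp only: to_ac_eq_iff)
    then have "c x = t^2 * c y \<or> c x = (i * t)^2 * c y"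
      using a(1)[OF x] a(1)[OF y] i by (auto simp: power_mult_distrib minus_equation_iff[of "c x"])
    then show ?thesis using dist[OF y x] by blast
  qed
  have inj: "inj_on \<theta> R"
  proof (rule inj_onI)
    fix x y assume "x \<in> R" "y \<in> R" "\<theta> x = \<theta> y"
    then show "x = y" using ratio[of x y 1] \<theta>nz by simp
  qed
  define l' where "l' = (\<lambda>t. to_ac (l (inv_into R \<theta> t)))"
  have "(\<Sum>x\<in>R. to_ac (l x) * \<theta> x) *s u = 0"
    using rel_ac[OF u(1)] by (simp add: \<theta> vector_smult_assoc vec.scale_sum_left)
  then have "(\<Sum>x\<in>R. to_ac (l x) * \<theta> x) = 0" using u(2) by simp
  then have sum0: "(\<Sum>t\<in>\<theta> ` R. l' t * t) = 0"
    by (simp add: sum.reindex[OF inj] l'_def inv_into_f_f[OF inj])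
  have "subfield_set (range (to_ac :: 'a \<Rightarrow> _))"
    unfolding subfield_set_def
    by (auto simp flip: to_ac_1 to_ac_diff to_ac_mult to_ac_inverse)
  then have "\<theta> ` R = {}"
  proof (rule sqrt_independent[rotated, where x = l'])
    show "finite (\<theta> ` R)" using finR by simp
    show "(2 :: 'a alg_closure) \<noteq> 0" using two by (metis to_ac_eq_0_iff to_ac_numeral)
    show "t \<noteq> 0 \<and> t^2 \<in> range to_ac" if "t \<in> \<theta> ` R" for t using that \<theta>nz \<theta>2 by auto
    show "t / s \<notin> range to_ac" if "t \<in> \<theta> ` R" "s \<in> \<theta> ` R" "t \<noteq> s" for t s
      using that ratio by blast
    show "l' t \<in> range to_ac \<and> l' t \<noteq> 0" if "t \<in> \<theta> ` R" for t
      using that l by (auto simp: l'_def inv_into_f_f[OF inj])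
  qed (rule sum0)
  then show ?thesis by simp
qed

text \<open>A shortest relation has pairwise commuting support, since conjugating it by one of its
  members multiplies the coefficients by signs.\<close>

lemma operators_independent:
  assumes "R \<subseteq> Stab" "\<And>x y r. x \<in> R \<Longrightarrow> y \<in> R \<Longrightarrow> c y = r^2 * c x \<Longrightarrow> x = y"
    "\<And>x. x \<in> R \<Longrightarrow> l x \<noteq> 0" "\<And>w. w \<in> Eig \<eta> \<Longrightarrow> (\<Sum>x\<in>R. l x *s (A x *v w)) = 0"
  shows "R = {}"
  using assms
proof (induction "card R" arbitrary: R l rule: less_induct)
  case less
  note R = less.prems(1) and dist = less.prems(2) and l = less.prems(3) and rel = less.prems(4)
  have finR: "finite R" using R finH by (auto simp: Stab_def intro: finite_subset)
  have "\<forall>x y. \<exists>e. x \<in> Stab \<longrightarrow> y \<in> Stab \<longrightarrow> (\<forall>w\<in>Eig \<eta>. A x *v (A y *v w) = e *s (A y *v (A x *v w)))"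
    using Stab_commute by blast
  then obtain e where e: "\<And>x y w. x \<in> Stab \<Longrightarrow> y \<in> Stab \<Longrightarrow> w \<in> Eig \<eta> \<Longrightarrow>
      A x *v (A y *v w) = e x y *s (A y *v (A x *v w))" by metis
  have eq: "e x y = e x' y" if xx: "x \<in> R" "x' \<in> R" and y: "y \<in> R" for x x' y
  proof -
    have yS: "y \<in> Stab" and yc: "y \<in> carrier G" using y R Stab(1) H_carrier by auto
    \<comment> \<open>Moving \<open>A y\<close> through the relation multiplies the coefficient of
      \<open>z\<close> by \<open>e z y\<close>. Subtracting \<open>e x' y\<close> times the relation
      kills the term of \<open>x'\<close>.\<close>
    define m where "m = (\<lambda>z. l z * (e z y - e x' y))"
    define R' where "R' = {z \<in> R. m z \<noteq> 0}"
    have "R' \<subset> R" using xx by (auto simp: R'_def m_def)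
    then have lt: "card R' < card R" using finR by (rule psubset_card_mono[rotated])
    have rel': "(\<Sum>z\<in>R'. m z *s (A z *v w)) = 0" if w: "w \<in> Eig \<eta>" for w
    proof -
      have "A y *v (\<Sum>z\<in>R. (l z * e z y) *s (A z *v w)) = (\<Sum>z\<in>R. l z *s (A z *v (A y *v w)))"
      proof -
        have "A y *v (\<Sum>z\<in>Q. (l z * e z y) *s (A z *v w)) = (\<Sum>z\<in>Q. l z *s (A z *v (A y *v w)))" if "Q \<subseteq> R" "finite Q" for Q
          using that(2,1)
        proof (induction Q rule: finite_induct)
          case (insert z Q)
          then show ?case using e[of z y w] R yS w by (auto simp: act_lin vector_smult_assoc)
        qed simp
        then show ?thesis using finR by blast
      qed
      also have "\<dots> = 0" by (rule rel[OF Stab(2)[OF yS w]])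
      finally have "A y *v (\<Sum>z\<in>R. (l z * e z y) *s (A z *v w)) = A y *v 0" by simp
      then have 1: "(\<Sum>z\<in>R. (l z * e z y) *s (A z *v w)) = 0" by (rule act_cancel[OF yc])
      have "(\<Sum>z\<in>R'. m z *s (A z *v w)) = (\<Sum>z\<in>R. m z *s (A z *v w))"
        by (rule sum.mono_neutral_left) (use finR in \<open>auto simp: R'_def\<close>)
      also have "\<dots> = (\<Sum>z\<in>R. (l z * e z y) *s (A z *v w)) - e x' y *s (\<Sum>z\<in>R. l z *s (A z *v w))"
        unfolding m_def vec.scale_sum_right sum_subtractf[symmetric]
        by (intro sum.cong refl) (simp add: vec_eq_iff algebra_simps)
      also have "\<dots> = 0" unfolding 1 rel[OF w] by simp
      finally show ?thesis .
    qed
    have "R' = {}"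
    proof (rule less.hyps[OF lt])
      show "R' \<subseteq> Stab" using R by (auto simp: R'_def)
      show "x = y" if "x \<in> R'" "y \<in> R'" "c y = r^2 * c x" for x y r
        using dist[of x y r] that by (simp add: R'_def)
      show "m z \<noteq> 0" if "z \<in> R'" for z using that by (simp add: R'_def)
    qed (rule rel')
    then have "m x = 0" using xx(1) by (auto simp: R'_def)
    then show ?thesis using l[OF xx(1)] by (simp add: m_def)
  qed
  have comm: "A x *v (A y *v w) = A y *v (A x *v w)" if "x \<in> R" "y \<in> R" "w \<in> Eig \<eta>" for x y w
  proof -
    have yS: "y \<in> Stab" and yc: "y \<in> carrier G" using that R Stab(1) H_carrier by auto
    \<comment> \<open>The case of \<open>y\<close> against itself gives \<open>e y y = 1\<close>,
      and \<open>eq\<close> transfers this to every \<open>e x y\<close>.\<close>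
    have "A y *v (A y *v w0) \<noteq> 0" using act_inj[OF yc] w0(2) by blast
    moreover have "A y *v (A y *v w0) = e y y *s (A y *v (A y *v w0))" by (rule e[OF yS yS w0(1)])
    then have "(e y y - 1) *s (A y *v (A y *v w0)) = 0" by (simp add: vec.scale_left_diff_distrib)
    ultimately have "e y y = 1" by simp
    then have "e x y = 1" using eq[OF that(1) that(2) that(2)] by simp
    then show ?thesis using e[of x y w] that R by auto
  qed
  show ?case by (rule commuting_independent[OF R dist comm l rel])
qed

end

context similitude_block
begin

text \<open>Operators on the block are square matrices of size \<open>card B\<close>, and
  \<open>operators_independent\<close> bounds their number by the dimension. The injection
  \<open>e\<close> of the basis into \<open>'n\<close> turns them into vectors supported on
  \<open>D\<close>.\<close>

lemma card_independent_operators: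
  assumes R: "R \<subseteq> Stab" and dist: "\<And>x y r. x \<in> R \<Longrightarrow> y \<in> R \<Longrightarrow> c y = r^2 * c x \<Longrightarrow> x = y"
  shows "card R \<le> card B * card B"
proof -
  have finR: "finite R" using R finH by (auto simp: Stab_def intro: finite_subset)
  obtain e :: "'a ^ 'n \<Rightarrow> 'n" where e: "inj_on e B"
    using card_le_inj[OF B(4) _ card_B] by auto
  define coord where "coord = (\<lambda>x b b'. vec.representation B (A x *v b) b')"
  have expand: "A x *v b = (\<Sum>b'\<in>B. coord x b b' *s b')" if "x \<in> R" "b \<in> B" for x b
  proof -
    have "A x *v b \<in> vec.span B" using Stab(2)[of x b] R B that by blast
    then show ?thesis unfolding coord_def by (rule vec.sum_representation_eq[OF B(2) _ B(4) order_refl, symmetric])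
  qed
  define D where "D = e ` B \<times> e ` B"
  define g where "g = inv_into B e"
  have g: "g (e b) = b" if "b \<in> B" for b using that e by (simp add: g_def inv_into_f_f)
  define m :: "_ \<Rightarrow> 'a ^ ('n \<times> 'n)" where
    "m = (\<lambda>x. \<chi> p. if p \<in> D then coord x (g (fst p)) (g (snd p)) else 0)"
  have rel: "f x = 0" if "(\<Sum>x\<in>R. f x *s m x) = 0" "x \<in> R" for f x
  proof -
    have zero: "(\<Sum>x\<in>R. f x * coord x b b') = 0" if "b \<in> B" "b' \<in> B" for b b'
      using arg_cong[OF \<open>(\<Sum>x\<in>R. f x *s m x) = 0\<close>, of "\<lambda>z. z $ (e b, e b')"] that
      by (simp add: m_def D_def g)
    have onB: "(\<Sum>x\<in>R. f x *s (A x *v b)) = 0" if b: "b \<in> B" for b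
    proof -
      have "(\<Sum>x\<in>R. f x *s (A x *v b)) = (\<Sum>x\<in>R. \<Sum>b'\<in>B. (f x * coord x b b') *s b')"
        by (intro sum.cong refl) (simp add: expand[OF _ b] vec.scale_sum_right vector_smult_assoc)
      also have "\<dots> = (\<Sum>b'\<in>B. \<Sum>x\<in>R. (f x * coord x b b') *s b')" by (rule sum.swap)
      also have "\<dots> = (\<Sum>b'\<in>B. (\<Sum>x\<in>R. f x * coord x b b') *s b')"
        by (simp add: vec.scale_sum_left)
      also have "\<dots> = 0" by (rule sum.neutral) (simp add: zero[OF b])
      finally show ?thesis .
    qed
    let ?N = "{w. (\<Sum>x\<in>R. f x *s (A x *v w)) = 0}"
    have "vec.subspace ?N"
    proof -
      have "(\<Sum>x\<in>R. f x *s (A x *v (k *s w))) = k *s (\<Sum>x\<in>R. f x *s (A x *v w))" for k w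
        by (simp add: vec.scale vec.scale_sum_right vector_smult_assoc mult.commute)
      then show ?thesis
        by (auto simp: vec.subspace_def matrix_vector_right_distrib vec.scale_right_distrib sum.distrib)
    qed
    then have "vec.span B \<subseteq> ?N" by (intro vec.span_minimal) (use onB in auto)
    then have all: "(\<Sum>x\<in>R. f x *s (A x *v w)) = 0" if "w \<in> Eig \<eta>" for w using B(3) that by blast
    have "{x \<in> R. f x \<noteq> 0} = {}"
    proof (rule operators_independent[where l = f])
      show "{x \<in> R. f x \<noteq> 0} \<subseteq> Stab" using R by blast
      show "x = y" if "x \<in> {x \<in> R. f x \<noteq> 0}" "y \<in> {x \<in> R. f x \<noteq> 0}" "c y = r^2 * c x" for x y r
        using dist[of x y r] that by simp
      show "f x \<noteq> 0" if "x \<in> {x \<in> R. f x \<noteq> 0}" for x using that by simp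
      show "(\<Sum>x\<in>{x \<in> R. f x \<noteq> 0}. f x *s (A x *v w)) = 0" if "w \<in> Eig \<eta>" for w
        using all[OF that] by (subst sum.mono_neutral_left[OF finR, of "{x \<in> R. f x \<noteq> 0}"]) auto
    qed
    then show ?thesis using \<open>x \<in> R\<close> by blast
  qed
  have inj: "inj_on m R"
  proof (rule inj_onI, rule ccontr)
    fix x y assume xy: "x \<in> R" "y \<in> R" "m x = m y" "x \<noteq> y"
    define f where "f = (\<lambda>z. if z = x then 1 else if z = y then -1 else 0 :: 'a)"
    have "(\<Sum>z\<in>R. f z *s m z) = (\<Sum>z\<in>{x, y}. f z *s m z)"
      by (rule sum.mono_neutral_right) (use finR xy in \<open>auto simp: f_def\<close>)
    also have "\<dots> = 0" using xy by (simp add: f_def)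
    finally have "f x = 0" by (rule rel) (rule xy(1))
    then show False by (simp add: f_def)
  qed
  have "vec.independent (m ` R)"
  proof (rule vec.independent_if_scalars_zero)
    show "finite (m ` R)" using finR by simp
    fix f z assume 0: "(\<Sum>z\<in>m ` R. f z *s z) = 0" and z: "z \<in> m ` R"
    have "(\<Sum>x\<in>R. f (m x) *s m x) = 0" using 0 by (simp add: sum.reindex[OF inj])
    then show "f z = 0" using rel[of "\<lambda>x. f (m x)"] z by blast
  qed
  moreover have "m ` R \<subseteq> {z. \<forall>p. p \<notin> D \<longrightarrow> z $ p = 0}" by (auto simp: m_def)
  ultimately have "card (m ` R) \<le> vec.dim {z :: 'a ^ ('n \<times> 'n). \<forall>p. p \<notin> D \<longrightarrow> z $ p = 0}"
    by (rule vec.independent_card_le_dim[rotated])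
  also have "\<dots> = card D" by (rule dim_substandard_cart)
  also have "\<dots> = card B * card B" by (simp add: D_def card_cartesian_product card_image[OF e])
  finally show ?thesis by (simp add: card_image[OF inj])
qed

text \<open>Stabiliser elements in the same square class differ by an element of \<open>H0\<close>.
  One representative of each class gives a set of independent operators.\<close>

lemma card_Stab_le: "card Stab \<le> card B * card B * card H0"
proof -
  define cls where "cls = (\<lambda>x. {y \<in> Stab. \<exists>r. r \<noteq> 0 \<and> c y = r^2 * c x})"
  have self: "x \<in> cls x" if "x \<in> Stab" for x using that by (auto simp: cls_def intro!: exI[of _ 1])
  have carr: "x \<in> carrier G" if "x \<in> Stab" for x using that Stab(1) H_carrier by blast
  have cls_eq: "cls x = cls y" if "x \<in> Stab" "y \<in> Stab" "c y = r^2 * c x" for x y r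
  proof -
    have r: "r \<noteq> 0" using that c_nz[OF carr] by auto
    have "(\<exists>s. s \<noteq> 0 \<and> c z = s^2 * c x) \<longleftrightarrow> (\<exists>s. s \<noteq> 0 \<and> c z = s^2 * c y)" for z
    proof
      assume "\<exists>s. s \<noteq> 0 \<and> c z = s^2 * c x"
      then obtain s where s: "s \<noteq> 0" "c z = s^2 * c x" by blast
      have "c z = (s / r)^2 * c y" using r by (simp add: s(2) that(3) power_divide)
      then show "\<exists>s. s \<noteq> 0 \<and> c z = s^2 * c y" using r s(1) by (intro exI[of _ "s / r"]) simp
    next
      assume "\<exists>s. s \<noteq> 0 \<and> c z = s^2 * c y"
      then obtain s where s: "s \<noteq> 0" "c z = s^2 * c y" by blast
      have "c z = (s * r)^2 * c x" by (simp add: s(2) that(3) power_mult_distrib)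
      then show "\<exists>s. s \<noteq> 0 \<and> c z = s^2 * c x" using r s(1) by (intro exI[of _ "s * r"]) simp
    qed
    then show ?thesis by (simp add: cls_def)
  qed
  have StabH: "Stab \<subseteq> H" by (auto simp: Stab_def)
  have "card Stab \<le> card (cls ` Stab) * card H0"
  proof (rule card_le_fibres[OF H finH _ StabH])
    show "finite H0" using finH by (simp add: H0_def)
    fix x y assume xy: "x \<in> Stab" "y \<in> Stab" "cls x = cls y"
    have "y \<in> cls x" using self[OF xy(2)] xy(3) by simp
    then obtain r where r: "c y = r^2 * c x" unfolding cls_def by blast
    obtain k where k: "\<And>v. A (inv x \<otimes> y) *v v = k *s (A (inv x) *v (A y *v v))"
      using mult[of "inv x" y] carr xy by auto
    obtain k1 where k1: "\<And>v. A (inv x) *v (A x *v v) = k1 *s v" using inv_act[OF carr[OF xy(1)]] by blast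
    obtain v :: "'a ^ 'n" where v: "v \<noteq> 0" using exists_nonzero by blast
    have "c (inv x) * c x * qf v = k1^2 * qf v"
      using sim[of "inv x" "A x *v v"] sim[of x v] carr[OF xy(1)] by (auto simp add: k1 qf_scale mult.assoc)
    then have "c (inv x) * c x = k1^2" using aniso[OF v] by simp
    moreover have "c (inv x \<otimes> y) = k^2 * c (inv x) * c y"
      by (rule c_mult[OF _ _ k]) (use carr xy in auto)
    ultimately have "(k * k1 * r)^2 = c (inv x \<otimes> y)" by (simp add: r power_mult_distrib mult_ac)
    then show "inv x \<otimes> y \<in> H0"
      unfolding H0_def
      using H_closed(1)[OF H_closed(2)[OF Stab(1)[OF xy(1)]] Stab(1)[OF xy(2)]]
      by (intro CollectI conjI exI[of _ "k * k1 * r"])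
  qed
  note fibres = this
  have "\<exists>R\<subseteq>Stab. inj_on cls R \<and> cls ` Stab = cls ` R"
    using subset_image_inj[of "cls ` Stab" cls Stab] by simp
  then obtain R where R: "R \<subseteq> Stab" "inj_on cls R" "cls ` Stab = cls ` R" by (elim exE conjE)
  have "card R \<le> card B * card B"
  proof (rule card_independent_operators[OF R(1)])
    fix x y r assume xy: "x \<in> R" "y \<in> R" "c y = r^2 * c x"
    have "cls x = cls y" by (rule cls_eq[OF _ _ xy(3)]) (use R(1) xy in auto)
    then show "x = y" by (rule inj_onD[OF R(2) _ xy(1,2)])
  qed
  then have "card (cls ` Stab) \<le> card B * card B" by (simp add: R(3) card_image[OF R(2)])
  then have "card (cls ` Stab) * card H0 \<le> card B * card B * card H0" by (rule mult_le_mono1)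
  with fibres show ?thesis by (rule le_trans)
qed

end

context finite_similitude_subgroup
begin

text \<open>The orbit of the block contributes \<open>s\<close>, the square classes in the
  stabiliser \<open>d * d\<close>, and \<open>H0\<close> half of \<open>2 ^ s\<close>; the half is
  moved to the left-hand side.\<close>

lemma card_bound:
  obtains s d where "s \<ge> 1" "d \<ge> 1" "s * d \<le> CARD('n)" "2 * card H \<le> s * (d * d * 2 ^ s)"
proof -
  obtain \<eta> B where block: "\<eta> \<in> Wts" "B \<subseteq> Eig \<eta>" "vec.independent B" "Eig \<eta> \<subseteq> vec.span B" "finite B"
    "card B \<ge> 1" "card Wts * card B \<le> CARD('n)" "card Wts \<ge> 1"
    by (rule minimal_block)
  have "card B \<le> card Wts * card B" using block(8) by simp
  then have le: "card B \<le> CARD('n)" using block(7) by linarith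
  interpret similitude_block M G A c H \<eta> B
    by unfold_locales (use block le in auto)
  have "2 * card H \<le> 2 * (card Wts * (card B * card B * card H0))"
    using card_H_le_Stab card_Stab_le by (meson mult_le_mono2 order_trans)
  also have "\<dots> = card Wts * (card B * card B * (2 * card H0))" by simp
  also have "\<dots> \<le> card Wts * (card B * card B * 2 ^ card Wts)"
    using card_S card_S_le by (intro mult_le_mono2) simp
  finally show ?thesis using that[OF block(8) block(6) block(7)] by blast
qed

theorem card_le_8_power: "card H \<le> 8 ^ (CARD('n) - 1)"
proof -
  let ?n = "CARD('n)"
  obtain s d where sd: "s \<ge> 1" "d \<ge> 1" "s * d \<le> ?n" "2 * card H \<le> s * (d * d * 2 ^ s)"
    by (rule card_bound)
  have s: "s \<le> ?n" using sd by (metis le_trans mult.right_neutral mult_le_mono2)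
  have d: "d \<le> ?n" using sd by (metis le_trans mult.commute mult.right_neutral mult_le_mono2)
  \<comment> \<open>Each of two factors \<open>n\<close> is replaced by \<open>2 ^ (n - 1)\<close>;
    with half of \<open>2 ^ n\<close> this makes the cube \<open>8 ^ (n - 1)\<close>.\<close>
  have n: "?n \<le> 2 ^ (?n - 1)" using less_exp[of "?n - 1"] by (metis Suc_leI Suc_pred' zero_less_card_finite)
  have "s * (d * d * 2 ^ s) = (s * d) * d * 2 ^ s" by (simp add: mult_ac)
  also have "\<dots> \<le> ?n * ?n * 2 ^ ?n" using sd(3) d s by (intro mult_le_mono power_increasing) auto
  also have "\<dots> \<le> 2 ^ (?n - 1) * 2 ^ (?n - 1) * 2 ^ ?n" using n by (intro mult_le_mono) auto
  also have "\<dots> = 2 * 8 ^ (?n - 1)"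
  proof -
    have "(8::nat) ^ (?n - 1) = 2 ^ (?n - 1) * 2 ^ (?n - 1) * 2 ^ (?n - 1)" by (simp flip: power_mult_distrib)
    moreover have "(2::nat) ^ ?n = 2 * 2 ^ (?n - 1)" by (metis Suc_pred' power_Suc zero_less_card_finite)
    ultimately show ?thesis by simp
  qed
  finally show ?thesis using sd(4) by simp
qed

theorem card_le_32:
  assumes n: "CARD('n) = 4" shows "card H \<le> 32"
proof -
  obtain s d where sd: "s \<ge> 1" "d \<ge> 1" "s * d \<le> 4" "2 * card H \<le> s * (d * d * 2 ^ s)"
    using card_bound unfolding n by blast
  have "s \<le> 4" "d \<le> 4" using sd(1-3)
    by (metis le_trans mult.right_neutral mult_le_mono2, metis le_trans mult.commute mult.right_neutral mult_le_mono2)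
  then have "s \<in> {1, 2, 3, 4}" "d \<in> {1, 2, 3, 4}" using sd(1,2) by auto
  \<comment> \<open>The value 64 occurs only for \<open>s = 4\<close>, \<open>d = 1\<close>; blocks
    of dimension 2 or 4 give at most 32.\<close>
  then have "s * (d * d * 2 ^ s) \<le> 64" using sd(3) by auto
  then show ?thesis using sd(4) by simp
qed

text \<open>All multipliers are squares here, so \<open>H\<close> is \<open>H0\<close> and is
  bounded by the signs alone, without an orbit or square classes.\<close>

theorem card_le_2_power_odd:
  assumes n: "odd CARD('n)" shows "card H \<le> 2 ^ (CARD('n) - 1)"
proof -
  have "H0 = H" using multiplier_square_odd[OF n H_carrier] by (auto simp: H0_def)
  then have "2 * card H \<le> 2 ^ card Wts" using card_S card_S_le by simp
  moreover obtain \<eta> B where "card (B :: ('a ^ 'n) set) \<ge> 1" "card Wts * card B \<le> CARD('n)"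
    by (rule minimal_block)
  then have "card Wts \<le> CARD('n)" by (metis le_trans mult.right_neutral mult_le_mono2)
  then have "(2::nat) ^ card Wts \<le> 2 ^ CARD('n)" by simp
  moreover have "(2::nat) ^ CARD('n) = 2 * 2 ^ (CARD('n) - 1)"
    by (metis Suc_pred' power_Suc zero_less_card_finite)
  ultimately show ?thesis by simp
qed

end

section \<open>Automorphisms induced by matrices\<close>

text \<open>Elements of \<open>Bij\<close> are extensional, so the map has to be restricted to the
  points of the quadric.\<close>

definition induced :: "('n::finite, 'a::field) mvpoly \<Rightarrow> 'a ^ 'n ^ 'n \<Rightarrow>
    ('a alg_closure ^ 'n) set \<Rightarrow> ('a alg_closure ^ 'n) set" where
  "induced q A = (\<lambda>P\<in>geometric_points q. (\<lambda>z. mat_ac A *v z) ` P)"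

lemma geometric_pointI: "z \<noteq> 0 \<Longrightarrow> mv_eval to_ac q z = 0 \<Longrightarrow> proj_point z \<in> geometric_points q"
  by (auto simp: hypersurface_points_def)

lemma geometric_pointE:
  assumes "P \<in> geometric_points q"
  obtains z where "P = proj_point z" "z \<noteq> 0" "mv_eval to_ac q z = 0"
  using assms by (auto simp: hypersurface_points_def)

lemma image_proj_point: "(\<lambda>z. T *v z) ` proj_point x = proj_point (T *v x)"
  for T :: "'k::field ^ 'n ^ 'n"
proof -
  have "T *v (c *s x) = c *s (T *v x)" for c by (simp add: vec.scale)
  then show ?thesis unfolding proj_point_def by (auto simp: image_iff) metis
qed

lemma induced_point:
  "z \<noteq> 0 \<Longrightarrow> mv_eval to_ac q z = 0 \<Longrightarrow> induced q A (proj_point z) = proj_point (mat_ac A *v z)"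
  by (simp add: induced_def geometric_pointI image_proj_point)

lemma extensional_eq_induced:
  assumes "\<phi> \<in> extensional (geometric_points q)"
    and "\<And>z. z \<noteq> 0 \<Longrightarrow> mv_eval to_ac q z = 0 \<Longrightarrow> \<phi> (proj_point z) = proj_point (mat_ac A *v z)"
  shows "\<phi> = induced q A"
proof (rule extensionalityI[OF assms(1)])
  show "induced q A \<in> extensional (geometric_points q)" by (simp add: induced_def)
  fix P assume "P \<in> geometric_points q"
  then obtain z where "P = proj_point z" "z \<noteq> 0" "mv_eval to_ac q z = 0" by (rule geometric_pointE)
  then show "\<phi> P = induced q A P" using assms(2) by (simp add: induced_point)
qed

lemma regular_map_linear:
  assumes A: "\<And>z. mat_ac A *v z = 0 \<Longrightarrow> z = 0"
    and \<phi>: "\<And>z. z \<noteq> 0 \<Longrightarrow> mv_eval to_ac q z = 0 \<Longrightarrow> \<phi> (proj_point z) = proj_point (mat_ac A *v z)"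
  shows "regular_map q \<phi>"
  unfolding regular_map_def
proof (intro allI impI)
  fix x :: "'a alg_closure ^ 'b" assume x: "x \<noteq> 0 \<and> mv_eval to_ac q x = 0"
  \<comment> \<open>A nonzero constant has degree 0 and makes one linear formula valid
    everywhere.\<close>
  let ?g = "Poly_Mapping.single 0 1 :: ('b, 'a) mvpoly"
  have g: "mv_eval to_ac ?g y = 1" for y :: "'a alg_closure ^ 'b"
    by (subst mv_eval_single) simp_all
  have f: "(\<chi> j. mv_eval to_ac (linear_form (A $ j)) y) = mat_ac A *v y" for y
    by (simp add: mv_eval_linear_form matrix_vector_mult_def mat_ac_def vec_eq_iff)
  show "\<exists>(d::nat) (e::nat) (f :: 'b \<Rightarrow> ('b, 'a) mvpoly) (g :: ('b, 'a) mvpoly).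
     (\<forall>j. homogeneous d (f j)) \<and> homogeneous e g \<and> mv_eval to_ac g x \<noteq> 0 \<and>
     (\<forall>y. y \<noteq> 0 \<and> mv_eval to_ac q y = 0 \<and> mv_eval to_ac g y \<noteq> 0 \<longrightarrow>
        (\<chi> j. mv_eval to_ac (f j) y) \<noteq> 0 \<and>
        \<phi> (proj_point y) = proj_point (\<chi> j. mv_eval to_ac (f j) y))"
  proof (rule exI[of _ 1], rule exI[of _ 0], rule exI[of _ "\<lambda>j. linear_form (A $ j)"], rule exI[of _ ?g], intro conjI allI impI)
    show "homogeneous 1 (linear_form (A $ j))" for j by (rule homogeneous_linear_form)
    show "homogeneous 0 ?g" by (simp add: homogeneous_def)
    show "mv_eval to_ac ?g x \<noteq> 0" unfolding g by simp
    fix y :: "'a alg_closure ^ 'b" assume "y \<noteq> 0 \<and> mv_eval to_ac q y = 0 \<and> mv_eval to_ac ?g y \<noteq> 0"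
    then show "(\<chi> j. mv_eval to_ac (linear_form (A $ j)) y) \<noteq> 0"
      "\<phi> (proj_point y) = proj_point (\<chi> j. mv_eval to_ac (linear_form (A $ j)) y)"
      unfolding f using A \<phi> by blast+
  qed
qed

lemma induced_automorphism:
  assumes inv: "A ** A' = mat 1" "A' ** A = mat 1"
    and k: "k \<noteq> 0" "\<And>z. mv_eval to_ac q (mat_ac A *v z) = k * mv_eval to_ac q z"
  shows "induced q A \<in> carrier (Aut_hypersurface q)"
    "induced q A' \<in> Bij (geometric_points q)"
    "P \<in> geometric_points q \<Longrightarrow> induced q A' (induced q A P) = P"
    "P \<in> geometric_points q \<Longrightarrow> induced q A (induced q A' P) = P"
proof -
  let ?S = "geometric_points q"
  have TT: "mat_ac A *v (mat_ac A' *v z) = z" "mat_ac A' *v (mat_ac A *v z) = z" for z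
    by (simp_all add: matrix_vector_mul_assoc mat_ac_mult[symmetric] inv mat_ac_one)
  have nz: "mat_ac A *v z \<noteq> 0" "mat_ac A' *v z \<noteq> 0" if "z \<noteq> 0" for z
    using TT[of z] that by (metis matrix_vector_mult_0_right)+
  have q0: "mv_eval to_ac q (mat_ac A *v z) = 0" "mv_eval to_ac q (mat_ac A' *v z) = 0"
    if "mv_eval to_ac q z = 0" for z
    using k(2)[of z] k(2)[of "mat_ac A' *v z"] k(1) that by (auto simp: TT)
  show 1: "induced q A' (induced q A P) = P" if "P \<in> ?S" for P
    using that by (elim geometric_pointE) (simp add: induced_point nz q0 TT)
  show 2: "induced q A (induced q A' P) = P" if "P \<in> ?S" for P
    using that by (elim geometric_pointE) (simp add: induced_point nz q0 TT)
  have in_S: "induced q A P \<in> ?S" "induced q A' P \<in> ?S" if "P \<in> ?S" for P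
    using that by (elim geometric_pointE; simp add: induced_point geometric_pointI nz q0)+
  have bij: "bij_betw (induced q A) ?S ?S" "bij_betw (induced q A') ?S ?S"
    by (rule bij_betw_byWitness[where f' = "induced q A'"]; use 1 2 in_S in blast)
       (rule bij_betw_byWitness[where f' = "induced q A"]; use 1 2 in_S in blast)
  have ext: "induced q B \<in> extensional ?S" for B by (simp add: induced_def)
  show "induced q A' \<in> Bij ?S" using bij ext by (simp add: Bij_def)
  have "regular_map q (induced q A)"
    by (rule regular_map_linear[of A]) (use nz induced_point in blast)+
  moreover have "regular_map q (inv_into ?S (induced q A))"
  proof (rule regular_map_linear[of A'])
    fix z assume z: "z \<noteq> 0" "mv_eval to_ac q z = 0"
    have P: "proj_point z \<in> ?S" by (rule geometric_pointI[OF z])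
    have "inv_into ?S (induced q A) (induced q A (induced q A' (proj_point z))) = induced q A' (proj_point z)"
      using bij(1) in_S(2)[OF P] by (intro inv_into_f_f) (auto simp: bij_betw_def)
    then show "inv_into ?S (induced q A) (proj_point z) = proj_point (mat_ac A' *v z)"
      unfolding 2[OF P] unfolding induced_point[OF z] .
  qed (use nz in blast)
  ultimately show "induced q A \<in> carrier (Aut_hypersurface q)"
    using bij ext by (simp add: Aut_hypersurface_def Bij_def)
qed

lemma Aut_mult:
  "\<phi> \<in> Bij (geometric_points q) \<Longrightarrow> \<psi> \<in> Bij (geometric_points q) \<Longrightarrow>
     \<phi> \<otimes>\<^bsub>Aut_hypersurface q\<^esub> \<psi> = compose (geometric_points q) \<phi> \<psi>"
  by (simp add: Aut_hypersurface_def BijGroup_def)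

lemma Aut_one: "\<one>\<^bsub>Aut_hypersurface q\<^esub> = (\<lambda>P\<in>geometric_points q. P)"
  by (simp add: Aut_hypersurface_def BijGroup_def)

lemma Aut_carrier_Bij: "\<phi> \<in> carrier (Aut_hypersurface q) \<Longrightarrow> \<phi> \<in> Bij (geometric_points q)"
  by (simp add: Aut_hypersurface_def)

text \<open>The isotropic vectors \<open>x + u + qf u *s y\<close> and
  \<open>x - u + qf u *s y\<close> isolate \<open>T *v u\<close>, and pairing with \<open>x\<close>,
  \<open>y\<close> and \<open>u\<close> equates the eigenvalues. This makes the matrix of an
  automorphism unique up to a scalar.\<close>

lemma (in quad_closed) eigen_on_quadric_scalar:
  assumes T: "\<And>z. z \<noteq> 0 \<Longrightarrow> qf z = 0 \<Longrightarrow> \<exists>\<nu>. T *v z = \<nu> *s z"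
  shows "\<exists>\<nu>. \<forall>v. T *v v = \<nu> *s v"
proof -
  obtain x where x: "x \<noteq> 0" "qf x = 0"
    using isotropic_exists n3 alg_closed_imp_poly_has_root by (metis One_nat_def Suc_1 Suc_leD numeral_3_eq_3)
  obtain y where h: "hyp x y" using hyp_exists[OF x] by blast
  have y: "y \<noteq> 0" "qf y = 0" using h hyp_nz[OF h] by (auto simp: hyp_def)
  obtain \<nu> where \<nu>: "T *v x = \<nu> *s x" using T[OF x] by blast
  obtain \<nu>' where \<nu>': "T *v y = \<nu>' *s y" using T[OF y] by blast
  have non: "T *v u = \<nu> *s u \<and> \<nu>' = \<nu>" if u: "u \<in> perp x y" "qf u \<noteq> 0" for u
  proof -
    have eig: "\<exists>\<mu>. \<nu> *s x + e *s (T *v u) + (qf u * \<nu>') *s y = \<mu> *s (x + e *s u + qf u *s y)"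
      if e: "e * e = 1" for e
    proof -
      have eu: "e *s u \<in> perp x y" by (rule perp_scale[OF u(1)])
      have ch: "chart x y (e *s u) = x + e *s u + qf u *s y" using e by (simp add: chart_def qf_scale power2_eq_square)
      obtain \<mu> where "T *v chart x y (e *s u) = \<mu> *s chart x y (e *s u)"
        using T[OF chart_nz[OF h eu] qf_chart[OF h eu]] by blast
      then show ?thesis unfolding ch
        by (auto simp: matrix_vector_right_distrib vec.scale \<nu> \<nu>' vector_smult_assoc)
    qed
    obtain \<mu> where \<mu>: "\<nu> *s x + 1 *s (T *v u) + (qf u * \<nu>') *s y = \<mu> *s (x + 1 *s u + qf u *s y)"
      using eig[of 1] by auto
    obtain \<mu>' where \<mu>': "\<nu> *s x + (-1) *s (T *v u) + (qf u * \<nu>') *s y = \<mu>' *s (x + (-1) *s u + qf u *s y)"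
      using eig[of "-1"] by auto
    have s: "(2 * \<nu>) *s x + (2 * (qf u * \<nu>')) *s y = (\<mu> + \<mu>') *s x + (\<mu> - \<mu>') *s u + ((\<mu> + \<mu>') * qf u) *s y"
      using arg_cong2[OF \<mu> \<mu>', of "(+)"] by (simp add: vec_eq_iff algebra_simps)
    have d: "2 *s (T *v u) = (\<mu> - \<mu>') *s x + (\<mu> + \<mu>') *s u + ((\<mu> - \<mu>') * qf u) *s y"
      using arg_cong2[OF \<mu> \<mu>', of "(-)"] by (simp add: vec_eq_iff algebra_simps)
    have "bf y ((2 * \<nu>) *s x + (2 * (qf u * \<nu>')) *s y) = bf y ((\<mu> + \<mu>') *s x + (\<mu> - \<mu>') *s u + ((\<mu> + \<mu>') * qf u) *s y)"
      using s by simp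
    then have 1: "2 * \<nu> = \<mu> + \<mu>'" using two by (simp add: bf_lin hyp_bf[OF h] perpD[OF u(1)] mult.commute)
    have "bf x ((2 * \<nu>) *s x + (2 * (qf u * \<nu>')) *s y) = bf x ((\<mu> + \<mu>') *s x + (\<mu> - \<mu>') *s u + ((\<mu> + \<mu>') * qf u) *s y)"
      using s by simp
    then have "qf u * (2 * \<nu>') = qf u * (\<mu> + \<mu>')"
      using two by (simp add: bf_lin hyp_bf[OF h] perpD[OF u(1)] mult_ac)
    then have 2: "2 * \<nu>' = \<mu> + \<mu>'" by (rule iffD1[OF mult_left_cancel[OF u(2)]])
    have "2 * \<nu> = 2 * \<nu>'" using 1 2 by simp
    then have eq: "\<nu>' = \<nu>" by (simp only: mult_left_cancel[OF two])
    have "bf u ((2 * \<nu>) *s x + (2 * (qf u * \<nu>')) *s y) = bf u ((\<mu> + \<mu>') *s x + (\<mu> - \<mu>') *s u + ((\<mu> + \<mu>') * qf u) *s y)"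
      using s by simp
    then have "\<mu> = \<mu>'" using u(2) by (simp add: bf_lin perpD[OF u(1)] qf_def)
    moreover from this have "\<nu> = \<mu>'" using 1 two by simp
    ultimately have "2 *s (T *v u) = 2 *s (\<nu> *s u)" using d by (simp add: vector_smult_assoc)
    then have "T *v u = \<nu> *s u" using two by (metis vector_mul_lcancel)
    then show ?thesis using eq by simp
  qed
  have all: "T *v v = \<nu> *s v" if v: "v \<in> perp x y" for v
  proof (cases "qf v = 0 \<and> v \<noteq> 0")
    case True
    obtain w where w: "w \<in> perp x y" "qf w \<noteq> 0" "bf w v \<noteq> 0"
      using perp_nonisotropic_bf[OF h v] True by blast
    have pm: "\<exists>e. (e = 1 \<or> e = -1) \<and> qf (v + e *s w) \<noteq> 0"
    proof (rule ccontr)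
      assume "\<not> ?thesis"
      then have "qf (v + 1 *s w) = 0" "qf (v + (-1) *s w) = 0" by blast+
      then have 1: "2 * bf v w + qf w = 0" and 2: "qf w - 2 * bf v w = 0"
        using True unfolding qf_add qf_scale bf_scale_right by simp_all
      have "2 * qf w = 0" using arg_cong2[OF 1 2, of "(+)"] by simp
      then show False using w(2) two by simp
    qed
    then obtain e where e: "e = 1 \<or> e = -1" "qf (v + e *s w) \<noteq> 0" by blast
    have "v + e *s w \<in> perp x y" using v w by (intro perp_add perp_scale)
    then have "T *v (v + e *s w) = \<nu> *s (v + e *s w)" using non e(2) by blast
    moreover have "T *v w = \<nu> *s w" using non w by blast
    ultimately show ?thesis
      by (simp add: matrix_vector_right_distrib vec.scale vec_eq_iff algebra_simps)
  qed (use non v in \<open>auto\<close>)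
  obtain u0 where "u0 \<in> perp x y" "qf u0 \<noteq> 0" using perp_nonisotropic[OF h n3] by blast
  then have eq: "\<nu>' = \<nu>" using non by blast
  have "T *v v = \<nu> *s v" for v
  proof -
    obtain u where u: "u \<in> perp x y" "v = (-2 * bf y v) *s x + (-2 * bf x v) *s y + u"
      using hyp_decomp[OF h] by blast
    show ?thesis
      by (subst (1 2) u(2)) (simp only: matrix_vector_right_distrib vec.scale \<nu> \<nu>' eq all[OF u(1)]
        vec.scale_right_distrib vector_smult_assoc mult.commute)
  qed
  then show ?thesis by blast
qed

section \<open>The automorphisms of a pointless quadric as a group of similitudes\<close>

context pointless_quadric
begin

definition matrix_of where
  "matrix_of \<phi> = (SOME A. \<exists>c. c \<noteq> 0 \<and> (\<forall>v. K.qf (A *v v) = c * K.qf v) \<and>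
     (\<forall>z. z \<noteq> 0 \<longrightarrow> ac.qf z = 0 \<longrightarrow> \<phi> (proj_point z) = proj_point (mat_ac A *v z)))"

definition multiplier where
  "multiplier \<phi> = (SOME c. c \<noteq> 0 \<and> (\<forall>v. K.qf (matrix_of \<phi> *v v) = c * K.qf v))"

lemma matrix_of:
  assumes "\<phi> \<in> carrier (Aut_hypersurface q)"
  shows "multiplier \<phi> \<noteq> 0" "K.qf (matrix_of \<phi> *v v) = multiplier \<phi> * K.qf v"
    "z \<noteq> 0 \<Longrightarrow> ac.qf z = 0 \<Longrightarrow> \<phi> (proj_point z) = proj_point (mat_ac (matrix_of \<phi>) *v z)"
proof -
  have *: "\<exists>c. c \<noteq> 0 \<and> (\<forall>v. K.qf (matrix_of \<phi> *v v) = c * K.qf v) \<and>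
     (\<forall>z. z \<noteq> 0 \<longrightarrow> ac.qf z = 0 \<longrightarrow> \<phi> (proj_point z) = proj_point (mat_ac (matrix_of \<phi>) *v z))"
    unfolding matrix_of_def by (rule someI_ex[OF automorphism_matrix[OF assms]])
  then have "\<exists>c. c \<noteq> 0 \<and> (\<forall>v. K.qf (matrix_of \<phi> *v v) = c * K.qf v)" by blast
  then have "multiplier \<phi> \<noteq> 0 \<and> (\<forall>v. K.qf (matrix_of \<phi> *v v) = multiplier \<phi> * K.qf v)"
    unfolding multiplier_def by (rule someI_ex)
  then show "multiplier \<phi> \<noteq> 0" "K.qf (matrix_of \<phi> *v v) = multiplier \<phi> * K.qf v" by blast+
  show "z \<noteq> 0 \<Longrightarrow> ac.qf z = 0 \<Longrightarrow> \<phi> (proj_point z) = proj_point (mat_ac (matrix_of \<phi>) *v z)"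
    using * by blast
qed

lemma similitude_bf_K:
  assumes "\<And>v. K.qf (A *v v) = c * K.qf v" shows "K.bf (A *v v) (A *v w) = c * K.bf v w"
proof -
  have "K.qf (A *v (v + w)) = c * K.qf (v + w)" by (rule assms)
  then have "2 * K.bf (A *v v) (A *v w) = 2 * (c * K.bf v w)"
    unfolding matrix_vector_right_distrib K.qf_add assms by (simp add: algebra_simps)
  then show ?thesis by (simp only: mult_left_cancel[OF two])
qed

lemma similitude_ac:
  assumes "\<And>v. K.qf (A *v v) = c * K.qf v"
  shows "ac.qf (mat_ac A *v z) = to_ac c * ac.qf z"
proof -
  have z: "z = (\<Sum>i\<in>UNIV. z $ i *s vec_ac (axis i 1))"
    by (simp add: vec_eq_iff vec_ac_def axis_def if_distrib[of to_ac] if_distrib[of "\<lambda>t. _ * t"] cong: if_cong)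
  have Az: "mat_ac A *v z = (\<Sum>i\<in>UNIV. z $ i *s vec_ac (A *v axis i 1))"
    by (subst z) (simp add: vec.sum vec.scale vec_ac_simps)
  have bb: "ac.bf (\<Sum>i\<in>UNIV. z $ i *s vec_ac (f i)) (\<Sum>i\<in>UNIV. z $ i *s vec_ac (f i))
      = (\<Sum>i\<in>UNIV. \<Sum>j\<in>UNIV. z $ i * (z $ j * to_ac (K.bf (f i) (f j))))" for f
    by (simp add: ac.bf_sum_left ac.bf_sum_right ac.bf_lin bf_vec_ac sum_distrib_left)
       (simp add: K.bf_sym)
  have "ac.qf (mat_ac A *v z) = (\<Sum>i\<in>UNIV. \<Sum>j\<in>UNIV. z $ i * (z $ j * to_ac (c * K.bf (axis i 1) (axis j 1))))"
    unfolding Az ac.qf_def bb similitude_bf_K[OF assms] ..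
  also have "\<dots> = to_ac c * (\<Sum>i\<in>UNIV. \<Sum>j\<in>UNIV. z $ i * (z $ j * to_ac (K.bf (axis i 1) (axis j 1))))"
    by (simp add: sum_distrib_left mult_ac)
  also have "(\<Sum>i\<in>UNIV. \<Sum>j\<in>UNIV. z $ i * (z $ j * to_ac (K.bf (axis i 1) (axis j 1)))) = ac.qf z"
    unfolding ac.qf_def by (subst (2 3) z, subst bb) simp
  finally show ?thesis .
qed

lemma similitude_inverse:
  assumes c: "c \<noteq> 0" "\<And>v. K.qf (A *v v) = c * K.qf v"
  shows "\<exists>A'. A ** A' = mat 1 \<and> A' ** A = mat 1"
proof -
  obtain A' where "A' ** A = mat 1"
    using matrix_left_invertible_ker[of A] K.similitude_inj[OF c] by blast
  then show ?thesis using matrix_left_right_inverse by blast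
qed

lemma Aut_eq_induced: "\<phi> \<in> carrier (Aut_hypersurface q) \<Longrightarrow> \<phi> = induced q (matrix_of \<phi>)"
  by (rule extensional_eq_induced)
     (use Aut_carrier_Bij[of \<phi> q] matrix_of(3)[of \<phi>] in \<open>auto simp: Bij_def qf_eval_ac\<close>)

lemma induced_in_Aut:
  assumes c: "c \<noteq> 0" "\<And>v. K.qf (A *v v) = c * K.qf v"
  shows "induced q A \<in> carrier (Aut_hypersurface q)"
proof -
  obtain A' where A': "A ** A' = mat 1" "A' ** A = mat 1" using similitude_inverse[OF c] by blast
  show ?thesis
    by (rule induced_automorphism(1)[OF A', of "to_ac c"])
       (use c similitude_ac[OF c(2)] in \<open>auto simp: qf_eval_ac\<close>)
qed

text \<open>Closure under composition and inversion is read off from the matrices, every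
  automorphism being induced by a similitude over the ground field.\<close>

lemma group_Aut: "group (Aut_hypersurface q)"
proof -
  let ?S = "geometric_points q" and ?C = "carrier (Aut_hypersurface q)"
  have "subgroup ?C (BijGroup ?S)"
  proof (rule group.subgroupI[OF group_BijGroup])
    show "?C \<subseteq> carrier (BijGroup ?S)" using Aut_carrier_Bij by (auto simp: BijGroup_def)
    have "induced q (mat 1) \<in> ?C" by (rule induced_in_Aut[of 1]) auto
    then show "?C \<noteq> {}" by blast
    fix \<phi> assume \<phi>: "\<phi> \<in> ?C"
    note m = matrix_of[OF \<phi>]
    obtain A' where A': "matrix_of \<phi> ** A' = mat 1" "A' ** matrix_of \<phi> = mat 1"
      using similitude_inverse[OF m(1,2)] by blast
    have TA': "matrix_of \<phi> *v (A' *v v) = v" for v by (simp add: matrix_vector_mul_assoc A')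
    have sim': "K.qf (A' *v v) = 1 / multiplier \<phi> * K.qf v" for v
      using m(2)[of "A' *v v"] m(1) by (simp add: TA')
    have k: "to_ac (multiplier \<phi>) \<noteq> 0"
      "mv_eval to_ac q (mat_ac (matrix_of \<phi>) *v z) = to_ac (multiplier \<phi>) * mv_eval to_ac q z" for z
      using m(1) similitude_ac[OF m(2)] by (auto simp: qf_eval_ac)
    note ind = induced_automorphism[OF A' k]
    have "inv\<^bsub>BijGroup ?S\<^esub> \<phi> = induced q A'"
    proof (rule group.inv_equality[OF group_BijGroup])
      show "\<phi> \<in> carrier (BijGroup ?S)" using Aut_carrier_Bij[OF \<phi>] by (simp add: BijGroup_def)
      show "induced q A' \<in> carrier (BijGroup ?S)" using ind(2) by (simp add: BijGroup_def)
      have "compose ?S (induced q A') \<phi> = (\<lambda>P\<in>?S. P)"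
        by (subst Aut_eq_induced[OF \<phi>]) (intro ext, simp add: compose_def ind(3))
      then show "induced q A' \<otimes>\<^bsub>BijGroup ?S\<^esub> \<phi> = \<one>\<^bsub>BijGroup ?S\<^esub>"
        using ind(2) Aut_carrier_Bij[OF \<phi>] by (simp add: BijGroup_def)
    qed
    moreover have "induced q A' \<in> ?C" by (rule induced_in_Aut[OF _ sim']) (use m(1) in simp)
    ultimately show "inv\<^bsub>BijGroup ?S\<^esub> \<phi> \<in> ?C" by simp
    fix \<psi> assume \<psi>: "\<psi> \<in> ?C"
    note m' = matrix_of[OF \<psi>]
    have comp: "\<phi> \<otimes>\<^bsub>BijGroup ?S\<^esub> \<psi> = compose ?S \<phi> \<psi>"
      using Aut_carrier_Bij[OF \<phi>] Aut_carrier_Bij[OF \<psi>] by (simp add: BijGroup_def)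
    have "compose ?S \<phi> \<psi> = induced q (matrix_of \<phi> ** matrix_of \<psi>)"
    proof (rule extensional_eq_induced)
      fix z :: "'a alg_closure ^ 'n" assume z: "z \<noteq> 0" "mv_eval to_ac q z = 0"
      have "mat_ac (matrix_of \<psi>) *v z \<noteq> 0"
        by (rule ac.similitude_inj[OF _ similitude_ac[OF m'(2)] z(1)]) (use m'(1) in simp)
      moreover have "ac.qf (mat_ac (matrix_of \<psi>) *v z) = 0"
        using similitude_ac[OF m'(2)] z(2) by (simp add: qf_eval_ac)
      ultimately show "compose ?S \<phi> \<psi> (proj_point z) = proj_point (mat_ac (matrix_of \<phi> ** matrix_of \<psi>) *v z)"
        using z by (simp add: compose_def geometric_pointI m(3) m'(3) qf_eval_ac mat_ac_mult matrix_vector_mul_assoc)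
    qed (simp add: compose_def)
    moreover have "induced q (matrix_of \<phi> ** matrix_of \<psi>) \<in> ?C"
      by (rule induced_in_Aut[of "multiplier \<phi> * multiplier \<psi>"])
         (use m(1) m'(1) in \<open>auto simp: m(2) m'(2) simp flip: matrix_vector_mul_assoc\<close>)
    ultimately show "\<phi> \<otimes>\<^bsub>BijGroup ?S\<^esub> \<psi> \<in> ?C" by (simp add: comp)
  qed
  from subgroup.subgroup_is_group[OF this group_BijGroup] show ?thesis
    by (simp add: Aut_hypersurface_def)
qed

text \<open>The quotient of the two matrices has all points of the quadric as eigenvectors and is
  therefore scalar. Comparing one nonzero coordinate at a rational vector puts the scalar into the
  ground field.\<close>

lemma proportional_on_quadric:
  assumes c: "c \<noteq> 0" "\<And>v. K.qf (Y *v v) = c * K.qf v"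
    and par: "\<And>z. z \<noteq> 0 \<Longrightarrow> ac.qf z = 0 \<Longrightarrow> proj_point (mat_ac Z *v z) = proj_point (mat_ac Y *v z)"
  shows "\<exists>k. k \<noteq> 0 \<and> (\<forall>v. Z *v v = k *s (Y *v v))"
proof -
  obtain Y' where Y': "Y ** Y' = mat 1" "Y' ** Y = mat 1" using similitude_inverse[OF c] by blast
  have YY: "mat_ac Y' *v (mat_ac Y *v z) = z" "mat_ac Y *v (mat_ac Y' *v z) = z" for z
    by (simp_all add: matrix_vector_mul_assoc mat_ac_mult[symmetric] Y' mat_ac_one)
  have eig: "\<exists>\<nu>. \<nu> \<noteq> 0 \<and> (mat_ac Y' ** mat_ac Z) *v z = \<nu> *s z" if z: "z \<noteq> 0" "ac.qf z = 0" for z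
  proof -
    obtain \<nu> where \<nu>: "\<nu> \<noteq> 0" "mat_ac Z *v z = \<nu> *s (mat_ac Y *v z)" using par[OF z] by (auto simp: proj_point_eq_iff)
    have "(mat_ac Y' ** mat_ac Z) *v z = mat_ac Y' *v (mat_ac Z *v z)" by (simp add: matrix_vector_mul_assoc)
    then show ?thesis using \<nu> by (simp add: vec.scale YY) blast
  qed
  then obtain \<nu> where \<nu>: "\<And>v. (mat_ac Y' ** mat_ac Z) *v v = \<nu> *s v"
    using ac.eigen_on_quadric_scalar[of "mat_ac Y' ** mat_ac Z"] by blast
  obtain x where x: "x \<noteq> 0" "ac.qf x = 0"
    using ac.isotropic_exists n3 alg_closed_imp_poly_has_root by (metis One_nat_def Suc_1 Suc_leD numeral_3_eq_3)
  have \<nu>0: "\<nu> \<noteq> 0" using eig[OF x] \<nu>[of x] x(1) by auto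
  have Z: "mat_ac Z *v z = \<nu> *s (mat_ac Y *v z)" for z
  proof -
    have "mat_ac Z *v z = mat_ac Y *v ((mat_ac Y' ** mat_ac Z) *v z)"
      by (simp add: YY flip: matrix_vector_mul_assoc)
    then show ?thesis by (simp add: \<nu> vec.scale)
  qed
  define v :: "'a ^ 'n" where "v = axis undefined 1"
  have "Y *v v \<noteq> 0" by (rule K.similitude_inj[OF c]) (simp add: v_def)
  then obtain i where i: "(Y *v v) $ i \<noteq> 0" by (auto simp: vec_eq_iff)
  have "to_ac ((Z *v v) $ i) = \<nu> * to_ac ((Y *v v) $ i)"
    using arg_cong[OF Z[of "vec_ac v"], of "\<lambda>w. w $ i"] by (simp add: vec_ac_simps) (simp add: vec_ac_def)
  then have "\<nu> = to_ac ((Z *v v) $ i / (Y *v v) $ i)" using i by (simp add: field_simps)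
  then obtain k where k: "\<nu> = to_ac k" by blast
  have "vec_ac (Z *v w) = vec_ac (k *s (Y *v w))" for w
    using Z[of "vec_ac w"] by (simp add: vec_ac_simps k)
  then have "Z *v w = k *s (Y *v w)" for w by (simp only: vec_ac_simps(6))
  then show ?thesis using \<nu>0 k by (intro exI[of _ k]) auto
qed

lemma similitude_group_Aut:
  assumes "contains_all_roots_of_unity TYPE('a)"
  shows "similitude_group M (Aut_hypersurface q) matrix_of multiplier"
proof -
  interpret G: group "Aut_hypersurface q" by (rule group_Aut)
  let ?S = "geometric_points q" and ?C = "carrier (Aut_hypersurface q)"
  show ?thesis
  proof unfold_locales
    show "v \<noteq> 0 \<Longrightarrow> K.qf v \<noteq> 0" for v by (rule qf_nz)
    show "contains_all_roots_of_unity TYPE('a)" by (rule assms)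
    show "x \<in> ?C \<Longrightarrow> multiplier x \<noteq> 0" for x by (rule matrix_of(1))
    show "x \<in> ?C \<Longrightarrow> K.qf (matrix_of x *v v) = multiplier x * K.qf v" for x v by (rule matrix_of(2))
  next
    fix \<phi> \<psi> assume \<phi>: "\<phi> \<in> ?C" and \<psi>: "\<psi> \<in> ?C"
    note m = matrix_of[OF \<phi>] and m' = matrix_of[OF \<psi>]
    note prod = G.m_closed[OF \<phi> \<psi>]
    have sim: "K.qf ((matrix_of \<phi> ** matrix_of \<psi>) *v v) = (multiplier \<phi> * multiplier \<psi>) * K.qf v" for v
      by (simp add: m(2) m'(2) flip: matrix_vector_mul_assoc)
    have "\<exists>k. k \<noteq> 0 \<and> (\<forall>v. matrix_of (\<phi> \<otimes>\<^bsub>Aut_hypersurface q\<^esub> \<psi>) *v v = k *s ((matrix_of \<phi> ** matrix_of \<psi>) *v v))"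
    proof (rule proportional_on_quadric[OF _ sim])
      show "multiplier \<phi> * multiplier \<psi> \<noteq> 0" using m(1) m'(1) by simp
      fix z :: "'a alg_closure ^ 'n" assume z: "z \<noteq> 0" "ac.qf z = 0"
      have "mat_ac (matrix_of \<psi>) *v z \<noteq> 0"
        by (rule ac.similitude_inj[OF _ similitude_ac[OF m'(2)] z(1)]) (use m'(1) in simp)
      moreover have "ac.qf (mat_ac (matrix_of \<psi>) *v z) = 0"
        using similitude_ac[OF m'(2)] z(2) by simp
      moreover have "proj_point z \<in> ?S" using z by (intro geometric_pointI) (auto simp: qf_eval_ac)
      ultimately show "proj_point (mat_ac (matrix_of (\<phi> \<otimes>\<^bsub>Aut_hypersurface q\<^esub> \<psi>)) *v z)
          = proj_point (mat_ac (matrix_of \<phi> ** matrix_of \<psi>) *v z)"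
        unfolding matrix_of(3)[OF prod z, symmetric]
        by (simp add: Aut_mult[OF Aut_carrier_Bij[OF \<phi>] Aut_carrier_Bij[OF \<psi>]] compose_def m(3) m'(3)[OF z]
            mat_ac_mult matrix_vector_mul_assoc)
    qed
    then show "\<exists>k. k \<noteq> 0 \<and> (\<forall>v. matrix_of (\<phi> \<otimes>\<^bsub>Aut_hypersurface q\<^esub> \<psi>) *v v
        = k *s (matrix_of \<phi> *v (matrix_of \<psi> *v v)))"
      by (simp add: matrix_vector_mul_assoc)
  next
    fix \<phi> k assume \<phi>: "\<phi> \<in> ?C" and sc: "\<And>v. matrix_of \<phi> *v v = k *s v"
    have "matrix_of \<phi> = (\<chi> i j. if i = j then k else 0)"
      using sc[of "axis _ 1"] matrix_mult_axis_component[of "matrix_of \<phi>"]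
      by (simp add: vec_eq_iff) (simp add: axis_def)
    then have "mat_ac (matrix_of \<phi>) = (\<chi> i j. if i = j then to_ac k else 0)"
      by (simp add: mat_ac_def vec_eq_iff)
    then have ac: "mat_ac (matrix_of \<phi>) *v z = to_ac k *s z" for z
      by (simp add: matrix_vector_mult_def vec_eq_iff if_distrib[of "\<lambda>t. t * _"] cong: if_cong)
    define v :: "'a ^ 'n" where "v = axis undefined 1"
    have "matrix_of \<phi> *v v \<noteq> 0" by (rule K.similitude_inj[OF matrix_of(1,2)[OF \<phi>]]) (simp add: v_def)
    then have k: "k \<noteq> 0" by (auto simp: sc)
    have "\<phi> \<in> extensional ?S" using Aut_carrier_Bij[OF \<phi>] by (simp add: Bij_def)
    then have "\<phi> = (\<lambda>P\<in>?S. P)"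
    proof (rule extensionalityI)
      fix P assume "P \<in> ?S"
      then obtain z where "P = proj_point z" "z \<noteq> 0" "mv_eval to_ac q z = 0" by (rule geometric_pointE)
      then show "\<phi> P = (\<lambda>P\<in>?S. P) P"
        using matrix_of(3)[OF \<phi>, of z] k by (simp add: ac proj_point_scale qf_eval_ac geometric_pointI)
    qed simp
    then show "\<phi> = \<one>\<^bsub>Aut_hypersurface q\<^esub>" by (simp add: Aut_one)
  qed
qed

end

section \<open>Quadrics with a rational point\<close>

text \<open>The form and its polar form are treated separately, since in characteristic two the
  polar form does not determine the quadratic form.\<close>

definition quad :: "'k::field ^ 'n ^ 'n \<Rightarrow> 'k ^ 'n \<Rightarrow> 'k" where
  "quad C v = (\<Sum>i\<in>UNIV. \<Sum>j\<in>UNIV. C $ i $ j * (v $ i * v $ j))"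

definition polar :: "'k::field ^ 'n ^ 'n \<Rightarrow> 'k ^ 'n \<Rightarrow> 'k ^ 'n \<Rightarrow> 'k" where
  "polar C v w = (\<Sum>i\<in>UNIV. \<Sum>j\<in>UNIV. (C $ i $ j + C $ j $ i) * (v $ i * w $ j))"

lemma polar_linear:
  "polar C (v + v') w = polar C v w + polar C v' w" "polar C v (w + w') = polar C v w + polar C v w'"
  "polar C (a *s v) w = a * polar C v w" "polar C v (a *s w) = a * polar C v w"
  by (simp_all add: polar_def sum_distrib_left flip: sum.distrib) (simp_all add: algebra_simps)

lemma polar_sym: "polar C v w = polar C w v"
proof -
  have "polar C v w = (\<Sum>j\<in>UNIV. \<Sum>i\<in>UNIV. (C $ i $ j + C $ j $ i) * (v $ i * w $ j))"
    unfolding polar_def by (rule sum.swap)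
  also have "\<dots> = polar C w v"
    unfolding polar_def by (intro sum.cong refl) (simp add: mult_ac add_ac)
  finally show ?thesis .
qed

lemma polar_self: "polar C v v = 2 * quad C v"
proof -
  have "polar C v v = quad C v + (\<Sum>i\<in>UNIV. \<Sum>j\<in>UNIV. C $ j $ i * (v $ i * v $ j))"
    by (simp add: polar_def quad_def distrib_right sum.distrib)
  also have "(\<Sum>i\<in>UNIV. \<Sum>j\<in>UNIV. C $ j $ i * (v $ i * v $ j)) = quad C v"
    unfolding quad_def by (subst sum.swap) (simp add: mult_ac)
  finally show ?thesis by simp
qed

lemma quad_add: "quad C (v + w) = quad C v + polar C v w + quad C w"
proof -
  have "polar C v w = (\<Sum>i\<in>UNIV. \<Sum>j\<in>UNIV. C $ i $ j * (v $ i * w $ j))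
      + (\<Sum>i\<in>UNIV. \<Sum>j\<in>UNIV. C $ j $ i * (v $ i * w $ j))"
    by (simp add: polar_def distrib_right sum.distrib)
  also have "(\<Sum>i\<in>UNIV. \<Sum>j\<in>UNIV. C $ j $ i * (v $ i * w $ j))
      = (\<Sum>i\<in>UNIV. \<Sum>j\<in>UNIV. C $ i $ j * (w $ i * v $ j))"
    by (subst sum.swap) (simp add: mult_ac)
  finally show ?thesis
    by (simp add: quad_def algebra_simps sum.distrib)
qed

lemma quad_scale: "quad C (a *s v) = a^2 * quad C v"
  by (simp add: quad_def sum_distrib_left power2_eq_square mult_ac)

lemma polar_axis: "polar C (axis i 1) w = (\<Sum>j\<in>UNIV. (C $ i $ j + C $ j $ i) * w $ j)"
proof -
  have "polar C (axis i 1) w = (\<Sum>k\<in>UNIV. if k = i then \<Sum>j\<in>UNIV. (C $ i $ j + C $ j $ i) * w $ j else 0)"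
    unfolding polar_def by (rule sum.cong) (auto simp: axis_def)
  then show ?thesis by simp
qed

lemma polar_expand: "polar C v w = (\<Sum>i\<in>UNIV. v $ i * polar C (axis i 1) w)"
  unfolding polar_axis by (simp add: polar_def sum_distrib_left mult_ac)

lemma quad_ac: "quad (mat_ac C) (vec_ac v) = to_ac (quad C v)"
  by (simp add: quad_def mat_ac_def vec_ac_def to_ac_sum)

lemma polar_ac: "polar (mat_ac C) (vec_ac v) (vec_ac w) = to_ac (polar C v w)"
  by (simp add: polar_def mat_ac_def vec_ac_def to_ac_sum)

definition hyperbolic :: "'k::field ^ 'n ^ 'n \<Rightarrow> 'k ^ 'n \<Rightarrow> 'k ^ 'n \<Rightarrow> bool" where
  "hyperbolic C x y \<longleftrightarrow> quad C x = 0 \<and> quad C y = 0 \<and> polar C x y = 1"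

lemma hyperbolic_ac: "hyperbolic C x y \<Longrightarrow> hyperbolic (mat_ac C) (vec_ac x) (vec_ac y)"
  by (simp add: hyperbolic_def quad_ac polar_ac)

lemma hyperbolic_polar:
  assumes "hyperbolic C x y"
  shows "polar C x x = 0" "polar C y y = 0" "polar C x y = 1" "polar C y x = 1"
  using assms by (simp_all add: hyperbolic_def polar_self polar_sym[of C y x])

lemma hyperbolic_exists:
  assumes x: "quad C x = 0" and z: "polar C z x \<noteq> 0"
  shows "\<exists>y. hyperbolic C x y"
proof -
  define y0 where "y0 = (1 / polar C z x) *s z"
  have y0: "polar C y0 x = 1" "polar C x y0 = 1"
    using z by (simp_all add: y0_def polar_linear polar_sym[of C x z])
  \<comment> \<open>Along \<open>x\<close> the form changes linearly with slope 1, so no division by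
    two occurs.\<close>
  have "hyperbolic C x (y0 + (- quad C y0) *s x)"
    by (simp only: hyperbolic_def quad_add quad_scale polar_linear y0 x polar_self) simp
  then show ?thesis by blast
qed

text \<open>The one-parameter group scaling a hyperbolic pair \<open>x\<close>, \<open>y\<close> by \<open>t\<close> and \<open>1 / t\<close> and fixing the
  orthogonal complement of the pair.\<close>

definition torus :: "'k::field ^ 'n ^ 'n \<Rightarrow> 'k ^ 'n \<Rightarrow> 'k ^ 'n \<Rightarrow> 'k \<Rightarrow> 'k ^ 'n ^ 'n" where
  "torus C x y t = (\<chi> i j. (if i = j then 1 else 0)
     + ((t - 1) * x $ i * polar C (axis j 1) y + (1 / t - 1) * y $ i * polar C (axis j 1) x))"

lemma torus_mult_vec:
  "torus C x y t *v z = z + ((t - 1) * polar C z y) *s x + ((1 / t - 1) * polar C z x) *s y"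
proof -
  have "(torus C x y t *v z) $ i = (\<Sum>j\<in>UNIV. if i = j then z $ j else 0)
      + ((t - 1) * x $ i * (\<Sum>j\<in>UNIV. z $ j * polar C (axis j 1) y)
      + (1 / t - 1) * y $ i * (\<Sum>j\<in>UNIV. z $ j * polar C (axis j 1) x))" for i
    unfolding torus_def matrix_vector_mult_def vec_lambda_beta sum_distrib_left sum.distrib[symmetric]
    by (rule sum.cong) (auto simp: algebra_simps)
  then show ?thesis unfolding polar_expand[symmetric]
    by (simp add: vec_eq_iff mult_ac)
qed

lemma mat_ac_torus: "mat_ac (torus C x y t) = torus (mat_ac C) (vec_ac x) (vec_ac y) (to_ac t)"
  unfolding torus_def polar_axis by (simp add: vec_eq_iff mat_ac_def vec_ac_def to_ac_sum)

lemma quad_torus: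
  assumes "hyperbolic C x y" "t \<noteq> 0" shows "quad C (torus C x y t *v z) = quad C z"
proof -
  have h: "quad C x = 0" "quad C y = 0" "polar C x y = 1" using assms(1) by (auto simp: hyperbolic_def)
  have "quad C (torus C x y t *v z) = quad C z
      + polar C z x * polar C z y * ((t - 1) + (1 / t - 1) + (t - 1) * (1 / t - 1))"
    by (simp only: torus_mult_vec quad_add quad_scale polar_linear h) (use assms(2) in \<open>simp add: field_simps\<close>)
  \<comment> \<open>This expands \<open>t * (1 / t) = 1\<close> around 1.\<close>
  also have "(t - 1) + (1 / t - 1) + (t - 1) * (1 / t - 1) = 0"
    using assms(2) by (simp add: field_simps)
  finally show ?thesis by simp
qed

lemma torus_torus:
  assumes h: "hyperbolic C x y" and nz: "s \<noteq> 0" "t \<noteq> 0"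
  shows "torus C x y s ** torus C x y t = torus C x y (s * t)"
proof -
  have "torus C x y s *v (torus C x y t *v z) = torus C x y (s * t) *v z" for z
  proof -
    have 1: "polar C (torus C x y t *v z) y = t * polar C z y" "polar C (torus C x y t *v z) x = 1 / t * polar C z x"
      by (simp_all add: torus_mult_vec polar_linear hyperbolic_polar[OF h] left_diff_distrib)
    show ?thesis unfolding torus_mult_vec[of _ _ _ s] 1 unfolding torus_mult_vec
      using nz by (simp add: vec_eq_iff field_simps)
  qed
  then show ?thesis by (simp add: matrix_eq flip: matrix_vector_mul_assoc)
qed

lemma torus_1: "torus C x y 1 = mat 1"
  by (simp add: matrix_eq torus_mult_vec)

lemma hyperbolic_complement:
  assumes h: "hyperbolic C x y" and n: "CARD('n) \<ge> 3"
  shows "\<exists>u :: 'k::field ^ 'n. u \<noteq> 0 \<and> polar C u x = 0 \<and> polar C u y = 0"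
proof -
  have "\<not> UNIV \<subseteq> vec.span {x, y}"
  proof
    assume "UNIV \<subseteq> vec.span {x, y}"
    then have "vec.dim (UNIV :: ('k ^ 'n) set) \<le> card {x, y}" by (intro vec.dim_le_card) auto
    moreover have "card {x, y} \<le> 2" by (simp add: card_insert_if)
    ultimately show False using n by (simp add: card_cart_basis)
  qed
  then obtain v where v: "v \<notin> vec.span {x, y}" by blast
  let ?w = "polar C v y *s x + polar C v x *s y"
  have "?w \<in> vec.span {x, y}" by (intro vec.span_add vec.span_scale vec.span_base) auto
  then have "v + (-1) *s ?w \<noteq> 0" using v by (metis add.right_inverse add_left_cancel vector_sneg_minus1 minus_minus)
  moreover have "polar C (v + (-1) *s ?w) x = 0" "polar C (v + (-1) *s ?w) y = 0"
    by (simp_all only: polar_linear hyperbolic_polar[OF h]) simp_all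
  ultimately show ?thesis by blast
qed

text \<open>The torus fixes the \<open>u\<close>-component, which forces the projective factor to be
  1; the \<open>x\<close>-component then shows the parameter. So distinct parameters act
  differently.\<close>

lemma torus_separating_point:
  assumes h: "hyperbolic C x y" and u: "u \<noteq> 0" "polar C u x = 0" "polar C u y = 0"
  defines "z \<equiv> x + u + (- quad C u) *s y"
  shows "quad C z = 0" "z \<noteq> 0"
    "proj_point (torus C x y s *v z) = proj_point (torus C x y t *v z) \<Longrightarrow> s = t"
proof -
  note hp = hyperbolic_polar[OF h]
  have u': "polar C x u = 0" "polar C y u = 0" using u by (simp_all add: polar_sym[of C _ u])
  show "quad C z = 0"
    unfolding z_def quad_add quad_scale polar_linear hp u u' using h by (simp add: hyperbolic_def)
  have zy: "polar C z y = 1" and zx: "polar C z x = - quad C u"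
    by (simp_all only: z_def polar_linear hp u) simp_all
  show "z \<noteq> 0" using zy polar_linear(3)[of C 0 0 y] by auto
  have T: "torus C x y r *v z = r *s x + u + (- (quad C u / r)) *s y" for r
    unfolding torus_mult_vec zy zx by (simp add: z_def vec_eq_iff algebra_simps)
  assume "proj_point (torus C x y s *v z) = proj_point (torus C x y t *v z)"
  then obtain c where c: "s *s x + u + (- (quad C u / s)) *s y = c *s (t *s x + u + (- (quad C u / t)) *s y)"
    unfolding T proj_point_eq_iff by blast
  have 1: "s = c * t" using arg_cong[OF c, of "\<lambda>v. polar C v y"] unfolding polar_linear hp u by simp
  have 2: "- (quad C u / s) = c * (- (quad C u / t))"
    using arg_cong[OF c, of "\<lambda>v. polar C v x"] unfolding polar_linear hp u by simp
  have "u = c *s u" using c unfolding 2 by (simp add: 1 vec_eq_iff algebra_simps)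
  then have "c = 1" using u(1) by (auto simp: vec_eq_iff)
  then show "s = t" using 1 by simp
qed

text \<open>The derivative of \<open>X^m - 1\<close> is nonzero at its roots, so no linear factor is
  repeated.\<close>

lemma card_roots_of_unity:
  assumes roots: "contains_all_roots_of_unity TYPE('a::field)" and m: "m > 0" "of_nat m \<noteq> (0 :: 'a)"
  shows "card {t :: 'a. t ^ m = 1} = m"
proof -
  let ?p = "Polynomial.monom 1 m - 1 :: 'a poly"
  obtain A :: "'a multiset" where A: "?p = (\<Prod>a\<in>#A. [:- a, 1:])"
    using roots m(1) unfolding contains_all_roots_of_unity_def by blast
  have nz: "(\<Prod>a\<in>#S. [:- a, 1:]) \<noteq> (0 :: 'a poly)" for S by (auto simp: prod_mset_zero_iff)
  have deg: "degree (\<Prod>a\<in>#S. [:- a, 1:] :: 'a poly) = size S" for S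
    by (induction S) (simp_all add: degree_mult_eq[OF _ nz] del: mult_pCons_left)
  have ev: "poly (\<Prod>a\<in>#S. [:- a, 1:]) t = 0 \<longleftrightarrow> t \<in># S" for S and t :: 'a
    by (induction S) (auto simp del: mult_pCons_left)
  have "degree ?p = m"
    using degree_add_eq_left[of "- 1" "Polynomial.monom (1::'a) m"] m(1) by (simp add: degree_monom_eq)
  then have size: "size A = m" using deg[of A] A by simp
  have "poly ?p t = 0 \<longleftrightarrow> t ^ m = 1" for t by (simp add: poly_monom)
  then have set: "{t. t ^ m = 1} = set_mset A" using ev[of A] A by auto
  have "count A a = 1" if a: "a \<in># A" for a
  proof (rule ccontr)
    assume ne: "count A a \<noteq> 1"
    obtain A' where A': "A = add_mset a A'" using multi_member_split[OF a] by blast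
    then have "a \<in># A'" using ne by (simp add: not_in_iff[symmetric])
    then obtain A'' where A'': "A' = add_mset a A''" using multi_member_split by metis
    define r :: "'a poly" where "r = (\<Prod>a\<in>#A''. [:- a, 1:])"
    have "?p = [:- a, 1:] * ([:- a, 1:] * r)"
      unfolding A A' A'' r_def image_mset_add_mset prod_mset.add_mset ..
    then have "pderiv ?p = pderiv ([:- a, 1:] * ([:- a, 1:] * r))" by (rule arg_cong)
    then have "poly (pderiv ?p) a = 0" unfolding pderiv_mult poly_add poly_mult by simp
    then have "of_nat m * a ^ (m - 1) = 0" by (simp add: pderiv_diff pderiv_monom poly_monom)
    moreover have "a ^ m = 1" using a set by auto
    ultimately show False using m by (auto simp: power_0_left)
  qed
  then have "size A = card (set_mset A)" by (simp add: size_multiset_overloaded_eq)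
  then show ?thesis using set size by simp
qed

lemma char_2_isotropic:
  fixes C :: "'a::field ^ 'n ^ 'n"
  assumes two: "(2 :: 'a) = 0" and perfect: "surj (\<lambda>x :: 'a. x^2)" and n: "CARD('n) \<ge> 3"
  shows "\<exists>x. x \<noteq> 0 \<and> quad C x = 0"
proof -
  obtain S :: "'n set" where "card S = 3" using obtain_subset_with_card_n[OF n] by blast
  then obtain i j k :: 'n where ijk: "i \<noteq> j" "j \<noteq> k" "i \<noteq> k" by (auto simp: card_3_iff)
  define v :: "'a ^ 'n" where "v = axis i 1"
  \<comment> \<open>The condition of orthogonality to \<open>v\<close> has a nonzero solution in the
    plane of the coordinates \<open>j\<close> and \<open>k\<close>; this is where three coordinates
    are used.\<close>
  obtain w where w: "w \<noteq> 0" "w $ i = 0" "polar C v w = 0"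
  proof (cases "polar C v (axis j 1) = 0")
    case True
    show ?thesis by (rule that[of "axis j 1"]) (use True ijk in \<open>auto simp: axis_def vec_eq_iff\<close>)
  next
    case False
    let ?w = "polar C v (axis k 1) *s axis j 1 + (- polar C v (axis j 1)) *s axis k 1"
    have "?w $ k \<noteq> 0" using False ijk by (simp add: axis_def)
    then have "?w \<noteq> 0" by (metis zero_index)
    moreover have "?w $ i = 0" using ijk by (simp add: axis_def)
    moreover have "polar C v ?w = 0" by (simp only: polar_linear) simp
    ultimately show ?thesis by (rule that)
  qed
  obtain \<alpha> \<beta> where \<alpha>: "quad C v = \<alpha>^2" and \<beta>: "quad C w = \<beta>^2" using perfect by (metis surjD)
  show ?thesis
  proof (cases "\<beta> *s v + \<alpha> *s w = 0")
    \<comment> \<open>Because \<open>w $ i = 0\<close>, the combination vanishes only if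
      \<open>\<beta> = 0\<close>, and then \<open>w\<close> itself is isotropic.\<close>
    case True
    from arg_cong[OF this, of "\<lambda>z. z $ i"] have "\<beta> = 0" using w(2) by (simp add: v_def)
    then have "w \<noteq> 0 \<and> quad C w = 0" using w(1) \<beta> by simp
    then show ?thesis by blast
  next
    case False
    have "quad C (\<beta> *s v + \<alpha> *s w) = 2 * (\<alpha>^2 * \<beta>^2)"
      by (simp add: quad_add quad_scale polar_linear w(3) \<alpha> \<beta>)
    then show ?thesis using False two by auto
  qed
qed

lemma unbounded_finite_subgroups:
  fixes q :: "('n::finite, 'a::field) mvpoly"
  assumes roots: "contains_all_roots_of_unity TYPE('a)" and n: "CARD('n) \<ge> 3"
    and C: "\<And>z. mv_eval to_ac q z = quad (mat_ac C) z" and h: "hyperbolic C x y"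
  shows "\<not> bounded_finite_subgroups (Aut_hypersurface q)"
proof -
  let ?S = "geometric_points q" and ?G = "Aut_hypersurface q"
  let ?t = "\<lambda>t. induced q (torus C x y t)"
  have q: "mv_eval to_ac q (mat_ac (torus C x y t) *v z) = 1 * mv_eval to_ac q z" if "t \<noteq> 0" for t z
    unfolding C mat_ac_torus using quad_torus[OF hyperbolic_ac[OF h]] that by simp
  have inv: "torus C x y t ** torus C x y (1 / t) = mat 1" "torus C x y (1 / t) ** torus C x y t = mat 1"
    if "t \<noteq> 0" for t using that by (simp_all add: torus_torus[OF h] torus_1)
  have car: "?t t \<in> carrier ?G" if "t \<noteq> 0" for t
    by (rule induced_automorphism(1)[OF inv[OF that] _ q[OF that]]) simp
  have mult: "?t s \<otimes>\<^bsub>?G\<^esub> ?t t = ?t (s * t)" if st: "s \<noteq> 0" "t \<noteq> 0" for s t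
  proof -
    have "compose ?S (?t s) (?t t) = ?t (s * t)"
    proof (rule extensional_eq_induced)
      fix z assume z: "z \<noteq> 0" "mv_eval to_ac q z = 0"
      have "mat_ac (torus C x y (1 / t)) *v (mat_ac (torus C x y t) *v z) = z"
        by (simp add: matrix_vector_mul_assoc mat_ac_mult[symmetric] inv[OF st(2)] mat_ac_one)
      then have "mat_ac (torus C x y t) *v z \<noteq> 0" using z(1) by auto
      then show "compose ?S (?t s) (?t t) (proj_point z) = proj_point (mat_ac (torus C x y (s * t)) *v z)"
        using z q[OF st(2)] by (simp add: compose_def geometric_pointI induced_point
          torus_torus[OF h st, symmetric] mat_ac_mult matrix_vector_mul_assoc)
    qed (simp add: compose_def)
    then show ?thesis using Aut_mult Aut_carrier_Bij car st by metis
  qed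
  have one: "?t 1 = \<one>\<^bsub>?G\<^esub>"
    unfolding Aut_one
    by (rule sym, rule extensional_eq_induced) (simp_all add: torus_1 mat_ac_one geometric_pointI)
  \<comment> \<open>Uniqueness of the inverse is taken from the group of all bijections of the
    geometric points.\<close>
  have m_inv: "inv\<^bsub>?G\<^esub> (?t t) = ?t (1 / t)" if t: "t \<noteq> 0" for t
    unfolding m_inv_def
  proof (rule the_equality)
    show "?t (1 / t) \<in> carrier ?G \<and> ?t t \<otimes>\<^bsub>?G\<^esub> ?t (1 / t) = \<one>\<^bsub>?G\<^esub> \<and> ?t (1 / t) \<otimes>\<^bsub>?G\<^esub> ?t t = \<one>\<^bsub>?G\<^esub>"
      using car mult one t by simp
    fix \<psi> assume \<psi>: "\<psi> \<in> carrier ?G \<and> ?t t \<otimes>\<^bsub>?G\<^esub> \<psi> = \<one>\<^bsub>?G\<^esub> \<and> \<psi> \<otimes>\<^bsub>?G\<^esub> ?t t = \<one>\<^bsub>?G\<^esub>"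
    have B: "carrier ?G \<subseteq> carrier (BijGroup ?S)" 
      "\<phi> \<otimes>\<^bsub>?G\<^esub> \<rho> = \<phi> \<otimes>\<^bsub>BijGroup ?S\<^esub> \<rho>" "\<one>\<^bsub>?G\<^esub> = \<one>\<^bsub>BijGroup ?S\<^esub>" for \<phi> \<rho>
      by (auto simp: Aut_hypersurface_def BijGroup_def)
    have eq: "inv\<^bsub>BijGroup ?S\<^esub> (?t t) = \<rho>" if "\<rho> \<in> carrier ?G" "\<rho> \<otimes>\<^bsub>?G\<^esub> ?t t = \<one>\<^bsub>?G\<^esub>" for \<rho>
      by (rule group.inv_equality[OF group_BijGroup]) (use that car[OF t] B in auto)
    have "?t (1 / t) \<otimes>\<^bsub>?G\<^esub> ?t t = \<one>\<^bsub>?G\<^esub>" using mult one t by simp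
    then show "\<psi> = ?t (1 / t)" using eq \<psi> car[of "1 / t"] t by (metis divide_eq_0_iff one_neq_zero)
  qed
  obtain u where u: "u \<noteq> 0" "polar C u x = 0" "polar C u y = 0" using hyperbolic_complement[OF h n] by blast
  define z where "z = vec_ac x + vec_ac u + (- quad (mat_ac C) (vec_ac u)) *s vec_ac y"
  have "vec_ac u \<noteq> 0" "polar (mat_ac C) (vec_ac u) (vec_ac x) = 0" "polar (mat_ac C) (vec_ac u) (vec_ac y) = 0"
    using u by (simp_all add: vec_ac_simps polar_ac)
  note z = torus_separating_point[OF hyperbolic_ac[OF h] this, folded z_def]
  have inj: "inj ?t"
  proof (rule injI)
    fix s t assume "?t s = ?t t"
    from fun_cong[OF this, of "proj_point z"] show "s = t"
      using z(3)[of "to_ac s" "to_ac t"] by (simp add: induced_point C z(1,2) mat_ac_torus)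
  qed
  have ex: "\<exists>H. subgroup H ?G \<and> finite H \<and> card H = m" if m: "m > 0" "of_nat m \<noteq> (0 :: 'a)" for m
  proof (intro exI conjI)
    let ?R = "{t :: 'a. t ^ m = 1}"
    have nz: "t \<noteq> 0" if "t \<in> ?R" for t using that m(1) by (auto simp: power_0_left)
    show "subgroup (?t ` ?R) ?G"
    proof
      show "?t ` ?R \<subseteq> carrier ?G" using car nz by blast
      show "\<one>\<^bsub>?G\<^esub> \<in> ?t ` ?R" unfolding one[symmetric] by simp
      show "\<phi> \<otimes>\<^bsub>?G\<^esub> \<psi> \<in> ?t ` ?R" if \<phi>: "\<phi> \<in> ?t ` ?R" and \<psi>: "\<psi> \<in> ?t ` ?R" for \<phi> \<psi>
      proof -
        obtain s t where st: "\<phi> = ?t s" "s \<in> ?R" "\<psi> = ?t t" "t \<in> ?R" using \<phi> \<psi> by blast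
        then have "\<phi> \<otimes>\<^bsub>?G\<^esub> \<psi> = ?t (s * t)" using mult nz by simp
        then show ?thesis using st by (simp add: power_mult_distrib)
      qed
      show "inv\<^bsub>?G\<^esub> \<phi> \<in> ?t ` ?R" if \<phi>: "\<phi> \<in> ?t ` ?R" for \<phi>
      proof -
        obtain t where t: "\<phi> = ?t t" "t \<in> ?R" using \<phi> by blast
        then have "inv\<^bsub>?G\<^esub> \<phi> = ?t (1 / t)" using m_inv nz by simp
        then show ?thesis using t by (simp add: power_one_over)
      qed
    qed
    show card: "card (?t ` ?R) = m"
      by (rule trans[OF card_image[OF inj_on_subset[OF inj subset_UNIV]] card_roots_of_unity[OF roots m]])
    show "finite (?t ` ?R)" by (rule card_ge_0_finite) (simp only: card m(1))
  qed
  show ?thesis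
  proof
    assume "bounded_finite_subgroups ?G"
    then obtain b where b: "\<And>H. subgroup H ?G \<Longrightarrow> finite H \<Longrightarrow> card H \<le> b"
      unfolding bounded_finite_subgroups_def by blast
    \<comment> \<open>Two consecutive integers cannot both vanish in the field, so there are
      arbitrarily large \<open>m\<close> not divisible by the characteristic.\<close>
    have "of_nat (Suc b) \<noteq> (0 :: 'a) \<or> of_nat (Suc (Suc b)) \<noteq> (0 :: 'a)"
      by (metis of_nat_Suc add.right_neutral one_neq_zero)
    then obtain m where "m > b" "of_nat m \<noteq> (0 :: 'a)" using lessI less_SucI by metis
    then show False using ex[of m] b by fastforce
  qed
qed

theorem proposition1p11:
  fixes q :: "('n::finite, 'a::field) mvpoly" and n :: nat
  assumes roots: "contains_all_roots_of_unity TYPE('a)"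
    and char_or_perfect: "CHAR('a) \<noteq> 2 \<or> perfect_field TYPE('a)"
    and dim: "CARD('n) = n" "n \<ge> 3"
    and quadric: "smooth_quadric q"
  shows
    "(bounded_finite_subgroups (Aut_hypersurface q) \<longleftrightarrow> rational_points q = {}) \<and>
     (odd n \<and> rational_points q = {} \<longrightarrow>
        (\<forall>x\<in>carrier (Aut_hypersurface q).
           x \<noteq> \<one>\<^bsub>Aut_hypersurface q\<^esub> \<and> group.ord (Aut_hypersurface q) x > 0 \<longrightarrow>
           group.ord (Aut_hypersurface q) x = 2) \<and>
        (\<forall>G. subgroup G (Aut_hypersurface q) \<and> finite G \<longrightarrow> card G \<le> 2 ^ (n - 1))) \<and>
     (even n \<and> rational_points q = {} \<longrightarrow>
        (\<forall>x\<in>carrier (Aut_hypersurface q).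
           x \<noteq> \<one>\<^bsub>Aut_hypersurface q\<^esub> \<and> group.ord (Aut_hypersurface q) x > 0 \<longrightarrow>
           group.ord (Aut_hypersurface q) x \<in> {2, 4}) \<and>
        (\<forall>G. subgroup G (Aut_hypersurface q) \<and> finite G \<longrightarrow> card G \<le> 8 ^ (n - 1))) \<and>
     (n = 4 \<and> rational_points q = {} \<longrightarrow>
        (\<forall>G. subgroup G (Aut_hypersurface q) \<and> finite G \<longrightarrow> card G \<le> 32))"
proof -
  let ?G = "Aut_hypersurface q"
  have n3: "CARD('n) \<ge> 3" using dim by simp
  have smooth: "z \<noteq> 0 \<Longrightarrow> mv_eval to_ac q z = 0 \<Longrightarrow> \<exists>i. mv_eval to_ac (mv_pderiv i q) z \<noteq> 0" for z
    using quadric by (auto simp: smooth_quadric_def smooth_hypersurface_def)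
  have hom: "homogeneous 2 q" using quadric by (simp add: smooth_quadric_def)
  obtain C :: "'a ^ 'n ^ 'n" where
    C: "\<forall>x. mv_eval (\<lambda>c. c) q x = (\<Sum>i\<in>UNIV. \<Sum>j\<in>UNIV. C $ i $ j * (x $ i * x $ j))"
      "\<forall>x. mv_eval to_ac q x = (\<Sum>i\<in>UNIV. \<Sum>j\<in>UNIV. to_ac (C $ i $ j) * (x $ i * x $ j))"
      "\<forall>i x. mv_eval to_ac (mv_pderiv i q) x = (\<Sum>j\<in>UNIV. to_ac (C $ i $ j + C $ j $ i) * x $ j)"
    using quadric_matrix[OF hom] by (elim exE conjE) (rule that)
  have q: "mv_eval (\<lambda>c. c) q x = quad C x" for x using C(1) by (simp add: quad_def)
  have q_ac: "mv_eval to_ac q z = quad (mat_ac C) z" for z using C(2) by (simp add: quad_def mat_ac_def)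
  have grad: "mv_eval to_ac (mv_pderiv i q) z = polar (mat_ac C) (axis i 1) z" for i z
    using C(3) by (simp add: polar_axis mat_ac_def)
  have points: "rational_points q = {} \<longleftrightarrow> (\<forall>x. x \<noteq> 0 \<longrightarrow> quad C x \<noteq> 0)"
    by (auto simp: hypersurface_points_def q)
  have unbounded: "\<not> bounded_finite_subgroups ?G" if ne: "rational_points q \<noteq> {}"
  proof -
    obtain x where x: "x \<noteq> 0" "quad C x = 0" using ne points by blast
    have "vec_ac x \<noteq> 0" "mv_eval to_ac q (vec_ac x) = 0" using x by (simp_all add: vec_ac_simps q_ac quad_ac)
    \<comment> \<open>Smoothness at the rational point provides a coordinate vector not orthogonal
      to it, hence a hyperbolic partner over the ground field.\<close>
    then obtain i where "polar (mat_ac C) (axis i 1) (vec_ac x) \<noteq> 0" using smooth grad by metis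
    moreover have "axis i 1 = vec_ac (axis i 1)" by (simp add: vec_ac_def axis_def vec_eq_iff)
    ultimately have "polar C (axis i 1) x \<noteq> 0" by (metis polar_ac to_ac_0)
    then obtain y where "hyperbolic C x y" using hyperbolic_exists[OF x(2)] by blast
    then show ?thesis by (rule unbounded_finite_subgroups[OF roots n3 q_ac])
  qed
  have pointless: "(\<forall>G. subgroup G ?G \<and> finite G \<longrightarrow> card G \<le> 8 ^ (n - 1)) \<and>
      (\<forall>x\<in>carrier ?G. x \<noteq> \<one>\<^bsub>?G\<^esub> \<and> group.ord ?G x > 0 \<longrightarrow> group.ord ?G x \<in> {2, 4}) \<and>
      (odd n \<longrightarrow> (\<forall>x\<in>carrier ?G. x \<noteq> \<one>\<^bsub>?G\<^esub> \<and> group.ord ?G x > 0 \<longrightarrow> group.ord ?G x = 2)) \<and>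
      (odd n \<longrightarrow> (\<forall>G. subgroup G ?G \<and> finite G \<longrightarrow> card G \<le> 2 ^ (n - 1))) \<and>
      (n = 4 \<longrightarrow> (\<forall>G. subgroup G ?G \<and> finite G \<longrightarrow> card G \<le> 32))"
    if e: "rational_points q = {}"
  proof -
    have aniso: "x \<noteq> 0 \<Longrightarrow> quad C x \<noteq> 0" for x using e points by blast
    have two: "(2 :: 'a) \<noteq> 0"
    proof
      assume 2: "(2 :: 'a) = 0"
      then have "CHAR('a) dvd 2" using of_nat_eq_0_iff_char_dvd[of 2, where 'a = 'a] by simp
      then have "CHAR('a) = 2" using CHAR_not_1' prime_nat_iff two_is_prime_nat by (metis One_nat_def)
      moreover then have "surj (\<lambda>x :: 'a. x^2)" using char_or_perfect by (simp add: perfect_field_def)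
      ultimately show False using char_2_isotropic[OF 2 _ n3] aniso by blast
    qed
    \<comment> \<open>With 2 invertible the form is represented by a symmetric matrix, half that of
      the polar form.\<close>
    define M where "M = (\<chi> i j. (C $ i $ j + C $ j $ i) / 2)"
    have M: "(\<Sum>i\<in>UNIV. \<Sum>j\<in>UNIV. h (M $ i $ j) * (x $ i * x $ j)) = (\<Sum>i\<in>UNIV. \<Sum>j\<in>UNIV. h (C $ i $ j) * (x $ i * x $ j))"
      if h: "\<And>a b. h (a + b) = h a + h b" "\<And>a. h (a / 2) = h a / 2" "(2 :: 'k) \<noteq> 0" for h :: "'a \<Rightarrow> 'k::field" and x
    proof -
      let ?C = "\<chi> i j. h (C $ i $ j)"
      have "(\<Sum>i\<in>UNIV. \<Sum>j\<in>UNIV. h (M $ i $ j) * (x $ i * x $ j)) = 1 / 2 * polar ?C x x"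
        by (simp add: polar_def M_def h sum_distrib_left)
      then show ?thesis unfolding polar_self using h(3) by (simp add: quad_def)
    qed
    have two_ac: "(2 :: 'a alg_closure) \<noteq> 0" using two by (metis to_ac_eq_0_iff to_ac_numeral)
    interpret pointless_quadric q M
    proof
      show "(2 :: 'a) \<noteq> 0" by (rule two)
      show "M $ i $ j = M $ j $ i" for i j by (simp add: M_def add.commute)
      show "mv_eval (\<lambda>c. c) q v = (\<Sum>i\<in>UNIV. \<Sum>j\<in>UNIV. M $ i $ j * (v $ i * v $ j))" for v
        using M[of "\<lambda>c. c" v] two by (simp add: C(1))
      show "mv_eval to_ac q x = (\<Sum>i\<in>UNIV. \<Sum>j\<in>UNIV. to_ac (M $ i $ j) * (x $ i * x $ j))" for x
        using M[of to_ac x] two_ac by (simp add: C(2) to_ac_divide)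
      show "v \<noteq> 0 \<Longrightarrow> mv_eval (\<lambda>c. c) q v \<noteq> 0" for v by (simp add: q aniso)
      show "CARD('n) \<ge> 3" by (rule n3)
      \<comment> \<open>A kernel vector of \<open>M\<close> has zero gradient and, by Euler's
        relation, lies on the quadric; if nonzero, it would be a singular point.\<close>
      fix z assume z: "mat_ac M *v z = 0"
      have "mv_eval to_ac (mv_pderiv i q) z = 2 * (mat_ac M *v z) $ i" for i
        using two_ac by (simp add: C(3) matrix_vector_mult_def mat_ac_def M_def to_ac_divide sum_distrib_left)
      then have g: "mv_eval to_ac (mv_pderiv i q) z = 0" for i by (simp add: z)
      have "polar (mat_ac C) z z = 0" by (subst polar_expand) (simp add: g flip: grad)
      then have "mv_eval to_ac q z = 0" using two_ac by (simp add: polar_self q_ac)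
      then show "z = 0" using smooth g by blast
    qed
    interpret similitude_group M ?G matrix_of multiplier by (rule similitude_group_Aut[OF roots])
    have fin: "finite_similitude_subgroup M ?G matrix_of multiplier H" if "subgroup H ?G" "finite H" for H
      by unfold_locales (use that in \<open>auto simp: subgroup_def\<close>)
    show ?thesis
    proof (intro conjI allI impI ballI; (elim conjE)?)
      fix H assume H: "subgroup H ?G" "finite H"
      interpret H: finite_similitude_subgroup M ?G matrix_of multiplier H by (rule fin[OF H])
      show "card H \<le> 8 ^ (n - 1)" using H.card_le_8_power dim by simp
      show "odd n \<Longrightarrow> card H \<le> 2 ^ (n - 1)" using H.card_le_2_power_odd dim by simp
      show "n = 4 \<Longrightarrow> card H \<le> 32" using H.card_le_32 dim by simp
    qed (use ord_2_or_4 ord_2_odd dim in \<open>auto\<close>)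
  qed
  have "bounded_finite_subgroups ?G" if "rational_points q = {}"
    using pointless[OF that] unfolding bounded_finite_subgroups_def by blast
  then show ?thesis using pointless unbounded by blast
qed

end
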